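(* Let $(\mathcal{P},\mathcal{N})$ be a Beurling number system with $N_{\mathcal{P}}(x)=Ax+O(x^\theta)$ for some $A>0$, $\theta\in[0,1)$, and suppose that for some real $k\ge1$ there is a constant $C_k$ such that for $T\ge2$ \[ \frac1T\int_0^T\Bigl|\zeta_{\mathcal{P}}\Bigl(\tfrac{1+\theta}{2}+\mathrm{i}t\Bigr)\Bigr|^{2k}\mathrm{d}t\ll_k(\log T)^{C_k},\qquad \frac1T\int_0^T\Bigl|\zeta'_{\mathcal{P}}\Bigl(\tfrac{1+\theta}{2}+\mathrm{i}t\Bigr)\Bigr|^{2k}\mathrm{d}t\ll_k(\log T)^{C_k}. \] Then, for $T\ge2$, uniformly for $\alpha\ge\frac{1+\theta}{2}$, \[ N(\zeta_{\mathcal{P}};\alpha,T)\ll_k T^{\frac{2(k+1)(1-\alpha)}{2(1-\alpha)+k(1-\theta)}}(\log T)^{O_k(1)}, \] and uniformly for $\alpha\ge\frac{3k-1+(k-1)\theta}{4k-2}$, \[ N(\zeta_{\mathcal{P}};\alpha,T)\ll_k T^{\frac{4(3\alpha-2-\theta)(1-\alpha)}{k(2\alpha-1-\theta)(4\alpha-3-\theta)+4(3\alpha-2-\theta)(1-\alpha)}}(\log T)^{O_k(1)}. \] Furthermore, if $2k$ is an integer, the hypothesis on the moment of $\zeta'_{\mathcal{P}}$ may be omitted.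
   Context: A Beurling number system $(\mathcal{P},\mathcal{N})$: generalized primes $1<p_1\le p_2\le\dots$, $p_j\to\infty$, and generalized integers $(n_j)$ = all finite products of generalized primes (including $1$), non-decreasing, with multiplicity; $N_{\mathcal{P}}(x)=\#\{j:n_j\le x\}$. $\zeta_{\mathcal{P}}(s)=\sum_j n_j^{-s}$ for $\Re s>1$, continued meromorphically to $\Re s>\theta$ (only a simple pole at $s=1$). $N(\zeta_{\mathcal{P}};\alpha,T)$ is the number of zeros $\beta+\mathrm{i}\gamma$ of $\zeta_{\mathcal{P}}$ with $\beta\ge\alpha$, $|\gamma|\le T$, counted with multiplicity. Implied constants may depend on the system and on $k$. *)

theory Defs
  imports "HOL-Complex_Analysis.Complex_Analysis" "HOL-Library.Landau_Symbols"
    "HOL-Library.Multiset"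
begin

definition beurling_primes :: "(nat \<Rightarrow> real) \<Rightarrow> bool" where
  "beurling_primes p \<longleftrightarrow> (\<forall>j. 1 < p j) \<and> mono p \<and> filterlim p at_top sequentially"

text \<open>
  Generalized integers are indexed by finite multisets of indices of primes, so that products
  (and primes) with equal values are counted with multiplicity; the empty multiset gives 1.
\<close>

definition beurling_int :: "(nat \<Rightarrow> real) \<Rightarrow> nat multiset \<Rightarrow> real" where
  "beurling_int p m = (\<Prod>j\<in>#m. p j)"

definition beurling_count :: "(nat \<Rightarrow> real) \<Rightarrow> real \<Rightarrow> nat" where
  "beurling_count p x = card {m. beurling_int p m \<le> x}"

text \<open>
  The continuation of the Dirichlet series from \<open>Re s > 1\<close> to \<open>Re s > \<theta>\<close>, holomorphic
  except at \<open>s = 1\<close>. By the identity theorem its values at the points \<open>s \<noteq> 1\<close> of the half-plane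
  are uniquely determined; the values at 1 and outside the half-plane are unspecified.
\<close>

definition beurling_zeta :: "(nat \<Rightarrow> real) \<Rightarrow> real \<Rightarrow> complex \<Rightarrow> complex" where
  "beurling_zeta p \<theta> = (SOME Z.
     Z meromorphic_on {s. Re s > \<theta>} \<and>
     Z holomorphic_on ({s. Re s > \<theta>} - {1}) \<and>
     (\<forall>s. Re s > 1 \<longrightarrow> Z s = (\<Sum>\<^sub>\<infinity>m. complex_of_real (beurling_int p m) powr (- s))))"

text \<open>
  Number of zeros with multiplicity, for \<open>\<alpha> > \<theta>\<close>. The point 1 is a pole of the zeta function,
  where the value of the HOL function is meaningless.
\<close>

definition beurling_zeros :: "(nat \<Rightarrow> real) \<Rightarrow> real \<Rightarrow> real \<Rightarrow> real \<Rightarrow> nat" where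
  "beurling_zeros p \<theta> \<alpha> T =
     (\<Sum>\<rho> | \<rho> \<noteq> 1 \<and> beurling_zeta p \<theta> \<rho> = 0 \<and> \<alpha> \<le> Re \<rho> \<and> \<bar>Im \<rho>\<bar> \<le> T.
        nat (zorder (beurling_zeta p \<theta>) \<rho>))"

end

theory Submission
  imports Defs "HOL-Probability.Probability"
begin

text \<open>
  Generalized integers are measured on the logarithmic scale \<open>\<nu> m = ln (beurling_int p m)\<close>, and
  every Dirichlet series is smoothed by a Gaussian in the variable \<open>t = \<nu> m\<close>. On the Fourier side
  this localizes the ordinate to windows of length \<open>b * ln T\<close>.

  Let \<open>M(s)\<close> be the Moebius polynomial of length \<open>exp x\<close>. The product \<open>\<zeta>(s) M(s)\<close> has constant term
  1 and no further coefficients up to \<open>exp x\<close>. Hence at a zero \<open>\<rho>\<close> with \<open>Re \<rho> \<ge> \<alpha>\<close> one of three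
  things happens: a polynomial over \<open>x < \<nu> m\<close>, smoothed at some scale below \<open>y\<close>, is large at
  \<open>Im \<rho>\<close>; or the integral of \<open>|\<zeta>|\<close> over the window around \<open>Im \<rho>\<close> on the line \<open>Re s = (1 + \<theta>) / 2\<close>
  exceeds some level \<open>U\<close>; or \<open>M\<close> is larger than some \<open>V\<close> at a point of that window, where
  \<open>U * V\<close> is about \<open>exp ((\<alpha> - (1 + \<theta>) / 2) * y)\<close>.

  The moment of \<open>\<zeta>\<close> bounds how often the second case occurs among well-spaced zeros. The other
  two cases are bounded by large value estimates for Dirichlet polynomials: the first density
  estimate uses the discrete mean value theorem, the second uses the Halasz-Montgomery inequality,
  whose dual sums are again controlled by the moment of \<open>\<zeta>\<close>. Here the Gaussian weights replace the
  missing arithmetic structure of the generalized integers, of which only the counting function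
  is known.
\<close>

section \<open>Gaussian kernels\<close>

text \<open>In a window of relative length 1 / T around exp u the hypothesis yields about exp u / T
  generalized integers only up to an error exp (\<theta> * u). The mean value theorem therefore
  weighs |c m|^2 with exp (\<nu> m) + T * exp (\<theta> * \<nu> m), and Re s = (1 + \<theta>) / 2 is
  the abscissa at which the second weight leaves divisor sums over exp (\<nu> m), of logarithmic
  size.

  No contour is shifted. For \<theta> < Re s < 1 zeta is s times a two-sided Laplace transform of
  the counting error, so a Gaussian sum of generalized integers at scale t equals a pole term plus a
  Gaussian mean of zeta on the same vertical line. Integrating over t against exp (- \<delta> * t)
  turns this mean into zeta at s + \<delta>: so zeros to the right of the line are felt. The cut t <
  y keeps the polynomials short; the rest of the integral costs the mean of zeta times M, damped by
  exp (- \<delta> * y).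

  The Gaussian parameter is a multiple of ln T because truncation errors and the pole must beat
  fixed powers of T, while windows of length O(ln T) only cost logarithms.\<close>

definition gs :: "real \<Rightarrow> real \<Rightarrow> real" where
  "gs l x = exp (- (l * x\<^sup>2 / 2))"

text \<open>Normal density of variance \<open>l\<close>, with Fourier transform \<open>gs l\<close>.
  A weight of width 1 / sqrt l in the variable \<nu> thus corresponds to a mean over ordinates at
  distance about sqrt l.\<close>

definition gh :: "real \<Rightarrow> real \<Rightarrow> real" where
  "gh l v = gs (1 / l) v / sqrt (2 * pi * l)"

lemma gs_pos [simp]: "gs l x > 0" and gs_nonneg [simp]: "gs l x \<ge> 0"
  by (auto simp: gs_def)

lemma gs_measurable [measurable]: "gs l \<in> borel_measurable borel"
  unfolding gs_def by measurable

lemma gs_le_1: "l \<ge> 0 \<Longrightarrow> gs l x \<le> 1"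
  by (auto simp: gs_def)

lemma gs_minus [simp]: "gs l (- x) = gs l x"
  by (simp add: gs_def)

lemma gh_nonneg [simp]: "l > 0 \<Longrightarrow> gh l x \<ge> 0"
  by (auto simp: gh_def)

lemma gh_measurable [measurable]: "gh l \<in> borel_measurable borel"
  unfolding gh_def by measurable

text \<open>Read off from the characteristic function of the standard normal distribution; the other
  Gaussian Fourier integrals are reduced to this one by scaling and translation.\<close>

lemma std_gauss:
  "integrable lborel (\<lambda>x. complex_of_real (exp (- (x\<^sup>2 / 2))) * iexp (t * x))"
  "(LINT x|lborel. complex_of_real (exp (- (x\<^sup>2 / 2))) * iexp (t * x)) = complex_of_real (sqrt (2 * pi) * exp (- (t\<^sup>2 / 2)))"
proof -
  have eq: "std_normal_density x *\<^sub>R iexp (t * x) = (1 / sqrt (2 * pi)) *\<^sub>R (complex_of_real (exp (- (x\<^sup>2 / 2))) * iexp (t * x))" for x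
    by (simp add: std_normal_density_def scaleR_conv_of_real)
  interpret real_distribution std_normal_distribution by (rule real_dist_normal_dist)
  have "integrable std_normal_distribution (\<lambda>x. iexp (t * x))"
    by (rule integrable_iexp) auto
  hence i: "integrable lborel (\<lambda>x. std_normal_density x *\<^sub>R iexp (t * x))"
    by (subst (asm) integrable_density) auto
  thus "integrable lborel (\<lambda>x. complex_of_real (exp (- (x\<^sup>2 / 2))) * iexp (t * x))"
    using integrable_scaleR_right[OF i, of "sqrt (2 * pi)"] unfolding eq by simp
  have "char std_normal_distribution t = (LINT x|lborel. std_normal_density x *\<^sub>R iexp (t * x))"
    unfolding char_def by (subst integral_density) auto
  also have "\<dots> = (1 / sqrt (2 * pi)) *\<^sub>R (LINT x|lborel. complex_of_real (exp (- (x\<^sup>2 / 2))) * iexp (t * x))"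
    unfolding eq by simp
  finally show "(LINT x|lborel. complex_of_real (exp (- (x\<^sup>2 / 2))) * iexp (t * x)) = complex_of_real (sqrt (2 * pi) * exp (- (t\<^sup>2 / 2)))"
    by (simp add: char_std_normal_distribution scaleR_conv_of_real field_simps)
qed

lemma gs_ft_imag:
  assumes "l > 0"
  shows "integrable lborel (\<lambda>x. gs l x * iexp (t * x))"
    and "(LINT x|lborel. gs l x * iexp (t * x)) = complex_of_real (sqrt (2 * pi / l) * exp (- (t\<^sup>2 / (2 * l))))"
proof -
  define c where "c = sqrt l"
  have c: "c > 0" "c\<^sup>2 = l" using assms by (auto simp: c_def)
  have eq: "complex_of_real (exp (- ((0 + c * x)\<^sup>2 / 2))) * iexp (t / c * (0 + c * x)) = gs l x * iexp (t * x)" for x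
    using c by (simp add: gs_def power_mult_distrib)
  show "integrable lborel (\<lambda>x. gs l x * iexp (t * x))"
    using lborel_integrable_real_affine[OF std_gauss(1)[of "t / c"], of c 0] c unfolding eq by auto
  have "(LINT x|lborel. complex_of_real (exp (- (x\<^sup>2 / 2))) * iexp (t / c * x)) = c *\<^sub>R (LINT x|lborel. gs l x * iexp (t * x))"
    using lborel_integral_real_affine[of c "\<lambda>x. complex_of_real (exp (- (x\<^sup>2 / 2))) * iexp (t / c * x)" 0] c unfolding eq by auto
  hence "(LINT x|lborel. gs l x * iexp (t * x)) = complex_of_real (sqrt (2 * pi) * exp (- ((t / c)\<^sup>2 / 2))) / c"
    unfolding std_gauss(2) using c by (simp add: scaleR_conv_of_real field_simps)
  also have "\<dots> = complex_of_real (sqrt (2 * pi / l) * exp (- (t\<^sup>2 / (2 * l))))"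
    using c by (simp add: real_sqrt_divide power_divide c_def real_sqrt_pow2 mult.commute field_simps)
  finally show "(LINT x|lborel. gs l x * iexp (t * x)) = complex_of_real (sqrt (2 * pi / l) * exp (- (t\<^sup>2 / (2 * l))))"
    .
qed

lemma gs_integrable: "l > 0 \<Longrightarrow> integrable lborel (gs l)"
proof -
  assume "l > 0"
  from gs_ft_imag(1)[OF this, of 0] have "integrable lborel (\<lambda>x. complex_of_real (gs l x))" by simp
  thus ?thesis by (simp only: complex_of_real_integrable_eq)
qed

text \<open>Completing the square: half of the Gaussian exponent absorbs the exponential. Bounds of
  the shape K * exp (b * |x|) * gs l x are therefore the uniform test for integrability and decay
  below.\<close>

lemma exp_abs_gs_le:
  assumes "l > 0"
  shows "exp (c * \<bar>x\<bar>) * gs l x \<le> exp (c\<^sup>2 / l) * gs (l / 2) x"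
proof -
  have "0 \<le> (c / sqrt l - sqrt l * \<bar>x\<bar> / 2)\<^sup>2" by simp
  also have "\<dots> = c\<^sup>2 / l + l * x\<^sup>2 / 4 - c * \<bar>x\<bar>"
    using assms by (simp add: power2_diff power_divide power_mult_distrib)
  finally have "c * \<bar>x\<bar> - l * x\<^sup>2 / 2 \<le> c\<^sup>2 / l - l * x\<^sup>2 / 4" by simp
  thus ?thesis by (simp add: gs_def flip: exp_add)
qed

lemma integrable_exp_gs:
  fixes f :: "real \<Rightarrow> 'b::{banach,second_countable_topology}"
  assumes l: "l > 0" and [measurable]: "f \<in> borel_measurable borel"
    and bd: "\<And>x. norm (f x) \<le> C * exp (c * \<bar>x\<bar>) * gs l x"
  shows "integrable lborel f"
proof (rule Bochner_Integration.integrable_bound)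
  show "integrable lborel (\<lambda>x. \<bar>C\<bar> * exp (c\<^sup>2 / l) * gs (l / 2) x)"
    using gs_integrable[of "l / 2"] l by simp
  show "AE x in lborel. norm (f x) \<le> norm (\<bar>C\<bar> * exp (c\<^sup>2 / l) * gs (l / 2) x)"
  proof (rule AE_I2)
    fix x
    have "norm (f x) \<le> C * (exp (c * \<bar>x\<bar>) * gs l x)" using bd[of x] by (simp add: mult_ac)
    also have "\<dots> \<le> \<bar>C\<bar> * (exp (c * \<bar>x\<bar>) * gs l x)" by (intro mult_right_mono) auto
    also have "\<dots> \<le> \<bar>C\<bar> * (exp (c\<^sup>2 / l) * gs (l / 2) x)"
      by (intro mult_left_mono exp_abs_gs_le l) auto
    finally show "norm (f x) \<le> norm (\<bar>C\<bar> * exp (c\<^sup>2 / l) * gs (l / 2) x)" by (simp add: abs_mult mult.assoc)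
  qed
qed auto

text \<open>Only \<open>Re z\<close> is removed by completing the square, through a real
  translation; \<open>Im z\<close> stays as a frequency. So complex exponents need no contour
  integral.\<close>

lemma gs_ft:
  fixes z :: complex
  assumes l: "l > 0"
  shows "integrable lborel (\<lambda>x. exp (z * of_real x) * of_real (gs l x))"
    and "(LINT x|lborel. exp (z * of_real x) * of_real (gs l x)) = of_real (sqrt (2 * pi / l)) * exp (z\<^sup>2 / (2 * of_real l))"
proof -
  define a where "a = Re z"
  define b where "b = Im z"
  have z: "z = of_real a + \<i> * of_real b" by (simp add: a_def b_def complex_eq)
  have key: "exp (z * of_real x) * gs l x
      = exp (of_real (a\<^sup>2 / (2 * l)) + \<i> * of_real (a * b / l)) * (gs l (- a / l + 1 * x) * iexp (b * (- a / l + 1 * x)))" for x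
  proof -
    have "z * of_real x + of_real (- (l * x\<^sup>2 / 2)) = of_real (a\<^sup>2 / (2 * l)) + \<i> * of_real (a * b / l) +
         (of_real (- (l * (- a / l + 1 * x)\<^sup>2 / 2)) + \<i> * of_real (b * (- a / l + 1 * x)))"
      using l by (simp add: z complex_eq_iff power2_eq_square field_simps)
    hence "exp (z * of_real x + of_real (- (l * x\<^sup>2 / 2))) = exp (of_real (a\<^sup>2 / (2 * l)) + \<i> * of_real (a * b / l) +
         (of_real (- (l * (- a / l + 1 * x)\<^sup>2 / 2)) + \<i> * of_real (b * (- a / l + 1 * x))))" by (rule arg_cong)
    thus ?thesis unfolding gs_def exp_add exp_of_real[symmetric] by simp
  qed
  have int: "integrable lborel (\<lambda>x. gs l (- a / l + 1 * x) * iexp (b * (- a / l + 1 * x)))"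
    using lborel_integrable_real_affine[OF gs_ft_imag(1)[OF l, of b], of 1 "- a / l"] by auto
  show "integrable lborel (\<lambda>x. exp (z * of_real x) * of_real (gs l x))"
    unfolding key by (rule integrable_mult_right[OF int])
  have "(LINT x|lborel. exp (z * of_real x) * gs l x) = exp (of_real (a\<^sup>2 / (2 * l)) + \<i> * of_real (a * b / l)) *
     (LINT x|lborel. gs l (- a / l + 1 * x) * iexp (b * (- a / l + 1 * x)))"
    unfolding key by simp
  also have "(LINT x|lborel. gs l (- a / l + 1 * x) * iexp (b * (- a / l + 1 * x))) = (LINT x|lborel. gs l x * iexp (b * x))"
    by (subst (2) lborel_integral_real_affine[of 1 _ "- a / l"]) auto
  also have "\<dots> = complex_of_real (sqrt (2 * pi / l) * exp (- (b\<^sup>2 / (2 * l))))" by (rule gs_ft_imag(2)[OF l])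
  also have "exp (of_real (a\<^sup>2 / (2 * l)) + \<i> * of_real (a * b / l)) * complex_of_real (sqrt (2 * pi / l) * exp (- (b\<^sup>2 / (2 * l))))
     = sqrt (2 * pi / l) * exp (of_real (a\<^sup>2 / (2 * l)) + \<i> * of_real (a * b / l) + of_real (- (b\<^sup>2 / (2 * l))))"
    by (simp only: exp_add of_real_mult exp_of_real mult_ac)
  also have "of_real (a\<^sup>2 / (2 * l)) + \<i> * of_real (a * b / l) + of_real (- (b\<^sup>2 / (2 * l))) = z\<^sup>2 / (2 * of_real l)"
    using l by (simp add: z complex_eq_iff power2_eq_square field_simps)
  finally show "(LINT x|lborel. exp (z * of_real x) * of_real (gs l x)) = of_real (sqrt (2 * pi / l)) * exp (z\<^sup>2 / (2 * of_real l))"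
    by simp
qed

lemma gs_ft_real:
  assumes l: "l > 0"
  shows "integrable lborel (\<lambda>x. exp (a * x) * gs l x)"
    and "(LINT x|lborel. exp (a * x) * gs l x) = sqrt (2 * pi / l) * exp (a\<^sup>2 / (2 * l))"
proof -
  have eq: "(\<lambda>x. exp (complex_of_real a * of_real x) * complex_of_real (gs l x)) = (\<lambda>x. of_real (exp (a * x) * gs l x))"
    by (simp only: of_real_mult exp_of_real[symmetric])
  show "integrable lborel (\<lambda>x. exp (a * x) * gs l x)"
    using gs_ft(1)[OF l, of "of_real a"] unfolding eq complex_of_real_integrable_eq .
  have e: "exp ((complex_of_real a)\<^sup>2 / (2 * complex_of_real l)) = of_real (exp (a\<^sup>2 / (2 * l)))"
    unfolding exp_of_real[symmetric] by simp
  have "complex_of_real (LINT x|lborel. exp (a * x) * gs l x) = of_real (sqrt (2 * pi / l)) * of_real (exp (a\<^sup>2 / (2 * l)))"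
    using gs_ft(2)[OF l, of "of_real a"] unfolding eq integral_complex_of_real e .
  thus "(LINT x|lborel. exp (a * x) * gs l x) = sqrt (2 * pi / l) * exp (a\<^sup>2 / (2 * l))"
    by (simp only: of_real_eq_iff of_real_mult[symmetric])
qed

lemma gh_ft:
  assumes l: "l > 0"
  shows "integrable lborel (\<lambda>v. gh l v * iexp (x * v))"
    and "(LINT v|lborel. gh l v * iexp (x * v)) = gs l x"
proof -
  have eq: "complex_of_real (gh l v) * iexp (x * v) = (gs (1 / l) v * iexp (x * v)) / sqrt (2 * pi * l)" for v
    by (simp add: gh_def)
  show "integrable lborel (\<lambda>v. gh l v * iexp (x * v))"
    unfolding eq using gs_ft_imag(1)[of "1 / l" x] l by simp
  show "(LINT v|lborel. gh l v * iexp (x * v)) = gs l x"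
    unfolding eq using gs_ft_imag(2)[of "1 / l" x] l
    by (simp add: gs_def mult_ac flip: of_real_mult of_real_divide)
qed

text \<open>Integration by parts on the whole line is used in this form: f is a product that decays
  at both ends.\<close>

lemma LBINT_derivative_eq_0:
  fixes f f' :: "real \<Rightarrow> complex"
  assumes d: "\<And>x. (f has_vector_derivative f' x) (at x)" and c: "continuous_on UNIV f'"
    and i: "integrable lborel f'" and top: "(f \<longlongrightarrow> 0) at_top" and bot: "(f \<longlongrightarrow> 0) at_bot"
  shows "(LINT x|lborel. f' x) = 0"
proof -
  have "(LBINT x=-\<infinity>..\<infinity>. f' x) = 0 - 0"
  proof (rule interval_integral_FTC_integrable[where F = f])
    show "set_integrable lborel (einterval (- \<infinity>) \<infinity>) f'" using i by (simp add: set_integrable_def)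
  qed (use d c top bot in \<open>auto simp: continuous_on_eq_continuous_at ereal_tendsto_simps\<close>)
  thus ?thesis by (simp add: interval_lebesgue_integral_def set_lebesgue_integral_def)
qed

lemma exp_gs_tendsto_0:
  assumes l: "l > 0"
  shows "((\<lambda>x. exp (c * \<bar>x\<bar>) * gs l x) \<longlongrightarrow> 0) at_top" "((\<lambda>x. exp (c * \<bar>x\<bar>) * gs l x) \<longlongrightarrow> 0) at_bot"
proof -
  show *: "((\<lambda>x. exp (c * \<bar>x\<bar>) * gs l x) \<longlongrightarrow> 0) at_top"
  proof (rule Lim_null_comparison)
    show "((\<lambda>x. exp (c\<^sup>2 / l) * gs (l / 2) x) \<longlongrightarrow> 0) at_top"
      unfolding gs_def using l by real_asymp
    show "eventually (\<lambda>x. norm (exp (c * \<bar>x\<bar>) * gs l x) \<le> exp (c\<^sup>2 / l) * gs (l / 2) x) at_top"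
      using exp_abs_gs_le[OF l, of c] by (intro always_eventually) auto
  qed
  show "((\<lambda>x. exp (c * \<bar>x\<bar>) * gs l x) \<longlongrightarrow> 0) at_bot"
    using * by (subst filterlim_at_bot_mirror) simp
qed

text \<open>Formally the x-derivative of \<open>gh_ft\<close>. It is obtained by integrating the
  v-derivative of gh l v * iexp (x * v), in which the density contributes the factor - v / l, so
  nothing is differentiated under the integral sign.\<close>

lemma gh_ft_deriv:
  assumes l: "l > 0"
  shows "integrable lborel (\<lambda>v. \<i> * v * gh l v * iexp (x * v))"
    and "(LINT v|lborel. \<i> * v * gh l v * iexp (x * v)) = - l * x * gs l x"
proof -
  have le: "\<bar>v\<bar> \<le> exp (1 * \<bar>v\<bar>)" for v :: real using exp_ge_add_one_self[of "\<bar>v\<bar>"] unfolding mult_1 by linarith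
  show i: "integrable lborel (\<lambda>v. \<i> * v * gh l v * iexp (x * v))"
  proof (rule integrable_exp_gs[where l = "1 / l" and c = 1 and C = "1 / sqrt (2 * pi * l)"])
    fix v
    have "norm (\<i> * v * gh l v * iexp (x * v)) = \<bar>v\<bar> * gh l v"
      using l by (simp add: norm_mult)
    also have "\<dots> \<le> exp (1 * \<bar>v\<bar>) * gh l v" using le l by (intro mult_right_mono) auto
    finally show "norm (\<i> * v * gh l v * iexp (x * v)) \<le> 1 / sqrt (2 * pi * l) * exp (1 * \<bar>v\<bar>) * gs (1 / l) v"
      by (simp add: gh_def)
  qed (use l in auto)
  let ?f = "\<lambda>v. complex_of_real (gh l v) * iexp (x * v)"
  let ?f' = "\<lambda>v. complex_of_real (- v / l * gh l v) * iexp (x * v) + complex_of_real (gh l v) * (\<i> * x * iexp (x * v))"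
  have dgh: "(gh l has_real_derivative (- v / l * gh l v)) (at v)" for v
  proof -
    have "(gs (1 / l) has_real_derivative (- v / l * gs (1 / l) v)) (at v)"
      unfolding gs_def using l by (auto intro!: derivative_eq_intros simp: power2_eq_square)
    from DERIV_cdivide[OF this, of "sqrt (2 * pi * l)"] show ?thesis
      unfolding gh_def by (simp add: field_simps)
  qed
  have d1: "((\<lambda>v. complex_of_real (gh l v)) has_vector_derivative complex_of_real (- v / l * gh l v)) (at v)" for v
    using dgh[of v] by (rule has_vector_derivative_of_real)
  have d2: "((\<lambda>v. iexp (x * v)) has_vector_derivative \<i> * x * iexp (x * v)) (at v)" for v
  proof -
    have "((\<lambda>w. exp (\<i> * (of_real x * w))) has_field_derivative \<i> * x * exp (\<i> * (of_real x * of_real v))) (at (of_real v))"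
      by (auto intro!: derivative_eq_intros)
    from has_vector_derivative_real_field[OF this] show ?thesis by simp
  qed
  have d: "(?f has_vector_derivative ?f' v) (at v)" for v
    using has_vector_derivative_mult[OF d1[of v] d2[of v]] by (simp add: add.commute)
  have norm_f: "norm (?f v) = 1 / sqrt (2 * pi * l) * (exp (0 * \<bar>v\<bar>) * gs (1 / l) v)" for v
    using l by (simp add: norm_mult norm_divide gh_def)
  have ii: "integrable lborel (\<lambda>v. complex_of_real (- v / l * gh l v) * iexp (x * v))"
  proof -
    have "complex_of_real (- v / l * gh l v) * iexp (x * v) = \<i> / l * (\<i> * v * gh l v * iexp (x * v))" for v
      using l by (simp add: field_simps)
    thus ?thesis using integrable_mult_right[OF i, of "\<i> / l"] by (simp only:)
  qed
  have iii: "integrable lborel (\<lambda>v. complex_of_real (gh l v) * (\<i> * x * iexp (x * v)))"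

  proof -
    have "complex_of_real (gh l v) * (\<i> * x * iexp (x * v)) = (\<i> * x) * (complex_of_real (gh l v) * iexp (x * v))" for v
      by (rule mult.left_commute)
    thus ?thesis using integrable_mult_right[OF gh_ft(1)[OF l, of x], of "\<i> * x"] by (simp only:)
  qed
  have "(LINT v|lborel. ?f' v) = 0"
  proof (rule LBINT_derivative_eq_0[OF d])
    show "continuous_on UNIV ?f'"
      unfolding gh_def gs_def by (intro continuous_intros) (use l in auto)
    show "integrable lborel ?f'" by (intro Bochner_Integration.integrable_add ii iii)
    have "((\<lambda>v. norm (?f v)) \<longlongrightarrow> 1 / sqrt (2 * pi * l) * 0) at_top" unfolding norm_f
      by (intro tendsto_intros exp_gs_tendsto_0) (use l in auto)
    thus "(?f \<longlongrightarrow> 0) at_top" by (subst tendsto_norm_zero_iff[symmetric]) simp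
    have "((\<lambda>v. norm (?f v)) \<longlongrightarrow> 1 / sqrt (2 * pi * l) * 0) at_bot" unfolding norm_f
      by (intro tendsto_intros exp_gs_tendsto_0) (use l in auto)
    thus "(?f \<longlongrightarrow> 0) at_bot" by (subst tendsto_norm_zero_iff[symmetric]) simp
  qed
  also have "(LINT v|lborel. ?f' v) = (LINT v|lborel. complex_of_real (- v / l * gh l v) * iexp (x * v)) +
      (LINT v|lborel. complex_of_real (gh l v) * (\<i> * x * iexp (x * v)))"
    by (rule Bochner_Integration.integral_add[OF ii iii])
  also have "(LINT v|lborel. complex_of_real (gh l v) * (\<i> * x * iexp (x * v))) = \<i> * x * gs l x"
  proof -
    have "(LINT v|lborel. complex_of_real (gh l v) * (\<i> * x * iexp (x * v))) = (LINT v|lborel. (\<i> * x) * (complex_of_real (gh l v) * iexp (x * v)))"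
      by (intro Bochner_Integration.integral_cong refl mult.left_commute)
    also have "\<dots> = (\<i> * x) * (LINT v|lborel. complex_of_real (gh l v) * iexp (x * v))"
      by (rule integral_mult_right_zero)
    finally show ?thesis by (simp only: gh_ft(2)[OF l, of x])
  qed
  also have "(LINT v|lborel. complex_of_real (- v / l * gh l v) * iexp (x * v)) = \<i> / l * (LINT v|lborel. \<i> * v * gh l v * iexp (x * v))"
  proof -
    have "(LINT v|lborel. complex_of_real (- v / l * gh l v) * iexp (x * v)) = (LINT v|lborel. (\<i> / l) * (\<i> * v * gh l v * iexp (x * v)))"
      using l by (intro Bochner_Integration.integral_cong) (simp_all add: field_simps)
    thus ?thesis by (simp only: integral_mult_right_zero)
  qed
  finally have "\<i> * ((LINT v|lborel. \<i> * v * gh l v * iexp (x * v)) / l + x * gs l x) = 0"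
    by (simp add: algebra_simps)
  hence "(LINT v|lborel. \<i> * v * gh l v * iexp (x * v)) / l + x * gs l x = 0" by simp
  thus "(LINT v|lborel. \<i> * v * gh l v * iexp (x * v)) = - l * x * gs l x"
    using l by (simp add: field_simps add_eq_0_iff)
qed

text \<open>With a = \<nu> m this writes the value f (\<nu> m) as an integral over u \<ge> \<nu> m,
  which is the entry to partial summation.\<close>

lemma LBINT_atLeast_derivative:
  fixes f f' :: "real \<Rightarrow> complex"
  assumes d: "\<And>x. (f has_vector_derivative f' x) (at x)" and c: "continuous_on UNIV f'"
    and i: "set_integrable lborel {a..} f'" and top: "(f \<longlongrightarrow> 0) at_top"
  shows "(LINT x:{a..}|lborel. f' x) = - f a"
proof -
  have cf: "isCont f x" for x using d[of x] has_vector_derivative_continuous by blast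
  have i2: "set_integrable lborel {a<..} f'"
    by (rule set_integrable_subset[OF i]) auto
  have "(LBINT x=ereal a..\<infinity>. f' x) = 0 - f a"
  proof (rule interval_integral_FTC_integrable[where F = f])
    show "set_integrable lborel (einterval (ereal a) \<infinity>) f'" using i2 by simp
    show "((f \<circ> real_of_ereal) \<longlongrightarrow> f a) (at_right (ereal a))"
      using cf[of a] by (simp add: ereal_tendsto_simps isCont_def filterlim_at_split)
  qed (use d c top in \<open>auto simp: continuous_on_eq_continuous_at ereal_tendsto_simps\<close>)
  hence "(LINT x:{a<..}|lborel. f' x) = - f a"
    by (simp add: interval_lebesgue_integral_def)
  moreover have "(LINT x:{a..}|lborel. f' x) = (LINT x:{a<..}|lborel. f' x)"
    unfolding set_lebesgue_integral_def
    by (rule integral_cong_AE)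
       (use i i2 AE_lborel_singleton[of a] in \<open>auto simp: set_integrable_def indicator_def\<close>)
  ultimately show ?thesis by simp
qed

section \<open>The zeta function of a regular counting function\<close>

text \<open>Only the counting function enters here, in the variable u = ln x and with an explicit
  constant valid for all real u. The multiplicative structure is added later, in
  \<open>beurling\<close>.\<close>

locale regular_count =
  fixes \<nu> :: "'a \<Rightarrow> real" and A \<theta> C0 :: real
  assumes nu_nonneg: "\<nu> m \<ge> 0"
    and fin_nu: "finite {m. \<nu> m \<le> u}"
    and err_bound': "\<bar>real (card {m. \<nu> m \<le> u}) - A * exp u\<bar> \<le> C0 * exp (\<theta> * u)"
    and A_pos: "A > 0" and theta: "0 \<le> \<theta>" "\<theta> < 1"
begin

definition cnt :: "real \<Rightarrow> real" where "cnt u = real (card {m. \<nu> m \<le> u})"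
definition err :: "real \<Rightarrow> real" where "err u = cnt u - A * exp u"

lemma err_bound: "\<bar>err u\<bar> \<le> C0 * exp (\<theta> * u)"
  using err_bound' by (simp add: err_def cnt_def)

lemma C0_nonneg: "C0 \<ge> 0"
  using err_bound[of 0] by simp

lemma cnt_nonneg [simp]: "cnt u \<ge> 0" by (simp add: cnt_def)

lemma cnt_neg [simp]: "u < 0 \<Longrightarrow> cnt u = 0"
proof -
  assume "u < 0"
  hence "{m. \<nu> m \<le> u} = {}" using nu_nonneg by (auto simp: not_le intro: less_le_trans)
  thus ?thesis by (simp add: cnt_def)
qed

lemma cnt_le: "cnt u \<le> (A + C0) * exp \<bar>u\<bar>"
proof -
  have "cnt u \<le> A * exp u + C0 * exp (\<theta> * u)" using err_bound[of u] by (simp add: err_def)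
  also have "\<theta> * u \<le> \<theta> * \<bar>u\<bar>" using theta by (intro mult_left_mono) auto
  hence "\<theta> * u \<le> 1 * \<bar>u\<bar>" using theta mult_right_mono[of \<theta> 1 "\<bar>u\<bar>"] by linarith
  hence "A * exp u + C0 * exp (\<theta> * u) \<le> A * exp \<bar>u\<bar> + C0 * exp \<bar>u\<bar>"
    using A_pos C0_nonneg by (intro add_mono mult_left_mono) auto
  finally show ?thesis by (simp add: algebra_simps)
qed

lemma cnt_mono: "mono cnt"
  by (auto intro!: monoI card_mono fin_nu simp: cnt_def)

lemma cnt_measurable [measurable]: "cnt \<in> borel_measurable borel"
  by (rule borel_measurable_mono[OF cnt_mono])

lemma err_measurable [measurable]: "err \<in> borel_measurable borel"
  unfolding err_def by measurable

text \<open>Gives sigma-finiteness of the counting measure, so that Fubini applies to sums over the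
  index type.\<close>

lemma countable_index: "countable (UNIV :: 'a set)"
proof -
  have "(UNIV :: 'a set) = (\<Union>n::nat. {m. \<nu> m \<le> real n})"
  proof (intro equalityI subsetI)
    fix m
    obtain n :: nat where "\<nu> m \<le> real n" using real_arch_simple by blast
    thus "m \<in> (\<Union>n::nat. {m. \<nu> m \<le> real n})" by blast
  qed auto
  also have "countable \<dots>" by (rule countable_UN) (auto intro: countable_finite fin_nu)
  finally show ?thesis .
qed

text \<open>Partial summation as Fubini: a point u is covered by exactly \<open>cnt u\<close> of the
  half-lines {\<nu> m..}.\<close>

lemma sum_integral_swap:
  fixes g :: "real \<Rightarrow> complex"
  assumes [measurable]: "g \<in> borel_measurable borel"
    and i: "integrable lborel (\<lambda>u. cnt u * norm (g u))"
  shows "integrable (count_space UNIV) (\<lambda>m. (LINT u:{\<nu> m..}|lborel. g u))"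
    and "(LINT m|count_space UNIV. (LINT u:{\<nu> m..}|lborel. g u)) = (LINT u|lborel. of_real (cnt u) * g u)"
    and "set_integrable lborel {\<nu> m..} g"
proof -
  interpret count: sigma_finite_measure "count_space (UNIV :: 'a set)"
    by (rule sigma_finite_measure_count_space_countable[OF countable_index])
  interpret pair_sigma_finite "count_space (UNIV :: 'a set)" lborel ..
  define f where "f = (\<lambda>m u. indicator {\<nu> m..} u *\<^sub>R g u)"
  have meas [measurable]: "case_prod f \<in> borel_measurable (count_space UNIV \<Otimes>\<^sub>M lborel)"
    unfolding f_def using countable_index by (rule measurable_pair_measure_countable1) simp
  have nn: "(\<integral>\<^sup>+m. ennreal (norm (f m u)) \<partial>count_space UNIV) = ennreal (cnt u * norm (g u))" for u
  proof -
    have "(\<integral>\<^sup>+m. ennreal (norm (f m u)) \<partial>count_space UNIV)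
        = (\<integral>\<^sup>+m. ennreal (norm (g u)) * indicator {m. \<nu> m \<le> u} m \<partial>count_space UNIV)"
      by (intro nn_integral_cong) (auto simp: f_def indicator_def)
    also have "\<dots> = ennreal (norm (g u)) * of_nat (card {m. \<nu> m \<le> u})"
      using fin_nu by (subst nn_integral_cmult_indicator) auto
    finally show ?thesis by (simp add: cnt_def ennreal_mult ennreal_of_nat_eq_real_of_nat mult.commute)
  qed
  have int: "integrable (count_space UNIV \<Otimes>\<^sub>M lborel) (case_prod f)"
  proof (rule integrableI_bounded)
    have "(\<integral>\<^sup>+x. ennreal (norm (case_prod f x)) \<partial>(count_space UNIV \<Otimes>\<^sub>M lborel))
        = (\<integral>\<^sup>+u. \<integral>\<^sup>+m. ennreal (norm (f m u)) \<partial>count_space UNIV \<partial>lborel)"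
      by (subst nn_integral_snd[symmetric]) (auto simp: case_prod_unfold)
    also have "\<dots> < \<infinity>" using i unfolding nn by (subst (asm) integrable_iff_bounded) auto
    finally show "(\<integral>\<^sup>+x. ennreal (norm (case_prod f x)) \<partial>(count_space UNIV \<Otimes>\<^sub>M lborel)) < \<infinity>" .
  qed simp
  have "integrable (count_space UNIV) (\<lambda>m. LINT u|lborel. f m u)"
    using integrable_fst'[OF int] by simp
  thus "integrable (count_space UNIV) (\<lambda>m. (LINT u:{\<nu> m..}|lborel. g u))"
    by (simp add: f_def set_lebesgue_integral_def)
  have inner: "(LINT m|count_space UNIV. f m u) = of_real (cnt u) * g u" for u
  proof -
    have "(LINT m|count_space UNIV. f m u) = (LINT m|count_space UNIV. indicator {m. \<nu> m \<le> u} m *\<^sub>R g u)"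
      by (intro Bochner_Integration.integral_cong) (auto simp: f_def indicator_def)
    also have "\<dots> = measure (count_space UNIV) {m. \<nu> m \<le> u} *\<^sub>R g u"
      using fin_nu[of u] by (intro has_bochner_integral_integral_eq has_bochner_integral_indicator) (auto simp: of_nat_less_top)
    also have "\<dots> = of_real (cnt u) * g u"
      using fin_nu[of u] by (simp add: measure_count_space cnt_def scaleR_conv_of_real)
    finally show ?thesis .
  qed
  have "(LINT u|lborel. LINT m|count_space UNIV. f m u) = (LINT m|count_space UNIV. LINT u|lborel. f m u)"
    by (rule Fubini_integral[OF int])
  thus "(LINT m|count_space UNIV. (LINT u:{\<nu> m..}|lborel. g u)) = (LINT u|lborel. of_real (cnt u) * g u)"
    unfolding inner by (simp add: f_def set_lebesgue_integral_def)
  show "set_integrable lborel {\<nu> m..} g"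
    unfolding set_integrable_def
  proof (rule Bochner_Integration.integrable_bound[OF i])
    show "AE u in lborel. norm (indicator {\<nu> m..} u *\<^sub>R g u) \<le> norm (cnt u * norm (g u))"
    proof (rule AE_I2)
      fix u
      \<comment> \<open>The index \<open>m\<close> itself is counted, so \<open>cnt u\<close> is at
        least 1 on this half-line and the weighted hypothesis dominates the unweighted
        integrand.\<close>
      have "1 * norm (g u) \<le> cnt u * norm (g u)" if "\<nu> m \<le> u"
      proof (intro mult_right_mono)
        have "card {m} \<le> card {m. \<nu> m \<le> u}" using that by (intro card_mono fin_nu) auto
        thus "1 \<le> cnt u" by (simp add: cnt_def)
      qed auto
      thus "norm (indicator {\<nu> m..} u *\<^sub>R g u) \<le> norm (cnt u * norm (g u))"
        by (auto simp: indicator_def abs_mult)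
    qed
  qed simp
qed

text \<open>Partial summation with \<open>cnt\<close> split into A * exp and \<open>err\<close>. The
  smooth part is integrated by parts back to exp u * f u; the irregular \<open>err\<close> has to
  keep f'.\<close>

lemma gauss_summation:
  fixes f f' :: "real \<Rightarrow> complex"
  assumes d: "\<And>x. (f has_vector_derivative f' x) (at x)" and c: "continuous_on UNIV f'" and l: "l > 0"
    and bf: "\<And>x. norm (f x) \<le> K * exp (b * \<bar>x\<bar>) * gs l x"
    and bf': "\<And>x. norm (f' x) \<le> K * exp (b * \<bar>x\<bar>) * gs l x"
  shows "integrable (count_space UNIV) (\<lambda>m. f (\<nu> m))"
    and "(LINT m|count_space UNIV. f (\<nu> m)) = A * (LINT u|lborel. of_real (exp u) * f u) - (LINT u|lborel. of_real (err u) * f' u)"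
proof -
  have cf: "continuous_on UNIV f"
    by (meson d continuous_at_imp_continuous_on has_vector_derivative_continuous)
  have [measurable]: "f \<in> borel_measurable borel" "f' \<in> borel_measurable borel"
    using cf c by (auto intro: borel_measurable_continuous_onI)
  have K: "0 \<le> K"
  proof -
    have "0 \<le> K * gs l 0" using order_trans[OF norm_ge_zero bf[of 0]] by simp
    thus ?thesis using gs_pos[of l 0] by (simp add: zero_le_mult_iff)
  qed
  have top: "(f \<longlongrightarrow> 0) at_top"
  proof (rule Lim_null_comparison)
    show "eventually (\<lambda>x. norm (f x) \<le> K * (exp (b * \<bar>x\<bar>) * gs l x)) at_top"
      using bf by (intro always_eventually) (simp add: mult_ac)
    show "((\<lambda>x. K * (exp (b * \<bar>x\<bar>) * gs l x)) \<longlongrightarrow> 0) at_top"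
      using exp_gs_tendsto_0[OF l] by (intro tendsto_mult_right_zero) auto
  qed
  have w: "norm (of_real (h x) * g x) \<le> (W * K) * exp ((1 + b) * \<bar>x\<bar>) * gs l x"
    if "\<bar>h x\<bar> \<le> W * exp \<bar>x\<bar>" "norm (g x) \<le> K * exp (b * \<bar>x\<bar>) * gs l x" for h :: "real \<Rightarrow> real" and g :: "real \<Rightarrow> complex" and W x
  proof -
    have "norm (of_real (h x) * g x) = \<bar>h x\<bar> * norm (g x)" by (simp add: norm_mult)
    also have "\<dots> \<le> (W * exp \<bar>x\<bar>) * (K * exp (b * \<bar>x\<bar>) * gs l x)"
      using that by (intro mult_mono) (auto intro: order_trans[OF abs_ge_zero])
    finally show ?thesis by (simp add: exp_add algebra_simps)
  qed
  have Ice: "integrable lborel (\<lambda>u. of_real (cnt u) * f' u)"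
  proof (rule integrable_exp_gs[OF l])
    show "norm (of_real (cnt x) * f' x) \<le> ((A + C0) * K) * exp ((1 + b) * \<bar>x\<bar>) * gs l x" for x
      by (rule w[OF _ bf']) (use cnt_le in simp)
  qed simp
  have I1: "integrable lborel (\<lambda>u. of_real (exp u) * f u)"
  proof (rule integrable_exp_gs[OF l])
    show "norm (of_real (exp x) * f x) \<le> (1 * K) * exp ((1 + b) * \<bar>x\<bar>) * gs l x" for x
      by (rule w[OF _ bf]) simp
  qed simp
  have I2: "integrable lborel (\<lambda>u. of_real (exp u) * f' u)"
  proof (rule integrable_exp_gs[OF l])
    show "norm (of_real (exp x) * f' x) \<le> (1 * K) * exp ((1 + b) * \<bar>x\<bar>) * gs l x" for x
      by (rule w[OF _ bf']) simp
  qed simp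
  have Icn: "integrable lborel (\<lambda>u. cnt u * norm (f' u))"
    using integrable_norm[OF Ice] by (simp add: norm_mult)
  have eq: "(LINT u:{\<nu> m..}|lborel. f' u) = - f (\<nu> m)" for m
    by (rule LBINT_atLeast_derivative[OF d c sum_integral_swap(3)[OF _ Icn] top]) simp
  show "integrable (count_space UNIV) (\<lambda>m. f (\<nu> m))"
    using sum_integral_swap(1)[OF _ Icn] unfolding eq by simp
  have s: "- (LINT m|count_space UNIV. f (\<nu> m)) = (LINT u|lborel. of_real (cnt u) * f' u)"
    using sum_integral_swap(2)[OF _ Icn] unfolding eq by simp
  have "(LINT u|lborel. of_real (exp u) * f u + of_real (exp u) * f' u) = 0"
  proof (rule LBINT_derivative_eq_0)
    show "((\<lambda>u. of_real (exp u) * f u) has_vector_derivative of_real (exp x) * f x + of_real (exp x) * f' x) (at x)" for x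
    proof -
      have "((\<lambda>u. complex_of_real (exp u)) has_vector_derivative complex_of_real (exp x)) (at x)"
        by (rule has_vector_derivative_of_real) (rule DERIV_exp)
      from has_vector_derivative_mult[OF this d[of x]] show ?thesis by (simp add: add.commute)
    qed
    show "continuous_on UNIV (\<lambda>x. of_real (exp x) * f x + of_real (exp x) * f' x)"
      by (intro continuous_intros cf c)
    show "integrable lborel (\<lambda>x. of_real (exp x) * f x + of_real (exp x) * f' x)"
      by (intro Bochner_Integration.integrable_add I1 I2)
    have bd: "norm (of_real (exp x) * f x) \<le> K * (exp ((1 + b) * \<bar>x\<bar>) * gs l x)" for x
    proof -
      have "norm (of_real (exp x) * f x) \<le> (1 * K) * exp ((1 + b) * \<bar>x\<bar>) * gs l x"
        by (rule w[OF _ bf]) simp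
      thus ?thesis by (simp add: mult_ac)
    qed
    show "((\<lambda>u. of_real (exp u) * f u) \<longlongrightarrow> 0) at_top"
      by (rule Lim_null_comparison[OF always_eventually tendsto_mult_right_zero[OF exp_gs_tendsto_0(1)[OF l]]]) (use bd in auto)
    show "((\<lambda>u. of_real (exp u) * f u) \<longlongrightarrow> 0) at_bot"
      by (rule Lim_null_comparison[OF always_eventually tendsto_mult_right_zero[OF exp_gs_tendsto_0(2)[OF l]]]) (use bd in auto)
  qed
  hence "(LINT u|lborel. of_real (exp u) * f u) + (LINT u|lborel. of_real (exp u) * f' u) = 0"
    by (simp add: Bochner_Integration.integral_add[OF I1 I2])
  moreover have "(LINT u|lborel. of_real (err u) * f' u) = (LINT u|lborel. of_real (cnt u) * f' u) - A * (LINT u|lborel. of_real (exp u) * f' u)"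
  proof -
    have "(LINT u|lborel. of_real (err u) * f' u) = (LINT u|lborel. of_real (cnt u) * f' u - of_real A * (of_real (exp u) * f' u))"
      by (intro Bochner_Integration.integral_cong) (auto simp: err_def algebra_simps)
    also have "\<dots> = (LINT u|lborel. of_real (cnt u) * f' u) - A * (LINT u|lborel. of_real (exp u) * f' u)"
      using Ice I2 by (subst Bochner_Integration.integral_diff) auto
    finally show ?thesis .
  qed
  ultimately show "(LINT m|count_space UNIV. f (\<nu> m)) = A * (LINT u|lborel. of_real (exp u) * f u) - (LINT u|lborel. of_real (err u) * f' u)"
    using s by (simp add: algebra_simps add_eq_0_iff minus_equation_iff[of "LINT m|count_space UNIV. f (\<nu> m)"])
qed

end

section \<open>One-sided Laplace transforms\<close>

lemma exp_decay_atLeast: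
  fixes a c :: real
  assumes a: "a > 0"
  shows "set_integrable lborel {c..} (\<lambda>u. exp (- (a * u)))"
    and "(LINT u:{c..}|lborel. exp (- (a * u))) = exp (- (a * c)) / a"
proof -
  have nn: "(\<integral>\<^sup>+u. ennreal (exp (- (a * u))) * indicator {c..} u \<partial>lborel) = 0 - (- exp (- (a * c)) / a)"
  proof (rule nn_integral_FTC_atLeast[where F = "\<lambda>u. - exp (- (a * u)) / a"])
    show "((\<lambda>u. - exp (- (a * u)) / a) \<longlongrightarrow> 0) at_top" using a by real_asymp
  qed (use a in \<open>auto intro!: derivative_eq_intros\<close>)
  have eq: "ennreal (indicator {c..} u * exp (- (a * u))) = ennreal (exp (- (a * u))) * indicator {c..} u" for u
    by (auto simp: indicator_def)
  have "has_bochner_integral lborel (\<lambda>u. indicator {c..} u *\<^sub>R exp (- (a * u))) (exp (- (a * c)) / a)"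
    by (rule has_bochner_integral_nn_integral) (use nn a in \<open>auto simp: eq\<close>)
  thus "set_integrable lborel {c..} (\<lambda>u. exp (- (a * u)))"
    and "(LINT u:{c..}|lborel. exp (- (a * u))) = exp (- (a * c)) / a"
    by (auto simp: set_integrable_def set_lebesgue_integral_def has_bochner_integral_iff)
qed

lemma exp_decay_complex:
  fixes z :: complex and c :: real
  assumes z: "Re z > 0"
  shows "set_integrable lborel {c..} (\<lambda>u. exp (- z * of_real u))"
    and "(LINT u:{c..}|lborel. exp (- z * of_real u)) = exp (- z * of_real c) / z"
proof -
  show i: "set_integrable lborel {c..} (\<lambda>u. exp (- z * of_real u))"
    unfolding set_integrable_def
    by (rule Bochner_Integration.integrable_bound[OF exp_decay_atLeast(1)[OF z, of c, unfolded set_integrable_def]])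
       (auto simp: indicator_def)
  have z0: "z \<noteq> 0" using z by auto
  have "(LINT u:{c..}|lborel. exp (- z * of_real u)) = - (- exp (- z * of_real c) / z)"
  proof (rule LBINT_atLeast_derivative[OF _ _ i])
    show "((\<lambda>u. - exp (- z * of_real u) / z) has_vector_derivative exp (- z * of_real u)) (at u)" for u :: real
    proof -
      have "((\<lambda>w. - exp (- z * w) / z) has_field_derivative exp (- z * of_real u)) (at (of_real u))"
        using z0 by (auto intro!: derivative_eq_intros)
      from has_vector_derivative_real_field[OF this] show ?thesis .
    qed
    have "((\<lambda>u. exp (- (Re z * u)) / norm z) \<longlongrightarrow> 0) at_top" using z z0 by real_asymp
    thus "((\<lambda>u. - exp (- z * of_real u) / z) \<longlongrightarrow> 0) at_top"
      by (rule Lim_null_comparison[rotated]) (auto simp: norm_divide)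
  qed (auto intro!: continuous_intros)
  thus "(LINT u:{c..}|lborel. exp (- z * of_real u)) = exp (- z * of_real c) / z" by simp
qed

lemma laplace_bound:
  fixes g :: "real \<Rightarrow> complex"
  assumes [measurable]: "g \<in> borel_measurable borel" and g: "\<And>u. u \<ge> 0 \<Longrightarrow> norm (g u) \<le> C * exp (c * u)"
    and s: "Re s > c"
  shows "set_integrable lborel {0..} (\<lambda>u. exp (- s * of_real u) * g u)"
    and "norm (LINT u:{0..}|lborel. exp (- s * of_real u) * g u) \<le> C / (Re s - c)"
proof -
  have i: "set_integrable lborel {0..} (\<lambda>u. exp (- ((Re s - c) * u)))"
    by (rule exp_decay_atLeast) (use s in simp)
  have i': "integrable lborel (\<lambda>u. C * (indicator {0..} u *\<^sub>R exp (- ((Re s - c) * u))))"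
    using i unfolding set_integrable_def by (rule integrable_mult_right)
  have bd: "norm (indicator {0..} u *\<^sub>R (exp (- s * of_real u) * g u)) \<le> C * (indicator {0..} u *\<^sub>R exp (- ((Re s - c) * u)))" for u
  proof (cases "u \<ge> 0")
    case True
    have "norm (exp (- s * of_real u) * g u) \<le> exp (- Re s * u) * (C * exp (c * u))"
      using g[OF True] by (simp add: norm_mult)
    also have "\<dots> = C * exp (- ((Re s - c) * u))" by (simp add: algebra_simps flip: exp_add)
    finally show ?thesis using True by simp
  qed simp
  show "set_integrable lborel {0..} (\<lambda>u. exp (- s * of_real u) * g u)"
    unfolding set_integrable_def
  proof (rule Bochner_Integration.integrable_bound[OF i'])
    show "AE u in lborel. norm (indicator {0..} u *\<^sub>R (exp (- s * of_real u) * g u)) \<le> norm (C * (indicator {0..} u *\<^sub>R exp (- ((Re s - c) * u))))"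
      by (rule AE_I2, rule order_trans[OF bd]) (simp only: real_norm_def abs_ge_self)
  qed measurable
  have "norm (LINT u:{0..}|lborel. exp (- s * of_real u) * g u)
      \<le> (LINT u|lborel. C * (indicator {0..} u *\<^sub>R exp (- ((Re s - c) * u))))"
    unfolding set_lebesgue_integral_def
    by (rule Bochner_Integration.integral_norm_bound_integral[OF \<open>set_integrable lborel {0..} (\<lambda>u. exp (- s * of_real u) * g u)\<close>[unfolded set_integrable_def] i']) (rule bd)
  also have "\<dots> = C / (Re s - c)"
    using exp_decay_atLeast(2)[of "Re s - c" 0] s by (simp add: set_lebesgue_integral_def)
  finally show "norm (LINT u:{0..}|lborel. exp (- s * of_real u) * g u) \<le> C / (Re s - c)" .
qed

text \<open>Differentiation under the integral sign, by dominated convergence of the difference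
  quotients along an arbitrary sequence tending to the point.\<close>

lemma laplace_holomorphic:
  fixes g :: "real \<Rightarrow> complex"
  assumes [measurable]: "g \<in> borel_measurable borel" and g: "\<And>u. u \<ge> 0 \<Longrightarrow> norm (g u) \<le> C * exp (c * u)"
  shows "(\<lambda>s. LINT u:{0..}|lborel. exp (- s * of_real u) * g u) holomorphic_on {s. Re s > c}"
proof (rule holomorphic_onI)
  fix s0 assume "s0 \<in> {s. Re s > c}"
  hence s0: "Re s0 > c" by simp
  \<comment> \<open>The distance to the abscissa c is spent in three equal parts: one keeps the
    sequence inside Re s \<ge> c + 2 * \<epsilon>, one absorbs the factor u produced by the
    derivative, one remains as decay of the dominating function.\<close>
  define \<epsilon> where "\<epsilon> = (Re s0 - c) / 3"
  have "3 * \<epsilon> = Re s0 - c" by (simp add: \<epsilon>_def)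
  hence eps: "\<epsilon> > 0" "Re s0 = c + 3 * \<epsilon>" using s0 by linarith+
  define F where "F = (\<lambda>s. LINT u:{0..}|lborel. exp (- s * of_real u) * g u)"
  define D where "D = (LINT u:{0..}|lborel. - of_real u * exp (- s0 * of_real u) * g u)"
  have C: "C \<ge> 0" using order_trans[OF norm_ge_zero g[of 0]] by simp
  have "((\<lambda>s. (F s - F s0) / (s - s0)) \<longlongrightarrow> D) (at s0)"
    unfolding tendsto_at_iff_sequentially
  proof (intro allI impI)
    fix X :: "nat \<Rightarrow> complex"
    assume X0: "\<forall>i. X i \<in> UNIV - {s0}" and X: "X \<longlonglongrightarrow> s0"
    have "\<forall>\<^sub>F i in sequentially. dist (X i) s0 < \<epsilon>" using X eps tendstoD by blast
    then obtain N where N: "\<And>i. i \<ge> N \<Longrightarrow> dist (X i) s0 < \<epsilon>" by (auto simp: eventually_sequentially)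
    define Y where "Y = (\<lambda>i. X (i + N))"
    have Y: "Y \<longlonglongrightarrow> s0" unfolding Y_def using X by (rule LIMSEQ_ignore_initial_segment)
    have Yne: "Y i \<noteq> s0" for i using X0 by (auto simp: Y_def)
    have YRe: "Re (Y i) \<ge> c + 2 * \<epsilon>" for i
    proof -
      have "\<bar>Re (Y i - s0)\<bar> < \<epsilon>"
        using N[of "i + N"] abs_Re_le_cmod[of "Y i - s0"] by (auto simp: Y_def dist_norm)
      thus ?thesis using eps by (simp add: abs_less_iff)
    qed
    let ?q = "\<lambda>i u. indicator {0..} u *\<^sub>R ((exp (- Y i * of_real u) - exp (- s0 * of_real u)) / (Y i - s0) * g u)"
    have "(\<lambda>i. LINT u|lborel. ?q i u) \<longlonglongrightarrow> (LINT u|lborel. indicator {0..} u *\<^sub>R (- of_real u * exp (- s0 * of_real u) * g u))"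
    proof (rule integral_dominated_convergence)
      show "integrable lborel (\<lambda>u. C / \<epsilon> * (indicator {0..} u *\<^sub>R exp (- (\<epsilon> * u))))"
        using exp_decay_atLeast(1)[OF eps(1), of 0] unfolding set_integrable_def by (rule integrable_mult_right)
      show "AE u in lborel. (\<lambda>i. ?q i u) \<longlonglongrightarrow> indicator {0..} u *\<^sub>R (- of_real u * exp (- s0 * of_real u) * g u)"
      proof (rule AE_I2)
        fix u :: real
        have "((\<lambda>s. exp (- s * of_real u)) has_field_derivative - of_real u * exp (- s0 * of_real u)) (at s0)"
          by (auto intro!: derivative_eq_intros)
        hence "((\<lambda>s. (exp (- s * of_real u) - exp (- s0 * of_real u)) / (s - s0)) \<longlongrightarrow> - of_real u * exp (- s0 * of_real u)) (at s0)"
          by (simp add: has_field_derivative_iff)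
        hence "((\<lambda>s. (exp (- s * of_real u) - exp (- s0 * of_real u)) / (s - s0)) \<circ> Y) \<longlonglongrightarrow> - of_real u * exp (- s0 * of_real u)"
          using Y Yne unfolding tendsto_at_iff_sequentially by auto
        thus "(\<lambda>i. ?q i u) \<longlonglongrightarrow> indicator {0..} u *\<^sub>R (- of_real u * exp (- s0 * of_real u) * g u)"
          unfolding o_def by (intro tendsto_intros)
      qed
      show "AE u in lborel. norm (?q i u) \<le> C / \<epsilon> * (indicator {0..} u *\<^sub>R exp (- (\<epsilon> * u)))" for i
      proof (rule AE_I2)
        fix u :: real
        show "norm (?q i u) \<le> C / \<epsilon> * (indicator {0..} u *\<^sub>R exp (- (\<epsilon> * u)))"
        proof (cases "u \<ge> 0")
          case u: True
          have "norm (exp (- Y i * of_real u) - exp (- s0 * of_real u)) \<le> (u * exp (- (c + 2 * \<epsilon>) * u)) * norm (Y i - s0)"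
          proof (rule field_differentiable_bound[of "{s. Re s \<ge> c + 2 * \<epsilon>}"])
            show "convex {s. Re s \<ge> c + 2 * \<epsilon>}" by (rule convex_halfspace_Re_ge)
            show "((\<lambda>s. exp (- s * of_real u)) has_field_derivative - of_real u * exp (- z * of_real u)) (at z within {s. Re s \<ge> c + 2 * \<epsilon>})" for z
              by (auto intro!: derivative_eq_intros)
            show "norm (- of_real u * exp (- z * of_real u)) \<le> u * exp (- (c + 2 * \<epsilon>) * u)" if "z \<in> {s. Re s \<ge> c + 2 * \<epsilon>}" for z
              using that u mult_right_mono[of "c + 2 * \<epsilon>" "Re z" u] by (auto simp: norm_mult algebra_simps intro!: mult_left_mono)
          qed (use YRe eps in auto)
          hence "norm ((exp (- Y i * of_real u) - exp (- s0 * of_real u)) / (Y i - s0)) \<le> u * exp (- (c + 2 * \<epsilon>) * u)"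
            using Yne[of i] by (simp add: norm_divide divide_le_eq)
          hence "norm (?q i u) \<le> (u * exp (- (c + 2 * \<epsilon>) * u)) * (C * exp (c * u))"
            using u g[OF u] by (simp only: norm_mult norm_scaleR) (auto intro!: mult_mono)
          also have "\<dots> = C * (u * exp (- (2 * \<epsilon> * u)))"
            by (simp add: algebra_simps flip: exp_add)
          also have "u * exp (- (2 * \<epsilon> * u)) \<le> (exp (\<epsilon> * u) / \<epsilon>) * exp (- (2 * \<epsilon> * u))"
          proof (intro mult_right_mono)
            have "\<epsilon> * u \<le> exp (\<epsilon> * u)" using exp_ge_add_one_self[of "\<epsilon> * u"] by linarith
            thus "u \<le> exp (\<epsilon> * u) / \<epsilon>" using eps by (simp add: field_simps)
          qed simp
          also have "\<dots> = exp (- (\<epsilon> * u)) / \<epsilon>" by (simp flip: exp_add)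
          finally show ?thesis using u C by (simp add: mult_left_mono)
        qed simp
      qed
    qed measurable
    hence lim: "(\<lambda>i. LINT u|lborel. ?q i u) \<longlonglongrightarrow> D" by (simp add: D_def set_lebesgue_integral_def)
    have eq: "(F (Y i) - F s0) / (Y i - s0) = (LINT u|lborel. ?q i u)" for i
    proof -
      have i1: "set_integrable lborel {0..} (\<lambda>u. exp (- Y i * of_real u) * g u)"
        by (rule laplace_bound(1)[OF _ g]) (use YRe[of i] eps in auto)
      have i2: "set_integrable lborel {0..} (\<lambda>u. exp (- s0 * of_real u) * g u)"
        by (rule laplace_bound(1)[OF _ g]) (use s0 in auto)
      have "F (Y i) - F s0 = (LINT u:{0..}|lborel. exp (- Y i * of_real u) * g u - exp (- s0 * of_real u) * g u)"
        unfolding F_def by (rule set_integral_diff(2)[symmetric, OF i1 i2])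
      also have "\<dots> / (Y i - s0) = (LINT u|lborel. ?q i u)"
        unfolding set_lebesgue_integral_def integral_divide_zero[symmetric]
        by (intro Bochner_Integration.integral_cong) (auto simp: indicator_def algebra_simps diff_divide_distrib)
      finally show ?thesis .
    qed
    have "(\<lambda>i. (F (X (i + N)) - F s0) / (X (i + N) - s0)) \<longlonglongrightarrow> D"
      using lim by (simp only: eq[unfolded Y_def] Y_def)
    hence "(\<lambda>i. (F (X i) - F s0) / (X i - s0)) \<longlonglongrightarrow> D" by (rule LIMSEQ_offset)
    thus "((\<lambda>s. (F s - F s0) / (s - s0)) \<circ> X) \<longlonglongrightarrow> D" by (simp add: o_def)
  qed
  hence "(F has_field_derivative D) (at s0)" by (simp add: has_field_derivative_iff)
  hence "F field_differentiable at s0" by (auto simp: field_differentiable_def)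
  thus "(\<lambda>s. LINT u:{0..}|lborel. exp (- s * of_real u) * g u) field_differentiable at s0 within {s. Re s > c}"
    unfolding F_def by (rule field_differentiable_at_within)
qed

section \<open>Continuation of zeta to the half-plane Re s > \<theta>\<close>

context regular_count
begin

definition mel :: "complex \<Rightarrow> complex" where
  "mel s = (LINT u:{0..}|lborel. exp (- s * of_real u) * of_real (err u))"

text \<open>The classical s times the integral of N(x) x^(-s-1) over x \<ge> 1, with N split into A
  x and the error; the first part gives the pole. At s = 1 division by zero leaves the value
  \<open>mel 1\<close>.\<close>

definition zet :: "complex \<Rightarrow> complex" where
  "zet s = of_real A * s / (s - 1) + s * mel s"

lemma err_bound_complex: "norm (complex_of_real (err u)) \<le> C0 * exp (\<theta> * u)"
  using err_bound[of u] by simp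

lemma mel_bound: "Re s > \<theta> \<Longrightarrow> norm (mel s) \<le> C0 / (Re s - \<theta>)"
  unfolding mel_def by (rule laplace_bound(2)[OF _ err_bound_complex]) auto

lemma mel_holomorphic: "mel holomorphic_on {s. Re s > \<theta>}"
  unfolding mel_def by (rule laplace_holomorphic[OF _ err_bound_complex]) auto

lemma zet_holomorphic: "zet holomorphic_on ({s. Re s > \<theta>} - {1})"
  unfolding zet_def
  by (intro holomorphic_intros holomorphic_on_subset[OF mel_holomorphic]) auto

text \<open>Each term is s times the integral of exp (- s * u) over u \<ge> \<nu> m; summed over m,
  the point u receives the weight \<open>cnt u\<close>.\<close>

lemma zet_dirichlet:
  assumes s: "Re s > 1"
  shows "integrable (count_space UNIV) (\<lambda>m. exp (- s * of_real (\<nu> m)))"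
    and "(LINT m|count_space UNIV. exp (- s * of_real (\<nu> m))) = zet s"
proof -
  have s0: "s \<noteq> 0" "s \<noteq> 1" using s by auto
  let ?g = "\<lambda>u::real. s * (indicator {0..} u *\<^sub>R exp (- s * of_real u))"
  have ig: "integrable lborel (\<lambda>u. cnt u * norm (?g u))"
  proof (rule Bochner_Integration.integrable_bound)
    show "integrable lborel (\<lambda>u. ((A + C0) * norm s) * (indicator {0..} u *\<^sub>R exp (- ((Re s - 1) * u))))"
      using exp_decay_atLeast(1)[of "Re s - 1" 0] s unfolding set_integrable_def by (intro integrable_mult_right) auto
    show "AE u in lborel. norm (cnt u * norm (?g u)) \<le> norm (((A + C0) * norm s) * (indicator {0..} u *\<^sub>R exp (- ((Re s - 1) * u))))"
    proof (rule AE_I2)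
      fix u :: real
      show "norm (cnt u * norm (?g u)) \<le> norm (((A + C0) * norm s) * (indicator {0..} u *\<^sub>R exp (- ((Re s - 1) * u))))"
      proof (cases "u \<ge> 0")
        case True
        have "norm (cnt u * norm (?g u)) = cnt u * (norm s * exp (- Re s * u))" using True by (simp add: norm_mult abs_mult)
        also have "\<dots> \<le> ((A + C0) * exp \<bar>u\<bar>) * (norm s * exp (- Re s * u))"
          by (intro mult_right_mono cnt_le) auto
        also have "\<dots> = ((A + C0) * norm s) * exp (- ((Re s - 1) * u))"
          using True by (simp add: algebra_simps flip: exp_add)
        also have "\<dots> = norm (((A + C0) * norm s) * (indicator {0..} u *\<^sub>R exp (- ((Re s - 1) * u))))"
          using True A_pos C0_nonneg by (simp add: abs_mult)
        finally show ?thesis .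
      qed simp
    qed
  qed simp
  have eq: "(LINT u:{\<nu> m..}|lborel. ?g u) = exp (- s * of_real (\<nu> m))" for m
  proof -
    have "(LINT u:{\<nu> m..}|lborel. ?g u) = (LINT u|lborel. s * (indicator {\<nu> m..} u *\<^sub>R exp (- s * of_real u)))"
      unfolding set_lebesgue_integral_def
      by (intro Bochner_Integration.integral_cong refl) (use nu_nonneg[of m] in \<open>auto simp: indicator_def\<close>)
    also have "\<dots> = s * (LINT u:{\<nu> m..}|lborel. exp (- s * of_real u))"
      unfolding set_lebesgue_integral_def by (rule integral_mult_right_zero)
    also have "\<dots> = exp (- s * of_real (\<nu> m))" using exp_decay_complex(2)[of s "\<nu> m"] s s0 by simp
    finally show ?thesis .
  qed
  show "integrable (count_space UNIV) (\<lambda>m. exp (- s * of_real (\<nu> m)))"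
    using sum_integral_swap(1)[OF _ ig] unfolding eq by simp
  have i1: "set_integrable lborel {0..} (\<lambda>u. exp (- s * of_real u) * of_real (err u))"
    by (rule laplace_bound(1)[OF _ err_bound_complex]) (use s theta in auto)
  have i2: "set_integrable lborel {0..} (\<lambda>u. exp (- (s - 1) * of_real u))"
    by (rule exp_decay_complex(1)) (use s in auto)
  have "(LINT m|count_space UNIV. exp (- s * of_real (\<nu> m))) = (LINT u|lborel. of_real (cnt u) * ?g u)"
    using sum_integral_swap(2)[OF _ ig] unfolding eq by simp
  also have "\<dots> = (LINT u|lborel. s * (indicator {0..} u *\<^sub>R (exp (- s * of_real u) * of_real (err u)))
      + (of_real A * s) * (indicator {0..} u *\<^sub>R exp (- (s - 1) * of_real u)))"
  proof (intro Bochner_Integration.integral_cong refl)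
    fix u :: real
    have "exp (- (s - 1) * of_real u) = exp (- s * of_real u) * of_real (exp u)"
      by (simp add: algebra_simps exp_add exp_diff exp_minus exp_of_real field_simps)
    thus "of_real (cnt u) * ?g u = s * (indicator {0..} u *\<^sub>R (exp (- s * of_real u) * of_real (err u)))
      + (of_real A * s) * (indicator {0..} u *\<^sub>R exp (- (s - 1) * of_real u))"
      by (simp add: err_def algebra_simps indicator_def)
  qed
  also have "\<dots> = s * (LINT u:{0..}|lborel. exp (- s * of_real u) * of_real (err u)) +
       (of_real A * s) * (LINT u:{0..}|lborel. exp (- (s - 1) * of_real u))"
    unfolding set_lebesgue_integral_def
    by (simp only: Bochner_Integration.integral_add[OF integrable_mult_right[OF i1[unfolded set_integrable_def]]
          integrable_mult_right[OF i2[unfolded set_integrable_def]]] integral_mult_right_zero)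
  also have "(LINT u:{0..}|lborel. exp (- (s - 1) * of_real u)) = 1 / (s - 1)"
    using exp_decay_complex(2)[of "s - 1" 0] s by simp
  finally show "(LINT m|count_space UNIV. exp (- s * of_real (\<nu> m))) = zet s"
    by (simp add: zet_def mel_def)
qed

lemma exp_decay_atMost:
  fixes z :: complex
  assumes z: "Re z > 0"
  shows "set_integrable lborel {..<c} (\<lambda>u. exp (z * of_real u))"
    and "(LINT u:{..<c}|lborel. exp (z * of_real u)) = exp (z * of_real c) / z"
proof -
  have ae: "AE u in lborel. (indicator {- c<..} u *\<^sub>R exp (- z * of_real u)) = (indicator {- c..} u *\<^sub>R exp (- z * of_real u))"
    using AE_lborel_singleton[of "- c"] by eventually_elim (auto simp: indicator_def)
  have i: "integrable lborel (\<lambda>u. indicator {- c<..} u *\<^sub>R exp (- z * of_real u))"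
    by (subst integrable_cong_AE[OF _ _ ae]) (use exp_decay_complex(1)[OF z, of "- c"] in \<open>auto simp: set_integrable_def\<close>)
  have v: "(LINT u|lborel. indicator {- c<..} u *\<^sub>R exp (- z * of_real u)) = exp (z * of_real c) / z"
    by (subst integral_cong_AE[OF _ _ ae]) (use exp_decay_complex(2)[OF z, of "- c"] in \<open>auto simp: set_lebesgue_integral_def\<close>)
  have eq: "indicator {- c<..} (0 + (- 1) * u) *\<^sub>R exp (- z * of_real (0 + (- 1) * u)) = indicator {..<c} u *\<^sub>R exp (z * of_real u)" for u
    by (auto simp: indicator_def)
  show "set_integrable lborel {..<c} (\<lambda>u. exp (z * of_real u))"
    using lborel_integrable_real_affine[OF i, of "-1" 0] unfolding eq by (simp add: set_integrable_def)
  show "(LINT u:{..<c}|lborel. exp (z * of_real u)) = exp (z * of_real c) / z"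
    using lborel_integral_real_affine[of "-1" "\<lambda>u. indicator {- c<..} u *\<^sub>R exp (- z * of_real u)" 0] v
    unfolding eq by (simp add: set_lebesgue_integral_def)
qed

text \<open>For Re s < 1 the pole term is itself an integral: \<open>err u\<close> equals - A * exp
  u for u < 0, and that half-line contributes - A / (1 - s). Zeta becomes s times a two-sided
  transform, so Fourier analysis applies without treating the pole separately.\<close>

lemma zet_mellin:
  assumes s: "\<theta> < Re s" "Re s < 1"
  shows "integrable lborel (\<lambda>u. exp (- s * of_real u) * of_real (err u))"
    and "zet s = s * (LINT u|lborel. exp (- s * of_real u) * of_real (err u))"
proof -
  have i1: "integrable lborel (\<lambda>u. indicator {0..} u *\<^sub>R (exp (- s * of_real u) * of_real (err u)))"
    using laplace_bound(1)[OF _ err_bound_complex s(1)] by (simp add: set_integrable_def)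
  have i2: "integrable lborel (\<lambda>u. (- of_real A) * (indicator {..<0} u *\<^sub>R exp ((1 - s) * of_real u)))"
    using exp_decay_atMost(1)[of "1 - s" 0] s by (intro integrable_mult_right) (simp add: set_integrable_def)
  have eq: "exp (- s * of_real u) * of_real (err u) = indicator {0..} u *\<^sub>R (exp (- s * of_real u) * of_real (err u))
     + (- of_real A) * (indicator {..<0} u *\<^sub>R exp ((1 - s) * of_real u))" for u
  proof (cases "u \<ge> 0")
    case False
    have "exp ((1 - s) * of_real u) = exp (- s * of_real u) * of_real (exp u)"
      by (simp add: algebra_simps exp_add exp_diff exp_minus exp_of_real field_simps)
    thus ?thesis using False by (simp add: err_def)
  qed simp
  show "integrable lborel (\<lambda>u. exp (- s * of_real u) * of_real (err u))"
    by (subst eq) (intro Bochner_Integration.integrable_add i1 i2)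
  have "(LINT u|lborel. exp (- s * of_real u) * of_real (err u)) =
     (LINT u|lborel. indicator {0..} u *\<^sub>R (exp (- s * of_real u) * of_real (err u))) +
     (LINT u|lborel. (- of_real A) * (indicator {..<0} u *\<^sub>R exp ((1 - s) * of_real u)))"
    by (subst eq) (rule Bochner_Integration.integral_add[OF i1 i2])
  also have "\<dots> = mel s - of_real A * (1 / (1 - s))"
    using exp_decay_atMost(2)[of "1 - s" 0] s unfolding integral_mult_right_zero by (simp add: mel_def set_lebesgue_integral_def)
  finally have *: "(LINT u|lborel. exp (- s * of_real u) * of_real (err u)) = mel s - of_real A * (1 / (1 - s))" .
  have "1 / (s - 1) = - (1 / (1 - s))" by (metis minus_diff_eq minus_divide_right)
  thus "zet s = s * (LINT u|lborel. exp (- s * of_real u) * of_real (err u))"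
    unfolding * zet_def by (simp add: algebra_simps divide_inverse)
qed

lemma mel_cnj: "mel (cnj s) = cnj (mel s)"
proof -
  have eq: "(\<lambda>u. indicator {0..} u *\<^sub>R (exp (- cnj s * of_real u) * of_real (err u)))
      = (\<lambda>u. cnj (indicator {0..} u *\<^sub>R (exp (- s * of_real u) * of_real (err u))))"
    by (rule ext) (simp add: exp_cnj)
  show ?thesis unfolding mel_def set_lebesgue_integral_def eq by (rule Bochner_Integration.integral_cnj)
qed

lemma zet_cnj: "zet (cnj s) = cnj (zet s)"
  by (simp add: zet_def mel_cnj)

lemma zet_bound:
  assumes s: "Re s \<ge> \<sigma>" and sg: "\<sigma> > \<theta>"
  shows "norm ((s - 1) * zet s) \<le> (A + C0 / (\<sigma> - \<theta>)) * (1 + norm s)\<^sup>2"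
proof (cases "s = 1")
  case True
  thus ?thesis using A_pos C0_nonneg sg by simp
next
  case False
  have m: "norm (mel s) \<le> C0 / (\<sigma> - \<theta>)"
    by (rule order_trans[OF mel_bound]) (use s sg C0_nonneg in \<open>auto intro!: divide_left_mono\<close>)
  have "(s - 1) * zet s = of_real A * s + s * (s - 1) * mel s"
    using False by (simp add: zet_def field_simps)
  hence "norm ((s - 1) * zet s) \<le> A * norm s + norm s * norm (s - 1) * norm (mel s)"
    using norm_triangle_ineq[of "of_real A * s" "s * (s - 1) * mel s"] A_pos by (simp add: norm_mult)
  also have "\<dots> \<le> A * (1 + norm s)\<^sup>2 + (1 + norm s)\<^sup>2 * (C0 / (\<sigma> - \<theta>))"
  proof (intro add_mono mult_left_mono mult_mono m)
    show "norm s \<le> (1 + norm s)\<^sup>2" by (simp add: power2_eq_square algebra_simps)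
    have "norm (s - 1) \<le> 1 + norm s" using norm_triangle_ineq4[of s 1] by simp
    thus "norm s * norm (s - 1) \<le> (1 + norm s)\<^sup>2" unfolding power2_eq_square by (intro mult_mono) auto
  qed (use A_pos in auto)
  finally show ?thesis by (simp add: algebra_simps)
qed

text \<open>Linear growth on each vertical line is enough, because this bound is only ever met by
  Gaussian tails.\<close>

lemma zet_growth:
  assumes s: "\<theta> < Re s" "Re s < 1"
  shows "norm (zet s) \<le> (A / (1 - Re s) + C0 / (Re s - \<theta>)) * (1 + \<bar>Im s\<bar>)"
proof -
  have n: "norm s \<le> 1 + \<bar>Im s\<bar>" using cmod_le[of s] s theta by simp
  have "1 - Re s \<le> norm (s - 1)" using abs_Re_le_cmod[of "s - 1"] s by simp
  hence "norm (of_real A * s / (s - 1)) \<le> A * norm s / (1 - Re s)"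
    using A_pos s by (auto simp: norm_divide norm_mult intro!: divide_left_mono mult_pos_pos)
  hence "norm (zet s) \<le> A * norm s / (1 - Re s) + norm s * (C0 / (Re s - \<theta>))"
    unfolding zet_def by (intro order_trans[OF norm_triangle_ineq] add_mono) (simp_all only: norm_mult mult_left_mono[OF mel_bound[OF s(1)] norm_ge_zero])
  also have "\<dots> = (A / (1 - Re s) + C0 / (Re s - \<theta>)) * norm s" by (simp add: algebra_simps)
  also have "\<dots> \<le> (A / (1 - Re s) + C0 / (Re s - \<theta>)) * (1 + \<bar>Im s\<bar>)"
    using n s A_pos C0_nonneg by (intro mult_left_mono) auto
  finally show ?thesis .
qed

end

section \<open>Gaussian Dirichlet sums\<close>

lemma integrable_product_bound:
  fixes f :: "real \<Rightarrow> real \<Rightarrow> complex" and a b :: "real \<Rightarrow> real"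
  assumes a: "integrable lborel a" and b: "integrable lborel b"
    and [measurable]: "case_prod f \<in> borel_measurable (lborel \<Otimes>\<^sub>M lborel)"
    and bd: "\<And>x y. norm (f x y) \<le> a x * b y"
  shows "integrable (lborel \<Otimes>\<^sub>M lborel) (case_prod f)"
proof (rule integrableI_bounded)
  have [measurable]: "a \<in> borel_measurable borel" "b \<in> borel_measurable borel" using a b by auto
  have "(\<integral>\<^sup>+z. ennreal (norm (case_prod f z)) \<partial>(lborel \<Otimes>\<^sub>M lborel))
      = (\<integral>\<^sup>+x. \<integral>\<^sup>+y. ennreal (norm (f x y)) \<partial>lborel \<partial>lborel)"
    using lborel.nn_integral_fst[of "\<lambda>z. ennreal (norm (case_prod f z))" lborel] by simp
  also have "\<dots> \<le> (\<integral>\<^sup>+x. \<integral>\<^sup>+y. ennreal (norm (a x)) * ennreal (norm (b y)) \<partial>lborel \<partial>lborel)"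
  proof (intro nn_integral_mono)
    fix x y
    have "norm (f x y) \<le> norm (a x) * norm (b y)" using bd[of x y] by (simp add: abs_mult flip: abs_mult)
    thus "ennreal (norm (f x y)) \<le> ennreal (norm (a x)) * ennreal (norm (b y))"
      by (simp flip: ennreal_mult add: ennreal_leI)
  qed
  also have "\<dots> = (\<integral>\<^sup>+x. ennreal (norm (a x)) \<partial>lborel) * (\<integral>\<^sup>+y. ennreal (norm (b y)) \<partial>lborel)"
    by (simp add: nn_integral_cmult nn_integral_multc)
  also have "\<dots> < \<infinity>" using a b by (auto simp: integrable_iff_bounded ennreal_mult_less_top)
  finally show "(\<integral>\<^sup>+z. ennreal (norm (case_prod f z)) \<partial>(lborel \<Otimes>\<^sub>M lborel)) < \<infinity>" .
qed simp

lemma integrable_convolution: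
  fixes a k :: "real \<Rightarrow> complex"
  assumes a: "integrable lborel a" and k: "integrable lborel k"
  shows "integrable (lborel \<Otimes>\<^sub>M lborel) (\<lambda>(t, u). a u * k (u - t))"
proof (rule integrableI_bounded)
  have [measurable]: "a \<in> borel_measurable borel" "k \<in> borel_measurable borel" using a k by auto
  show "(\<lambda>(t, u). a u * k (u - t)) \<in> borel_measurable (lborel \<Otimes>\<^sub>M lborel)" by measurable
  have tr: "(\<integral>\<^sup>+t. ennreal (norm (k (u - t))) \<partial>lborel) = (\<integral>\<^sup>+x. ennreal (norm (k x)) \<partial>lborel)" for u
    using nn_integral_real_affine[of "\<lambda>x. ennreal (norm (k x))" "-1" u] by simp
  have "(\<integral>\<^sup>+z. ennreal (norm (case z of (t, u) \<Rightarrow> a u * k (u - t))) \<partial>(lborel \<Otimes>\<^sub>M lborel))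
      = (\<integral>\<^sup>+u. \<integral>\<^sup>+t. ennreal (norm (a u)) * ennreal (norm (k (u - t))) \<partial>lborel \<partial>lborel)"
    using lborel_pair.nn_integral_snd[of "\<lambda>z. ennreal (norm (case z of (t, u) \<Rightarrow> a u * k (u - t)))"]
    by (simp add: norm_mult ennreal_mult)
  also have "\<dots> = (\<integral>\<^sup>+u. ennreal (norm (a u)) \<partial>lborel) * (\<integral>\<^sup>+x. ennreal (norm (k x)) \<partial>lborel)"
    by (simp add: nn_integral_cmult nn_integral_multc tr)
  also have "\<dots> < \<infinity>" using a k by (auto simp: integrable_iff_bounded ennreal_mult_less_top)
  finally show "(\<integral>\<^sup>+z. ennreal (norm (case z of (t, u) \<Rightarrow> a u * k (u - t))) \<partial>(lborel \<Otimes>\<^sub>M lborel)) < \<infinity>" .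
qed

lemma integrable_gauss_linear:
  fixes p q z :: complex
  assumes l: "l > 0"
  shows "integrable lborel (\<lambda>x. exp (z * of_real x) * (p + q * of_real x) * of_real (gs l x))"
proof (rule integrable_exp_gs[OF l])
  fix x :: real
  have "\<bar>x\<bar> \<le> exp \<bar>x\<bar>" using exp_ge_add_one_self[of "\<bar>x\<bar>"] by linarith
  hence "norm (p + q * of_real x) \<le> norm p * exp \<bar>x\<bar> + norm q * exp \<bar>x\<bar>"
    by (intro order_trans[OF norm_triangle_ineq] add_mono)
       (auto simp: norm_mult intro!: mult_left_mono mult_le_cancel_left1[THEN iffD2])
  moreover have "norm (exp (z * of_real x)) \<le> exp (norm z * \<bar>x\<bar>)"
    by (rule order_trans[OF norm_exp]) (simp add: norm_mult)
  ultimately have "norm (exp (z * of_real x) * (p + q * of_real x) * of_real (gs l x))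
     \<le> exp (norm z * \<bar>x\<bar>) * (norm p * exp \<bar>x\<bar> + norm q * exp \<bar>x\<bar>) * gs l x"
    by (auto simp: norm_mult intro!: mult_mono)
  also have "\<dots> = (norm p + norm q) * exp ((norm z + 1) * \<bar>x\<bar>) * gs l x"
    by (simp add: exp_add algebra_simps)
  finally show "norm (exp (z * of_real x) * (p + q * of_real x) * of_real (gs l x))
     \<le> (norm p + norm q) * exp ((norm z + 1) * \<bar>x\<bar>) * gs l x" .
qed simp

lemma gs_has_vector_derivative:
  "((\<lambda>u. complex_of_real (gs l (u - t))) has_vector_derivative of_real (- l * (u - t) * gs l (u - t))) (at u)"
proof (rule has_vector_derivative_of_real)
  show "((\<lambda>u. gs l (u - t)) has_real_derivative - l * (u - t) * gs l (u - t)) (at u)"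
    unfolding gs_def by (auto intro!: derivative_eq_intros simp: power2_eq_square field_simps)
qed

lemma exp_has_vector_derivative:
  "((\<lambda>u. exp (z * complex_of_real u)) has_vector_derivative z * exp (z * of_real u)) (at u)"
proof -
  have "((\<lambda>w. exp (z * w)) has_field_derivative z * exp (z * of_real u)) (at (of_real u))"
    by (auto intro!: derivative_eq_intros)
  from has_vector_derivative_real_field[OF this] show ?thesis .
qed

text \<open>The function (z - l * x) * exp (z * x) * gs l x is a derivative and has integral 0, so
  under the integral the factor l * x may be replaced by z.\<close>

lemma gauss_linear_moment:
  fixes s z :: complex
  assumes l: "l > 0"
  shows "(LINT x|lborel. exp (z * of_real x) * (s + of_real l * of_real x) * of_real (gs l x))
     = (s + z) * (of_real (sqrt (2 * pi / l)) * exp (z\<^sup>2 / (2 * of_real l)))"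
proof -
  let ?f = "\<lambda>x. exp (z * of_real x) * of_real (gs l (x - 0))"
  let ?f' = "\<lambda>x. exp (z * of_real x) * (z + (- of_real l) * of_real x) * of_real (gs l x)"
  have i: "integrable lborel ?f'" by (rule integrable_gauss_linear[OF l])
  have i0: "integrable lborel (\<lambda>x. exp (z * of_real x) * of_real (gs l x))" by (rule gs_ft[OF l])
  have d: "(?f has_vector_derivative ?f' x) (at x)" for x
    using has_vector_derivative_mult[OF exp_has_vector_derivative[of z x] gs_has_vector_derivative[of l 0 x]]
    by (rule has_vector_derivative_eq_rhs) (simp add: algebra_simps)
  have bd: "norm (?f x) \<le> exp (norm z * \<bar>x\<bar>) * gs l x" for x
    using norm_exp[of "z * of_real x"] by (auto simp: norm_mult intro!: mult_right_mono)
  have "(LINT x|lborel. ?f' x) = 0"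
  proof (rule LBINT_derivative_eq_0[OF d _ i])
    show "continuous_on UNIV ?f'" unfolding gs_def by (intro continuous_intros) auto
    show "(?f \<longlongrightarrow> 0) at_top" by (rule Lim_null_comparison[OF always_eventually exp_gs_tendsto_0(1)[OF l]]) (use bd in auto)
    show "(?f \<longlongrightarrow> 0) at_bot" by (rule Lim_null_comparison[OF always_eventually exp_gs_tendsto_0(2)[OF l]]) (use bd in auto)
  qed
  moreover have "(LINT x|lborel. exp (z * of_real x) * (s + of_real l * of_real x) * of_real (gs l x))
      = (LINT x|lborel. (s + z) * (exp (z * of_real x) * of_real (gs l x)) - ?f' x)"
    by (intro Bochner_Integration.integral_cong refl) (simp add: algebra_simps)
  ultimately show ?thesis
    by (simp only: Bochner_Integration.integral_diff[OF integrable_mult_right[OF i0] i] integral_mult_right_zero gs_ft(2)[OF l] diff_zero)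
qed

context regular_count
begin

text \<open>Mean of zeta along the vertical line through s with a normal weight of variance
  \<open>l\<close>. The twist by - t makes it the part of the Gaussian sum around \<nu> = t that
  remains after the pole term.\<close>

definition wt :: "real \<Rightarrow> complex \<Rightarrow> real \<Rightarrow> complex" where
  "wt l s t = (LINT v|lborel. of_real (gh l v) * iexp (- t * v) * zet (s - \<i> * of_real v))"

text \<open>Zeta is replaced by its two-sided integral and the integral over v is done first. The
  factor s - \<i> * v in front of that transform is the reason why both \<open>gh_ft\<close> and
  \<open>gh_ft_deriv\<close> are needed.\<close>

lemma wt_integral:
  assumes l: "l > 0" and s: "\<theta> < Re s" "Re s < 1"
  shows "integrable lborel (\<lambda>v. of_real (gh l v) * iexp (- t * v) * zet (s - \<i> * of_real v))"
    and "wt l s t = (LINT u|lborel. exp (- s * of_real u) * of_real (err u) * ((s + of_real l * of_real (u - t)) * of_real (gs l (u - t))))"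
proof -
  define f where "f = (\<lambda>v u. complex_of_real (gh l v) * iexp (- t * v) * (s - \<i> * of_real v) * (exp (- (s - \<i> * of_real v) * of_real u) * of_real (err u)))"
  have ia: "integrable lborel (\<lambda>v. gh l v * (norm s + \<bar>v\<bar>))"
  proof (rule integrable_exp_gs[where l = "1 / l"])
    fix v :: real
    have "\<bar>v\<bar> \<le> exp \<bar>v\<bar>" using exp_ge_add_one_self[of "\<bar>v\<bar>"] by linarith
    moreover have "norm s * 1 \<le> norm s * exp \<bar>v\<bar>" by (intro mult_left_mono) auto
    ultimately have "norm s + \<bar>v\<bar> \<le> (norm s + 1) * exp \<bar>v\<bar>" by (simp add: distrib_right)
    hence "norm (gh l v * (norm s + \<bar>v\<bar>)) \<le> gh l v * ((norm s + 1) * exp \<bar>v\<bar>)"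
      using l by (simp add: abs_mult mult_left_mono)
    thus "norm (gh l v * (norm s + \<bar>v\<bar>)) \<le> ((norm s + 1) / sqrt (2 * pi * l)) * exp (1 * \<bar>v\<bar>) * gs (1 / l) v"
      by (simp add: gh_def mult_ac)
  qed (use l in auto)
  have ib: "integrable lborel (\<lambda>u. norm (exp (- s * of_real u) * of_real (err u)))"
    by (rule integrable_norm[OF zet_mellin(1)[OF s]])
  have int: "integrable (lborel \<Otimes>\<^sub>M lborel) (case_prod f)"
  proof (rule integrable_product_bound[OF ia ib])
    show "case_prod f \<in> borel_measurable (lborel \<Otimes>\<^sub>M lborel)" unfolding f_def by measurable
    fix v u
    have "norm (s - \<i> * of_real v) \<le> norm s + \<bar>v\<bar>"
      using norm_triangle_ineq4[of s "\<i> * of_real v"] by (simp add: norm_mult)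
    thus "norm (f v u) \<le> gh l v * (norm s + \<bar>v\<bar>) * norm (exp (- s * of_real u) * of_real (err u))"
      using l by (auto simp: f_def norm_mult intro!: mult_mono)
  qed
  have in_u: "(LINT u|lborel. f v u) = of_real (gh l v) * iexp (- t * v) * zet (s - \<i> * of_real v)" for v
    unfolding f_def using zet_mellin(2)[of "s - \<i> * of_real v"] s by simp
  have in_v: "(LINT v|lborel. f v u) = exp (- s * of_real u) * of_real (err u) * ((s + of_real l * of_real (u - t)) * of_real (gs l (u - t)))" for u
  proof -
    have "f v u = exp (- s * of_real u) * of_real (err u) * (s * (of_real (gh l v) * iexp ((u - t) * v)) - \<i> * of_real v * of_real (gh l v) * iexp ((u - t) * v))" for v
    proof -
      have e: "iexp (- t * v) * exp (- (s - \<i> * of_real v) * of_real u) = exp (- s * of_real u) * iexp ((u - t) * v)"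
        unfolding exp_add[symmetric] by (rule arg_cong[of _ _ exp]) (simp add: algebra_simps)
      have "f v u = of_real (gh l v) * (s - \<i> * of_real v) * of_real (err u) * (iexp (- t * v) * exp (- (s - \<i> * of_real v) * of_real u))"
        by (simp add: f_def mult_ac)
      thus ?thesis unfolding e by (simp add: algebra_simps)
    qed
    hence "(LINT v|lborel. f v u) = exp (- s * of_real u) * of_real (err u) *
        (LINT v|lborel. s * (of_real (gh l v) * iexp ((u - t) * v)) - \<i> * of_real v * of_real (gh l v) * iexp ((u - t) * v))"
      by (simp only: integral_mult_right_zero)
    also have "(LINT v|lborel. s * (of_real (gh l v) * iexp ((u - t) * v)) - \<i> * of_real v * of_real (gh l v) * iexp ((u - t) * v))
       = s * of_real (gs l (u - t)) - of_real (- l * (u - t) * gs l (u - t))"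
      by (simp only: Bochner_Integration.integral_diff[OF integrable_mult_right[OF gh_ft(1)[OF l]] gh_ft_deriv(1)[OF l]]
           integral_mult_right_zero gh_ft(2)[OF l] gh_ft_deriv(2)[OF l])
    finally show ?thesis by (simp add: algebra_simps)
  qed
  show "integrable lborel (\<lambda>v. of_real (gh l v) * iexp (- t * v) * zet (s - \<i> * of_real v))"
    using lborel_pair.integrable_fst'[OF int] by (simp add: in_u)
  show "wt l s t = (LINT u|lborel. exp (- s * of_real u) * of_real (err u) * ((s + of_real l * of_real (u - t)) * of_real (gs l (u - t))))"
    using lborel_pair.Fubini_integral[OF int] by (simp only: in_u in_v wt_def)
qed

text \<open>Partial summation for f u = exp (- s * u) * gs l (u - t). The error integral is
  literally the one found for \<open>wt\<close> in \<open>wt_integral\<close>.\<close>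

lemma gauss_dirichlet:
  fixes s :: complex
  assumes l: "l > 0"
  shows "integrable (count_space UNIV) (\<lambda>m. exp (- s * of_real (\<nu> m)) * of_real (gs l (\<nu> m - t)))"
    and "(LINT m|count_space UNIV. exp (- s * of_real (\<nu> m)) * of_real (gs l (\<nu> m - t))) =
       of_real A * (exp ((1 - s) * of_real t) * (of_real (sqrt (2 * pi / l)) * exp ((1 - s)\<^sup>2 / (2 * of_real l)))) +
       (LINT u|lborel. exp (- s * of_real u) * of_real (err u) * ((s + of_real l * of_real (u - t)) * of_real (gs l (u - t))))"
proof -
  let ?f = "\<lambda>u. exp (- s * of_real u) * complex_of_real (gs l (u - t))"
  let ?f' = "\<lambda>u. exp (- s * of_real u) * complex_of_real (- l * (u - t) * gs l (u - t)) + (- s * exp (- s * of_real u)) * of_real (gs l (u - t))"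
  define K where "K = norm s + l + l * \<bar>t\<bar> + 1"
  define b where "b = norm s + l * \<bar>t\<bar> + 1"
  \<comment> \<open>Recentring the Gaussian from t to 0 costs only an exponential in |u|, which is
    the shape of bound that \<open>gauss_summation\<close> asks for.\<close>
  have gs_shift: "gs l (u - t) \<le> exp (l * \<bar>t\<bar> * \<bar>u\<bar>) * gs l u" for u
  proof -
    have "t * u \<le> \<bar>t\<bar> * \<bar>u\<bar>" by (metis abs_ge_self abs_mult)
    hence "l * (t * u) \<le> l * (\<bar>t\<bar> * \<bar>u\<bar>)" using l by (intro mult_left_mono) auto
    moreover have "0 \<le> l * t\<^sup>2" using l by simp
    moreover have "- (l * (u - t)\<^sup>2 / 2) = l * (t * u) - l * u\<^sup>2 / 2 - l * t\<^sup>2 / 2"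
      by (simp add: power2_eq_square field_simps)
    ultimately have "- (l * (u - t)\<^sup>2 / 2) \<le> l * \<bar>t\<bar> * \<bar>u\<bar> - l * u\<^sup>2 / 2"
      by (simp add: mult.assoc)
    thus ?thesis by (simp add: gs_def flip: exp_add)
  qed
  have ee: "norm (exp (- s * of_real u)) * gs l (u - t) \<le> exp ((norm s + l * \<bar>t\<bar>) * \<bar>u\<bar>) * gs l u" for u
  proof -
    have "norm (exp (- s * of_real u)) \<le> exp (norm s * \<bar>u\<bar>)"
      using norm_exp[of "- s * of_real u"] by (simp add: norm_mult)
    hence "norm (exp (- s * of_real u)) * gs l (u - t) \<le> exp (norm s * \<bar>u\<bar>) * (exp (l * \<bar>t\<bar> * \<bar>u\<bar>) * gs l u)"
      using gs_shift by (intro mult_mono) auto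
    thus ?thesis by (simp add: algebra_simps exp_add)
  qed
  have bb: "exp ((norm s + l * \<bar>t\<bar>) * \<bar>u\<bar>) * exp \<bar>u\<bar> = exp (b * \<bar>u\<bar>)" for u
    by (simp add: b_def algebra_simps flip: exp_add)
  have K1: "K \<ge> 1" unfolding K_def using l by simp
  have bf: "norm (?f u) \<le> K * exp (b * \<bar>u\<bar>) * gs l u" for u
  proof -
    have "norm (?f u) \<le> exp ((norm s + l * \<bar>t\<bar>) * \<bar>u\<bar>) * gs l u" using ee[of u] by (simp add: norm_mult)
    also have "\<dots> \<le> (K * exp (b * \<bar>u\<bar>)) * gs l u"
    proof (intro mult_right_mono)
      have "1 * (exp ((norm s + l * \<bar>t\<bar>) * \<bar>u\<bar>) * 1) \<le> K * (exp ((norm s + l * \<bar>t\<bar>) * \<bar>u\<bar>) * exp \<bar>u\<bar>)"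
        using K1 by (intro mult_mono) auto
      thus "exp ((norm s + l * \<bar>t\<bar>) * \<bar>u\<bar>) \<le> K * exp (b * \<bar>u\<bar>)" by (simp add: bb)
    qed simp
    finally show ?thesis .
  qed
  have bf': "norm (?f' u) \<le> K * exp (b * \<bar>u\<bar>) * gs l u" for u
  proof -
    have u1: "\<bar>u\<bar> \<le> exp \<bar>u\<bar>" "1 \<le> exp \<bar>u\<bar>" using exp_ge_add_one_self[of "\<bar>u\<bar>"] by linarith+
    have "?f' u = (- s - of_real (l * (u - t))) * ?f u" by (simp add: algebra_simps)
    hence "norm (?f' u) = norm (- s - of_real (l * (u - t))) * (norm (exp (- s * of_real u)) * gs l (u - t))"
      by (simp only: norm_mult norm_of_real abs_of_nonneg[OF gs_nonneg])
    also have "\<dots> \<le> (K * exp \<bar>u\<bar>) * (exp ((norm s + l * \<bar>t\<bar>) * \<bar>u\<bar>) * gs l u)"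
    proof (rule mult_mono[OF _ ee])
      have "norm (- s - of_real (l * (u - t))) \<le> norm s + l * \<bar>u - t\<bar>"
        using norm_triangle_ineq4[of "- s" "of_real (l * (u - t))"] l by (simp only: norm_minus_cancel norm_of_real abs_mult abs_of_pos)
      also have "\<dots> \<le> norm s + l * (\<bar>u\<bar> + \<bar>t\<bar>)" using l by (intro add_left_mono mult_left_mono) auto
      also have "\<dots> \<le> norm s * exp \<bar>u\<bar> + l * exp \<bar>u\<bar> + (l * \<bar>t\<bar>) * exp \<bar>u\<bar> + 1 * exp \<bar>u\<bar>"
      proof -
        have "norm s * 1 \<le> norm s * exp \<bar>u\<bar>" using u1 by (intro mult_left_mono) auto
        moreover have "l * \<bar>u\<bar> \<le> l * exp \<bar>u\<bar>" using u1 l by (intro mult_left_mono) auto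
        moreover have "(l * \<bar>t\<bar>) * 1 \<le> (l * \<bar>t\<bar>) * exp \<bar>u\<bar>" using u1 l by (intro mult_left_mono) auto
        ultimately show ?thesis using u1 unfolding distrib_left mult_1_right mult_1_left by linarith
      qed
      finally show "norm (- s - of_real (l * (u - t))) \<le> K * exp \<bar>u\<bar>" by (simp add: K_def algebra_simps)
    qed (use K1 in auto)
    also have "\<dots> = K * exp (b * \<bar>u\<bar>) * gs l u" unfolding bb[symmetric] by (simp add: mult_ac)
    finally show ?thesis .
  qed
  have d: "(?f has_vector_derivative ?f' u) (at u)" for u
    by (rule has_vector_derivative_mult[OF exp_has_vector_derivative gs_has_vector_derivative])
  have c: "continuous_on UNIV ?f'" unfolding gs_def by (intro continuous_intros) auto
  show "integrable (count_space UNIV) (\<lambda>m. ?f (\<nu> m))"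
    by (rule gauss_summation(1)[OF d c l bf bf'])
  have "(LINT m|count_space UNIV. ?f (\<nu> m)) = A * (LINT u|lborel. of_real (exp u) * ?f u) - (LINT u|lborel. of_real (err u) * ?f' u)"
    by (rule gauss_summation(2)[OF d c l bf bf'])
  also have "(LINT u|lborel. of_real (exp u) * ?f u) = exp ((1 - s) * of_real t) * (of_real (sqrt (2 * pi / l)) * exp ((1 - s)\<^sup>2 / (2 * of_real l)))"
  proof -
    have "(LINT u|lborel. of_real (exp u) * ?f u) = (LINT x|lborel. of_real (exp (t + 1 * x)) * ?f (t + 1 * x))"
      by (subst lborel_integral_real_affine[of 1 _ t]) auto
    also have "\<dots> = (LINT x|lborel. exp ((1 - s) * of_real t) * (exp ((1 - s) * of_real x) * of_real (gs l x)))"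
    proof (intro Bochner_Integration.integral_cong refl)
      fix x :: real
      have "of_real (exp (t + 1 * x)) * exp (- s * of_real (t + 1 * x)) = exp ((1 - s) * of_real t) * exp ((1 - s) * of_real x)"
        unfolding exp_of_real[symmetric] exp_add[symmetric] by (rule arg_cong[of _ _ exp]) (simp add: algebra_simps)
      thus "of_real (exp (t + 1 * x)) * ?f (t + 1 * x) = exp ((1 - s) * of_real t) * (exp ((1 - s) * of_real x) * of_real (gs l x))"
        by (simp add: mult.assoc[symmetric])
    qed
    also have "\<dots> = exp ((1 - s) * of_real t) * (LINT x|lborel. exp ((1 - s) * of_real x) * of_real (gs l x))"
      by (rule integral_mult_right_zero)
    finally show ?thesis by (simp only: gs_ft(2)[OF l])
  qed
  also have "(LINT u|lborel. of_real (err u) * ?f' u) = (LINT u|lborel. - (exp (- s * of_real u) * of_real (err u) * ((s + of_real l * of_real (u - t)) * of_real (gs l (u - t)))))"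
    by (intro Bochner_Integration.integral_cong refl) (simp add: algebra_simps)
  finally show "(LINT m|count_space UNIV. ?f (\<nu> m)) =
       of_real A * (exp ((1 - s) * of_real t) * (of_real (sqrt (2 * pi / l)) * exp ((1 - s)\<^sup>2 / (2 * of_real l)))) +
       (LINT u|lborel. exp (- s * of_real u) * of_real (err u) * ((s + of_real l * of_real (u - t)) * of_real (gs l (u - t))))"
    by simp
qed

text \<open>The integral of A * exp u against the weighted exponential, that is, the contribution of
  the pole of zeta at 1.\<close>

definition pol :: "real \<Rightarrow> complex \<Rightarrow> real \<Rightarrow> complex" where
  "pol l s t = of_real A * (exp ((1 - s) * of_real t) * (of_real (sqrt (2 * pi / l)) * exp ((1 - s)\<^sup>2 / (2 * of_real l))))"

text \<open>A smoothed Perron formula. The sum and the mean of zeta lead to the same integral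
  against \<open>err\<close>, so the mean is taken on the line of s itself.\<close>

lemma wt_dirichlet:
  assumes l: "l > 0" and s: "\<theta> < Re s" "Re s < 1"
  shows "(LINT m|count_space UNIV. exp (- s * of_real (\<nu> m)) * of_real (gs l (\<nu> m - t))) = pol l s t + wt l s t"
  using gauss_dirichlet(2)[OF l, of s t] wt_integral(2)[OF l s, of t] by (simp only: pol_def)

text \<open>Integration over the scale t recovers the value of zeta at s + \<delta>, to the right of
  the line of means; through this channel a zero acts. The integral over u in
  \<open>wt_integral\<close> is a convolution in t, so Fubini separates the transform of
  \<open>err\<close> from a Gaussian moment.\<close>

lemma wt_laplace:
  fixes \<delta> :: real
  assumes l: "l > 0" and s: "\<theta> < Re s" and d: "\<delta> \<ge> 0" "Re s + \<delta> < 1"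
  shows "integrable lborel (\<lambda>t. exp (- \<delta> * t) * wt l s t)"
    and "(LINT t|lborel. exp (- \<delta> * t) * wt l s t) = of_real (sqrt (2 * pi / l) * exp (\<delta>\<^sup>2 / (2 * l))) * zet (s + of_real \<delta>)"
proof -
  define a where "a = (\<lambda>u. exp (- (s + of_real \<delta>) * of_real u) * complex_of_real (err u))"
  define k where "k = (\<lambda>x. exp (of_real \<delta> * of_real x) * (s + of_real l * of_real x) * of_real (gs l x))"
  have s1: "Re s < 1" using d by simp
  have sd: "\<theta> < Re (s + of_real \<delta>)" "Re (s + of_real \<delta>) < 1" using s d by auto
  have ia: "integrable lborel a" unfolding a_def by (rule zet_mellin(1)[OF sd])
  have ik: "integrable lborel k" unfolding k_def by (rule integrable_gauss_linear[OF l])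
  have int: "integrable (lborel \<Otimes>\<^sub>M lborel) (\<lambda>(t, u). a u * k (u - t))"
    by (rule integrable_convolution[OF ia ik])
  have in_u: "(LINT u|lborel. a u * k (u - t)) = exp (- \<delta> * t) * wt l s t" for t
  proof -
    have "a u * k (u - t) = exp (- \<delta> * t) * (exp (- s * of_real u) * of_real (err u) * ((s + of_real l * of_real (u - t)) * of_real (gs l (u - t))))" for u
    proof -
      have e: "exp (- (s + of_real \<delta>) * of_real u) * exp (of_real \<delta> * of_real (u - t)) = of_real (exp (- \<delta> * t)) * exp (- s * of_real u)"
        unfolding exp_of_real[symmetric] exp_add[symmetric] by (rule arg_cong[of _ _ exp]) (simp add: algebra_simps)
      have "a u * k (u - t) = (exp (- (s + of_real \<delta>) * of_real u) * exp (of_real \<delta> * of_real (u - t))) * of_real (err u) * ((s + of_real l * of_real (u - t)) * of_real (gs l (u - t)))"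
        by (simp add: a_def k_def mult_ac)
      thus ?thesis unfolding e by (simp add: mult_ac)
    qed
    thus ?thesis by (simp only: integral_mult_right_zero wt_integral(2)[OF l s s1])
  qed
  have in_t: "(LINT t|lborel. a u * k (u - t)) = a u * ((s + of_real \<delta>) * (of_real (sqrt (2 * pi / l)) * exp ((of_real \<delta>)\<^sup>2 / (2 * of_real l))))" for u
  proof -
    have "(LINT t|lborel. k (u - t)) = (LINT x|lborel. k x)"
      using lborel_integral_real_affine[of "-1" k u] by simp
    thus ?thesis by (simp only: integral_mult_right_zero k_def gauss_linear_moment[OF l])
  qed
  show "integrable lborel (\<lambda>t. exp (- \<delta> * t) * wt l s t)"
    using lborel_pair.integrable_fst'[OF int] by (simp add: in_u)
  have e: "exp ((complex_of_real \<delta>)\<^sup>2 / (2 * complex_of_real l)) = of_real (exp (\<delta>\<^sup>2 / (2 * l)))"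
    unfolding exp_of_real[symmetric] by simp
  have "(LINT t|lborel. exp (- \<delta> * t) * wt l s t) = (LINT u|lborel. a u) * ((s + of_real \<delta>) * (of_real (sqrt (2 * pi / l)) * exp ((of_real \<delta>)\<^sup>2 / (2 * of_real l))))"
    using lborel_pair.Fubini_integral[OF int] by (simp only: in_u in_t integral_mult_left_zero)
  also have "\<dots> = of_real (sqrt (2 * pi / l) * exp (\<delta>\<^sup>2 / (2 * l))) * zet (s + of_real \<delta>)"
    unfolding zet_mellin(2)[OF sd] a_def e by (simp add: mult_ac)
  finally show "(LINT t|lborel. exp (- \<delta> * t) * wt l s t) = of_real (sqrt (2 * pi / l) * exp (\<delta>\<^sup>2 / (2 * l))) * zet (s + of_real \<delta>)" .
qed

end

section \<open>Mean values and the Halasz inequality\<close>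

text \<open>Separation by more than \<open>w\<close> makes the windows disjoint, so every point of
  {lo..hi} is used at most once.\<close>

lemma sum_separated_integrals:
  fixes F :: "real \<Rightarrow> real"
  assumes P: "finite P" and sep: "\<And>a b. a \<in> P \<Longrightarrow> b \<in> P \<Longrightarrow> a \<noteq> b \<Longrightarrow> \<bar>a - b\<bar> > w"
    and sub: "\<And>a. a \<in> P \<Longrightarrow> {a + c..a + c + w} \<subseteq> {lo..hi}"
    and F: "\<And>u. F u \<ge> 0" and i: "set_integrable lborel {lo..hi} F"
  shows "(\<Sum>a\<in>P. (LINT u:{a + c..a + c + w}|lborel. F u)) \<le> (LINT u:{lo..hi}|lborel. F u)"
proof -
  have ia: "integrable lborel (\<lambda>u. indicator {a + c..a + c + w} u *\<^sub>R F u)" if "a \<in> P" for a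
    using set_integrable_subset[OF i _ sub[OF that]] by (simp add: set_integrable_def)
  have "(\<Sum>a\<in>P. (LINT u:{a + c..a + c + w}|lborel. F u)) = (LINT u|lborel. (\<Sum>a\<in>P. indicator {a + c..a + c + w} u *\<^sub>R F u))"
    unfolding set_lebesgue_integral_def by (rule Bochner_Integration.integral_sum[symmetric]) (rule ia)
  also have "\<dots> \<le> (LINT u:{lo..hi}|lborel. F u)"
    unfolding set_lebesgue_integral_def
  proof (rule integral_mono)
    show "integrable lborel (\<lambda>u. \<Sum>a\<in>P. indicator {a + c..a + c + w} u *\<^sub>R F u)"
      by (intro Bochner_Integration.integrable_sum ia)
    show "integrable lborel (\<lambda>u. indicator {lo..hi} u *\<^sub>R F u)" using i by (simp add: set_integrable_def)
    fix u
    show "(\<Sum>a\<in>P. indicator {a + c..a + c + w} u *\<^sub>R F u) \<le> indicator {lo..hi} u *\<^sub>R F u"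
    proof (cases "\<exists>a\<in>P. u \<in> {a + c..a + c + w}")
      case True
      then obtain a where a: "a \<in> P" "u \<in> {a + c..a + c + w}" by blast
      have uniq: "b = a" if "b \<in> P" "u \<in> {b + c..b + c + w}" for b
        using sep[OF that(1) a(1)] that(2) a(2) by (cases "b = a") (auto simp: abs_less_iff)
      have "(\<Sum>b\<in>P. indicator {b + c..b + c + w} u *\<^sub>R F u) = (\<Sum>b\<in>P. if b = a then F u else 0)"
      proof (intro sum.cong refl)
        fix b assume b: "b \<in> P"
        show "indicator {b + c..b + c + w} u *\<^sub>R F u = (if b = a then F u else 0)"
        proof (cases "b = a")
          case True thus ?thesis using a(2) by simp
        next
          case False
          hence "u \<notin> {b + c..b + c + w}" using uniq[OF b] by blast
          thus ?thesis using False by simp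
        qed
      qed
      also have "\<dots> = indicator {lo..hi} u *\<^sub>R F u" using a P sub[OF a(1)] by auto
      finally show ?thesis by simp
    next
      case False
      hence "(\<Sum>b\<in>P. indicator {b + c..b + c + w} u *\<^sub>R F u) = 0"
        by (intro sum.neutral) (auto simp: indicator_def)
      thus ?thesis using F[of u] by simp
    qed
  qed
  finally show ?thesis .
qed

lemma set_integrable_continuous:
  fixes f :: "real \<Rightarrow> 'b::euclidean_space"
  shows "continuous_on {a..b} f \<Longrightarrow> set_integrable lborel {a..b} f"
  unfolding set_integrable_def by (rule borel_integrable_compact) auto

text \<open>Gallagher's passage from points to integrals: for every x of the unit interval, |f a| is
  at most |f x| plus the integral of |f'|; then x is averaged.\<close>

lemma sobolev_pointwise:
  fixes f f' :: "real \<Rightarrow> complex"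
  assumes d: "\<And>x. (f has_vector_derivative f' x) (at x)" and c: "continuous_on UNIV f'"
  shows "(norm (f a))\<^sup>2 \<le> 2 * (LINT x:{a..a + 1}|lborel. (norm (f x))\<^sup>2 + (norm (f' x))\<^sup>2)"
proof -
  have cf: "continuous_on UNIV f"
    by (meson d continuous_at_imp_continuous_on has_vector_derivative_continuous)
  have cont: "continuous_on {a..a+1} f" "continuous_on {a..a+1} f'" using cf c continuous_on_subset by blast+
  define I where "I = {a..a + 1}"
  have one: "(LINT x:I|lborel. (k::real)) = k" for k
    by (simp add: I_def set_lebesgue_integral_def)
  define \<mu> where "\<mu> = (LINT x:I|lborel. norm (f' x))"
  have i1: "set_integrable lborel I (\<lambda>x. norm (f' x))" "set_integrable lborel I (\<lambda>x. (norm (f' x))\<^sup>2)"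
     "set_integrable lborel I (\<lambda>x. (norm (f x))\<^sup>2)" "set_integrable lborel I (\<lambda>x. \<mu>\<^sup>2)" "set_integrable lborel I (\<lambda>x. 2 * \<mu> * norm (f' x))"
    "set_integrable lborel I (\<lambda>x. k::real)" for k
    unfolding I_def by (intro set_integrable_continuous continuous_intros cont)+
  \<comment> \<open>Nonnegativity of the variance serves as Cauchy-Schwarz: the squared mean of |f'|
    is at most the mean of its square.\<close>
  have "0 \<le> (LINT x:I|lborel. (norm (f' x) - \<mu>)\<^sup>2)" unfolding set_lebesgue_integral_def
    by (intro integral_nonneg_AE AE_I2) auto
  also have "\<dots> = (LINT x:I|lborel. ((norm (f' x))\<^sup>2 - 2 * \<mu> * norm (f' x)) + \<mu>\<^sup>2)"
    by (simp add: power2_diff algebra_simps)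
  also have "\<dots> = (LINT x:I|lborel. (norm (f' x))\<^sup>2) - 2 * \<mu> * \<mu> + \<mu>\<^sup>2"
    using i1 by (simp add: set_integral_add set_integral_diff one \<mu>_def)
  finally have mu: "\<mu>\<^sup>2 \<le> (LINT x:I|lborel. (norm (f' x))\<^sup>2)" by (simp add: power2_eq_square)
  have mu0: "\<mu> \<ge> 0" unfolding \<mu>_def set_lebesgue_integral_def by (intro integral_nonneg_AE AE_I2) auto
  have pt: "(norm (f a))\<^sup>2 \<le> 2 * (norm (f x))\<^sup>2 + 2 * \<mu>\<^sup>2" if x: "x \<in> I" for x
  proof -
    have "(LINT u|lborel. indicator {a..x} u *\<^sub>R f' u) = f x - f a"
      using x by (intro integral_FTC_atLeastAtMost) (auto simp: I_def intro: d has_vector_derivative_at_within continuous_on_subset[OF c])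
    hence "norm (f x - f a) = norm (LINT u|lborel. indicator {a..x} u *\<^sub>R f' u)" by simp
    also have "\<dots> \<le> (LINT u|lborel. norm (indicator {a..x} u *\<^sub>R f' u))" by (rule integral_norm_bound)
    also have "\<dots> \<le> \<mu>" unfolding \<mu>_def set_lebesgue_integral_def
    proof (rule integral_mono)
      show "integrable lborel (\<lambda>u. norm (indicator {a..x} u *\<^sub>R f' u))"
        using set_integrable_continuous[OF continuous_on_subset[OF c], of a x] unfolding set_integrable_def
        by (intro integrable_norm) auto
      show "integrable lborel (\<lambda>u. indicator I u *\<^sub>R norm (f' u))" using i1(1) by (simp add: set_integrable_def)
      show "norm (indicator {a..x} u *\<^sub>R f' u) \<le> indicator I u *\<^sub>R norm (f' u)" for u
        using x by (auto simp: indicator_def I_def)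
    qed
    finally have "norm (f a) \<le> norm (f x) + \<mu>" using norm_triangle_ineq2[of "f a" "f x"] by (simp add: norm_minus_commute)
    hence "(norm (f a))\<^sup>2 \<le> (norm (f x) + \<mu>)\<^sup>2" by (intro power_mono) auto
    also have "\<dots> \<le> 2 * (norm (f x))\<^sup>2 + 2 * \<mu>\<^sup>2"
      using zero_le_power2[of "norm (f x) - \<mu>"] by (simp add: power2_eq_square algebra_simps)
    finally show ?thesis .
  qed
  have "(norm (f a))\<^sup>2 = (LINT x:I|lborel. (norm (f a))\<^sup>2)" by (simp add: one)
  also have "\<dots> \<le> (LINT x:I|lborel. 2 * (norm (f x))\<^sup>2 + 2 * \<mu>\<^sup>2)"
    by (rule set_integral_mono[OF i1(6) _ pt]) (use i1(3,6) in \<open>intro set_integral_add(1) set_integrable_mult_right; simp\<close>)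
  also have "\<dots> = 2 * (LINT x:I|lborel. (norm (f x))\<^sup>2) + 2 * \<mu>\<^sup>2"
    using i1(3,6) by (simp add: set_integral_add one)
  also have "\<dots> \<le> 2 * (LINT x:I|lborel. (norm (f x))\<^sup>2) + 2 * (LINT x:I|lborel. (norm (f' x))\<^sup>2)"
    using mu by simp
  also have "\<dots> = 2 * (LINT x:I|lborel. (norm (f x))\<^sup>2 + (norm (f' x))\<^sup>2)"
    using i1(2,3) by (simp add: set_integral_add)
  finally show ?thesis by (simp add: I_def)
qed

text \<open>Schur's test in its simplest form: the product c m * c n is at most half the sum of the
  squares, and symmetry of K makes the two halves equal.\<close>

lemma symmetric_kernel_bound:
  fixes c :: "'b \<Rightarrow> real" and K :: "'b \<Rightarrow> 'b \<Rightarrow> real"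
  assumes sym: "\<And>m n. K m n = K n m" and nn: "\<And>m n. K m n \<ge> 0"
  shows "(\<Sum>m\<in>F. \<Sum>n\<in>F. c m * c n * K m n) \<le> (\<Sum>m\<in>F. (c m)\<^sup>2 * (\<Sum>n\<in>F. K m n))"
proof -
  have "(\<Sum>m\<in>F. \<Sum>n\<in>F. c m * c n * K m n) \<le> (\<Sum>m\<in>F. \<Sum>n\<in>F. ((c m)\<^sup>2 + (c n)\<^sup>2) / 2 * K m n)"
  proof (intro sum_mono mult_right_mono nn)
    fix m n show "c m * c n \<le> ((c m)\<^sup>2 + (c n)\<^sup>2) / 2"
      using zero_le_power2[of "c m - c n"] by (simp add: power2_diff)
  qed
  also have "\<dots> = (\<Sum>m\<in>F. \<Sum>n\<in>F. (c m)\<^sup>2 / 2 * K m n) + (\<Sum>m\<in>F. \<Sum>n\<in>F. (c n)\<^sup>2 / 2 * K m n)"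
    by (simp add: sum.distrib[symmetric] algebra_simps add_divide_distrib)
  also have "(\<Sum>m\<in>F. \<Sum>n\<in>F. (c n)\<^sup>2 / 2 * K m n) = (\<Sum>m\<in>F. \<Sum>n\<in>F. (c m)\<^sup>2 / 2 * K m n)"
    by (subst sum.swap) (simp add: sym)
  also have "(\<Sum>m\<in>F. \<Sum>n\<in>F. (c m)\<^sup>2 / 2 * K m n) + (\<Sum>m\<in>F. \<Sum>n\<in>F. (c m)\<^sup>2 / 2 * K m n) = (\<Sum>m\<in>F. \<Sum>n\<in>F. (c m)\<^sup>2 * K m n)"
    by (simp add: sum.distrib[symmetric] mult.commute)
  finally show ?thesis by (simp add: sum_distrib_left)
qed

text \<open>The Gaussian is split as the square of \<open>gs (1 / (2 * l))\<close>. Outside {- L..L}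
  one factor gives exp (- L^2 / (4 * l)); the other absorbs the linear growth of h and stays
  integrable.\<close>

lemma gh_tail_bound:
  fixes h :: "real \<Rightarrow> real"
  assumes l: "l \<ge> 1" and [measurable]: "h \<in> borel_measurable borel" and B: "B \<ge> 0" and L: "L \<ge> 0"
    and h: "\<And>v. 0 \<le> h v" "\<And>v. h v \<le> B * (1 + \<bar>v\<bar>)"
  shows "integrable lborel (\<lambda>v. gh l v * h v)"
    and "set_integrable lborel {- L..L} (\<lambda>v. gh l v * h v)"
    and "(LINT v|lborel. gh l v * h v) \<le> (LINT v:{- L..L}|lborel. gh l v * h v) + 4 * exp 2 * sqrt l * B * exp (- (L\<^sup>2 / (4 * l)))"
proof -
  have l0: "l > 0" using l by simp
  have v1: "1 + \<bar>v\<bar> \<le> 2 * sqrt l * exp (1 / sqrt l * \<bar>v\<bar>)" for v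
  proof -
    have s1: "sqrt l \<ge> 1" using l by simp
    have "1 + \<bar>v\<bar> / sqrt l \<le> exp (1 / sqrt l * \<bar>v\<bar>)" using exp_ge_add_one_self[of "\<bar>v\<bar> / sqrt l"] by simp
    hence "sqrt l * (1 + \<bar>v\<bar> / sqrt l) \<le> sqrt l * exp (1 / sqrt l * \<bar>v\<bar>)" using s1 by (intro mult_left_mono) auto
    moreover have "sqrt l * (1 + \<bar>v\<bar> / sqrt l) = sqrt l + \<bar>v\<bar>" using s1 by (simp add: field_simps)
    moreover have "1 * (0::real) \<le> sqrt l * exp (1 / sqrt l * \<bar>v\<bar>)" using s1 by (intro mult_mono) auto
    ultimately show ?thesis using s1 by linarith
  qed
  have dom: "gs (1 / (2 * l)) v * (1 + \<bar>v\<bar>) \<le> 2 * sqrt l * exp 2 * gs (1 / (4 * l)) v" for v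
  proof -
    have "gs (1 / (2 * l)) v * (1 + \<bar>v\<bar>) \<le> gs (1 / (2 * l)) v * (2 * sqrt l * exp (1 / sqrt l * \<bar>v\<bar>))"
      by (intro mult_left_mono v1) auto
    also have "\<dots> = 2 * sqrt l * (exp (1 / sqrt l * \<bar>v\<bar>) * gs (1 / (2 * l)) v)" by (simp add: mult_ac)
    also have "\<dots> \<le> 2 * sqrt l * (exp ((1 / sqrt l)\<^sup>2 / (1 / (2 * l))) * gs (1 / (2 * l) / 2) v)"
      by (intro mult_left_mono exp_abs_gs_le) (use l0 in auto)
    also have "(1 / sqrt l)\<^sup>2 / (1 / (2 * l)) = 2" using l0 by (simp add: power_divide)
    finally show ?thesis by (simp add: mult_ac)
  qed
  define Q where "Q = (\<lambda>v. (B * (2 * sqrt l * exp 2) / sqrt (2 * pi * l)) * gs (1 / (4 * l)) v)"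
  have iQ: "integrable lborel Q" unfolding Q_def using gs_integrable[of "1 / (4 * l)"] l0 by simp
  have sq: "gs (1 / l) v = gs (1 / (2 * l)) v * gs (1 / (2 * l)) v" for v
    using l0 by (simp add: gs_def flip: exp_add)
  have gQ: "gs (1 / (2 * l)) v * h v / sqrt (2 * pi * l) \<le> Q v" for v
  proof -
    have "gs (1 / (2 * l)) v * h v \<le> gs (1 / (2 * l)) v * (B * (1 + \<bar>v\<bar>))" by (intro mult_left_mono h) auto
    also have "\<dots> = B * (gs (1 / (2 * l)) v * (1 + \<bar>v\<bar>))" by (simp add: mult_ac)
    also have "\<dots> \<le> B * (2 * sqrt l * exp 2 * gs (1 / (4 * l)) v)" using dom B by (intro mult_left_mono) auto
    finally show ?thesis unfolding Q_def using l0 by (simp add: divide_right_mono mult_ac)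
  qed
  have gb: "gh l v * h v = gs (1 / (2 * l)) v * (gs (1 / (2 * l)) v * h v / sqrt (2 * pi * l))" for v
    by (simp add: gh_def sq)
  show i: "integrable lborel (\<lambda>v. gh l v * h v)"
  proof (rule Bochner_Integration.integrable_bound[OF iQ])
    show "AE v in lborel. norm (gh l v * h v) \<le> norm (Q v)"
    proof (rule AE_I2)
      fix v
      have "gh l v * h v \<le> 1 * Q v" unfolding gb
        using l0 h B by (intro mult_mono gQ gs_le_1) (auto simp: Q_def)
      thus "norm (gh l v * h v) \<le> norm (Q v)" using l0 h by (simp add: abs_mult)
    qed
  qed simp
  show i': "set_integrable lborel {- L..L} (\<lambda>v. gh l v * h v)"
    unfolding set_integrable_def using i by (intro integrable_mult_indicator) auto
  have "(LINT v|lborel. gh l v * h v) \<le> (LINT v|lborel. indicator {- L..L} v *\<^sub>R (gh l v * h v) + exp (- (L\<^sup>2 / (4 * l))) * Q v)"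
  proof (rule integral_mono[OF i])
    show "integrable lborel (\<lambda>v. indicator {- L..L} v *\<^sub>R (gh l v * h v) + exp (- (L\<^sup>2 / (4 * l))) * Q v)"
      using i' iQ by (simp add: set_integrable_def)
    fix v
    have Q0: "0 \<le> exp (- (L\<^sup>2 / (4 * l))) * Q v" using B l0 by (simp add: Q_def)
    show "gh l v * h v \<le> indicator {- L..L} v *\<^sub>R (gh l v * h v) + exp (- (L\<^sup>2 / (4 * l))) * Q v"
    proof (cases "v \<in> {- L..L}")
      case True thus ?thesis using Q0 by simp
    next
      case False
      hence "L\<^sup>2 \<le> v\<^sup>2" using L by (auto simp: abs_le_square_iff[symmetric])
      hence "gs (1 / (2 * l)) v \<le> exp (- (L\<^sup>2 / (4 * l)))" using l0 by (simp add: gs_def divide_right_mono)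
      hence "gh l v * h v \<le> exp (- (L\<^sup>2 / (4 * l))) * Q v" unfolding gb
        using l0 h by (intro mult_mono gQ) auto
      thus ?thesis using False by simp
    qed
  qed
  also have "\<dots> = (LINT v:{- L..L}|lborel. gh l v * h v) + exp (- (L\<^sup>2 / (4 * l))) * (LINT v|lborel. Q v)"
    using i' iQ by (simp add: set_integrable_def set_lebesgue_integral_def)
  also have "(LINT v|lborel. Q v) = 4 * exp 2 * sqrt l * B"
  proof -
    have "(LINT v|lborel. Q v) = (B * (2 * sqrt l * exp 2) / sqrt (2 * pi * l)) * (LINT v|lborel. gs (1 / (4 * l)) v)"
      unfolding Q_def by simp
    also have "(LINT v|lborel. gs (1 / (4 * l)) v) = sqrt (2 * pi / (1 / (4 * l)))"
      using gs_ft_real(2)[of "1 / (4 * l)" 0] l0 by simp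
    also have "2 * pi / (1 / (4 * l)) = 2\<^sup>2 * (2 * pi * l)" by simp
    also have "sqrt (2\<^sup>2 * (2 * pi * l)) = 2 * sqrt (2 * pi * l)" by (subst real_sqrt_mult) simp
    finally show ?thesis using l0 by simp
  qed
  finally show "(LINT v|lborel. gh l v * h v) \<le> (LINT v:{- L..L}|lborel. gh l v * h v) + 4 * exp 2 * sqrt l * B * exp (- (L\<^sup>2 / (4 * l)))"
    by (simp add: mult_ac)
qed

text \<open>The bound does not depend on l: on the scale 1 / sqrt l of the Gaussian the factor l *
  |x| is of size sqrt l, while the Gaussian mass is of size 1 / sqrt l.\<close>

lemma gauss_exp_linear_integral:
  assumes l: "l \<ge> 1"
  shows "integrable lborel (\<lambda>x. exp \<bar>x\<bar> * (l * \<bar>x\<bar>) * gs l x)"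
    and "(LINT x|lborel. exp \<bar>x\<bar> * (l * \<bar>x\<bar>) * gs l x) \<le> 2 * exp 1 * sqrt (8 * pi)"
proof -
  have l0: "l > 0" using l by simp
  have bd: "exp \<bar>x\<bar> * (l * \<bar>x\<bar>) * gs l x \<le> (2 * exp 1 * sqrt l) * gs (l / 4) x" for x
  proof -
    have a: "exp \<bar>x\<bar> \<le> exp 1 * exp (l * x\<^sup>2 / 4)"
    proof -
      have "\<bar>x\<bar> \<le> 1 + x\<^sup>2 / 4" using zero_le_power2[of "\<bar>x\<bar> / 2 - 1"] by (simp add: power2_eq_square algebra_simps)
      also have "x\<^sup>2 / 4 \<le> l * x\<^sup>2 / 4" using mult_right_mono[OF l, of "x\<^sup>2"] by simp
      finally show ?thesis by (simp flip: exp_add)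
    qed
    have b: "l * \<bar>x\<bar> \<le> 2 * sqrt l * exp (l * x\<^sup>2 / 8)"
    proof -
      define y where "y = sqrt l * \<bar>x\<bar>"
      have "y / 2 \<le> 1 + y\<^sup>2 / 8" using zero_le_power2[of "y - 2"] by (simp add: power2_eq_square algebra_simps)
      also have "\<dots> \<le> exp (y\<^sup>2 / 8)" by (rule exp_ge_add_one_self)
      finally have "y \<le> 2 * exp (y\<^sup>2 / 8)" by simp
      hence "sqrt l * y \<le> sqrt l * (2 * exp (y\<^sup>2 / 8))" using l0 by (intro mult_left_mono) auto
      thus ?thesis using l0 by (simp add: y_def power_mult_distrib mult_ac flip: mult.assoc)
    qed
    have "exp \<bar>x\<bar> * (l * \<bar>x\<bar>) * gs l x \<le> (exp 1 * exp (l * x\<^sup>2 / 4)) * (2 * sqrt l * exp (l * x\<^sup>2 / 8)) * gs l x"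
      using l0 by (intro mult_right_mono mult_mono[OF a b]) auto
    also have "\<dots> = (2 * exp 1 * sqrt l) * (exp (l * x\<^sup>2 / 4) * exp (l * x\<^sup>2 / 8) * gs l x)" by (simp add: mult_ac)
    also have "exp (l * x\<^sup>2 / 4) * exp (l * x\<^sup>2 / 8) * gs l x = gs (l / 4) x"
      by (simp add: gs_def flip: exp_add)
    finally show ?thesis .
  qed
  have iq: "integrable lborel (\<lambda>x. (2 * exp 1 * sqrt l) * gs (l / 4) x)"
    using gs_integrable[of "l / 4"] l0 by simp
  show i: "integrable lborel (\<lambda>x. exp \<bar>x\<bar> * (l * \<bar>x\<bar>) * gs l x)"
    by (rule Bochner_Integration.integrable_bound[OF iq]) (use bd l0 in \<open>auto simp: abs_mult\<close>)
  have "(LINT x|lborel. exp \<bar>x\<bar> * (l * \<bar>x\<bar>) * gs l x) \<le> (LINT x|lborel. (2 * exp 1 * sqrt l) * gs (l / 4) x)"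
    by (rule integral_mono[OF i iq bd])
  also have "\<dots> = (2 * exp 1 * sqrt l) * sqrt (8 * pi / l)"
    using gs_ft_real(2)[of "l / 4" 0] l0 by (simp add: mult.commute)
  also have "\<dots> = 2 * exp 1 * sqrt (8 * pi)" using l0 by (simp add: real_sqrt_divide)
  finally show "(LINT x|lborel. exp \<bar>x\<bar> * (l * \<bar>x\<bar>) * gs l x) \<le> 2 * exp 1 * sqrt (8 * pi)" .
qed

section \<open>Counting in short windows and mean values of Dirichlet polynomials\<close>

context regular_count
begin

definition gconst :: real where
  "gconst = A * (sqrt (2 * pi) * exp 1) + C0 * (2 * exp 1 * sqrt (8 * pi))"

lemma gconst_nonneg: "gconst \<ge> 0"
  unfolding gconst_def using A_pos C0_nonneg by simp

text \<open>The weight counts indices with |\<nu> m - y| below about 1 / sqrt l. The main term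
  shrinks with the window, the error exp (\<theta> * y) does not; this second term dictates the line
  Re s = (1 + \<theta>) / 2.\<close>

lemma gauss_count:
  assumes l: "l \<ge> 1"
  shows "integrable (count_space UNIV) (\<lambda>m. gs l (\<nu> m - y))"
    and "(LINT m|count_space UNIV. gs l (\<nu> m - y)) \<le> gconst * (exp y / sqrt l + exp (\<theta> * y))"
proof -
  have l0: "l > 0" using l by simp
  have "integrable (count_space UNIV) (\<lambda>m. complex_of_real (gs l (\<nu> m - y)))"
    using gauss_dirichlet(1)[OF l0, of 0 y] by simp
  thus i: "integrable (count_space UNIV) (\<lambda>m. gs l (\<nu> m - y))" by (simp only: complex_of_real_integrable_eq)
  define J where "J = (LINT u|lborel. of_real (err u) * (of_real l * of_real (u - y) * complex_of_real (gs l (u - y))))"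
  have "complex_of_real (LINT m|count_space UNIV. gs l (\<nu> m - y)) =
      of_real A * (exp (of_real y) * (of_real (sqrt (2 * pi / l)) * exp (1 / (2 * of_real l)))) + J"
    using gauss_dirichlet(2)[OF l0, of 0 y] unfolding J_def by (simp flip: integral_complex_of_real)
  hence "norm (complex_of_real (LINT m|count_space UNIV. gs l (\<nu> m - y))) \<le>
      norm (of_real A * (exp (complex_of_real y) * (of_real (sqrt (2 * pi / l)) * exp (1 / (2 * of_real l))))) + norm J"
    by (simp only: norm_triangle_ineq)
  hence "(LINT m|count_space UNIV. gs l (\<nu> m - y)) \<le> A * (exp y * (sqrt (2 * pi / l) * exp (1 / (2 * l)))) + norm J"
    using A_pos l0 by (simp add: norm_mult)
  also have "A * (exp y * (sqrt (2 * pi / l) * exp (1 / (2 * l)))) \<le> A * (exp y * (sqrt (2 * pi / l) * exp 1))"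
    using l A_pos by (intro mult_left_mono) auto
  also have "\<dots> = A * (sqrt (2 * pi) * exp 1) * (exp y / sqrt l)" by (simp add: real_sqrt_divide)
  also have "norm J \<le> C0 * (2 * exp 1 * sqrt (8 * pi)) * exp (\<theta> * y)"
  proof -
    have iE: "integrable lborel (\<lambda>u. (C0 * exp (\<theta> * y)) * (exp \<bar>- y + 1 * u\<bar> * (l * \<bar>- y + 1 * u\<bar>) * gs l (- y + 1 * u)))"
      by (intro integrable_mult_right lborel_integrable_real_affine[OF gauss_exp_linear_integral(1)[OF l]]) simp
    have bd: "norm (of_real (err u) * (of_real l * of_real (u - y) * complex_of_real (gs l (u - y)))) \<le>
      (C0 * exp (\<theta> * y)) * (exp \<bar>- y + 1 * u\<bar> * (l * \<bar>- y + 1 * u\<bar>) * gs l (- y + 1 * u))" for u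
    proof -
      have "\<theta> * u = \<theta> * y + \<theta> * (u - y)" by (simp add: algebra_simps)
      also have "\<theta> * (u - y) \<le> \<theta> * \<bar>u - y\<bar>" using theta by (intro mult_left_mono) auto
      also have "\<dots> \<le> 1 * \<bar>u - y\<bar>" using theta by (intro mult_right_mono) auto
      finally have "exp (\<theta> * u) \<le> exp (\<theta> * y) * exp \<bar>u - y\<bar>" by (simp flip: exp_add)
      hence "\<bar>err u\<bar> \<le> C0 * (exp (\<theta> * y) * exp \<bar>u - y\<bar>)"
        using err_bound[of u] C0_nonneg mult_left_mono[of "exp (\<theta> * u)" _ C0] by (meson order_trans)
      hence "\<bar>err u\<bar> * (l * \<bar>u - y\<bar> * gs l (u - y)) \<le> (C0 * (exp (\<theta> * y) * exp \<bar>u - y\<bar>)) * (l * \<bar>u - y\<bar> * gs l (u - y))"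
        using l0 by (intro mult_right_mono) auto
      thus ?thesis using l0 by (simp only: norm_mult norm_of_real abs_of_pos abs_of_nonneg[OF gs_nonneg]) (simp add: mult_ac)
    qed
    have "norm J \<le> (LINT u|lborel. (C0 * exp (\<theta> * y)) * (exp \<bar>- y + 1 * u\<bar> * (l * \<bar>- y + 1 * u\<bar>) * gs l (- y + 1 * u)))"
      unfolding J_def
    proof (rule Bochner_Integration.integral_norm_bound_integral[OF _ iE])
      show "integrable lborel (\<lambda>u. of_real (err u) * (of_real l * of_real (u - y) * complex_of_real (gs l (u - y))))"
      proof (rule Bochner_Integration.integrable_bound[OF iE])
        show "AE u in lborel. norm (of_real (err u) * (of_real l * of_real (u - y) * complex_of_real (gs l (u - y)))) \<le>
            norm ((C0 * exp (\<theta> * y)) * (exp \<bar>- y + 1 * u\<bar> * (l * \<bar>- y + 1 * u\<bar>) * gs l (- y + 1 * u)))"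
          by (rule AE_I2, rule order_trans[OF bd]) (simp only: real_norm_def abs_ge_self)
      qed measurable
    qed (rule bd)
    also have "\<dots> = (C0 * exp (\<theta> * y)) * (LINT x|lborel. exp \<bar>x\<bar> * (l * \<bar>x\<bar>) * gs l x)"
      using lborel_integral_real_affine[of 1 "\<lambda>x. exp \<bar>x\<bar> * (l * \<bar>x\<bar>) * gs l x" "- y"] by simp
    also have "\<dots> \<le> (C0 * exp (\<theta> * y)) * (2 * exp 1 * sqrt (8 * pi))"
      using C0_nonneg by (intro mult_left_mono gauss_exp_linear_integral(2)[OF l]) auto
    finally show ?thesis by (simp add: mult_ac)
  qed
  finally have "(LINT m|count_space UNIV. gs l (\<nu> m - y)) \<le> A * (sqrt (2 * pi) * exp 1) * (exp y / sqrt l) + C0 * (2 * exp 1 * sqrt (8 * pi)) * exp (\<theta> * y)"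
    by simp
  also have "\<dots> \<le> gconst * (exp y / sqrt l) + gconst * exp (\<theta> * y)"
    using A_pos C0_nonneg l0 by (intro add_mono mult_right_mono) (auto simp: gconst_def)
  finally show "(LINT m|count_space UNIV. gs l (\<nu> m - y)) \<le> gconst * (exp y / sqrt l + exp (\<theta> * y))"
    by (simp add: distrib_left)
qed

lemma gauss_count_finite:
  assumes l: "l \<ge> 1" and F: "finite F"
  shows "(\<Sum>m\<in>F. gs l (\<nu> m - y)) \<le> gconst * (exp y / sqrt l + exp (\<theta> * y))"
proof -
  have "(\<Sum>m\<in>F. gs l (\<nu> m - y)) = (LINT m|count_space UNIV. indicator F m *\<^sub>R gs l (\<nu> m - y))"
  proof -
    have "{m \<in> UNIV. indicator F m *\<^sub>R gs l (\<nu> m - y) \<noteq> 0} = F"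
      using gs_pos[of l] by (auto simp: indicator_def less_imp_neq[symmetric])
    thus ?thesis using F lebesgue_integral_count_space_finite_support[of UNIV "\<lambda>m. indicator F m *\<^sub>R gs l (\<nu> m - y)"]
      by simp
  qed
  also have "\<dots> \<le> (LINT m|count_space UNIV. gs l (\<nu> m - y))"
  proof (rule integral_mono)
    show "integrable (count_space UNIV) (\<lambda>m. indicator F m *\<^sub>R gs l (\<nu> m - y))"
      using gauss_count(1)[OF l] by (intro integrable_mult_indicator) auto
  qed (use gauss_count(1)[OF l] in \<open>auto simp: indicator_def\<close>)
  also have "\<dots> \<le> gconst * (exp y / sqrt l + exp (\<theta> * y))" by (rule gauss_count(2)[OF l])
  finally show ?thesis .
qed

text \<open>The real part of the variable is kept in the coefficients, so one object serves for the
  Moebius polynomial, the detecting polynomials and their derivatives in t.\<close>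

definition dpoly :: "('a \<Rightarrow> complex) \<Rightarrow> 'a set \<Rightarrow> real \<Rightarrow> complex" where
  "dpoly c F t = (\<Sum>m\<in>F. c m * iexp (- t * \<nu> m))"

lemma dpoly_has_vector_derivative:
  "(dpoly c F has_vector_derivative dpoly (\<lambda>m. - \<i> * of_real (\<nu> m) * c m) F t) (at t)"
  unfolding dpoly_def
proof (rule has_vector_derivative_sum)
  fix m
  have "((\<lambda>t. exp ((- \<i> * of_real (\<nu> m)) * complex_of_real t)) has_vector_derivative
      (- \<i> * of_real (\<nu> m)) * exp ((- \<i> * of_real (\<nu> m)) * of_real t)) (at t)"
    by (rule exp_has_vector_derivative)
  from has_vector_derivative_mult_right[OF this, of "c m"]
  show "((\<lambda>t. c m * iexp (- t * \<nu> m)) has_vector_derivative - \<i> * of_real (\<nu> m) * c m * iexp (- t * \<nu> m)) (at t)"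
    by (simp add: mult_ac)
qed

lemma dpoly_continuous: "continuous_on S (dpoly c F)"
  by (meson dpoly_has_vector_derivative continuous_at_imp_continuous_on has_vector_derivative_continuous)

lemma dpoly_norm_sq:
  "of_real ((norm (dpoly c F t))\<^sup>2) = (\<Sum>m\<in>F. \<Sum>n\<in>F. c m * cnj (c n) * iexp ((\<nu> n - \<nu> m) * t))"
proof -
  have "of_real ((norm (dpoly c F t))\<^sup>2) = dpoly c F t * cnj (dpoly c F t)" by (rule complex_norm_square)
  also have "\<dots> = (\<Sum>m\<in>F. \<Sum>n\<in>F. (c m * iexp (- t * \<nu> m)) * cnj (c n * iexp (- t * \<nu> n)))"
    unfolding dpoly_def cnj_sum sum_product ..
  also have "\<dots> = (\<Sum>m\<in>F. \<Sum>n\<in>F. c m * cnj (c n) * iexp ((\<nu> n - \<nu> m) * t))"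
  proof (intro sum.cong refl)
    fix m n
    have "iexp (- t * \<nu> m) * cnj (iexp (- t * \<nu> n)) = iexp ((\<nu> n - \<nu> m) * t)"
      unfolding exp_cnj exp_add[symmetric] by (rule arg_cong[of _ _ exp]) (simp add: algebra_simps)
    thus "(c m * iexp (- t * \<nu> m)) * cnj (c n * iexp (- t * \<nu> n)) = c m * cnj (c n) * iexp ((\<nu> n - \<nu> m) * t)"
      by (simp add: mult_ac)
  qed
  finally show ?thesis .
qed

text \<open>The interval is majorized by a Gaussian of width T, whose Fourier transform couples only
  indices with |\<nu> m - \<nu> n| below about 1 / T. Schur's test then leaves a window count, made
  with T^2 in the place of l.\<close>

lemma dpoly_mean_value:
  assumes F: "finite F" and T: "T \<ge> 1"
  shows "(LINT t:{- 3 * T..3 * T}|lborel. (norm (dpoly c F t))\<^sup>2)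
     \<le> exp (9 / 2) * sqrt (2 * pi) * gconst * (\<Sum>m\<in>F. (norm (c m))\<^sup>2 * (exp (\<nu> m) + T * exp (\<theta> * \<nu> m)))"
proof -
  define l where "l = 1 / T\<^sup>2"
  have l: "l > 0" and T2: "T\<^sup>2 \<ge> 1" using T by (auto simp: l_def)
  let ?g = "\<lambda>t. complex_of_real (gs l t * (norm (dpoly c F t))\<^sup>2)"
  have eq: "?g t = (\<Sum>m\<in>F. \<Sum>n\<in>F. (c m * cnj (c n)) * (of_real (gs l t) * iexp ((\<nu> n - \<nu> m) * t)))" for t
    unfolding of_real_mult dpoly_norm_sq sum_distrib_left by (simp add: mult_ac)
  have ig: "integrable lborel ?g" unfolding eq
    by (intro Bochner_Integration.integrable_sum integrable_mult_right gs_ft_imag(1) l)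
  hence igr: "integrable lborel (\<lambda>t. gs l t * (norm (dpoly c F t))\<^sup>2)" by (simp only: complex_of_real_integrable_eq)
  have ker: "(LINT t|lborel. of_real (gs l t) * iexp (x * t)) = of_real (sqrt (2 * pi) * T * gs (T\<^sup>2) x)" for x
    unfolding gs_ft_imag(2)[OF l] using T by (simp add: l_def gs_def real_sqrt_mult mult_ac)
  have "complex_of_real (LINT t|lborel. gs l t * (norm (dpoly c F t))\<^sup>2) = (LINT t|lborel. ?g t)"
    by (simp only: integral_complex_of_real)
  also have "\<dots> = (\<Sum>m\<in>F. \<Sum>n\<in>F. (c m * cnj (c n)) * of_real (sqrt (2 * pi) * T * gs (T\<^sup>2) (\<nu> n - \<nu> m)))"
    unfolding eq ker[symmetric]
    by (simp only: Bochner_Integration.integral_sum integral_mult_right_zero Bochner_Integration.integrable_sum integrable_mult_right gs_ft_imag(1) l)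
  finally have "(LINT t|lborel. gs l t * (norm (dpoly c F t))\<^sup>2) =
      Re (\<Sum>m\<in>F. \<Sum>n\<in>F. (c m * cnj (c n)) * of_real (sqrt (2 * pi) * T * gs (T\<^sup>2) (\<nu> n - \<nu> m)))"
    by (metis Re_complex_of_real)
  also have "\<dots> \<le> norm (\<Sum>m\<in>F. \<Sum>n\<in>F. (c m * cnj (c n)) * of_real (sqrt (2 * pi) * T * gs (T\<^sup>2) (\<nu> n - \<nu> m)))"
    by (rule complex_Re_le_cmod)
  also have "\<dots> \<le> (\<Sum>m\<in>F. \<Sum>n\<in>F. norm (c m) * norm (c n) * (sqrt (2 * pi) * T * gs (T\<^sup>2) (\<nu> n - \<nu> m)))"
    by (intro sum_norm_le) (use T in \<open>auto simp: norm_mult intro!: sum_norm_le\<close>)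
  also have "\<dots> \<le> (\<Sum>m\<in>F. (norm (c m))\<^sup>2 * (\<Sum>n\<in>F. sqrt (2 * pi) * T * gs (T\<^sup>2) (\<nu> n - \<nu> m)))"
  proof (rule symmetric_kernel_bound)
    fix m n show "sqrt (2 * pi) * T * gs (T\<^sup>2) (\<nu> n - \<nu> m) = sqrt (2 * pi) * T * gs (T\<^sup>2) (\<nu> m - \<nu> n)"
      using gs_minus[of "T\<^sup>2" "\<nu> n - \<nu> m"] by simp
  qed (use T in auto)
  also have "\<dots> \<le> (\<Sum>m\<in>F. (norm (c m))\<^sup>2 * (sqrt (2 * pi) * gconst * (exp (\<nu> m) + T * exp (\<theta> * \<nu> m))))"
  proof (intro sum_mono mult_left_mono)
    fix m
    have "(\<Sum>n\<in>F. sqrt (2 * pi) * T * gs (T\<^sup>2) (\<nu> n - \<nu> m)) = sqrt (2 * pi) * T * (\<Sum>n\<in>F. gs (T\<^sup>2) (\<nu> n - \<nu> m))"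
      by (simp add: sum_distrib_left)
    also have "\<dots> \<le> sqrt (2 * pi) * T * (gconst * (exp (\<nu> m) / sqrt (T\<^sup>2) + exp (\<theta> * \<nu> m)))"
      using T T2 by (intro mult_left_mono gauss_count_finite F) auto
    also have "\<dots> = sqrt (2 * pi) * gconst * (exp (\<nu> m) + T * exp (\<theta> * \<nu> m))" using T by (simp add: field_simps)
    finally show "(\<Sum>n\<in>F. sqrt (2 * pi) * T * gs (T\<^sup>2) (\<nu> n - \<nu> m)) \<le> sqrt (2 * pi) * gconst * (exp (\<nu> m) + T * exp (\<theta> * \<nu> m))" .
  qed auto
  also have "\<dots> = sqrt (2 * pi) * gconst * (\<Sum>m\<in>F. (norm (c m))\<^sup>2 * (exp (\<nu> m) + T * exp (\<theta> * \<nu> m)))"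
    by (simp add: sum_distrib_left mult_ac)
  finally have main: "(LINT t|lborel. gs l t * (norm (dpoly c F t))\<^sup>2) \<le> sqrt (2 * pi) * gconst * (\<Sum>m\<in>F. (norm (c m))\<^sup>2 * (exp (\<nu> m) + T * exp (\<theta> * \<nu> m)))" .
  have "(LINT t:{- 3 * T..3 * T}|lborel. (norm (dpoly c F t))\<^sup>2) \<le> (LINT t|lborel. exp (9 / 2) * (gs l t * (norm (dpoly c F t))\<^sup>2))"
    unfolding set_lebesgue_integral_def
  proof (rule integral_mono)
    show "integrable lborel (\<lambda>t. indicator {- 3 * T..3 * T} t *\<^sub>R (norm (dpoly c F t))\<^sup>2)"
      unfolding set_integrable_def[symmetric] by (intro set_integrable_continuous continuous_intros dpoly_continuous)
    show "integrable lborel (\<lambda>t. exp (9 / 2) * (gs l t * (norm (dpoly c F t))\<^sup>2))" by (intro integrable_mult_right igr)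
    fix t
    show "indicator {- 3 * T..3 * T} t *\<^sub>R (norm (dpoly c F t))\<^sup>2 \<le> exp (9 / 2) * (gs l t * (norm (dpoly c F t))\<^sup>2)"
    proof (cases "t \<in> {- 3 * T..3 * T}")
      case True
      \<comment> \<open>At |t| = 3 * T the Gaussian has dropped to exp (- 9 / 2), whence the
        constant exp (9 / 2).\<close>
      hence "\<bar>t\<bar> \<le> \<bar>3 * T\<bar>" using T by auto
      hence "t\<^sup>2 \<le> (3 * T)\<^sup>2" by (simp only: abs_le_square_iff)
      hence "l * t\<^sup>2 \<le> 9" using T by (simp add: l_def field_simps)
      hence "1 \<le> exp (9 / 2) * gs l t" by (simp add: gs_def flip: exp_add)
      hence "1 * (norm (dpoly c F t))\<^sup>2 \<le> (exp (9 / 2) * gs l t) * (norm (dpoly c F t))\<^sup>2" by (intro mult_right_mono) auto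
      thus ?thesis using True by (simp add: mult.assoc)
    qed simp
  qed
  also have "\<dots> = exp (9 / 2) * (LINT t|lborel. gs l t * (norm (dpoly c F t))\<^sup>2)" by (rule integral_mult_right_zero)
  also have "\<dots> \<le> exp (9 / 2) * (sqrt (2 * pi) * gconst * (\<Sum>m\<in>F. (norm (c m))\<^sup>2 * (exp (\<nu> m) + T * exp (\<theta> * \<nu> m))))"
    by (intro mult_left_mono main) simp
  finally show ?thesis by (simp add: mult.assoc)
qed

text \<open>The unit windows to the right of the points stay inside {- 3 * T..3 * T}; the derivative
  in the Sobolev bound costs the factor (\<nu> m)^2.\<close>

lemma dpoly_discrete_mean_value:
  assumes F: "finite F" and T: "T \<ge> 1" and P: "finite P" "\<And>a. a \<in> P \<Longrightarrow> \<bar>a\<bar> \<le> 2 * T"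
    and sep: "\<And>a b. a \<in> P \<Longrightarrow> b \<in> P \<Longrightarrow> a \<noteq> b \<Longrightarrow> \<bar>a - b\<bar> > 1"
  shows "(\<Sum>t\<in>P. (norm (dpoly c F t))\<^sup>2)
     \<le> 2 * exp (9 / 2) * sqrt (2 * pi) * gconst * (\<Sum>m\<in>F. (1 + (\<nu> m)\<^sup>2) * (norm (c m))\<^sup>2 * (exp (\<nu> m) + T * exp (\<theta> * \<nu> m)))"
proof -
  let ?c' = "\<lambda>m. - \<i> * of_real (\<nu> m) * c m"
  define W where "W = (\<lambda>t. (norm (dpoly c F t))\<^sup>2 + (norm (dpoly ?c' F t))\<^sup>2)"
  have ii: "set_integrable lborel {- 3 * T..3 * T} (\<lambda>t. (norm (dpoly c F t))\<^sup>2)" for c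
    by (intro set_integrable_continuous continuous_intros dpoly_continuous)
  have iW: "set_integrable lborel {- 3 * T..3 * T} W"
    unfolding W_def by (rule set_integral_add(1)[OF ii ii])
  have "(\<Sum>t\<in>P. (norm (dpoly c F t))\<^sup>2) \<le> (\<Sum>t\<in>P. 2 * (LINT x:{t + 0..t + 0 + 1}|lborel. W x))"
    unfolding W_def add_0_right
    by (intro sum_mono sobolev_pointwise dpoly_has_vector_derivative dpoly_continuous)
  also have "\<dots> = 2 * (\<Sum>t\<in>P. (LINT x:{t + 0..t + 0 + 1}|lborel. W x))" by (simp only: sum_distrib_left)
  also have "\<dots> \<le> 2 * (LINT x:{- 3 * T..3 * T}|lborel. W x)"
  proof (intro mult_left_mono sum_separated_integrals P(1) sep iW)
    fix a assume "a \<in> P"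
    from P(2)[OF this] show "{a + 0..a + 0 + 1} \<subseteq> {- 3 * T..3 * T}" using T by (auto simp: abs_le_iff)
  qed (auto simp: W_def)
  also have "(LINT x:{- 3 * T..3 * T}|lborel. W x) = (LINT x:{- 3 * T..3 * T}|lborel. (norm (dpoly c F x))\<^sup>2) + (LINT x:{- 3 * T..3 * T}|lborel. (norm (dpoly ?c' F x))\<^sup>2)"
    unfolding W_def by (rule set_integral_add(2)[OF ii ii])
  also have "\<dots> \<le> exp (9 / 2) * sqrt (2 * pi) * gconst * (\<Sum>m\<in>F. (norm (c m))\<^sup>2 * (exp (\<nu> m) + T * exp (\<theta> * \<nu> m)))
     + exp (9 / 2) * sqrt (2 * pi) * gconst * (\<Sum>m\<in>F. (norm (?c' m))\<^sup>2 * (exp (\<nu> m) + T * exp (\<theta> * \<nu> m)))"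
    by (intro add_mono dpoly_mean_value F T)
  also have "\<dots> = exp (9 / 2) * sqrt (2 * pi) * gconst * (\<Sum>m\<in>F. (1 + (\<nu> m)\<^sup>2) * (norm (c m))\<^sup>2 * (exp (\<nu> m) + T * exp (\<theta> * \<nu> m)))"
    unfolding distrib_left[symmetric] sum.distrib[symmetric]
    by (simp add: norm_mult power_mult_distrib algebra_simps)
  finally show ?thesis by (simp add: mult_left_mono mult.assoc)
qed

text \<open>Bounds \<open>wt 1\<close> uniformly in t, which allows a single estimate for all unit
  blocks j in \<open>halasz\<close>.\<close>

definition vmean :: "real \<Rightarrow> real \<Rightarrow> real" where
  "vmean \<sigma> \<tau> = (LINT v|lborel. gh 1 v * norm (zet (Complex \<sigma> (\<tau> - v))))"

lemma wt_le_vmean: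
  assumes s: "\<theta> < \<sigma>" "\<sigma> < 1"
  shows "norm (wt 1 (Complex \<sigma> \<tau>) t) \<le> vmean \<sigma> \<tau>"
proof -
  have "Complex \<sigma> \<tau> - \<i> * of_real v = Complex \<sigma> (\<tau> - v)" for v by (simp add: complex_eq_iff)
  hence "norm (of_real (gh 1 v) * iexp (- t * v) * zet (Complex \<sigma> \<tau> - \<i> * of_real v)) = gh 1 v * norm (zet (Complex \<sigma> (\<tau> - v)))" for v
    by (simp add: norm_mult)
  thus ?thesis unfolding wt_def vmean_def
    by (metis (no_types, lifting) Bochner_Integration.integral_cong integral_norm_bound)
qed

lemma norm_pol:
  "l > 0 \<Longrightarrow> norm (pol l (Complex \<sigma> \<tau>) t) = A * exp ((1 - \<sigma>) * t) * sqrt (2 * pi / l) * exp (((1 - \<sigma>)\<^sup>2 - \<tau>\<^sup>2) / (2 * l))"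
proof -
  assume l: "l > 0"
  have r1: "Re ((1 - Complex \<sigma> \<tau>) * of_real t) = (1 - \<sigma>) * t" by simp
  have "(1 - Complex \<sigma> \<tau>)\<^sup>2 / (2 * of_real l) = (1 - Complex \<sigma> \<tau>)\<^sup>2 / of_real (2 * l)" by simp
  hence r2: "Re ((1 - Complex \<sigma> \<tau>)\<^sup>2 / (2 * of_real l)) = ((1 - \<sigma>)\<^sup>2 - \<tau>\<^sup>2) / (2 * l)"
    by (simp only: Re_divide_of_real) (simp add: power2_eq_square)
  show ?thesis unfolding pol_def norm_mult norm_exp_eq_Re r1 r2 using A_pos l by simp
qed

text \<open>Duality: the sum of |dpoly| over P is a sum over m of c m * a m, where a m is an
  exponential sum over P. After Cauchy-Schwarz the squares |a m|^2 are summed with Gaussian weights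
  over all generalized integers, and this dual sum is evaluated by \<open>wt_dirichlet\<close> at
  the differences t - t'.\<close>

lemma halasz:
  assumes P: "finite P" and F: "finite F" "\<And>m. m \<in> F \<Longrightarrow> \<nu> m \<le> real J" and s: "\<theta> < \<sigma>" "\<sigma> < 1"
  shows "(\<Sum>t\<in>P. norm (dpoly c F t))\<^sup>2 \<le> exp (1 / 2) * (\<Sum>m\<in>F. (norm (c m))\<^sup>2 * exp (\<sigma> * \<nu> m)) *
     (\<Sum>j\<le>J. \<Sum>t\<in>P. \<Sum>t'\<in>P. norm (pol 1 (Complex \<sigma> (t - t')) (real j)) + vmean \<sigma> (t - t'))"
proof -
  \<comment> \<open>Phases that turn each value of the polynomial into its modulus;
    \<open>sgn 0 = 0\<close> covers points where it vanishes.\<close>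
  define \<eta> where "\<eta> = (\<lambda>t. cnj (sgn (dpoly c F t)))"
  define a where "a = (\<lambda>m. \<Sum>t\<in>P. \<eta> t * iexp (- t * \<nu> m))"
  have eta: "\<eta> t * dpoly c F t = of_real (norm (dpoly c F t))" for t
  proof (cases "dpoly c F t = 0")
    case False
    thus ?thesis by (simp add: \<eta>_def sgn_eq complex_norm_square[symmetric] field_simps power2_eq_square)
  qed simp
  have eta1: "norm (\<eta> t) \<le> 1" for t by (simp add: \<eta>_def norm_sgn)
  have "of_real (\<Sum>t\<in>P. norm (dpoly c F t)) = (\<Sum>t\<in>P. \<eta> t * dpoly c F t)" by (simp add: eta)
  also have "\<dots> = (\<Sum>m\<in>F. c m * a m)"
    unfolding dpoly_def a_def sum_distrib_left by (subst sum.swap) (simp add: mult_ac)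
  finally have "norm (complex_of_real (\<Sum>t\<in>P. norm (dpoly c F t))) = norm (\<Sum>m\<in>F. c m * a m)" by (rule arg_cong)
  hence "(\<Sum>t\<in>P. norm (dpoly c F t)) = norm (\<Sum>m\<in>F. c m * a m)"
    by (simp only: norm_of_real) (simp add: sum_nonneg)
  also have "\<dots> \<le> (\<Sum>m\<in>F. norm (c m) * norm (a m))" by (rule sum_norm_le) (simp add: norm_mult)
  \<comment> \<open>The weight is distributed so that the dual sum carries exp (- \<sigma> * \<nu>
    m), a Dirichlet series on the line Re s = \<sigma>.\<close>
  also have "\<dots> = (\<Sum>m\<in>F. (norm (c m) * exp (\<sigma> * \<nu> m / 2)) * (exp (- \<sigma> * \<nu> m / 2) * norm (a m)))"
    by (intro sum.cong refl) (simp add: exp_minus field_simps)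
  finally have "(\<Sum>t\<in>P. norm (dpoly c F t))\<^sup>2 \<le> (\<Sum>m\<in>F. (norm (c m) * exp (\<sigma> * \<nu> m / 2)) * (exp (- \<sigma> * \<nu> m / 2) * norm (a m)))\<^sup>2"
    by (intro power_mono sum_nonneg) auto
  also have "\<dots> \<le> (\<Sum>m\<in>F. (norm (c m) * exp (\<sigma> * \<nu> m / 2))\<^sup>2) * (\<Sum>m\<in>F. (exp (- \<sigma> * \<nu> m / 2) * norm (a m))\<^sup>2)"
    by (rule Cauchy_Schwarz_ineq_sum)
  also have "(\<Sum>m\<in>F. (norm (c m) * exp (\<sigma> * \<nu> m / 2))\<^sup>2) = (\<Sum>m\<in>F. (norm (c m))\<^sup>2 * exp (\<sigma> * \<nu> m))"
    by (simp add: power_mult_distrib flip: exp_double)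
  also have "(\<Sum>m\<in>F. (exp (- \<sigma> * \<nu> m / 2) * norm (a m))\<^sup>2) = (\<Sum>m\<in>F. exp (- \<sigma> * \<nu> m) * (norm (a m))\<^sup>2)"
    by (simp add: power_mult_distrib flip: exp_double)
  finally have S0: "(\<Sum>t\<in>P. norm (dpoly c F t))\<^sup>2 \<le> (\<Sum>m\<in>F. (norm (c m))\<^sup>2 * exp (\<sigma> * \<nu> m)) * (\<Sum>m\<in>F. exp (- \<sigma> * \<nu> m) * (norm (a m))\<^sup>2)" .
  \<comment> \<open>Unit Gaussians centred at integers cover F: for j the integer part of \<nu> m
    the weight is at least exp (- 1 / 2).\<close>
  have S1: "(\<Sum>m\<in>F. exp (- \<sigma> * \<nu> m) * (norm (a m))\<^sup>2) \<le>
     exp (1 / 2) * (\<Sum>j\<le>J. \<Sum>m\<in>F. exp (- \<sigma> * \<nu> m) * gs 1 (\<nu> m - real j) * (norm (a m))\<^sup>2)"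
  proof -
    have "exp (- \<sigma> * \<nu> m) * (norm (a m))\<^sup>2 \<le> (\<Sum>j\<le>J. exp (1 / 2) * (exp (- \<sigma> * \<nu> m) * gs 1 (\<nu> m - real j) * (norm (a m))\<^sup>2))" if m: "m \<in> F" for m
    proof -
      define j where "j = nat \<lfloor>\<nu> m\<rfloor>"
      have j1: "real j \<le> \<nu> m" "\<nu> m < real j + 1" using nu_nonneg[of m] by (auto simp: j_def)
      hence j: "j \<le> J" using F(2)[OF m] by linarith
      have "(\<nu> m - real j)\<^sup>2 \<le> 1" using j1 by (intro power_le_one) auto
      hence "1 \<le> exp (1 / 2) * gs 1 (\<nu> m - real j)" by (simp add: gs_def flip: exp_add)
      hence "1 * (exp (- \<sigma> * \<nu> m) * (norm (a m))\<^sup>2) \<le> (exp (1 / 2) * gs 1 (\<nu> m - real j)) * (exp (- \<sigma> * \<nu> m) * (norm (a m))\<^sup>2)"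
        by (intro mult_right_mono) auto
      also have "\<dots> = exp (1 / 2) * (exp (- \<sigma> * \<nu> m) * gs 1 (\<nu> m - real j) * (norm (a m))\<^sup>2)" by (simp add: mult_ac)
      also have "\<dots> \<le> (\<Sum>j\<le>J. exp (1 / 2) * (exp (- \<sigma> * \<nu> m) * gs 1 (\<nu> m - real j) * (norm (a m))\<^sup>2))"
        by (rule member_le_sum[where f = "\<lambda>j. exp (1 / 2) * (exp (- \<sigma> * \<nu> m) * gs 1 (\<nu> m - real j) * (norm (a m))\<^sup>2)"]) (use j in auto)
      finally show ?thesis by simp
    qed
    hence "(\<Sum>m\<in>F. exp (- \<sigma> * \<nu> m) * (norm (a m))\<^sup>2) \<le> (\<Sum>m\<in>F. \<Sum>j\<le>J. exp (1 / 2) * (exp (- \<sigma> * \<nu> m) * gs 1 (\<nu> m - real j) * (norm (a m))\<^sup>2))"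
      by (rule sum_mono)
    also have "\<dots> = exp (1 / 2) * (\<Sum>j\<le>J. \<Sum>m\<in>F. exp (- \<sigma> * \<nu> m) * gs 1 (\<nu> m - real j) * (norm (a m))\<^sup>2)"
      by (subst sum.swap) (simp only: sum_distrib_left)
    finally show ?thesis .
  qed
  have S2: "(\<Sum>j\<le>J. \<Sum>m\<in>F. exp (- \<sigma> * \<nu> m) * gs 1 (\<nu> m - real j) * (norm (a m))\<^sup>2)
     \<le> (\<Sum>j\<le>J. \<Sum>t\<in>P. \<Sum>t'\<in>P. norm (pol 1 (Complex \<sigma> (t - t')) (real j)) + vmean \<sigma> (t - t'))"
  proof (rule sum_mono)
    fix j assume "j \<in> {..J}"
    let ?h = "\<lambda>m. exp (- \<sigma> * \<nu> m) * gs 1 (\<nu> m - real j) * (norm (a m))\<^sup>2"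
    let ?B = "\<lambda>\<tau> m. exp (- Complex \<sigma> \<tau> * of_real (\<nu> m)) * complex_of_real (gs 1 (\<nu> m - real j))"
    have eq: "complex_of_real (?h m) = (\<Sum>t\<in>P. \<Sum>t'\<in>P. (\<eta> t * cnj (\<eta> t')) * ?B (t - t') m)" for m
    proof -
      have "complex_of_real ((norm (a m))\<^sup>2) = a m * cnj (a m)" by (rule complex_norm_square)
      also have "\<dots> = (\<Sum>t\<in>P. \<Sum>t'\<in>P. (\<eta> t * iexp (- t * \<nu> m)) * cnj (\<eta> t' * iexp (- t' * \<nu> m)))"
        unfolding a_def cnj_sum sum_product ..
      finally have "complex_of_real (?h m) = (\<Sum>t\<in>P. \<Sum>t'\<in>P. of_real (exp (- \<sigma> * \<nu> m)) * of_real (gs 1 (\<nu> m - real j)) * ((\<eta> t * iexp (- t * \<nu> m)) * cnj (\<eta> t' * iexp (- t' * \<nu> m))))"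
        unfolding of_real_mult by (simp only: sum_distrib_left)
      also have "\<dots> = (\<Sum>t\<in>P. \<Sum>t'\<in>P. (\<eta> t * cnj (\<eta> t')) * ?B (t - t') m)"
      proof (intro sum.cong refl)
        fix t t'
        have "of_real (exp (- \<sigma> * \<nu> m)) * (iexp (- t * \<nu> m) * cnj (iexp (- t' * \<nu> m))) = exp (- Complex \<sigma> (t - t') * of_real (\<nu> m))"
          unfolding exp_cnj exp_of_real[symmetric] exp_add[symmetric]
          by (rule arg_cong[of _ _ exp]) (simp add: complex_eq_iff algebra_simps)
        thus "of_real (exp (- \<sigma> * \<nu> m)) * of_real (gs 1 (\<nu> m - real j)) * ((\<eta> t * iexp (- t * \<nu> m)) * cnj (\<eta> t' * iexp (- t' * \<nu> m))) =
           (\<eta> t * cnj (\<eta> t')) * ?B (t - t') m"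
          by (simp add: mult_ac)
      qed
      finally show ?thesis .
    qed
    have iB: "integrable (count_space UNIV) (?B \<tau>)" for \<tau> by (rule gauss_dirichlet(1)) simp
    have ih': "integrable (count_space UNIV) (\<lambda>m. complex_of_real (?h m))" unfolding eq
      by (intro Bochner_Integration.integrable_sum integrable_mult_right iB)
    hence ih: "integrable (count_space UNIV) ?h" by (simp only: complex_of_real_integrable_eq)
    \<comment> \<open>All ?h m are nonnegative, so F may be enlarged to the whole index type, where
      the sum has a closed evaluation.\<close>
    have "(\<Sum>m\<in>F. ?h m) = (LINT m|count_space UNIV. indicator F m *\<^sub>R ?h m)"
    proof -
      have "(LINT m|count_space UNIV. indicator F m *\<^sub>R ?h m) = (\<Sum>m | m \<in> UNIV \<and> indicator F m *\<^sub>R ?h m \<noteq> 0. indicator F m *\<^sub>R ?h m)"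
        by (rule lebesgue_integral_count_space_finite_support) (rule finite_subset[OF _ F(1)], auto simp: indicator_def split: if_splits)
      also have "\<dots> = (\<Sum>m\<in>F. ?h m)"
        by (rule sum.mono_neutral_cong_left[OF F(1)]) (auto simp: indicator_def split: if_splits)
      finally show ?thesis by simp
    qed
    also have "\<dots> \<le> (LINT m|count_space UNIV. ?h m)"
      by (rule integral_mono[OF integrable_mult_indicator[OF _ ih] ih]) (auto simp: indicator_def)
    also have "\<dots> \<le> norm (complex_of_real (LINT m|count_space UNIV. ?h m))" by simp
    also have "complex_of_real (LINT m|count_space UNIV. ?h m) = (\<Sum>t\<in>P. \<Sum>t'\<in>P. (\<eta> t * cnj (\<eta> t')) * (LINT m|count_space UNIV. ?B (t - t') m))"
      unfolding integral_complex_of_real[symmetric] eq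
      by (simp only: Bochner_Integration.integral_sum integral_mult_right_zero Bochner_Integration.integrable_sum integrable_mult_right iB)
    also have "norm \<dots> \<le> (\<Sum>t\<in>P. \<Sum>t'\<in>P. norm (pol 1 (Complex \<sigma> (t - t')) (real j)) + vmean \<sigma> (t - t'))"
    proof (intro sum_norm_le)
      fix t t'
      have b: "norm (LINT m|count_space UNIV. ?B (t - t') m) \<le> norm (pol 1 (Complex \<sigma> (t - t')) (real j)) + vmean \<sigma> (t - t')"
        using wt_dirichlet[of 1 "Complex \<sigma> (t - t')" "real j"] s wt_le_vmean[OF s, of "t - t'" "real j"]
        by (simp add: norm_triangle_mono)
      have "norm ((\<eta> t * cnj (\<eta> t')) * (LINT m|count_space UNIV. ?B (t - t') m)) = (norm (\<eta> t) * norm (\<eta> t')) * norm (LINT m|count_space UNIV. ?B (t - t') m)"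
        by (simp only: norm_mult complex_mod_cnj)
      also have "\<dots> \<le> (1 * 1) * norm (LINT m|count_space UNIV. ?B (t - t') m)"
        by (intro mult_right_mono mult_mono eta1) auto
      finally show "norm ((\<eta> t * cnj (\<eta> t')) * (LINT m|count_space UNIV. ?B (t - t') m)) \<le> norm (pol 1 (Complex \<sigma> (t - t')) (real j)) + vmean \<sigma> (t - t')"
        using b by simp
    qed
    finally show "(\<Sum>m\<in>F. ?h m) \<le> (\<Sum>t\<in>P. \<Sum>t'\<in>P. norm (pol 1 (Complex \<sigma> (t - t')) (real j)) + vmean \<sigma> (t - t'))" .
  qed
  have "(\<Sum>m\<in>F. exp (- \<sigma> * \<nu> m) * (norm (a m))\<^sup>2) \<le> exp (1 / 2) *
     (\<Sum>j\<le>J. \<Sum>t\<in>P. \<Sum>t'\<in>P. norm (pol 1 (Complex \<sigma> (t - t')) (real j)) + vmean \<sigma> (t - t'))"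
    by (rule order_trans[OF S1]) (intro mult_left_mono S2, simp)
  hence "(\<Sum>m\<in>F. (norm (c m))\<^sup>2 * exp (\<sigma> * \<nu> m)) * (\<Sum>m\<in>F. exp (- \<sigma> * \<nu> m) * (norm (a m))\<^sup>2) \<le>
     (\<Sum>m\<in>F. (norm (c m))\<^sup>2 * exp (\<sigma> * \<nu> m)) * (exp (1 / 2) *
     (\<Sum>j\<le>J. \<Sum>t\<in>P. \<Sum>t'\<in>P. norm (pol 1 (Complex \<sigma> (t - t')) (real j)) + vmean \<sigma> (t - t')))"
    by (intro mult_left_mono sum_nonneg) auto
  with S0 show ?thesis by (simp only: mult_ac)
qed

text \<open>Characterized by 2 * s0 - \<theta> = 1: the weight exp (\<theta> * \<nu> m) from the
  window counts turns exp (- 2 * s0 * \<nu> m) into exp (- \<nu> m).\<close>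

definition s0 :: real where "s0 = (1 + \<theta>) / 2"

lemma s0: "\<theta> < s0" "s0 < 1" "0 < s0"
  using theta by (auto simp: s0_def)

definition zc :: "real \<Rightarrow> real" where "zc u = norm (zet (Complex s0 u))"

definition Cz :: real where "Cz = A / (1 - s0) + C0 / (s0 - \<theta>)"

lemma Cz_nonneg: "Cz \<ge> 0"
  unfolding Cz_def using A_pos C0_nonneg s0 by simp

lemma zc_nonneg [simp]: "zc u \<ge> 0" by (simp add: zc_def)

lemma zc_growth: "zc u \<le> Cz * (1 + \<bar>u\<bar>)"
  unfolding zc_def Cz_def using zet_growth[of "Complex s0 u"] s0 by simp

lemma zc_continuous: "continuous_on S zc"
proof -
  have "continuous_on UNIV (\<lambda>u. zet (Complex s0 u))"
  proof (rule continuous_on_compose2[OF holomorphic_on_imp_continuous_on[OF zet_holomorphic]])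
    show "continuous_on UNIV (Complex s0)"
      unfolding Complex_eq by (intro continuous_intros)
  qed (use s0 in \<open>auto simp: complex_eq_iff\<close>)
  thus ?thesis unfolding zc_def by (intro continuous_intros) (rule continuous_on_subset, auto)
qed

lemma zc_measurable [measurable]: "zc \<in> borel_measurable borel"
  by (rule borel_measurable_continuous_onI[OF zc_continuous])

definition zmass :: "real \<Rightarrow> real \<Rightarrow> real" where
  "zmass L \<tau> = (LINT u:{\<tau> - L..\<tau> + L}|lborel. zc u)"

lemma zc_powr_continuous: "p > 0 \<Longrightarrow> continuous_on S (\<lambda>u. zc u powr p)"
  by (intro continuous_on_powr' zc_continuous continuous_on_const) auto

lemma zmass_nonneg: "zmass L \<tau> \<ge> 0"
  unfolding zmass_def set_lebesgue_integral_def by (intro integral_nonneg_AE AE_I2) auto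

text \<open>Splitting at the level \<open>U\<close> replaces Hoelder's inequality; \<open>U\<close> is optimized later.\<close>

lemma zmass_le:
  assumes U: "U > 0" and p: "p \<ge> 1" and L: "L \<ge> 0"
  shows "zmass L \<tau> \<le> 2 * L * U + U powr (1 - p) * (LINT u:{\<tau> - L..\<tau> + L}|lborel. zc u powr p)"
proof -
  let ?I = "{\<tau> - L..\<tau> + L}"
  have pt: "zc u \<le> U + U powr (1 - p) * zc u powr p" for u
  proof (cases "zc u \<le> U")
    case False
    hence z: "zc u > 0" using U by simp
    have "zc u powr (1 - p) \<le> U powr (1 - p)" using False U p by (intro powr_mono2') auto
    hence "zc u powr (1 - p) * zc u powr p \<le> U powr (1 - p) * zc u powr p" by (intro mult_right_mono) auto
    moreover have "zc u powr (1 - p) * zc u powr p = zc u" using z by (simp flip: powr_add)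
    ultimately show ?thesis using U by simp
  next
    case True
    moreover have "0 \<le> U powr (1 - p) * zc u powr p" by simp
    ultimately show ?thesis by linarith
  qed
  have i1: "set_integrable lborel ?I (\<lambda>u. U)" by (intro set_integrable_continuous continuous_intros)
  have i2: "set_integrable lborel ?I (\<lambda>u. U powr (1 - p) * zc u powr p)"
    using p by (intro set_integrable_continuous continuous_intros zc_powr_continuous) auto
  have "zmass L \<tau> \<le> (LINT u:?I|lborel. U + U powr (1 - p) * zc u powr p)"
    unfolding zmass_def
    by (rule set_integral_mono[OF set_integrable_continuous[OF zc_continuous] set_integral_add(1)[OF i1 i2] pt])
  also have "\<dots> = (LINT u:?I|lborel. U) + (LINT u:?I|lborel. U powr (1 - p) * zc u powr p)"
    by (rule set_integral_add(2)[OF i1 i2])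
  also have "(LINT u:?I|lborel. U) = 2 * L * U" using L by (simp add: set_lebesgue_integral_def)
  also have "(LINT u:?I|lborel. U powr (1 - p) * zc u powr p) = U powr (1 - p) * (LINT u:?I|lborel. zc u powr p)"
    by simp
  finally show ?thesis .
qed

text \<open>The shift by x serves the dual sum of the Halasz inequality, whose windows are centred
  at differences a - x.\<close>

lemma sum_local_moments:
  assumes p: "p > 0" and P: "finite P" and sep: "\<And>a b. a \<in> P \<Longrightarrow> b \<in> P \<Longrightarrow> a \<noteq> b \<Longrightarrow> \<bar>a - b\<bar> > 2 * L"
    and D: "\<And>a. a \<in> P \<Longrightarrow> \<bar>a - x\<bar> + L \<le> D"
  shows "(\<Sum>a\<in>P. (LINT u:{a - x - L..a - x + L}|lborel. zc u powr p)) \<le> (LINT u:{- D..D}|lborel. zc u powr p)"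
proof -
  have "(\<Sum>a\<in>P. (LINT u:{a + (- x - L)..a + (- x - L) + 2 * L}|lborel. zc u powr p)) \<le> (LINT u:{- D..D}|lborel. zc u powr p)"
  proof (intro sum_separated_integrals P sep set_integrable_continuous zc_powr_continuous p)
    fix a assume "a \<in> P"
    from D[OF this] show "{a + (- x - L)..a + (- x - L) + 2 * L} \<subseteq> {- D..D}" by (auto simp: abs_le_iff)
  qed auto
  moreover have "a + (- x - L) = a - x - L" "a - x - L + 2 * L = a - x + L" for a by simp_all
  ultimately show ?thesis by (simp only:)
qed

lemma set_integral_reflect:
  fixes f :: "real \<Rightarrow> real"
  shows "(LINT v:{- L..L}|lborel. f (\<tau> - v)) = (LINT u:{\<tau> - L..\<tau> + L}|lborel. f u)"
proof -
  have "(LINT u:{\<tau> - L..\<tau> + L}|lborel. f u) = (LINT v|lborel. indicator {\<tau> - L..\<tau> + L} (\<tau> + (- 1) * v) *\<^sub>R f (\<tau> + (- 1) * v))"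
    unfolding set_lebesgue_integral_def by (subst lborel_integral_real_affine[of "-1" _ \<tau>]) auto
  also have "\<dots> = (LINT v:{- L..L}|lborel. f (\<tau> - v))"
    unfolding set_lebesgue_integral_def by (intro Bochner_Integration.integral_cong refl) (auto simp: indicator_def)
  finally show ?thesis ..
qed

lemma gh_le_1: "l \<ge> 1 \<Longrightarrow> gh l v \<le> 1"
proof -
  assume l: "l \<ge> 1"
  have "1 * 1 \<le> (2 * pi) * l" using pi_gt3 l by (intro mult_mono) auto
  hence s1: "1 \<le> sqrt (2 * pi * l)" by simp
  have "gs (1 / l) v \<le> 1" using l by (intro gs_le_1) auto
  also note s1
  finally show ?thesis unfolding gh_def using s1 by (subst pos_divide_le_eq) linarith+
qed

text \<open>The Gaussian mean is replaced by the plain integral over a window, up to a tail that is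
  a negative power of T once L is a large multiple of ln T.\<close>

lemma vmean_le:
  assumes L: "L \<ge> 0"
  shows "vmean s0 \<tau> \<le> zmass L \<tau> + 4 * exp 2 * Cz * (1 + \<bar>\<tau>\<bar>) * exp (- (L\<^sup>2 / 4))"
proof -
  have g: "zc (\<tau> - v) \<le> (Cz * (1 + \<bar>\<tau>\<bar>)) * (1 + \<bar>v\<bar>)" for v
  proof -
    have "zc (\<tau> - v) \<le> Cz * (1 + \<bar>\<tau> - v\<bar>)" by (rule zc_growth)
    also have "1 + \<bar>\<tau> - v\<bar> \<le> (1 + \<bar>\<tau>\<bar>) * (1 + \<bar>v\<bar>)"
    proof -
      have "0 \<le> \<bar>\<tau>\<bar> * \<bar>v\<bar>" by simp
      thus ?thesis using abs_triangle_ineq4[of \<tau> v] unfolding distrib_left distrib_right mult_1_left mult_1_right by linarith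
    qed
    hence "Cz * (1 + \<bar>\<tau> - v\<bar>) \<le> Cz * ((1 + \<bar>\<tau>\<bar>) * (1 + \<bar>v\<bar>))" using Cz_nonneg by (intro mult_left_mono) auto
    finally show ?thesis by (simp add: mult_ac)
  qed
  have h: "(\<lambda>v. zc (\<tau> - v)) \<in> borel_measurable borel" by measurable
  have B: "Cz * (1 + \<bar>\<tau>\<bar>) \<ge> 0" using Cz_nonneg by simp
  note tb = gh_tail_bound[OF order_refl h B L zc_nonneg g]
  have "vmean s0 \<tau> \<le> (LINT v:{- L..L}|lborel. gh 1 v * zc (\<tau> - v)) + 4 * exp 2 * sqrt 1 * (Cz * (1 + \<bar>\<tau>\<bar>)) * exp (- (L\<^sup>2 / (4 * 1)))"
    using tb(3) unfolding vmean_def zc_def .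
  also have "(LINT v:{- L..L}|lborel. gh 1 v * zc (\<tau> - v)) \<le> (LINT v:{- L..L}|lborel. zc (\<tau> - v))"
  proof (rule set_integral_mono[OF tb(2)])
    show "set_integrable lborel {- L..L} (\<lambda>v. zc (\<tau> - v))"
      by (intro set_integrable_continuous continuous_on_compose2[OF zc_continuous[of UNIV]] continuous_intros) auto
    show "gh 1 v * zc (\<tau> - v) \<le> zc (\<tau> - v)" for v using gh_le_1[of 1 v] by (simp add: mult_left_le_one_le)
  qed
  also have "\<dots> = zmass L \<tau>" unfolding zmass_def by (rule set_integral_reflect)
  finally show ?thesis by (simp add: mult_ac)
qed

text \<open>The spacing concentrates the pole terms on the diagonal. The zeta terms are summed over
  t for fixed t': the differences t - t' are as well spaced as P, so their windows are disjoint and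
  the local moments add up to at most \<open>H\<close>.\<close>

lemma halasz_moment:
  assumes P: "finite P" and F: "finite F" "\<And>m. m \<in> F \<Longrightarrow> \<nu> m \<le> real J"
    and sep: "\<And>a b. a \<in> P \<Longrightarrow> b \<in> P \<Longrightarrow> a \<noteq> b \<Longrightarrow> \<bar>a - b\<bar> > 2 * L" and L: "L \<ge> 0"
    and D: "\<And>a b. a \<in> P \<Longrightarrow> b \<in> P \<Longrightarrow> \<bar>a - b\<bar> + L \<le> D"
    and H: "(LINT u:{- D..D}|lborel. zc u powr p) \<le> H" and p: "p \<ge> 1" and U: "U > 0"
  shows "(\<Sum>t\<in>P. norm (dpoly c F t))\<^sup>2 \<le> exp (1 / 2) * (\<Sum>m\<in>F. (norm (c m))\<^sup>2 * exp (s0 * \<nu> m)) * (real J + 1) *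
     (A * sqrt (2 * pi) * exp (1 / 2) * exp ((1 - s0) * J) * (real (card P) + (real (card P))\<^sup>2 * exp (- 2 * L\<^sup>2))
      + real (card P) * (2 * L * U * real (card P) + U powr (1 - p) * H)
      + (real (card P))\<^sup>2 * (4 * exp 2 * Cz * (1 + D) * exp (- (L\<^sup>2 / 4))))"
proof -
  define R where "R = real (card P)"
  define a where "a = A * sqrt (2 * pi) * exp (1 / 2) * exp ((1 - s0) * J)"
  have a0: "a \<ge> 0" unfolding a_def using A_pos by simp
  define b where "b = 4 * exp 2 * Cz * (1 + D) * exp (- (L\<^sup>2 / 4))"
  have pol_le: "norm (pol 1 (Complex s0 (t - t')) (real j)) \<le> a * (if t = t' then 1 else exp (- 2 * L\<^sup>2))"
    if t: "t \<in> P" "t' \<in> P" and j: "j \<le> J" for t t' j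
  proof -
    have "norm (pol 1 (Complex s0 (t - t')) (real j)) = A * exp ((1 - s0) * j) * sqrt (2 * pi) * exp (((1 - s0)\<^sup>2 - (t - t')\<^sup>2) / 2)"
      by (subst norm_pol) auto
    also have "exp (((1 - s0)\<^sup>2 - (t - t')\<^sup>2) / 2) \<le> exp (1 / 2) * (if t = t' then 1 else exp (- 2 * L\<^sup>2))"
    proof -
      have "(1 - s0)\<^sup>2 \<le> 1" using s0 by (intro power_le_one) auto
      moreover have "4 * L\<^sup>2 \<le> (t - t')\<^sup>2" if "t \<noteq> t'"
      proof -
        have "(2 * L)\<^sup>2 \<le> \<bar>t - t'\<bar>\<^sup>2" using sep[OF t that] L by (intro power_mono) auto
        thus ?thesis by simp
      qed
      ultimately show ?thesis by (auto simp flip: exp_add)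
    qed
    also have "exp ((1 - s0) * j) \<le> exp ((1 - s0) * J)" using s0 j by simp
    finally have "norm (pol 1 (Complex s0 (t - t')) (real j)) \<le> A * exp ((1 - s0) * J) * sqrt (2 * pi) * (exp (1 / 2) * (if t = t' then 1 else exp (- 2 * L\<^sup>2)))"
      using A_pos by (simp add: mult_left_mono mult_right_mono mult_mono)
    thus ?thesis by (simp add: a_def mult_ac)
  qed
  have pol_sum: "(\<Sum>t\<in>P. \<Sum>t'\<in>P. norm (pol 1 (Complex s0 (t - t')) (real j))) \<le> a * (R + R\<^sup>2 * exp (- 2 * L\<^sup>2))" if j: "j \<le> J" for j
  proof -
    have "(\<Sum>t\<in>P. \<Sum>t'\<in>P. norm (pol 1 (Complex s0 (t - t')) (real j))) \<le> (\<Sum>t\<in>P. \<Sum>t'\<in>P. a * ((if t = t' then 1 else 0) + exp (- 2 * L\<^sup>2)))"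
    proof (intro sum_mono)
      fix t t' assume "t \<in> P" "t' \<in> P"
      from pol_le[OF this j] show "norm (pol 1 (Complex s0 (t - t')) (real j)) \<le> a * ((if t = t' then 1 else 0) + exp (- 2 * L\<^sup>2))"
        by (rule order_trans) (intro mult_left_mono a0, simp)
    qed
    also have "\<dots> = a * (R + R\<^sup>2 * exp (- 2 * L\<^sup>2))"
      unfolding sum_distrib_left[symmetric] sum.distrib using P by (simp add: R_def power2_eq_square algebra_simps)
    finally show ?thesis .
  qed
  have v_sum: "(\<Sum>t\<in>P. vmean s0 (t - t')) \<le> (2 * L * U * R + U powr (1 - p) * H) + R * b" if t': "t' \<in> P" for t'
  proof -
    have "(\<Sum>t\<in>P. vmean s0 (t - t')) \<le> (\<Sum>t\<in>P. (2 * L * U + U powr (1 - p) * (LINT u:{t - t' - L..t - t' + L}|lborel. zc u powr p)) + b)"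
    proof (rule sum_mono)
      fix t assume t: "t \<in> P"
      have "4 * exp 2 * Cz * (1 + \<bar>t - t'\<bar>) * exp (- (L\<^sup>2 / 4)) \<le> b" unfolding b_def
        using D[OF t t'] L Cz_nonneg by (intro mult_right_mono mult_left_mono) auto
      thus "vmean s0 (t - t') \<le> (2 * L * U + U powr (1 - p) * (LINT u:{t - t' - L..t - t' + L}|lborel. zc u powr p)) + b"
        using vmean_le[OF L, of "t - t'"] zmass_le[OF U p L, of "t - t'"] by linarith
    qed
    also have "\<dots> = 2 * L * U * R + U powr (1 - p) * (\<Sum>t\<in>P. (LINT u:{t - t' - L..t - t' + L}|lborel. zc u powr p)) + R * b"
      by (simp add: sum.distrib sum_distrib_left R_def algebra_simps)
    also have "(\<Sum>t\<in>P. (LINT u:{t - t' - L..t - t' + L}|lborel. zc u powr p)) \<le> H"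
      using sum_local_moments[OF _ P sep D, of p t'] p t' H by auto
    finally show ?thesis by (simp add: mult_left_mono)
  qed
  have "(\<Sum>j\<le>J. \<Sum>t\<in>P. \<Sum>t'\<in>P. norm (pol 1 (Complex s0 (t - t')) (real j)) + vmean s0 (t - t'))
     \<le> (\<Sum>j\<le>J. a * (R + R\<^sup>2 * exp (- 2 * L\<^sup>2)) + R * ((2 * L * U * R + U powr (1 - p) * H) + R * b))"
  proof (intro sum_mono)
    fix j assume j: "j \<in> {..J}"
    have "(\<Sum>t\<in>P. \<Sum>t'\<in>P. vmean s0 (t - t')) = (\<Sum>t'\<in>P. \<Sum>t\<in>P. vmean s0 (t - t'))" by (rule sum.swap)
    also have "\<dots> \<le> (\<Sum>t'\<in>P. (2 * L * U * R + U powr (1 - p) * H) + R * b)" by (intro sum_mono v_sum)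
    also have "\<dots> = R * ((2 * L * U * R + U powr (1 - p) * H) + R * b)" by (simp add: R_def)
    finally show "(\<Sum>t\<in>P. \<Sum>t'\<in>P. norm (pol 1 (Complex s0 (t - t')) (real j)) + vmean s0 (t - t'))
      \<le> a * (R + R\<^sup>2 * exp (- 2 * L\<^sup>2)) + R * ((2 * L * U * R + U powr (1 - p) * H) + R * b)"
      using pol_sum[of j] j by (simp add: sum.distrib)
  qed
  also have "\<dots> = (real J + 1) * (a * (R + R\<^sup>2 * exp (- 2 * L\<^sup>2)) + R * (2 * L * U * R + U powr (1 - p) * H) + R\<^sup>2 * b)"
    by (simp add: algebra_simps power2_eq_square)
  finally have S: "(\<Sum>j\<le>J. \<Sum>t\<in>P. \<Sum>t'\<in>P. norm (pol 1 (Complex s0 (t - t')) (real j)) + vmean s0 (t - t'))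
     \<le> (real J + 1) * (a * (R + R\<^sup>2 * exp (- 2 * L\<^sup>2)) + R * (2 * L * U * R + U powr (1 - p) * H) + R\<^sup>2 * b)" .
  have "(\<Sum>t\<in>P. norm (dpoly c F t))\<^sup>2 \<le> exp (1 / 2) * (\<Sum>m\<in>F. (norm (c m))\<^sup>2 * exp (s0 * \<nu> m)) *
     (\<Sum>j\<le>J. \<Sum>t\<in>P. \<Sum>t'\<in>P. norm (pol 1 (Complex s0 (t - t')) (real j)) + vmean s0 (t - t'))"
    by (rule halasz[OF P F s0(1,2)])
  also have "\<dots> \<le> exp (1 / 2) * (\<Sum>m\<in>F. (norm (c m))\<^sup>2 * exp (s0 * \<nu> m)) *
      ((real J + 1) * (a * (R + R\<^sup>2 * exp (- 2 * L\<^sup>2)) + R * (2 * L * U * R + U powr (1 - p) * H) + R\<^sup>2 * b))"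
    by (intro mult_left_mono S mult_nonneg_nonneg sum_nonneg) auto
  finally show ?thesis by (simp only: R_def a_def b_def mult.assoc)
qed

end

section \<open>Local zero counts\<close>

text \<open>Induction over Z. Away from the new zero a the quotient by its power is holomorphic;
  near a it agrees with \<open>zor_poly f a\<close> divided by the factors already removed, and the
  two pieces are glued.\<close>

lemma holomorphic_factor_out_zeros:
  fixes f :: "complex \<Rightarrow> complex"
  assumes hol: "f holomorphic_on S" and S: "open S" "connected S" and ne: "\<exists>w\<in>S. f w \<noteq> 0"
    and Z: "finite Z" "Z \<subseteq> S"
  shows "\<exists>h. h holomorphic_on S \<and> (\<forall>z\<in>S. f z = h z * (\<Prod>\<rho>\<in>Z. (z - \<rho>) ^ nat (zorder f \<rho>)))"
  using Z
proof (induction Z rule: finite_induct)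
  case empty
  show ?case using hol by (intro exI[of _ f]) auto
next
  case (insert a Z)
  then obtain h where h: "h holomorphic_on S" "\<And>z. z \<in> S \<Longrightarrow> f z = h z * (\<Prod>\<rho>\<in>Z. (z - \<rho>) ^ nat (zorder f \<rho>))" by auto
  define Q where "Q = (\<lambda>z. \<Prod>\<rho>\<in>Z. (z - \<rho>) ^ nat (zorder f \<rho>))"
  define n where "n = nat (zorder f a)"
  have aS: "a \<in> S" using insert by auto
  have Qhol: "Q holomorphic_on A" for A unfolding Q_def by (intro holomorphic_intros)
  have Qnz: "Q z \<noteq> 0" if "z \<notin> Z" for z using that insert.hyps by (auto simp: Q_def)
  obtain r where r: "r > 0" "cball a r \<subseteq> S" "zor_poly f a holomorphic_on cball a r"
     and r4: "\<forall>w\<in>cball a r. f w = zor_poly f a w * (w - a) ^ nat (zorder f a) \<and> zor_poly f a w \<noteq> 0"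
    using zorder_exist_zero[OF hol S aS ne] by blast
  have r5: "f w = zor_poly f a w * (w - a) ^ n" if "w \<in> cball a r" for w
    using r4 that unfolding n_def by blast
  have "open (- Z)" using insert.hyps by (simp add: finite_imp_closed open_Compl)
  then obtain r' where r': "r' > 0" "ball a r' \<subseteq> - Z" using insert.hyps by (meson ComplI open_contains_ball)
  define B where "B = ball a (min r r')"
  have B: "open B" "a \<in> B" "B \<subseteq> cball a r" "B \<inter> Z = {}" using r r' by (auto simp: B_def)
  define h' where "h' = (\<lambda>z. if z = a then zor_poly f a a / Q a else h z / (z - a) ^ n)"
  have hB: "h' z = zor_poly f a z / Q z" if z: "z \<in> B" for z
  proof (cases "z = a")
    case False
    have "z \<in> S" "z \<in> cball a r" using r(2) B(3) z by blast+
    hence "h z * Q z = zor_poly f a z * (z - a) ^ n" using h(2)[of z] r5[of z] by (simp add: Q_def)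
    moreover have "Q z \<noteq> 0" using Qnz B z by blast
    ultimately show ?thesis using False by (simp add: h'_def field_simps)
  qed (simp add: h'_def)
  have "h' holomorphic_on ((S - {a}) \<union> B)"
  proof (rule holomorphic_on_Un)
    have "(\<lambda>z. h z / (z - a) ^ n) holomorphic_on (S - {a})"
      by (intro holomorphic_intros holomorphic_on_subset[OF h(1)]) auto
    thus "h' holomorphic_on (S - {a})" by (rule holomorphic_transform) (auto simp: h'_def)
    have "(\<lambda>z. zor_poly f a z / Q z) holomorphic_on B"
      by (intro holomorphic_intros holomorphic_on_subset[OF r(3)] Qhol) (use B Qnz in auto)
    thus "h' holomorphic_on B" by (rule holomorphic_transform) (simp add: hB)
    show "open (S - {a})" using S(1) by (simp add: open_delete)
  qed (use B in auto)
  hence "h' holomorphic_on S" by (rule holomorphic_on_subset) (use B in auto)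
  moreover have "f z = h' z * (\<Prod>\<rho>\<in>insert a Z. (z - \<rho>) ^ nat (zorder f \<rho>))" if z: "z \<in> S" for z
  proof -
    have e: "(\<Prod>\<rho>\<in>insert a Z. (z - \<rho>) ^ nat (zorder f \<rho>)) = (z - a) ^ n * Q z"
      using insert.hyps by (simp add: Q_def n_def)
    show ?thesis
    proof (cases "z = a")
      case True
      thus ?thesis unfolding e using r5[of a] r(1) Qnz[of a] insert.hyps by (simp add: h'_def)
    next
      case False
      thus ?thesis unfolding e using h(2)[OF z] by (simp add: h'_def Q_def)
    qed
  qed
  ultimately show ?case by blast
qed

text \<open>Jensen's inequality through Blaschke factors: each z - \<rho> is exchanged for a
  function of the same modulus on the circle, then the maximum principle is applied. Comparison at
  the centre gains a factor R / r for every zero.\<close>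

lemma zero_count_disc:
  fixes f :: "complex \<Rightarrow> complex"
  assumes hol: "f holomorphic_on S" and S: "open S" "connected S" and R: "0 < r" "r < R" "cball c R \<subseteq> S"
    and M: "\<And>z. z \<in> S \<Longrightarrow> dist c z = R \<Longrightarrow> norm (f z) \<le> M" and fc: "f c \<noteq> 0"
    and Z: "finite Z" "Z \<subseteq> cball c r"
  shows "real (\<Sum>\<rho>\<in>Z. nat (zorder f \<rho>)) * ln (R / r) \<le> ln (M / norm (f c))"
proof -
  have R0: "R > 0" using R by simp
  have cS: "c \<in> S" using R by auto
  have ZS: "Z \<subseteq> S" using Z(2) R by (meson dual_order.trans less_imp_le subset_cball)
  obtain h where h: "h holomorphic_on S" "\<And>z. z \<in> S \<Longrightarrow> f z = h z * (\<Prod>\<rho>\<in>Z. (z - \<rho>) ^ nat (zorder f \<rho>))"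
    using holomorphic_factor_out_zeros[OF hol S _ Z(1) ZS] fc cS by blast
  define n where "n = (\<Sum>\<rho>\<in>Z. nat (zorder f \<rho>))"
  \<comment> \<open>On |z - c| = R the modulus is |z - \<rho>|, while at the centre it is R, at
    least R / r times |c - \<rho>|.\<close>
  define b where "b = (\<lambda>\<rho> z. (of_real (R\<^sup>2) - cnj (\<rho> - c) * (z - c)) / of_real R)"
  define g where "g = (\<lambda>z. h z * (\<Prod>\<rho>\<in>Z. b \<rho> z ^ nat (zorder f \<rho>)))"
  have ghol: "g holomorphic_on S"
    unfolding g_def b_def using R0 by (intro holomorphic_intros h(1)) auto
  have bd: "norm (g z) \<le> M" if z: "dist c z = R" for z
  proof -
    have zS: "z \<in> S" using R z by auto
    have "norm (b \<rho> z) = norm (z - \<rho>)" for \<rho>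
    proof -
      define w where "w = z - c"
      have nw: "norm w = R" using z by (simp add: w_def dist_norm norm_minus_commute)
      have w: "w * cnj w = of_real (R\<^sup>2)" using complex_norm_square[of w, unfolded nw] by (rule sym)
      have "of_real (R\<^sup>2) - cnj (\<rho> - c) * w = w * cnj (w - (\<rho> - c))" unfolding w[symmetric] by (simp add: algebra_simps)
      hence "norm (of_real (R\<^sup>2) - cnj (\<rho> - c) * w) = R * norm (w - (\<rho> - c))" by (simp only: norm_mult complex_mod_cnj nw)
      thus ?thesis using R0 by (simp add: b_def w_def norm_divide)
    qed
    hence "norm (g z) = norm (f z)" unfolding g_def h(2)[OF zS] norm_mult by (simp add: norm_power flip: prod_norm)
    thus ?thesis using M[OF zS z] by simp
  qed
  have "norm (g c) \<le> M"
  proof (rule maximum_modulus_frontier[of g "cball c R"])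
    show "g holomorphic_on interior (cball c R)" by (rule holomorphic_on_subset[OF ghol]) (use R in auto)
    show "continuous_on (closure (cball c R)) g"
      by (rule holomorphic_on_imp_continuous_on, rule holomorphic_on_subset[OF ghol]) (use R in auto)
    show "norm (g z) \<le> M" if "z \<in> frontier (cball c R)" for z using bd that by (simp add: dist_commute)
  qed (use R in auto)
  moreover have "norm (g c) = norm (h c) * R ^ n"
    unfolding g_def b_def norm_mult using R0
    by (simp add: norm_power norm_divide power2_eq_square n_def power_sum flip: prod_norm)
  ultimately have hc: "norm (h c) * R ^ n \<le> M" by simp
  have "norm (f c) \<le> norm (h c) * r ^ n"
  proof -
    have "norm (\<Prod>\<rho>\<in>Z. (c - \<rho>) ^ nat (zorder f \<rho>)) \<le> (\<Prod>\<rho>\<in>Z. r ^ nat (zorder f \<rho>))"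
      unfolding prod_norm[symmetric] norm_power
      using Z(2) by (intro prod_mono conjI power_mono) (auto simp: dist_norm)
    thus ?thesis unfolding h(2)[OF cS] norm_mult n_def power_sum by (intro mult_left_mono) auto
  qed
  hence "norm (f c) * R ^ n \<le> norm (h c) * r ^ n * R ^ n" using R0 by (intro mult_right_mono) auto
  also have "\<dots> = (norm (h c) * R ^ n) * r ^ n" by simp
  also have "\<dots> \<le> M * r ^ n" using hc R by (intro mult_right_mono) auto
  finally have "(R / r) ^ n \<le> M / norm (f c)" using R fc by (simp add: field_simps power_divide)
  hence "ln ((R / r) ^ n) \<le> ln (M / norm (f c))" using R by (intro ln_mono) auto
  thus ?thesis using R by (simp add: ln_realpow n_def)
qed

context regular_count
begin

text \<open>The product (s - 1) * zet s with its removable singularity filled; the value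
  \<open>A\<close> at 1 shows that it does not vanish identically.\<close>

definition zf :: "complex \<Rightarrow> complex" where "zf s = of_real A * s + s * (s - 1) * mel s"

lemma zf_eq: "s \<noteq> 1 \<Longrightarrow> zf s = (s - 1) * zet s"
  by (simp add: zf_def zet_def field_simps)

lemma zf_holomorphic: "zf holomorphic_on {s. Re s > \<theta>}"
  unfolding zf_def by (intro holomorphic_intros mel_holomorphic)

lemma zf_bound:
  assumes "Re s \<ge> \<sigma>" "\<sigma> > \<theta>"
  shows "norm (zf s) \<le> (2 * A + C0 / (\<sigma> - \<theta>)) * (1 + norm s)\<^sup>2"
proof (cases "s = 1")
  case True
  obtain q where q: "q = C0 / (\<sigma> - \<theta>)" by blast
  have "q \<ge> 0" unfolding q using C0_nonneg assms by simp
  thus ?thesis unfolding q[symmetric] using True A_pos by (simp add: zf_def)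
next
  case False
  have "norm (zf s) \<le> (A + C0 / (\<sigma> - \<theta>)) * (1 + norm s)\<^sup>2"
    using zet_bound[OF assms] False by (simp add: zf_eq)
  also have "\<dots> \<le> (2 * A + C0 / (\<sigma> - \<theta>)) * (1 + norm s)\<^sup>2" using A_pos by (intro mult_right_mono) auto
  finally show ?thesis .
qed

text \<open>The two functions differ by the factor s - 1, which is nonzero near \<rho>.\<close>

lemma zorder_zf:
  assumes s: "Re \<rho> > \<theta>" "\<rho> \<noteq> 1"
  shows "zorder zet \<rho> = zorder zf \<rho>"
proof -
  have ne: "\<exists>w\<in>{s. Re s > \<theta>}. zf w \<noteq> 0" using A_pos theta by (intro bexI[of _ 1]) (auto simp: zf_def)
  have op: "open {s. Re s > \<theta>}" "connected {s. Re s > \<theta>}"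
    by (simp_all add: open_halfspace_Re_gt convex_halfspace_Re_gt convex_connected)
  define n where "n = zorder zf \<rho>"
  define g where "g = zor_poly zf \<rho>"
  have z: "(if zf \<rho> = 0 then n > 0 else n = 0) \<and> (\<exists>r. r > 0 \<and> cball \<rho> r \<subseteq> {s. Re s > \<theta>} \<and> g holomorphic_on cball \<rho> r
    \<and> (\<forall>w\<in>cball \<rho> r. zf w = g w * (w - \<rho>) ^ nat n \<and> g w \<noteq> 0))"
    unfolding n_def g_def by (rule zorder_exist_zero[OF zf_holomorphic op _ ne]) (use s in simp)
  then obtain r where r: "r > 0" "cball \<rho> r \<subseteq> {s. Re s > \<theta>}" "g holomorphic_on cball \<rho> r"
      and r4: "\<forall>w\<in>cball \<rho> r. zf w = g w * (w - \<rho>) ^ nat n \<and> g w \<noteq> 0" by blast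
  have n: "n \<ge> 0" using conjunct1[OF z] by (simp split: if_splits)
  show ?thesis unfolding n_def[symmetric]
  proof (rule zorder_eqI[where S = "ball \<rho> r - {1}" and g = "\<lambda>w. g w / (w - 1)"])
    show "(\<lambda>w. g w / (w - 1)) holomorphic_on ball \<rho> r - {1}"
      by (intro holomorphic_intros holomorphic_on_subset[OF r(3)]) auto
    show "g \<rho> / (\<rho> - 1) \<noteq> 0" using r4 r(1) s by auto
    fix w assume w: "w \<in> ball \<rho> r - {1}" "w \<noteq> \<rho>"
    hence "(w - 1) * zet w = g w * (w - \<rho>) ^ nat n" using r4 zf_eq[of w] by auto
    thus "zet w = g w / (w - 1) * (w - \<rho>) powi n" using w n by (simp add: power_int_def field_simps)
  qed (use s r in \<open>auto simp: open_delete\<close>)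
qed

text \<open>Discs around 2 + \<i> t: the lower bound at the centre and polynomial growth in T leave
  O(ln T) zeros in a box of fixed height.\<close>

lemma local_zero_count:
  assumes c1: "c1 > 0" and low: "\<And>t. norm (zet (Complex 2 t)) \<ge> c1"
  shows "\<exists>K\<ge>0. \<forall>T\<ge>2. \<forall>t Z. \<bar>t\<bar> \<le> T \<longrightarrow> finite Z \<longrightarrow>
     Z \<subseteq> {\<rho>. s0 \<le> Re \<rho> \<and> Re \<rho> \<le> 2 \<and> \<bar>Im \<rho> - t\<bar> \<le> (1 - \<theta>) / 6} \<longrightarrow>
     real (\<Sum>\<rho>\<in>Z. nat (zorder zf \<rho>)) \<le> K * ln T"
proof -
  define d where "d = (1 - \<theta>) / 2"
  have d: "d > 0" "d \<le> 1/2" "s0 = \<theta> + d" using theta by (auto simp: d_def s0_def field_simps)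
  \<comment> \<open>With d = s0 - \<theta>, the inner disc contains the box reaching left to Re = s0
    with half-height d / 3 = (1 - \<theta>) / 6; the outer disc still ends d / 3 to the right of Re
    = \<theta>.\<close>
  define r R where "r = 2 - s0 + d / 3" and "R = 2 - s0 + 2 * d / 3"
  have rR: "0 < r" "r < R" "R \<le> 3" using d s0 theta by (auto simp: r_def R_def)
  define \<sigma> where "\<sigma> = s0 - 2 * d / 3"
  have sg: "\<sigma> > \<theta>" using d by (simp add: \<sigma>_def)
  define K0 where "K0 = 2 * A + C0 / (\<sigma> - \<theta>)"
  have K0: "K0 > 0" unfolding K0_def using A_pos C0_nonneg sg by (intro add_pos_nonneg) auto
  define K1 where "K1 = \<bar>ln (16 * K0 / c1)\<bar> / ln 2 + 2"
  have lnRr: "ln (R / r) > 0" using rR by simp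
  show ?thesis
  proof (intro exI[of _ "K1 / ln (R / r)"] conjI allI impI)
    show "0 \<le> K1 / ln (R / r)" using lnRr by (simp add: K1_def)
    fix T t :: real and Z :: "complex set"
    assume T: "T \<ge> 2" and t: "\<bar>t\<bar> \<le> T" and Z: "finite Z" "Z \<subseteq> {\<rho>. s0 \<le> Re \<rho> \<and> Re \<rho> \<le> 2 \<and> \<bar>Im \<rho> - t\<bar> \<le> (1 - \<theta>) / 6}"
    define c where "c = Complex 2 t"
    have op: "open {s. Re s > \<theta>}" "connected {s. Re s > \<theta>}"
      by (simp_all add: open_halfspace_Re_gt convex_halfspace_Re_gt convex_connected)
    have Re_ge: "Re z \<ge> \<sigma>" if "dist c z \<le> R" for z
    proof -
      have "\<bar>Re (c - z)\<bar> \<le> R" using abs_Re_le_cmod[of "c - z"] that by (simp add: dist_norm)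
      thus ?thesis by (simp add: c_def \<sigma>_def R_def)
    qed
    have c1': "c1 \<le> norm (zf c)"
    proof -
      have c1: "c \<noteq> 1" by (simp add: c_def complex_eq_iff)
      have "1 \<le> norm (c - 1)" using abs_Re_le_cmod[of "c - 1"] by (simp add: c_def)
      hence "1 * c1 \<le> norm (c - 1) * norm (zet c)" using low[of t] \<open>c1 > 0\<close> unfolding c_def by (intro mult_mono) auto
      thus ?thesis using c1 by (simp add: zf_eq norm_mult)
    qed
    have zc0: "norm (zf c) * c1 > 0" using c1 c1' by (intro mult_pos_pos) linarith+
    have M: "norm (zf z) \<le> K0 * (4 * T)\<^sup>2" if "dist c z = R" for z
    proof -
      have "norm z \<le> norm c + R" using norm_triangle_ineq2[of z c] that by (simp add: dist_norm norm_minus_commute)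
      moreover have "norm c \<le> 2 + T" using cmod_le[of c] t by (simp add: c_def)
      ultimately have "1 + norm z \<le> 4 * T" using rR T by linarith
      hence "K0 * (1 + norm z)\<^sup>2 \<le> K0 * (4 * T)\<^sup>2" using K0 by (intro mult_left_mono power_mono) auto
      thus ?thesis using zf_bound[OF Re_ge sg, of z] that unfolding K0_def by simp
    qed
    have "real (\<Sum>\<rho>\<in>Z. nat (zorder zf \<rho>)) * ln (R / r) \<le> ln (K0 * (4 * T)\<^sup>2 / norm (zf c))"
    proof (rule zero_count_disc[OF zf_holomorphic op rR(1,2) _ M _ Z(1)])
      show "cball c R \<subseteq> {s. Re s > \<theta>}" using Re_ge sg by force
      show "zf c \<noteq> 0" using c1' c1 by auto
      show "Z \<subseteq> cball c r"
      proof
        fix \<rho> assume "\<rho> \<in> Z"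
        hence q: "s0 \<le> Re \<rho>" "Re \<rho> \<le> 2" "\<bar>Im \<rho> - t\<bar> \<le> (1 - \<theta>) / 6" using Z by auto
        have "norm (c - \<rho>) \<le> \<bar>Re (c - \<rho>)\<bar> + \<bar>Im (c - \<rho>)\<bar>" by (rule cmod_le)
        also have "\<dots> \<le> r"
        proof -
          have "(1 - \<theta>) / 6 = d / 3" by (simp add: d_def)
          thus ?thesis using q by (simp add: c_def r_def abs_minus_commute[of t])
        qed
        finally show "\<rho> \<in> cball c r" by (simp add: dist_norm)
      qed
    qed auto
    also have "\<dots> \<le> ln (K0 * (4 * T)\<^sup>2 / c1)"
    proof (intro ln_mono divide_left_mono c1')
      show "0 < K0 * (4 * T)\<^sup>2 / norm (zf c)" using K0 T c1 c1' by (intro divide_pos_pos mult_pos_pos) auto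
    qed (use K0 T c1 zc0 in auto)
    also have "K0 * (4 * T)\<^sup>2 / c1 = (16 * K0 / c1) * T\<^sup>2" by (simp add: power_mult_distrib)
    also have "ln \<dots> = ln (16 * K0 / c1) + 2 * ln T"
      using K0 c1 T by (subst ln_mult) (auto simp: ln_realpow)
    also have "\<dots> \<le> K1 * ln T"
    proof -
      have l2: "ln 2 \<le> ln T" "ln (2::real) > 0" using T by auto
      have "ln (16 * K0 / c1) \<le> \<bar>ln (16 * K0 / c1)\<bar> / ln 2 * ln 2" using l2 by simp
      also have "\<dots> \<le> \<bar>ln (16 * K0 / c1)\<bar> / ln 2 * ln T" using l2 by (intro mult_left_mono) auto
      finally show ?thesis by (simp add: K1_def algebra_simps)
    qed
    finally show "real (\<Sum>\<rho>\<in>Z. nat (zorder zf \<rho>)) \<le> K1 / ln (R / r) * ln T"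
      using lnRr by (simp add: field_simps)
  qed
qed

end

section \<open>Moebius inversion and divisor sums\<close>

lemma sum_alternating_Pow:
  assumes "finite A" "A \<noteq> {}"
  shows "(\<Sum>X\<in>Pow A. (- 1) ^ card X) = (0::real)"
proof -
  have "(\<Prod>x\<in>A. - 1 + 1) = (\<Sum>X\<in>Pow A. (\<Prod>x\<in>X. - 1) * (\<Prod>x\<in>A - X. (1::real)))"
    by (rule prod_add) (use assms in auto)
  thus ?thesis using assms by (simp add: power_0_left)
qed

lemma finite_submultisets: "finite {m. m \<subseteq># (k :: 'b multiset)}"
proof (induction k)
  case (add x k)
  have "{m. m \<subseteq># add_mset x k} \<subseteq> {m. m \<subseteq># k} \<union> add_mset x ` {m. m \<subseteq># k}"
  proof
    fix m assume m: "m \<in> {m. m \<subseteq># add_mset x k}"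
    show "m \<in> {m. m \<subseteq># k} \<union> add_mset x ` {m. m \<subseteq># k}"
    proof (cases "x \<in># m")
      case True
      then obtain m' where "m = add_mset x m'" by (metis insert_DiffM)
      thus ?thesis using m by auto
    next
      case False
      hence "m \<subseteq># k" using m by (auto simp: subseteq_mset_def) (metis count_greater_zero_iff count_inI leI not_gr_zero zero_le)
      thus ?thesis by simp
    qed
  qed
  thus ?case by (rule finite_subset) (use add.IH in auto)
qed simp

text \<open>Moebius function of the free commutative monoid on the prime indices. Repetition of an
  index matters, not of a value, so equal generalized primes cause no difficulty.\<close>

definition mu :: "'b multiset \<Rightarrow> real" where
  "mu m = (if \<forall>j. count m j \<le> 1 then (- 1) ^ size m else 0)"

definition ndiv :: "'b multiset \<Rightarrow> nat" where "ndiv k = card {m. m \<subseteq># k}"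

lemma abs_mu_le: "\<bar>mu m\<bar> \<le> 1"
  by (simp add: mu_def power_abs)

lemma mu_empty [simp]: "mu {#} = 1" by (simp add: mu_def)

text \<open>Only submultisets without repetition contribute; they are the subsets of the support,
  over which the signs cancel.\<close>

lemma sum_mu_submultisets: "(\<Sum>m | m \<subseteq># k. mu m) = (if k = {#} then 1 else 0)"
proof (cases "k = {#}")
  case False
  let ?A = "set_mset k"
  have "(\<Sum>m | m \<subseteq># k. mu m) = (\<Sum>m \<in> mset_set ` Pow ?A. mu m)"
  proof (rule sum.mono_neutral_right[OF finite_submultisets])
    show "mset_set ` Pow ?A \<subseteq> {m. m \<subseteq># k}"
    proof safe
      fix X assume "X \<subseteq> ?A"
      thus "mset_set X \<subseteq># k" by (intro mset_subset_eqI) (auto simp: count_mset_set' Suc_le_eq)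
    qed
    show "\<forall>m\<in>{m. m \<subseteq># k} - mset_set ` Pow ?A. mu m = 0"
    proof
      fix m assume m: "m \<in> {m. m \<subseteq># k} - mset_set ` Pow ?A"
      show "mu m = 0"
      proof (rule ccontr)
        assume "mu m \<noteq> 0"
        hence c: "count m j \<le> 1" for j by (auto simp: mu_def split: if_splits)
        have "count (mset_set (set_mset m)) j = count m j" for j
        proof (cases "j \<in># m")
          case True
          hence "count m j > 0" by simp
          hence "count m j = 1" using c[of j] by linarith
          thus ?thesis using True by simp
        next
          case False
          hence "count m j = 0" by (simp add: not_in_iff)
          thus ?thesis using False by simp
        qed
        hence "mset_set (set_mset m) = m" by (rule multiset_eqI)
        moreover have "set_mset m \<subseteq> ?A" using m by (auto dest: mset_subset_eqD)
        ultimately have "m \<in> mset_set ` Pow ?A" by (intro image_eqI[of _ _ "set_mset m"]) auto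
        thus False using m by simp
      qed
    qed
  qed
  also have "\<dots> = (\<Sum>X\<in>Pow ?A. mu (mset_set X))"
  proof (rule sum.reindex[unfolded o_def], rule inj_onI)
    fix X Y assume "X \<in> Pow ?A" "Y \<in> Pow ?A" and e: "mset_set X = mset_set Y"
    hence "finite X" "finite Y" by (auto dest: finite_subset)
    thus "X = Y" using arg_cong[OF e, of set_mset] by simp
  qed
  also have "\<dots> = (\<Sum>X\<in>Pow ?A. (- 1) ^ card X)"
  proof (intro sum.cong refl)
    fix X assume "X \<in> Pow ?A"
    hence "finite X" by (auto dest: finite_subset)
    thus "mu (mset_set X) = (- 1) ^ card X" by (simp add: mu_def count_mset_set')
  qed
  also have "\<dots> = 0" by (rule sum_alternating_Pow) (use False in auto)
  finally show ?thesis using False by simp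
qed (simp add: mu_def)

section \<open>Moebius inversion for the generalized integers\<close>

lemma one_le_beurling_int:
  assumes "\<And>j. 1 < p j"
  shows "beurling_int p m \<ge> 1"
proof (induction m)
  case (add x m)
  have "1 * 1 \<le> p x * beurling_int p m" using assms[of x] add by (intro mult_mono) auto
  thus ?case by (simp add: beurling_int_def)
qed (simp add: beurling_int_def)

locale beurling = regular_count "\<lambda>m. ln (beurling_int p m)" A \<theta> C0
  for p :: "nat \<Rightarrow> real" and A \<theta> C0 +
  assumes prime_gt_1: "\<And>j. 1 < p j"
begin

abbreviation nu :: "nat multiset \<Rightarrow> real" where "nu m \<equiv> ln (beurling_int p m)"

lemma beurling_int_add: "beurling_int p (m + n) = beurling_int p m * beurling_int p n"
  by (simp add: beurling_int_def)

lemma beurling_int_ge_1: "beurling_int p m \<ge> 1"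
  by (rule one_le_beurling_int[OF prime_gt_1])

lemma beurling_int_pos: "beurling_int p m > 0"
  using beurling_int_ge_1[of m] by linarith

lemma nu_add: "nu (m + n) = nu m + nu n"
  unfolding beurling_int_add using beurling_int_pos[of m] beurling_int_pos[of n] by (simp add: ln_mult)

lemma nu_empty [simp]: "nu {#} = 0"
  by (simp add: beurling_int_def)

lemma nu_mono: "m \<subseteq># k \<Longrightarrow> nu m \<le> nu k"
  using nu_add[of m "k - m"] nu_nonneg[of "k - m"] by simp

lemma dirichlet_summable:
  fixes s :: complex
  assumes "Re s > 1"
  shows "(\<lambda>m. norm (exp (- s * of_real (nu m)))) summable_on UNIV"
    and "(\<Sum>\<^sub>\<infinity>m. exp (- s * of_real (nu m))) = zet s"
proof -
  have a: "Infinite_Set_Sum.abs_summable_on (\<lambda>m. exp (- s * of_real (nu m))) UNIV"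
    using zet_dirichlet(1)[OF assms] by (simp add: Infinite_Set_Sum.abs_summable_on_def)
  thus "(\<lambda>m. norm (exp (- s * of_real (nu m)))) summable_on UNIV" unfolding abs_summable_equivalent[symmetric] .
  from infsetsum_infsum[OF a] show "(\<Sum>\<^sub>\<infinity>m. exp (- s * of_real (nu m))) = zet s"
    using zet_dirichlet(2)[OF assms] by (simp add: infsetsum_def)
qed

text \<open>The absolutely convergent double series is regrouped by k = m + n. Pairs (m, n)
  correspond to k together with a submultiset m, and the inner sums vanish unless k is
  empty.\<close>

lemma moebius_inverse:
  fixes s :: complex
  assumes s: "Re s > 1"
  shows "(\<lambda>m. norm (of_real (mu m) * exp (- s * of_real (nu m)))) summable_on UNIV"
    and "(\<Sum>\<^sub>\<infinity>m. of_real (mu m) * exp (- s * of_real (nu m))) * zet s = 1"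
proof -
  let ?e = "\<lambda>m. exp (- s * of_real (nu m))"
  have ae: "(\<lambda>m. norm (?e m)) summable_on UNIV" using dirichlet_summable(1)[OF s] .
  have le: "norm (of_real (mu m) * ?e m) \<le> norm (?e m)" for m
    using abs_mu_le[of m] by (simp add: norm_mult mult_left_le_one_le)
  show am: "(\<lambda>m. norm (of_real (mu m) * ?e m)) summable_on UNIV"
    by (rule Infinite_Sum.abs_summable_on_comparison_test[OF ae]) (use le in auto)
  define f where "f = (\<lambda>(m, n). of_real (mu m) * ?e m * ?e n)"
  have "(\<lambda>x. norm (f x)) summable_on (UNIV \<times> UNIV)"
    unfolding Infinite_Sum.abs_summable_on_Sigma_iff
  proof (intro conjI ballI)
    fix m show "(\<lambda>n. norm (f (m, n))) summable_on UNIV"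
      unfolding f_def using ae by (simp add: norm_mult mult.assoc summable_on_cmult_right)
    show "(\<lambda>m. norm (\<Sum>\<^sub>\<infinity>n. norm (f (m, n)))) summable_on UNIV"
    proof -
      have "(\<Sum>\<^sub>\<infinity>n. norm (f (m, n))) = norm (of_real (mu m) * ?e m) * (\<Sum>\<^sub>\<infinity>n. norm (?e n))" for m
        unfolding f_def case_prod_conv norm_mult[of "of_real (mu m) * ?e m" for m] by (rule infsum_cmult_right')
      moreover have "(\<Sum>\<^sub>\<infinity>n. norm (?e n)) \<ge> 0" by (rule infsum_nonneg) simp
      ultimately show ?thesis using am by (simp add: abs_mult summable_on_cmult_left)
    qed
  qed
  hence sf: "f summable_on (UNIV \<times> UNIV)" by (rule abs_summable_summable)
  have "(\<Sum>\<^sub>\<infinity>m. of_real (mu m) * ?e m) * zet s = (\<Sum>\<^sub>\<infinity>m. \<Sum>\<^sub>\<infinity>n. f (m, n))"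
    unfolding dirichlet_summable(2)[OF s, symmetric] f_def case_prod_conv
    by (simp only: infsum_cmult_right' infsum_cmult_left')
  also have "\<dots> = infsum f (UNIV \<times> UNIV)" by (rule infsum_Sigma_banach[OF sf])
  also have "\<dots> = infsum (\<lambda>(k, m). of_real (mu m) * ?e k) (SIGMA k:UNIV. {m. m \<subseteq># k})"
  proof (rule infsum_reindex_bij_witness[where j = "\<lambda>(m, n). (m + n, m)" and i = "\<lambda>(k, m). (m, k - m)"])
    fix a :: "nat multiset \<times> nat multiset"
    obtain m n where a: "a = (m, n)" by (cases a)
    have "?e m * ?e n = ?e (m + n)" unfolding exp_add[symmetric] nu_add by (rule arg_cong[of _ _ exp]) (simp add: algebra_simps)
    thus "(case (case a of (m, n) \<Rightarrow> (m + n, m)) of (k, m) \<Rightarrow> of_real (mu m) * ?e k) = f a"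
      unfolding a f_def by (simp add: mult.assoc)
  qed auto
  also have "\<dots> = (\<Sum>\<^sub>\<infinity>k. \<Sum>\<^sub>\<infinity>m\<in>{m. m \<subseteq># k}. of_real (mu m) * ?e k)"
  proof (rule infsum_Sigma'_banach[symmetric])
    show "(\<lambda>(k, m). of_real (mu m) * ?e k) summable_on (SIGMA k:UNIV. {m. m \<subseteq># k})"
    proof -
      have bij: "bij_betw (\<lambda>(m, n). (m + n, m)) (UNIV \<times> UNIV) (SIGMA k:UNIV. {m :: nat multiset. m \<subseteq># k})"
        by (rule bij_betw_byWitness[where f' = "\<lambda>(k, m). (m, k - m)"]) auto
      have "(\<lambda>a. (\<lambda>(k, m). of_real (mu m) * ?e k) ((\<lambda>(m, n). (m + n, m)) a)) summable_on (UNIV \<times> UNIV)"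
      proof (rule summable_on_cong[THEN iffD2, OF _ sf])
        fix a :: "nat multiset \<times> nat multiset"
        obtain m n where a: "a = (m, n)" by (cases a)
        have "?e m * ?e n = ?e (m + n)" unfolding exp_add[symmetric] nu_add by (rule arg_cong[of _ _ exp]) (simp add: algebra_simps)
        thus "(case (case a of (m, n) \<Rightarrow> (m + n, m)) of (k, m) \<Rightarrow> of_real (mu m) * ?e k) = f a"
          unfolding a f_def by (simp add: mult.assoc)
      qed
      thus ?thesis by (subst (asm) summable_on_reindex_bij_betw[OF bij])
    qed
  qed
  also have "(\<lambda>k. \<Sum>\<^sub>\<infinity>m\<in>{m. m \<subseteq># k}. of_real (mu m) * ?e k) = (\<lambda>k. if k = {#} then 1 else 0)"
  proof
    fix k
    have "(\<Sum>\<^sub>\<infinity>m\<in>{m. m \<subseteq># k}. of_real (mu m) * ?e k) = of_real (\<Sum>m | m \<subseteq># k. mu m) * ?e k"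
      by (simp add: infsum_finite finite_submultisets sum_distrib_right)
    thus "(\<Sum>\<^sub>\<infinity>m\<in>{m. m \<subseteq># k}. of_real (mu m) * ?e k) = (if k = {#} then 1 else 0)"
      by (auto simp: sum_mu_submultisets)
  qed
  also have "(\<Sum>\<^sub>\<infinity>k::nat multiset. if k = {#} then 1 else (0::complex)) = 1"
  proof -
    have "(\<Sum>\<^sub>\<infinity>k::nat multiset. if k = {#} then 1 else (0::complex)) = (\<Sum>\<^sub>\<infinity>k\<in>{{#} :: nat multiset}. (1::complex))"
      by (rule infsum_cong_neutral) auto
    thus ?thesis by simp
  qed
  finally show "(\<Sum>\<^sub>\<infinity>m. of_real (mu m) * ?e m) * zet s = 1" .
qed

lemma zet_nonzero: "Re s > 1 \<Longrightarrow> zet s \<noteq> 0"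
  using moebius_inverse(2)[of s] by auto

text \<open>By Moebius inversion 1 / zet is a Dirichlet series with coefficients of modulus at most
  1, hence bounded on Re s = 2 by the sum of the moduli of the terms of zeta.\<close>

lemma zet_lower_bound: "\<exists>c>0. \<forall>t. norm (zet (Complex 2 t)) \<ge> c"
proof -
  define B where "B = (\<Sum>\<^sub>\<infinity>m. norm (exp (- Complex 2 0 * of_real (nu m))))"
  have s2: "Re (Complex 2 t) > 1" for t by simp
  have eq: "norm (exp (- Complex 2 t * of_real (nu m))) = norm (exp (- Complex 2 0 * of_real (nu m)))" for t m
    by (simp add: norm_exp_eq_Re)
  have le: "norm (\<Sum>\<^sub>\<infinity>m. of_real (mu m) * exp (- Complex 2 t * of_real (nu m))) \<le> B" for t
  proof -
    have "norm (\<Sum>\<^sub>\<infinity>m. of_real (mu m) * exp (- Complex 2 t * of_real (nu m))) \<le> (\<Sum>\<^sub>\<infinity>m. norm (of_real (mu m) * exp (- Complex 2 t * of_real (nu m))))"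
      by (rule norm_infsum_bound[OF moebius_inverse(1)[OF s2]])
    also have "\<dots> \<le> B" unfolding B_def
    proof (rule infsum_mono)
      show "(\<lambda>m. norm (of_real (mu m) * exp (- Complex 2 t * of_real (nu m)))) summable_on UNIV" using moebius_inverse(1)[OF s2] .
      show "(\<lambda>m. norm (exp (- Complex 2 0 * of_real (nu m)))) summable_on UNIV" using dirichlet_summable(1)[OF s2] .
      show "norm (of_real (mu m) * exp (- Complex 2 t * of_real (nu m))) \<le> norm (exp (- Complex 2 0 * of_real (nu m)))" for m
        using abs_mu_le[of m] unfolding norm_mult eq[of t] by (simp add: mult_left_le_one_le)
    qed
    finally show ?thesis .
  qed
  have one: "1 \<le> B * norm (zet (Complex 2 t))" for t
  proof -
    have "1 = norm ((\<Sum>\<^sub>\<infinity>m. of_real (mu m) * exp (- Complex 2 t * of_real (nu m))) * zet (Complex 2 t))"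
      by (simp only: moebius_inverse(2)[OF s2] norm_one)
    also have "\<dots> \<le> B * norm (zet (Complex 2 t))" unfolding norm_mult by (intro mult_right_mono le) auto
    finally show ?thesis .
  qed
  have "B > 0"
  proof (rule ccontr)
    assume "\<not> B > 0"
    hence "B * norm (zet (Complex 2 0)) \<le> 0" by (intro mult_nonpos_nonneg) auto
    thus False using one[of 0] by linarith
  qed
  thus ?thesis using one by (intro exI[of _ "1 / B"]) (auto simp: field_simps)
qed

section \<open>Harmonic sums and the mean square of the divisor function\<close>

lemma finite_nu: "finite {m. nu m \<le> q}"
  by (rule fin_nu)

definition harm :: "real \<Rightarrow> real" where "harm q = (\<Sum>m | nu m \<le> q. exp (- nu m))"

lemma harm_nonneg: "harm q \<ge> 0" unfolding harm_def by (intro sum_nonneg) auto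

text \<open>Rankin's trick: on \<nu> m \<le> q the exponent 1 may be raised to 1 + 1 / q at the cost
  of a factor exp 1, and at distance 1 / q from its simple pole zeta is O(q).\<close>

lemma harm_bound: "\<exists>K\<ge>1. \<forall>q\<ge>1. harm q \<le> K * q"
proof (intro exI[of _ "max 1 (exp 1 * (2 * A + 2 * C0 / (1 - \<theta>)))"] conjI allI impI)
  fix q :: real assume q: "q \<ge> 1"
  define s where "s = complex_of_real (1 + 1 / q)"
  have s: "Re s > 1" using q by (simp add: s_def)
  have nm: "norm (exp (- s * of_real (nu m))) = exp (- (1 + 1 / q) * nu m)" for m by (simp add: s_def norm_exp_eq_Re)
  have sm: "(\<lambda>m. exp (- (1 + 1 / q) * nu m)) summable_on UNIV" using dirichlet_summable(1)[OF s] unfolding nm .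
  have "harm q \<le> (\<Sum>m | nu m \<le> q. exp 1 * exp (- (1 + 1 / q) * nu m))" unfolding harm_def
  proof (rule sum_mono)
    fix m assume "m \<in> {m. nu m \<le> q}"
    hence "nu m / q \<le> 1" using q by simp
    thus "exp (- nu m) \<le> exp 1 * exp (- (1 + 1 / q) * nu m)" unfolding exp_add[symmetric] by (simp add: algebra_simps)
  qed
  also have "\<dots> = exp 1 * (\<Sum>m | nu m \<le> q. exp (- (1 + 1 / q) * nu m))" by (simp add: sum_distrib_left)
  also have "(\<Sum>m | nu m \<le> q. exp (- (1 + 1 / q) * nu m)) \<le> (\<Sum>\<^sub>\<infinity>m. exp (- (1 + 1 / q) * nu m))"
    by (rule finite_sum_le_infsum[OF sm finite_nu]) auto
  also have "(\<Sum>\<^sub>\<infinity>m. exp (- (1 + 1 / q) * nu m)) \<le> norm (zet s)"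
  proof -
    have "complex_of_real (\<Sum>\<^sub>\<infinity>m. exp (- (1 + 1 / q) * nu m)) = (\<Sum>\<^sub>\<infinity>m. of_real (exp (- (1 + 1 / q) * nu m)))"
      using has_sum_of_real[OF has_sum_infsum[OF sm]] by (rule infsumI[symmetric])
    also have "(\<lambda>m. complex_of_real (exp (- (1 + 1 / q) * nu m))) = (\<lambda>m. exp (- s * of_real (nu m)))"
      unfolding s_def by (rule ext) (simp only: exp_of_real[symmetric] of_real_mult of_real_minus)
    also have "(\<Sum>\<^sub>\<infinity>m. exp (- s * of_real (nu m))) = zet s" by (rule dirichlet_summable(2)[OF s])
    finally show ?thesis by (metis abs_ge_self norm_of_real)
  qed
  also have "norm (zet s) \<le> 2 * A * q + 2 * C0 / (1 - \<theta>)"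
  proof -
    have q1: "1 + 1 / q \<le> 2" using q by (simp add: field_simps)
    have sn: "norm s \<le> 2" unfolding s_def norm_of_real using q q1 by simp
    have "norm (mel s) \<le> C0 / (Re s - \<theta>)" using s theta by (intro mel_bound) auto
    also have "\<dots> \<le> C0 / (1 - \<theta>)" using s theta C0_nonneg by (intro divide_left_mono) (auto simp: mult_pos_pos)
    finally have ml: "norm (mel s) \<le> C0 / (1 - \<theta>)" .
    have "s - 1 = of_real (1 / q)" by (simp add: s_def)
    hence n1: "norm (s - 1) = 1 / q" using q by (simp only: norm_of_real) simp
    have "norm (of_real A * s / (s - 1)) = A * norm s * q" using A_pos q by (simp add: norm_mult norm_divide n1)
    also have "\<dots> \<le> A * 2 * q" using A_pos q sn by (intro mult_right_mono mult_left_mono) auto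
    finally have a: "norm (of_real A * s / (s - 1)) \<le> A * 2 * q" .
    have b: "norm (s * mel s) \<le> 2 * (C0 / (1 - \<theta>))" unfolding norm_mult by (intro mult_mono sn ml) auto
    show ?thesis unfolding zet_def using norm_triangle_mono[OF a b] by simp
  qed
  also have "2 * A * q + 2 * C0 / (1 - \<theta>) \<le> (2 * A + 2 * C0 / (1 - \<theta>)) * q"
  proof -
    have "2 * C0 / (1 - \<theta>) * 1 \<le> 2 * C0 / (1 - \<theta>) * q" using q theta C0_nonneg by (intro mult_left_mono) auto
    thus ?thesis by (simp add: algebra_simps)
  qed
  finally have "harm q \<le> exp 1 * ((2 * A + 2 * C0 / (1 - \<theta>)) * q)" by simp
  also have "\<dots> \<le> max 1 (exp 1 * (2 * A + 2 * C0 / (1 - \<theta>))) * q" using q unfolding mult.assoc[symmetric] by (intro mult_right_mono) auto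
  finally show "harm q \<le> max 1 (exp 1 * (2 * A + 2 * C0 / (1 - \<theta>))) * q" .
qed simp

text \<open>A pair of divisors \<open>m, m'\<close> of \<open>k\<close> is encoded by the four factors of the factorization
  \<open>k = (m \<inter> m') + (m - m') + (m' - m) + (k - m \<union> m')\<close>.\<close>

lemma divisor_square_sum: "(\<Sum>k | nu k \<le> q. (real (ndiv k))\<^sup>2 * exp (- nu k)) \<le> harm q ^ 4"
proof -
  let ?S = "{m. nu m \<le> q}"
  let ?D = "SIGMA k:?S. {m. m \<subseteq># k} \<times> {m. m \<subseteq># k}"
  let ?F = "\<lambda>(k, m, m'). ((m \<inter># m', m - m'), (m' - m, k - (m \<union># m')))"
  let ?w = "\<lambda>((a, b), (c, d)). (exp (- nu a) * exp (- nu b)) * (exp (- nu c) * exp (- nu d))"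
  have eq: "m \<inter># m' + (m - m') + (m' - m) + (k - (m \<union># m')) = k" if "m \<subseteq># k" "m' \<subseteq># k" for k m m' :: "nat multiset"
  proof (rule multiset_eqI)
    fix x
    have "count m x \<le> count k x" "count m' x \<le> count k x" using that by (auto simp: mset_subset_eq_count)
    thus "count (m \<inter># m' + (m - m') + (m' - m) + (k - (m \<union># m'))) x = count k x" by (simp add: max_def min_def)
  qed
  have "(\<Sum>k\<in>?S. (real (ndiv k))\<^sup>2 * exp (- nu k)) = (\<Sum>k\<in>?S. \<Sum>(m, m') \<in> {m. m \<subseteq># k} \<times> {m. m \<subseteq># k}. exp (- nu k))"
    by (simp add: ndiv_def card_cartesian_product power2_eq_square case_prod_unfold)
  also have "\<dots> = (\<Sum>(k, m, m') \<in> ?D. exp (- nu k))"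
    by (subst sum.Sigma) (auto simp: finite_nu finite_submultisets case_prod_unfold)
  also have "\<dots> = (\<Sum>x \<in> ?D. ?w (?F x))"
  proof (intro sum.cong refl)
    fix x assume x: "x \<in> ?D"
    obtain k m m' where xe: "x = (k, m, m')" by (cases x)
    have "nu k = nu (m \<inter># m' + (m - m') + (m' - m) + (k - (m \<union># m')))" using eq[of m k m'] x xe by simp
    thus "(case x of (k, m, m') \<Rightarrow> exp (- nu k)) = ?w (?F x)"
      unfolding xe nu_add by (simp add: algebra_simps flip: exp_add)
  qed
  also have "\<dots> = (\<Sum>y \<in> ?F ` ?D. ?w y)"
  proof (rule sum.reindex[symmetric, unfolded o_def])
    show "inj_on ?F ?D"
    proof (rule inj_onI)
      fix x y assume xy: "x \<in> ?D" "y \<in> ?D" "?F x = ?F y"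
      obtain k m m' where xe: "x = (k, m, m')" by (cases x)
      obtain k1 m1 m1' where ye: "y = (k1, m1, m1')" by (cases y)
      have h: "m \<inter># m' = m1 \<inter># m1'" "m - m' = m1 - m1'" "m' - m = m1' - m1" "k - (m \<union># m') = k1 - (m1 \<union># m1')"
        using xy(3) by (auto simp: xe ye)
      have dec: "a = (a \<inter># b) + (a - b)" for a b :: "nat multiset" by (rule multiset_eqI) (simp add: min_def)
      have "m = m1" using dec[of m m'] dec[of m1 m1'] h by simp
      moreover have "m' = m1'" using dec[of m' m] dec[of m1' m1] h by (simp add: subset_mset.inf_commute)
      moreover have "k = k1" using eq[of m k m'] eq[of m1 k1 m1'] h xy(1,2) by (simp add: xe ye)
      ultimately show "x = y" by (simp add: xe ye)
    qed
  qed
  also have "\<dots> \<le> (\<Sum>y \<in> (?S \<times> ?S) \<times> (?S \<times> ?S). ?w y)"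
  proof (rule sum_mono2)
    show "?F ` ?D \<subseteq> (?S \<times> ?S) \<times> (?S \<times> ?S)"
    proof
      fix y assume "y \<in> ?F ` ?D"
      then obtain k m m' where x: "nu k \<le> q" "m \<subseteq># k" "m' \<subseteq># k" and y: "y = ?F (k, m, m')" by auto
      have "m \<inter># m' \<subseteq># k" "m - m' \<subseteq># k" "m' - m \<subseteq># k" "k - (m \<union># m') \<subseteq># k"
        using x subset_mset.order_trans[OF subset_mset.inf_le1 x(2)] subset_mset.order_trans[OF diff_subset_eq_self x(2)]
          subset_mset.order_trans[OF diff_subset_eq_self x(3)] by auto
      hence "nu (m \<inter># m') \<le> q" "nu (m - m') \<le> q" "nu (m' - m) \<le> q" "nu (k - (m \<union># m')) \<le> q"
        using nu_mono x(1) by (meson order_trans)+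
      thus "y \<in> (?S \<times> ?S) \<times> (?S \<times> ?S)" unfolding y by simp
    qed
  qed (auto simp: finite_nu)
  also have "\<dots> = harm q ^ 4"
  proof -
    have prod2: "(\<Sum>y\<in>B \<times> B. f (fst y) * f (snd y)) = sum f B * sum f B" for f :: "'c \<Rightarrow> real" and B
      by (simp add: sum_product sum.cartesian_product case_prod_unfold)
    have prod2': "(\<Sum>y\<in>B \<times> B. f (fst y) * f (snd y)) = sum f B * sum f B" for f :: "nat multiset \<times> nat multiset \<Rightarrow> real" and B
      by (simp add: sum_product sum.cartesian_product case_prod_unfold)
    let ?g = "\<lambda>z. exp (- nu (fst z)) * exp (- nu (snd z))"
    have "(\<Sum>y \<in> (?S \<times> ?S) \<times> (?S \<times> ?S). ?w y) = (\<Sum>y \<in> (?S \<times> ?S) \<times> (?S \<times> ?S). ?g (fst y) * ?g (snd y))"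
      by (simp add: case_prod_unfold)
    also have "\<dots> = sum ?g (?S \<times> ?S) * sum ?g (?S \<times> ?S)" by (rule prod2')
    also have "sum ?g (?S \<times> ?S) = harm q * harm q" unfolding harm_def by (rule prod2)
    finally show ?thesis by (simp add: power4_eq_xxxx mult.assoc)
  qed
  finally show ?thesis .
qed

end

section \<open>Zero detection\<close>

text \<open>The exponent l * a^2 / 2 is spent as l / 4 for smallness, l * a^2 / 8 for the factor exp
  (2 * t), and l * a^2 / 8 as a wider Gaussian. The factor exp (2 * t) keeps the truncation error
  integrable for t tending to minus infinity; it is available because a \<ge> - t, and l \<ge> 16
  gives 2 * a^2 \<le> l * a^2 / 8.\<close>

lemma gs_tail_dominate:
  assumes l: "l \<ge> 16" and a: "a > 1" "a \<ge> - t"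
  shows "gs l a \<le> exp (- (l / 4)) * exp (2 * t) * gs (l / 4) a"
proof -
  have a2: "a\<^sup>2 \<ge> 1" using a by (simp add: power2_eq_square) (metis less_imp_le mult_mono' mult_1 zero_le_one)
  have "- t \<le> a\<^sup>2"
  proof -
    have "a \<le> a * a" using a mult_left_mono[of 1 a a] by simp
    thus ?thesis using a unfolding power2_eq_square by linarith
  qed
  hence "- (2 * t) \<le> 2 * a\<^sup>2" by simp
  also have "\<dots> \<le> (l / 8) * a\<^sup>2" using l by (intro mult_right_mono) auto
  finally have b: "- (2 * t) \<le> l * a\<^sup>2 / 8" by simp
  have "l / 4 * 1 \<le> l / 4 * a\<^sup>2" using a2 l by (intro mult_left_mono) auto
  hence "- (l * a\<^sup>2 / 2) \<le> - (l / 4) + 2 * t - l / 4 * a\<^sup>2 / 2" using b by simp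
  thus ?thesis by (simp add: gs_def flip: exp_add)
qed

context regular_count
begin

text \<open>In use, b is \<nu> m for a term m of the Moebius polynomial. The cut \<nu> n + \<nu> m
  \<le> t + 1 then depends on the product alone, so the truncated sums can be regrouped
  exactly.\<close>

lemma gauss_dirichlet_tail:
  assumes l: "l \<ge> 16" and s: "Re s \<ge> 0" and b: "b \<ge> 0"
  shows "norm ((LINT n|count_space UNIV. exp (- s * of_real (\<nu> n)) * of_real (gs l (\<nu> n - (t - b))))
      - (\<Sum>n | \<nu> n + b \<le> t + 1. exp (- s * of_real (\<nu> n)) * of_real (gs l (\<nu> n - (t - b)))))
    \<le> gconst * exp (- (l / 4)) * exp (2 * t) * (exp t + exp (\<theta> * t))"
proof -
  define F where "F = {n. \<nu> n + b \<le> t + 1}"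
  have "F = {n. \<nu> n \<le> t + 1 - b}" by (auto simp: F_def)
  hence F: "finite F" using fin_nu by simp
  let ?f = "\<lambda>n. exp (- s * of_real (\<nu> n)) * complex_of_real (gs l (\<nu> n - (t - b)))"
  let ?g = "\<lambda>n. (exp (- (l / 4)) * exp (2 * t)) * gs (l / 4) (\<nu> n - (t - b))"
  have fi: "integrable (count_space UNIV) ?f" by (rule gauss_dirichlet(1)) (use l in simp)
  have gi: "integrable (count_space UNIV) ?g" by (intro integrable_mult_right gauss_count(1)) (use l in simp)
  have Fi: "integrable (count_space UNIV) (\<lambda>n. indicator F n *\<^sub>R ?f n)" by (rule integrable_mult_indicator[OF _ fi]) simp
  have "(\<Sum>n\<in>F. ?f n) = (LINT n|count_space UNIV. indicator F n *\<^sub>R ?f n)"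
  proof -
    have "(LINT n|count_space UNIV. indicator F n *\<^sub>R ?f n) = (\<Sum>n | n \<in> UNIV \<and> indicator F n *\<^sub>R ?f n \<noteq> 0. indicator F n *\<^sub>R ?f n)"
      by (rule lebesgue_integral_count_space_finite_support) (rule finite_subset[OF _ F], auto simp: indicator_def split: if_splits)
    also have "\<dots> = (\<Sum>n\<in>F. ?f n)"
      by (rule sum.mono_neutral_cong_left[OF F]) (auto simp: indicator_def split: if_splits)
    finally show ?thesis by simp
  qed
  hence "norm ((LINT n|count_space UNIV. ?f n) - (\<Sum>n\<in>F. ?f n)) = norm (LINT n|count_space UNIV. ?f n - indicator F n *\<^sub>R ?f n)"
    by (simp only: Bochner_Integration.integral_diff[OF fi Fi])
  also have "\<dots> \<le> (LINT n|count_space UNIV. ?g n)"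
  proof (rule order_trans[OF integral_norm_bound integral_mono])
    show "integrable (count_space UNIV) (\<lambda>n. norm (?f n - indicator F n *\<^sub>R ?f n))"
      by (rule integrable_norm[OF Bochner_Integration.integrable_diff[OF fi Fi]])
    show "integrable (count_space UNIV) ?g" by (rule gi)
    fix n
    show "norm (?f n - indicator F n *\<^sub>R ?f n) \<le> ?g n"
    proof (cases "n \<in> F")
      case False
      have "norm (?f n) = exp (- Re s * \<nu> n) * gs l (\<nu> n - (t - b))" by (simp add: norm_mult)
      also have "\<dots> \<le> 1 * gs l (\<nu> n - (t - b))"
        using s nu_nonneg[of n] by (intro mult_right_mono) auto
      also have "\<dots> \<le> 1 * ?g n" using False nu_nonneg[of n] b
        by (intro mult_left_mono gs_tail_dominate l) (auto simp: F_def)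
      finally show ?thesis using False by simp
    qed simp
  qed
  also have "\<dots> = (exp (- (l / 4)) * exp (2 * t)) * (LINT n|count_space UNIV. gs (l / 4) (\<nu> n - (t - b)))"
    by (rule integral_mult_right_zero)
  also have "\<dots> \<le> (exp (- (l / 4)) * exp (2 * t)) * (gconst * (exp t + exp (\<theta> * t)))"
  proof (intro mult_left_mono)
    have "(LINT n|count_space UNIV. gs (l / 4) (\<nu> n - (t - b))) \<le> gconst * (exp (t - b) / sqrt (l / 4) + exp (\<theta> * (t - b)))"
      by (rule gauss_count(2)) (use l in simp)
    also have "\<dots> \<le> gconst * (exp t + exp (\<theta> * t))"
    proof (intro mult_left_mono add_mono gconst_nonneg)
      have "sqrt (l / 4) \<ge> 1" using l by simp
      hence "exp (t - b) / sqrt (l / 4) \<le> exp (t - b) / 1" by (intro divide_left_mono) auto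
      also have "\<dots> \<le> exp t" using b by simp
      finally show "exp (t - b) / sqrt (l / 4) \<le> exp t" .
      show "exp (\<theta> * (t - b)) \<le> exp (\<theta> * t)" using b theta by (simp add: mult_left_mono)
    qed
    finally show "(LINT n|count_space UNIV. gs (l / 4) (\<nu> n - (t - b))) \<le> gconst * (exp t + exp (\<theta> * t))" .
  qed simp
  finally show ?thesis unfolding F_def by (simp add: mult_ac)
qed

end

section \<open>The product of zeta with a Moebius polynomial\<close>

context beurling
begin

definition mpoly :: "real \<Rightarrow> complex \<Rightarrow> complex" where
  "mpoly x s = (\<Sum>m | nu m \<le> x. of_real (mu m) * exp (- s * of_real (nu m)))"

text \<open>Dirichlet coefficient at k of zeta times the Moebius polynomial of length exp x.\<close>

definition acoef :: "real \<Rightarrow> nat multiset \<Rightarrow> real" where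
  "acoef x k = (\<Sum>m | m \<subseteq># k \<and> nu m \<le> x. mu m)"

lemma acoef_small: "nu k \<le> x \<Longrightarrow> acoef x k = (if k = {#} then 1 else 0)"
proof -
  assume "nu k \<le> x"
  hence "{m. m \<subseteq># k \<and> nu m \<le> x} = {m. m \<subseteq># k}" using nu_mono by (auto intro: order_trans)
  thus ?thesis unfolding acoef_def by (simp add: sum_mu_submultisets)
qed

lemma abs_acoef_le: "\<bar>acoef x k\<bar> \<le> real (ndiv k)"
proof -
  have "\<bar>acoef x k\<bar> \<le> (\<Sum>m | m \<subseteq># k \<and> nu m \<le> x. \<bar>mu m\<bar>)" unfolding acoef_def by (rule sum_abs)
  also have "\<dots> \<le> (\<Sum>m | m \<subseteq># k. \<bar>mu m\<bar>)" by (rule sum_mono2[OF finite_submultisets]) auto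
  also have "\<dots> \<le> (\<Sum>m | m \<subseteq># k. 1)" by (intro sum_mono abs_mu_le)
  finally show ?thesis by (simp add: ndiv_def)
qed

lemma dirichlet_convolution_sum:
  fixes h :: "real \<Rightarrow> complex"
  shows "(\<Sum>m | nu m \<le> x. of_real (mu m) * (\<Sum>n | nu n + nu m \<le> q. h (nu m + nu n))) = (\<Sum>k | nu k \<le> q. of_real (acoef x k) * h (nu k))"
proof -
  have fin: "finite {n. nu n + b \<le> q}" for b
    using finite_nu[of "q - b"] by (rule finite_subset[rotated]) auto
  have "(\<Sum>m | nu m \<le> x. of_real (mu m) * (\<Sum>n | nu n + nu m \<le> q. h (nu m + nu n)))
      = (\<Sum>(m, n) \<in> (SIGMA m:{m. nu m \<le> x}. {n. nu n + nu m \<le> q}). of_real (mu m) * h (nu m + nu n))"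
    unfolding sum_distrib_left by (rule sum.Sigma) (auto simp: finite_nu fin)
  also have "\<dots> = (\<Sum>(k, m) \<in> (SIGMA k:{k. nu k \<le> q}. {m. m \<subseteq># k \<and> nu m \<le> x}). of_real (mu m) * h (nu k))"
  proof (rule sum.reindex_bij_witness[where j = "\<lambda>(m, n). (m + n, m)" and i = "\<lambda>(k, m). (m, k - m)"])
    fix b assume b: "b \<in> (SIGMA k:{k. nu k \<le> q}. {m. m \<subseteq># k \<and> nu m \<le> x})"
    obtain k m where km: "b = (k, m)" by (cases b)
    have "nu k = nu m + nu (k - m)" using b km nu_add[of m "k - m"] by simp
    thus "(case b of (k, m) \<Rightarrow> (m, k - m)) \<in> (SIGMA m:{m. nu m \<le> x}. {n. nu n + nu m \<le> q})" using b km by auto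
    show "(case case b of (k, m) \<Rightarrow> (m, k - m) of (m, n) \<Rightarrow> (m + n, m)) = b" using b km by auto
  qed (auto simp: nu_add add.commute)
  also have "\<dots> = (\<Sum>k | nu k \<le> q. \<Sum>m | m \<subseteq># k \<and> nu m \<le> x. of_real (mu m) * h (nu k))"
    by (rule sum.Sigma[symmetric]) (auto simp: finite_nu intro: finite_subset[OF _ finite_submultisets])
  also have "\<dots> = (\<Sum>k | nu k \<le> q. of_real (acoef x k) * h (nu k))"
    by (simp add: acoef_def sum_distrib_right)
  finally show ?thesis .
qed

text \<open>Detecting polynomial at scale t. Its Gaussian weights have width 1 / sqrt l around t, so
  the upper cut t + 1 lies many widths away when l is large and only serves to keep the sum
  finite.\<close>

definition ppoly :: "real \<Rightarrow> real \<Rightarrow> real \<Rightarrow> real \<Rightarrow> complex" where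
  "ppoly l x t = dpoly (\<lambda>k. of_real (acoef x k * exp (- s0 * nu k) * gs l (nu k - t))) {k. x < nu k \<and> nu k \<le> t + 1}"

text \<open>The shift t - \<nu> m aligns all terms at the same scale of the product. By linearity
  this is the Gaussian mean of zeta times the Moebius polynomial.\<close>

definition wm :: "real \<Rightarrow> real \<Rightarrow> complex \<Rightarrow> real \<Rightarrow> complex" where
  "wm l x s t = (\<Sum>m | nu m \<le> x. of_real (mu m) * exp (- s * of_real (nu m)) * wt l s (t - nu m))"

definition imean :: "real \<Rightarrow> real \<Rightarrow> real \<Rightarrow> real" where
  "imean l x \<gamma> = (LINT v|lborel. gh l v * (zc (\<gamma> - v) * norm (mpoly x (Complex s0 (\<gamma> - v)))))"

lemma norm_mpoly_le: "Re s \<ge> 0 \<Longrightarrow> norm (mpoly x s) \<le> cnt x"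
proof -
  assume s: "Re s \<ge> 0"
  have "norm (mpoly x s) \<le> (\<Sum>m | nu m \<le> x. 1)" unfolding mpoly_def
  proof (rule sum_norm_le)
    fix m
    have "norm (of_real (mu m) * exp (- s * of_real (nu m))) = \<bar>mu m\<bar> * exp (- Re s * nu m)" by (simp add: norm_mult)
    also have "\<dots> \<le> 1 * 1" using s nu_nonneg[of m] by (intro mult_mono abs_mu_le) auto
    finally show "norm (of_real (mu m) * exp (- s * of_real (nu m))) \<le> 1" by simp
  qed
  thus ?thesis by (simp add: cnt_def)
qed

lemma mpoly_dpoly: "mpoly x (Complex s0 u) = dpoly (\<lambda>m. of_real (mu m * exp (- s0 * nu m))) {m. nu m \<le> x} u"
  unfolding mpoly_def dpoly_def
proof (intro sum.cong refl)
  fix m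
  have "exp (- Complex s0 u * of_real (nu m)) = of_real (exp (- s0 * nu m)) * iexp (- u * nu m)"
    unfolding exp_of_real[symmetric] exp_add[symmetric] by (rule arg_cong[of _ _ exp]) (simp add: complex_eq_iff)
  thus "of_real (mu m) * exp (- Complex s0 u * of_real (nu m)) = of_real (mu m * exp (- s0 * nu m)) * iexp (- u * nu m)"
    by (simp only: of_real_mult mult.assoc)
qed

lemma mpoly_line_continuous: "continuous_on S (\<lambda>u. mpoly x (Complex s0 u))"
  unfolding mpoly_dpoly by (rule dpoly_continuous)

lemma mpoly_line_measurable [measurable]: "(\<lambda>u. mpoly x (Complex s0 u)) \<in> borel_measurable borel"
  by (rule borel_measurable_continuous_onI[OF mpoly_line_continuous])

text \<open>Inside the integral over v, shifting t by \<nu> m completes exp (- s * \<nu> m) to the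
  corresponding term of M at s - \<i> * v. What remains of t is a factor of modulus 1, so the bound
  is uniform in t.\<close>

lemma norm_wm_le:
  assumes l: "l > 0"
  shows "norm (wm l x (Complex s0 \<gamma>) t) \<le> imean l x \<gamma>"
proof -
  let ?s = "Complex s0 \<gamma>"
  have s: "\<theta> < Re ?s" "Re ?s < 1" using s0 by auto
  have "wm l x ?s t = (\<Sum>m | nu m \<le> x. (LINT v|lborel. of_real (mu m) * exp (- ?s * of_real (nu m)) * (of_real (gh l v) * iexp (- (t - nu m) * v) * zet (?s - \<i> * of_real v))))"
    unfolding wm_def wt_def by (simp only: integral_mult_right_zero)
  also have "\<dots> = (LINT v|lborel. (\<Sum>m | nu m \<le> x. of_real (mu m) * exp (- ?s * of_real (nu m)) * (of_real (gh l v) * iexp (- (t - nu m) * v) * zet (?s - \<i> * of_real v))))"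
    by (rule Bochner_Integration.integral_sum[symmetric]) (intro integrable_mult_right wt_integral(1)[OF l s])
  finally have "norm (wm l x ?s t) = norm (LINT v|lborel. (\<Sum>m | nu m \<le> x. of_real (mu m) * exp (- ?s * of_real (nu m)) * (of_real (gh l v) * iexp (- (t - nu m) * v) * zet (?s - \<i> * of_real v))))"
    by (rule arg_cong)
  also have "\<dots> \<le> (LINT v|lborel. norm (\<Sum>m | nu m \<le> x. of_real (mu m) * exp (- ?s * of_real (nu m)) * (of_real (gh l v) * iexp (- (t - nu m) * v) * zet (?s - \<i> * of_real v))))"
    by (rule integral_norm_bound)
  also have "\<dots> = imean l x \<gamma>" unfolding imean_def
  proof (intro Bochner_Integration.integral_cong refl)
    fix v :: real
    have sv: "?s - \<i> * of_real v = Complex s0 (\<gamma> - v)" by (simp add: complex_eq_iff)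
    have "(\<Sum>m | nu m \<le> x. of_real (mu m) * exp (- ?s * of_real (nu m)) * (of_real (gh l v) * iexp (- (t - nu m) * v) * zet (?s - \<i> * of_real v)))
       = of_real (gh l v) * iexp (- t * v) * zet (?s - \<i> * of_real v) * mpoly x (?s - \<i> * of_real v)"
      unfolding mpoly_def sum_distrib_left
    proof (intro sum.cong refl)
      fix m
      have "exp (- ?s * of_real (nu m)) * iexp (- (t - nu m) * v) = iexp (- t * v) * exp (- (?s - \<i> * of_real v) * of_real (nu m))"
        unfolding exp_add[symmetric] by (rule arg_cong[of _ _ exp]) (simp add: algebra_simps)
      hence e: "exp (- ?s * of_real (nu m)) * (iexp (- (t - nu m) * v) * w) = iexp (- t * v) * (exp (- (?s - \<i> * of_real v) * of_real (nu m)) * w)" for w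
        by (simp only: mult.assoc[symmetric])
      show "of_real (mu m) * exp (- ?s * of_real (nu m)) * (of_real (gh l v) * iexp (- (t - nu m) * v) * zet (?s - \<i> * of_real v)) =
         of_real (gh l v) * iexp (- t * v) * zet (?s - \<i> * of_real v) * (of_real (mu m) * exp (- (?s - \<i> * of_real v) * of_real (nu m)))"
        unfolding mult.assoc mult.left_commute[of _ "of_real (gh l v)"] e by (simp only: mult_ac)
    qed
    thus "norm (\<Sum>m | nu m \<le> x. of_real (mu m) * exp (- ?s * of_real (nu m)) * (of_real (gh l v) * iexp (- (t - nu m) * v) * zet (?s - \<i> * of_real v)))
      = gh l v * (zc (\<gamma> - v) * norm (mpoly x (Complex s0 (\<gamma> - v))))"
      using l unfolding sv by (simp add: norm_mult zc_def)
  qed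
  finally show ?thesis .
qed

text \<open>The translation of t by \<nu> m contributes exp (- \<delta> * \<nu> m), which moves the
  Moebius polynomial to s + \<delta> together with zeta.\<close>

lemma wm_laplace:
  fixes \<delta> :: real
  assumes l: "l > 0" and s: "\<theta> < Re s" and d: "\<delta> \<ge> 0" "Re s + \<delta> < 1"
  shows "integrable lborel (\<lambda>t. exp (- \<delta> * t) * wm l x s t)"
    and "(LINT t|lborel. exp (- \<delta> * t) * wm l x s t) = of_real (sqrt (2 * pi / l) * exp (\<delta>\<^sup>2 / (2 * l))) * (zet (s + of_real \<delta>) * mpoly x (s + of_real \<delta>))"
proof -
  let ?K = "complex_of_real (sqrt (2 * pi / l) * exp (\<delta>\<^sup>2 / (2 * l))) * zet (s + of_real \<delta>)"
  let ?c = "\<lambda>m. of_real (mu m) * exp (- s * of_real (nu m)) * of_real (exp (- \<delta> * nu m))"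
  let ?W = "\<lambda>t. complex_of_real (exp (- \<delta> * t)) * wt l s t"
  have eq: "of_real (exp (- \<delta> * t)) * wm l x s t = (\<Sum>m | nu m \<le> x. ?c m * ?W (- nu m + 1 * t))" for t
    unfolding wm_def sum_distrib_left
  proof (intro sum.cong refl)
    fix m
    have "complex_of_real (exp (- \<delta> * t)) = of_real (exp (- \<delta> * nu m)) * of_real (exp (- \<delta> * (- nu m + 1 * t)))"
      unfolding of_real_mult[symmetric] exp_add[symmetric] by (simp add: algebra_simps)
    thus "of_real (exp (- \<delta> * t)) * (of_real (mu m) * exp (- s * of_real (nu m)) * wt l s (t - nu m)) = ?c m * ?W (- nu m + 1 * t)"
      by (simp add: mult_ac)
  qed
  have iW: "integrable lborel (\<lambda>t. ?W (- nu m + 1 * t))" for m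
    by (rule lborel_integrable_real_affine[OF wt_laplace(1)[OF l s d]]) simp
  show "integrable lborel (\<lambda>t. exp (- \<delta> * t) * wm l x s t)" unfolding eq
    by (intro Bochner_Integration.integrable_sum integrable_mult_right iW)
  have vW: "(LINT t|lborel. ?W (- nu m + 1 * t)) = ?K" for m
    using lborel_integral_real_affine[of 1 ?W "- nu m"] wt_laplace(2)[OF l s d] by simp
  have "(LINT t|lborel. exp (- \<delta> * t) * wm l x s t) = (\<Sum>m | nu m \<le> x. ?c m * ?K)"
    unfolding eq by (simp only: Bochner_Integration.integral_sum integrable_mult_right iW integral_mult_right_zero vW)
  also have "\<dots> = ?K * mpoly x (s + of_real \<delta>)"
    unfolding mpoly_def sum_distrib_left
  proof (intro sum.cong refl)
    fix m
    have "exp (- s * of_real (nu m)) * of_real (exp (- \<delta> * nu m)) = exp (- (s + of_real \<delta>) * of_real (nu m))"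
      unfolding exp_of_real[symmetric] exp_add[symmetric] by (rule arg_cong[of _ _ exp]) (simp add: algebra_simps)
    thus "?c m * ?K = ?K * (of_real (mu m) * exp (- (s + of_real \<delta>) * of_real (nu m)))" by (simp add: mult_ac)
  qed
  finally show "(LINT t|lborel. exp (- \<delta> * t) * wm l x s t) = of_real (sqrt (2 * pi / l) * exp (\<delta>\<^sup>2 / (2 * l))) * (zet (s + of_real \<delta>) * mpoly x (s + of_real \<delta>))"
    by (simp add: mult_ac)
qed

text \<open>The product of exp (- s * \<nu> m) and exp ((1 - s) * (t - \<nu> m)) is exp (- \<nu> m)
  * exp ((1 - s) * t), so the pole terms of all m share one dependence on t; this is its
  coefficient.\<close>

definition pconst :: "real \<Rightarrow> real \<Rightarrow> complex \<Rightarrow> complex" where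
  "pconst l x s = of_real (\<Sum>m | nu m \<le> x. mu m * exp (- nu m)) * (of_real A * (of_real (sqrt (2 * pi / l)) * exp ((1 - s)\<^sup>2 / (2 * of_real l))))"

lemma sum_pol: "(\<Sum>m | nu m \<le> x. of_real (mu m) * exp (- s * of_real (nu m)) * pol l s (t - nu m)) = pconst l x s * exp ((1 - s) * of_real t)"
  unfolding pconst_def of_real_sum sum_distrib_right
proof (intro sum.cong refl)
  fix m
  have "exp (- s * of_real (nu m)) * exp ((1 - s) * of_real (t - nu m)) = of_real (exp (- nu m)) * exp ((1 - s) * of_real t)"
    unfolding exp_of_real[symmetric] exp_add[symmetric] by (rule arg_cong[of _ _ exp]) (simp add: algebra_simps)
  hence e: "exp (- s * of_real (nu m)) * (exp ((1 - s) * of_real (t - nu m)) * w) = of_real (exp (- nu m)) * (exp ((1 - s) * of_real t) * w)" for w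
    by (simp only: mult.assoc[symmetric])
  show "of_real (mu m) * exp (- s * of_real (nu m)) * pol l s (t - nu m) =
    of_real (mu m * exp (- nu m)) * (of_real A * (of_real (sqrt (2 * pi / l)) * exp ((1 - s)\<^sup>2 / (2 * of_real l)))) * exp ((1 - s) * of_real t)"
    unfolding pol_def of_real_mult mult.assoc mult.left_commute[of _ "of_real A"] e by (simp only: mult_ac)
qed

text \<open>The truncated product regroups to the coefficients \<open>acoef\<close>: the empty
  multiset gives the constant term, the rest of the range up to x vanishes, and \<open>ppoly\<close>
  remains. The indicator records that the constant term, at \<nu> = 0, passes the cut t + 1 only for
  t \<ge> - 1.\<close>

lemma wm_decomposition:
  assumes l: "l \<ge> 16" and x: "x \<ge> 0"
  shows "norm (wm l x (Complex s0 \<gamma>) t + pconst l x (Complex s0 \<gamma>) * exp ((1 - Complex s0 \<gamma>) * of_real t)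
      - of_real (indicator {-1..} t * gs l t) - ppoly l x t \<gamma>)
    \<le> cnt x * (gconst * exp (- (l / 4)) * exp (2 * t) * (exp t + exp (\<theta> * t)))"
proof -
  let ?s = "Complex s0 \<gamma>"
  have l0: "l > 0" using l by simp
  have s: "\<theta> < Re ?s" "Re ?s < 1" "Re ?s \<ge> 0" using s0 by auto
  let ?c = "\<lambda>m. of_real (mu m) * exp (- ?s * of_real (nu m))"
  let ?h = "\<lambda>z. exp (- ?s * of_real z) * complex_of_real (gs l (z - t))"
  let ?L = "\<lambda>m. LINT n|count_space UNIV. exp (- ?s * of_real (nu n)) * complex_of_real (gs l (nu n - (t - nu m)))"
  let ?S = "\<lambda>m. \<Sum>n | nu n + nu m \<le> t + 1. exp (- ?s * of_real (nu n)) * complex_of_real (gs l (nu n - (t - nu m)))"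
  let ?B = "gconst * exp (- (l / 4)) * exp (2 * t) * (exp t + exp (\<theta> * t))"
  have main: "(\<Sum>m | nu m \<le> x. ?c m * ?S m) = of_real (indicator {-1..} t * gs l t) + ppoly l x t \<gamma>"
  proof -
    have "(\<Sum>m | nu m \<le> x. ?c m * ?S m) = (\<Sum>m | nu m \<le> x. of_real (mu m) * (\<Sum>n | nu n + nu m \<le> t + 1. ?h (nu m + nu n)))"
    proof (intro sum.cong refl)
      fix m
      have "exp (- ?s * of_real (nu m)) * (exp (- ?s * of_real (nu n)) * complex_of_real (gs l (nu n - (t - nu m)))) = ?h (nu m + nu n)" for n
      proof -
        have "exp (- ?s * of_real (nu m)) * exp (- ?s * of_real (nu n)) = exp (- ?s * of_real (nu m + nu n))"
          unfolding exp_add[symmetric] by (rule arg_cong[of _ _ exp]) (simp add: algebra_simps)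
        moreover have "nu n - (t - nu m) = nu m + nu n - t" by simp
        ultimately show ?thesis by (simp only: mult.assoc[symmetric])
      qed
      thus "?c m * ?S m = of_real (mu m) * (\<Sum>n | nu n + nu m \<le> t + 1. ?h (nu m + nu n))"
        by (simp only: mult.assoc sum_distrib_left)
    qed
    also have "\<dots> = (\<Sum>k | nu k \<le> t + 1. of_real (acoef x k) * ?h (nu k))" by (rule dirichlet_convolution_sum)
    also have "\<dots> = (\<Sum>k \<in> {k. nu k \<le> t + 1 \<and> k = {#}} \<union> {k. x < nu k \<and> nu k \<le> t + 1}. of_real (acoef x k) * ?h (nu k))"
    proof (rule sum.mono_neutral_right[OF finite_nu])
      show "\<forall>k\<in>{k. nu k \<le> t + 1} - ({k. nu k \<le> t + 1 \<and> k = {#}} \<union> {k. x < nu k \<and> nu k \<le> t + 1}). of_real (acoef x k) * ?h (nu k) = 0"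
      proof
        fix k assume k: "k \<in> {k. nu k \<le> t + 1} - ({k. nu k \<le> t + 1 \<and> k = {#}} \<union> {k. x < nu k \<and> nu k \<le> t + 1})"
        hence "nu k \<le> x" "k \<noteq> {#}" by auto
        thus "of_real (acoef x k) * ?h (nu k) = 0" by (simp add: acoef_small)
      qed
    qed auto
    also have "\<dots> = (\<Sum>k | nu k \<le> t + 1 \<and> k = {#}. of_real (acoef x k) * ?h (nu k)) + (\<Sum>k | x < nu k \<and> nu k \<le> t + 1. of_real (acoef x k) * ?h (nu k))"
      by (rule sum.union_disjoint) (use x in \<open>auto intro: finite_subset[OF _ finite_nu[of "t + 1"]]\<close>)
    also have "(\<Sum>k | nu k \<le> t + 1 \<and> k = {#}. of_real (acoef x k) * ?h (nu k)) = of_real (indicator {-1..} t * gs l t)"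
    proof (cases "t \<ge> -1")
      case True
      hence S: "{k. nu k \<le> t + 1 \<and> k = {#}} = {{#}}" by auto
      show ?thesis unfolding S using True x by (simp add: acoef_small)
    next
      case False
      hence S: "{k. nu k \<le> t + 1 \<and> k = {#}} = {}" by auto
      show ?thesis unfolding S using False by simp
    qed
    also have "(\<Sum>k | x < nu k \<and> nu k \<le> t + 1. of_real (acoef x k) * ?h (nu k)) = ppoly l x t \<gamma>"
      unfolding ppoly_def dpoly_def
    proof (intro sum.cong refl)
      fix k
      have "exp (- ?s * of_real (nu k)) = of_real (exp (- s0 * nu k)) * iexp (- \<gamma> * nu k)"
        unfolding exp_of_real[symmetric] exp_add[symmetric] by (rule arg_cong[of _ _ exp]) (simp add: complex_eq_iff)
      thus "of_real (acoef x k) * ?h (nu k) = of_real (acoef x k * exp (- s0 * nu k) * gs l (nu k - t)) * iexp (- \<gamma> * nu k)"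
        by (simp only: of_real_mult mult_ac)
    qed
    finally show ?thesis .
  qed
  have "wm l x ?s t + pconst l x ?s * exp ((1 - ?s) * of_real t) = (\<Sum>m | nu m \<le> x. ?c m * ?L m)"
    unfolding sum_pol[symmetric] wm_def sum.distrib[symmetric] wt_dirichlet[OF l0 s(1,2)] by (simp add: algebra_simps)
  hence "wm l x ?s t + pconst l x ?s * exp ((1 - ?s) * of_real t) - of_real (indicator {-1..} t * gs l t) - ppoly l x t \<gamma>
     = (\<Sum>m | nu m \<le> x. ?c m * ?L m) - (\<Sum>m | nu m \<le> x. ?c m * ?S m)" unfolding main by simp
  also have "\<dots> = (\<Sum>m | nu m \<le> x. ?c m * (?L m - ?S m))" by (simp only: right_diff_distrib sum_subtractf)
  finally have eq: "wm l x ?s t + pconst l x ?s * exp ((1 - ?s) * of_real t) - of_real (indicator {-1..} t * gs l t) - ppoly l x t \<gamma>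
     = (\<Sum>m | nu m \<le> x. ?c m * (?L m - ?S m))" .
  have "norm (\<Sum>m | nu m \<le> x. ?c m * (?L m - ?S m)) \<le> (\<Sum>m | nu m \<le> x. ?B)"
  proof (rule sum_norm_le)
    fix m
    have "norm (?c m) \<le> 1 * 1" unfolding norm_mult using s0 nu_nonneg[of m] abs_mu_le[of m] by (intro mult_mono) auto
    hence "norm (?c m * (?L m - ?S m)) \<le> 1 * ?B"
      unfolding norm_mult[of "?c m"] by (intro mult_mono gauss_dirichlet_tail l s(3) nu_nonneg) auto
    thus "norm (?c m * (?L m - ?S m)) \<le> ?B" by simp
  qed
  also have "\<dots> = cnt x * ?B" by (simp add: cnt_def)
  finally show ?thesis unfolding eq .
qed

lemma ppoly_zero: "t + 1 < x \<Longrightarrow> ppoly l x t \<gamma> = 0"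
  unfolding ppoly_def dpoly_def by (rule sum.neutral) auto

text \<open>As a function of t the polynomial jumps whenever a generalized integer passes the cut t
  + 1. On a bounded range it is a finite sum of terms switched on at a threshold, which gives
  measurability.\<close>

lemma ppoly_set_integrable:
  assumes l: "l > 0"
  shows "set_integrable lborel {a..<y} (\<lambda>t. exp (- \<delta> * t) * norm (ppoly l x t \<gamma>))"
proof -
  define F where "F = {k. nu k \<le> y + 1}"
  have F: "finite F" unfolding F_def by (rule finite_nu)
  define q where "q = (\<lambda>t. \<Sum>k\<in>F. (if x < nu k \<and> nu k \<le> t + 1 then of_real (acoef x k * exp (- s0 * nu k) * gs l (nu k - t)) * iexp (- \<gamma> * nu k) else 0))"
  have qm [measurable]: "q \<in> borel_measurable borel" unfolding q_def by measurable
  have eq: "ppoly l x t \<gamma> = q t" if "t < y" for t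
  proof -
    have "q t = (\<Sum>k\<in>{k \<in> F. x < nu k \<and> nu k \<le> t + 1}. of_real (acoef x k * exp (- s0 * nu k) * gs l (nu k - t)) * iexp (- \<gamma> * nu k))"
      unfolding q_def by (rule sum.inter_filter[OF F, symmetric])
    also have "{k \<in> F. x < nu k \<and> nu k \<le> t + 1} = {k. x < nu k \<and> nu k \<le> t + 1}" using that by (auto simp: F_def)
    finally show ?thesis by (simp add: ppoly_def dpoly_def)
  qed
  have qb: "norm (q t) \<le> (\<Sum>k\<in>F. \<bar>acoef x k\<bar>)" for t
    unfolding q_def
  proof (rule sum_norm_le)
    fix k
    have "\<bar>acoef x k\<bar> * (exp (- s0 * nu k) * gs l (nu k - t)) \<le> \<bar>acoef x k\<bar> * (1 * 1)"
      using s0 nu_nonneg[of k] l by (intro mult_left_mono mult_mono gs_le_1) auto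
    thus "norm (if x < nu k \<and> nu k \<le> t + 1 then of_real (acoef x k * exp (- s0 * nu k) * gs l (nu k - t)) * iexp (- \<gamma> * nu k) else 0) \<le> \<bar>acoef x k\<bar>"
      by (auto simp: norm_mult mult.assoc)
  qed
  have "integrable lborel (\<lambda>t. indicator {a..<y} t *\<^sub>R (exp (- \<delta> * t) * norm (q t)))"
  proof (rule integrableI_bounded_set[where A = "{a..<y}" and B = "exp (\<bar>\<delta>\<bar> * (\<bar>a\<bar> + \<bar>y\<bar>)) * (\<Sum>k\<in>F. \<bar>acoef x k\<bar>)"])
    show "emeasure lborel {a..<y} < \<infinity>" by (cases "a \<le> y") auto
    show "AE t in lborel. t \<in> {a..<y} \<longrightarrow> norm (indicator {a..<y} t *\<^sub>R (exp (- \<delta> * t) * norm (q t))) \<le> exp (\<bar>\<delta>\<bar> * (\<bar>a\<bar> + \<bar>y\<bar>)) * (\<Sum>k\<in>F. \<bar>acoef x k\<bar>)"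
    proof (rule AE_I2, rule impI)
      fix t assume t: "t \<in> {a..<y}"
      have "- \<delta> * t \<le> \<bar>\<delta>\<bar> * \<bar>t\<bar>" by (metis abs_ge_self abs_minus_cancel abs_mult)
      also have "\<dots> \<le> \<bar>\<delta>\<bar> * (\<bar>a\<bar> + \<bar>y\<bar>)" using t by (intro mult_left_mono) auto
      finally have "exp (- \<delta> * t) * norm (q t) \<le> exp (\<bar>\<delta>\<bar> * (\<bar>a\<bar> + \<bar>y\<bar>)) * (\<Sum>k\<in>F. \<bar>acoef x k\<bar>)"
        by (intro mult_mono qb) auto
      thus "norm (indicator {a..<y} t *\<^sub>R (exp (- \<delta> * t) * norm (q t))) \<le> exp (\<bar>\<delta>\<bar> * (\<bar>a\<bar> + \<bar>y\<bar>)) * (\<Sum>k\<in>F. \<bar>acoef x k\<bar>)"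
        using t by simp
    qed
  qed auto
  also have "(\<lambda>t. indicator {a..<y} t *\<^sub>R (exp (- \<delta> * t) * norm (q t))) = (\<lambda>t. indicator {a..<y} t *\<^sub>R (exp (- \<delta> * t) * norm (ppoly l x t \<gamma>)))"
    by (rule ext) (auto simp: indicator_def eq)
  finally show ?thesis by (simp add: set_integrable_def)
qed

lemma imean_nonneg: "l > 0 \<Longrightarrow> imean l x \<gamma> \<ge> 0"
  unfolding imean_def by (intro integral_nonneg_AE AE_I2) auto

text \<open>The Gaussian factor in \<gamma> is what matters: for |\<gamma>| \<ge> l it outweighs
  even the trivial bound \<open>cnt x\<close> for the Moebius sum.\<close>

lemma norm_pconst_le:
  assumes l: "l \<ge> 1"
  shows "norm (pconst l x (Complex s0 \<gamma>)) \<le> A * sqrt (2 * pi) * exp 1 * cnt x * exp (- (\<gamma>\<^sup>2 / (2 * l)))"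
proof -
  have "\<bar>\<Sum>m | nu m \<le> x. mu m * exp (- nu m)\<bar> \<le> (\<Sum>m | nu m \<le> x. \<bar>mu m * exp (- nu m)\<bar>)" by (rule sum_abs)
  also have "\<dots> \<le> (\<Sum>m | nu m \<le> x. 1 * 1)"
    unfolding abs_mult by (intro sum_mono mult_mono abs_mu_le) (auto simp: nu_nonneg)
  finally have a: "\<bar>\<Sum>m | nu m \<le> x. mu m * exp (- nu m)\<bar> \<le> cnt x" by (simp add: cnt_def)
  have "(1 - Complex s0 \<gamma>)\<^sup>2 / (2 * of_real l) = (1 - Complex s0 \<gamma>)\<^sup>2 / of_real (2 * l)" by simp
  hence r: "Re ((1 - Complex s0 \<gamma>)\<^sup>2 / (2 * of_real l)) = ((1 - s0)\<^sup>2 - \<gamma>\<^sup>2) / (2 * l)"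
    by (simp only: Re_divide_of_real) (simp add: power2_eq_square)
  have "(1 - s0)\<^sup>2 \<le> 1" using s0 by (intro power_le_one) auto
  hence "(1 - s0)\<^sup>2 / (2 * l) \<le> 1" using l by (simp add: field_simps)
  hence b: "exp (((1 - s0)\<^sup>2 - \<gamma>\<^sup>2) / (2 * l)) \<le> exp 1 * exp (- (\<gamma>\<^sup>2 / (2 * l)))"
    by (simp add: diff_divide_distrib flip: exp_add)
  have "2 * pi / l \<le> 2 * pi / 1" using l pi_gt_zero by (intro divide_left_mono) auto
  hence c: "sqrt (2 * pi / l) \<le> sqrt (2 * pi)" by simp
  have "norm (pconst l x (Complex s0 \<gamma>)) = \<bar>\<Sum>m | nu m \<le> x. mu m * exp (- nu m)\<bar> * (A * (sqrt (2 * pi / l) * exp (((1 - s0)\<^sup>2 - \<gamma>\<^sup>2) / (2 * l))))"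
    unfolding pconst_def norm_mult norm_exp_eq_Re r norm_of_real using A_pos l by simp
  also have "\<dots> \<le> cnt x * (A * (sqrt (2 * pi) * (exp 1 * exp (- (\<gamma>\<^sup>2 / (2 * l))))))"
    using A_pos l by (intro mult_mono a b c order_refl) auto
  finally show ?thesis by (simp add: mult_ac)
qed

text \<open>The decomposition is multiplied by exp (- \<delta> * t) and integrated over t < y. The
  constant term is bounded below; on the other side stand, in order, the polynomials, the truncation
  error, the pole, the value of zeta times M at s0 + \<delta>, and the part t \<ge> y of the
  transform.\<close>

lemma detection:
  fixes \<delta> :: real
  assumes l: "l \<ge> 16" and x: "x \<ge> 1" and y: "y \<ge> 0" and d: "\<delta> > 0" "s0 + \<delta> < 1" and g: "\<bar>\<gamma>\<bar> \<ge> 1"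
  shows "exp (- (1 / 2)) / sqrt l \<le> (LINT t:{x - 1..<y}|lborel. exp (- \<delta> * t) * norm (ppoly l x t \<gamma>))
     + 2 * gconst * cnt x * exp (3 * y - l / 4)
     + A * sqrt (2 * pi) * exp 1 * cnt x * exp (y - \<gamma>\<^sup>2 / (2 * l))
     + sqrt (2 * pi / l) * exp (\<delta>\<^sup>2 / (2 * l)) * norm (zet (Complex (s0 + \<delta>) \<gamma>) * mpoly x (Complex (s0 + \<delta>) \<gamma>))
     + exp (- \<delta> * y) / \<delta> * imean l x \<gamma>"
proof -
  let ?s = "Complex s0 \<gamma>"
  let ?I = "{..<y}"
  have l0: "l > 0" "l \<ge> 1" using l by auto
  have th: "0 \<le> \<theta>" "\<theta> < 1" using theta by auto
  have sd: "?s + of_real \<delta> = Complex (s0 + \<delta>) \<gamma>" by (simp add: complex_eq_iff)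
  have d1: "\<delta> < 1" using d s0 by linarith
  define w where "w = (\<lambda>t. complex_of_real (exp (- \<delta> * t)) * wm l x ?s t)"
  define e where "e = 1 - ?s - of_real \<delta>"
  define pp where "pp = (\<lambda>t. pconst l x ?s * exp (e * of_real t))"
  define gt where "gt = (\<lambda>t. indicator {-1..} t * (exp (- \<delta> * t) * gs l t))"
  define z where "z = (\<lambda>t. w t + pp t - complex_of_real (gt t))"
  define C where "C = cnt x * gconst * exp (- (l / 4))"
  define tb where "tb = (\<lambda>t. C * (exp ((3 - \<delta>) * t) + exp ((2 + \<theta> - \<delta>) * t)))"
  define c1Z where "c1Z = of_real (sqrt (2 * pi / l) * exp (\<delta>\<^sup>2 / (2 * l))) * (zet (?s + of_real \<delta>) * mpoly x (?s + of_real \<delta>))"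
  have C0: "C \<ge> 0" unfolding C_def using gconst_nonneg by simp
  have ReE: "Re e > 0" unfolding e_def using d by simp
  have iw: "integrable lborel w" and vw: "(LINT t|lborel. w t) = c1Z"
    unfolding w_def c1Z_def using wm_laplace[OF l0(1), of ?s \<delta> x] s0 d by auto
  have iw1: "set_integrable lborel ?I w" "set_integrable lborel {y..} w"
    unfolding set_integrable_def by (intro integrable_mult_indicator iw; simp)+
  \<comment> \<open>Only the integral over the whole line is known exactly; the part t < y is this
    value minus the tail.\<close>
  have split: "(LINT t|lborel. w t) = (LINT t:?I|lborel. w t) + (LINT t:{y..}|lborel. w t)"
  proof -
    have "(LINT t|lborel. w t) = (LINT t:?I \<union> {y..}|lborel. w t)"
      unfolding set_lebesgue_integral_def by (intro Bochner_Integration.integral_cong) (auto simp: indicator_def)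
    also have "\<dots> = (LINT t:?I|lborel. w t) + (LINT t:{y..}|lborel. w t)"
      by (rule set_integral_Un[OF _ iw1]) auto
    finally show ?thesis .
  qed
  have ip: "set_integrable lborel ?I pp" unfolding pp_def
    by (rule set_integrable_mult_right) (rule exp_decay_atMost(1)[OF ReE])
  have vp: "(LINT t:?I|lborel. pp t) = pconst l x ?s * (exp (e * of_real y) / e)" unfolding pp_def
    using exp_decay_atMost(2)[OF ReE, of y] by simp
  have igt: "integrable lborel gt"
  proof (rule Bochner_Integration.integrable_bound[OF gs_ft_real(1)[OF l0(1), of "- \<delta>"]])
    show "AE t in lborel. norm (gt t) \<le> norm (exp (- \<delta> * t) * gs l t)"
      by (rule AE_I2) (simp add: gt_def indicator_def)
  qed (simp add: gt_def)
  have igt': "set_integrable lborel ?I (\<lambda>t. complex_of_real (gt t))"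
    unfolding set_integrable_def by (intro integrable_mult_indicator) (simp, simp only: complex_of_real_integrable_eq igt)
  have iz: "set_integrable lborel ?I z" unfolding z_def
    by (intro set_integral_diff(1) set_integral_add(1) iw1 ip igt')
  have itb: "set_integrable lborel ?I tb"
  proof -
    have "set_integrable lborel ?I (\<lambda>t. exp (a * t))" if "a > 0" for a :: real
    proof -
      have eq: "exp (complex_of_real a * of_real t) = of_real (exp (a * t))" for t by (simp only: of_real_mult[symmetric] exp_of_real)
      have "set_integrable lborel ?I (\<lambda>t. complex_of_real (exp (a * t)))"
        using exp_decay_atMost(1)[of "complex_of_real a" y] that unfolding eq by simp
      thus ?thesis unfolding set_integrable_def
        by (subst complex_of_real_integrable_eq[symmetric]) (simp add: scaleR_conv_of_real)
    qed
    thus ?thesis unfolding tb_def using d1 th by (intro set_integrable_mult_right set_integral_add(1)) auto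
  qed
  have vtb: "(LINT t:?I|lborel. tb t) \<le> 2 * gconst * cnt x * exp (3 * y - l / 4)"
  proof -
    have ie: "set_integrable lborel ?I (\<lambda>t. exp (a * t))" and ve: "(LINT t:?I|lborel. exp (a * t)) = exp (a * y) / a" if "a > 0" for a :: real
    proof -
      have eq: "exp (complex_of_real a * of_real t) = of_real (exp (a * t))" for t by (simp only: of_real_mult[symmetric] exp_of_real)
      have "set_integrable lborel ?I (\<lambda>t. complex_of_real (exp (a * t)))"
        using exp_decay_atMost(1)[of "complex_of_real a" y] that unfolding eq by simp
      thus "set_integrable lborel ?I (\<lambda>t. exp (a * t))" unfolding set_integrable_def
        by (subst complex_of_real_integrable_eq[symmetric]) (simp add: scaleR_conv_of_real)
      have "complex_of_real (LINT t:?I|lborel. exp (a * t)) = (LINT t:?I|lborel. complex_of_real (exp (a * t)))"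
        by (rule set_integral_complex_of_real[symmetric])
      also have "\<dots> = of_real (exp (a * y)) / of_real a"
        using exp_decay_atMost(2)[of "complex_of_real a" y] that unfolding eq by simp
      finally show "(LINT t:?I|lborel. exp (a * t)) = exp (a * y) / a" by (simp only: of_real_divide[symmetric] of_real_eq_iff)
    qed
    have p: "3 - \<delta> > 0" "2 + \<theta> - \<delta> > 0" using d1 th by auto
    have b: "exp (a * y) / a \<le> exp (3 * y)" if "1 \<le> a" "a \<le> 3" for a
    proof -
      have "exp (a * y) / a \<le> exp (a * y) / 1" using that by (intro divide_left_mono) auto
      also have "\<dots> \<le> exp (3 * y)" using that y by (simp add: mult_right_mono)
      finally show ?thesis .
    qed
    have "(LINT t:?I|lborel. tb t) = C * (exp ((3 - \<delta>) * y) / (3 - \<delta>) + exp ((2 + \<theta> - \<delta>) * y) / (2 + \<theta> - \<delta>))"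
      unfolding tb_def by (simp only: set_integral_mult_right set_integral_add(2)[OF ie[OF p(1)] ie[OF p(2)]] ve[OF p(1)] ve[OF p(2)])
    also have "\<dots> \<le> C * (exp (3 * y) + exp (3 * y))"
      using d1 d th by (intro mult_left_mono add_mono b C0) auto
    also have "\<dots> = 2 * gconst * cnt x * exp (3 * y - l / 4)"
    proof -
      have e: "exp (3 * y - l / 4) = exp (- (l / 4)) * exp (3 * y)"
        unfolding exp_add[symmetric] by (rule arg_cong[of _ _ exp]) simp
      have "c * g * F * (E + E) = 2 * g * c * (F * E)" for c g F E :: real by (simp add: algebra_simps)
      thus ?thesis unfolding C_def e .
    qed
    finally show ?thesis .
  qed
  define pb where "pb = (\<lambda>t. exp (- \<delta> * t) * norm (ppoly l x t \<gamma>))"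
  \<comment> \<open>Below t = x - 1 the polynomial is empty, whence the lower limit of the
    integral.\<close>
  have pbI: "(\<lambda>t. indicator ?I t *\<^sub>R pb t) = (\<lambda>t. indicator {x - 1..<y} t *\<^sub>R pb t)"
    by (rule ext) (auto simp: indicator_def pb_def ppoly_zero)
  have ipb: "set_integrable lborel ?I pb"
    unfolding set_integrable_def pbI using ppoly_set_integrable[OF l0(1), of "x - 1" y \<delta> x \<gamma>] by (simp add: set_integrable_def pb_def)
  have vpb: "(LINT t:?I|lborel. pb t) = (LINT t:{x - 1..<y}|lborel. exp (- \<delta> * t) * norm (ppoly l x t \<gamma>))"
    unfolding set_lebesgue_integral_def pbI by (simp add: pb_def)
  have zb: "norm (z t) \<le> pb t + tb t" for t
  proof -
    let ?D = "wm l x ?s t + pconst l x ?s * exp ((1 - ?s) * of_real t) - of_real (indicator {-1..} t * gs l t) - ppoly l x t \<gamma>"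
    have "exp (e * of_real t) = of_real (exp (- \<delta> * t)) * exp ((1 - ?s) * of_real t)"
      unfolding exp_of_real[symmetric] exp_add[symmetric] e_def by (rule arg_cong[of _ _ exp]) (simp add: algebra_simps)
    hence "z t = of_real (exp (- \<delta> * t)) * (?D + ppoly l x t \<gamma>)"
      unfolding z_def w_def pp_def gt_def by (simp add: algebra_simps)
    hence "norm (z t) = exp (- \<delta> * t) * norm (?D + ppoly l x t \<gamma>)" by (simp add: norm_mult)
    also have "\<dots> \<le> exp (- \<delta> * t) * (cnt x * (gconst * exp (- (l / 4)) * exp (2 * t) * (exp t + exp (\<theta> * t))) + norm (ppoly l x t \<gamma>))"
      using wm_decomposition[OF l, of x \<gamma> t] x by (intro mult_left_mono order_trans[OF norm_triangle_ineq] add_right_mono) auto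
    also have "\<dots> = pb t + tb t"
    proof -
      have e1: "exp ((3 - \<delta>) * t) = exp (- \<delta> * t) * (exp (2 * t) * exp t)"
        unfolding exp_add[symmetric] by (rule arg_cong[of _ _ exp]) (simp add: algebra_simps)
      have e2: "exp ((2 + \<theta> - \<delta>) * t) = exp (- \<delta> * t) * (exp (2 * t) * exp (\<theta> * t))"
        unfolding exp_add[symmetric] by (rule arg_cong[of _ _ exp]) (simp add: algebra_simps)
      have "D * (c * (g * E * X * (a + b)) + N) = D * N + c * g * E * (D * (X * a) + D * (X * b))" for D c g E X a b N :: real
        by (simp add: algebra_simps)
      thus ?thesis unfolding pb_def tb_def C_def e1 e2 .
    qed
    finally show ?thesis .
  qed
  have Z: "norm (LINT t:?I|lborel. z t) \<le> (LINT t:?I|lborel. pb t) + (LINT t:?I|lborel. tb t)"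
  proof -
    have "norm (LINT t:?I|lborel. z t) \<le> (LINT t:?I|lborel. norm (z t))"
      unfolding set_lebesgue_integral_def by (rule order_trans[OF integral_norm_bound]) (simp add: abs_of_nonneg)
    also have "\<dots> \<le> (LINT t:?I|lborel. pb t + tb t)"
      by (rule set_integral_mono[OF set_integrable_norm[OF iz] set_integral_add(1)[OF ipb itb] zb])
    also have "\<dots> = (LINT t:?I|lborel. pb t) + (LINT t:?I|lborel. tb t)" by (rule set_integral_add(2)[OF ipb itb])
    finally show ?thesis .
  qed
  have PP: "norm (LINT t:?I|lborel. pp t) \<le> A * sqrt (2 * pi) * exp 1 * cnt x * exp (y - \<gamma>\<^sup>2 / (2 * l))"
  proof -
    \<comment> \<open>Here |\<gamma>| \<ge> 1 keeps the denominator e away from 0.\<close>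
    have "norm (exp (e * of_real y) / e) \<le> exp y / 1" unfolding norm_divide
    proof (rule frac_le)
      have "Re e * y \<le> 1 * y" using y s0 d by (intro mult_right_mono) (auto simp: e_def)
      thus "norm (exp (e * of_real y)) \<le> exp y" by simp
      have "\<bar>Im e\<bar> = \<bar>\<gamma>\<bar>" by (simp add: e_def)
      thus "1 \<le> norm e" using abs_Im_le_cmod[of e] g by linarith
    qed auto
    hence "norm (LINT t:?I|lborel. pp t) \<le> (A * sqrt (2 * pi) * exp 1 * cnt x * exp (- (\<gamma>\<^sup>2 / (2 * l)))) * exp y"
      unfolding vp norm_mult[of "pconst l x ?s"] using A_pos by (intro mult_mono norm_pconst_le l0) auto
    moreover have "exp (y - \<gamma>\<^sup>2 / (2 * l)) = exp (- (\<gamma>\<^sup>2 / (2 * l))) * exp y"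
      unfolding exp_add[symmetric] by (rule arg_cong[of _ _ exp]) simp
    ultimately show ?thesis by (simp only: mult.assoc)
  qed
  have W: "norm (LINT t:{y..}|lborel. w t) \<le> exp (- \<delta> * y) / \<delta> * imean l x \<gamma>"
  proof -
    have ii: "set_integrable lborel {y..} (\<lambda>t. exp (- (\<delta> * t)))" by (rule exp_decay_atLeast(1)[OF d(1)])
    have "norm (LINT t:{y..}|lborel. w t) \<le> (LINT t:{y..}|lborel. norm (w t))"
      unfolding set_lebesgue_integral_def by (rule order_trans[OF integral_norm_bound]) (simp add: abs_of_nonneg)
    also have "\<dots> \<le> (LINT t:{y..}|lborel. exp (- (\<delta> * t)) * imean l x \<gamma>)"
    proof (rule set_integral_mono[OF set_integrable_norm[OF iw1(2)] set_integrable_mult_left[OF ii]])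
      fix t
      have "norm (w t) = exp (- (\<delta> * t)) * norm (wm l x ?s t)" by (simp add: w_def norm_mult)
      thus "norm (w t) \<le> exp (- (\<delta> * t)) * imean l x \<gamma>" using norm_wm_le[OF l0(1), of x \<gamma> t] by (simp add: mult_left_mono)
    qed
    also have "\<dots> = exp (- \<delta> * y) / \<delta> * imean l x \<gamma>" using exp_decay_atLeast(2)[OF d(1), of y] by simp
    finally show ?thesis .
  qed
  \<comment> \<open>Up to a constant the mass of the constant term already lies on - 1 / sqrt l
    \<le> t < 0, where l * t^2 \<le> 1 and exp (- \<delta> * t) \<ge> 1; y \<ge> 0 puts this
    interval inside the range.\<close>
  have gl: "exp (- (1 / 2)) / sqrt l \<le> (LINT t:?I|lborel. gt t)"
  proof -
    define h where "h = 1 / sqrt l"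
    have h: "0 < h" "h \<le> 1" "h\<^sup>2 = 1 / l" using l0 by (auto simp: h_def power_divide)
    have "exp (- (1 / 2)) / sqrt l = (LINT t|lborel. indicator {- h..<0} t *\<^sub>R exp (- (1 / 2 :: real)))"
      using h by (simp add: h_def)
    also have "\<dots> \<le> (LINT t|lborel. indicator ?I t *\<^sub>R gt t)"
    proof (rule integral_mono)
      show "integrable lborel (\<lambda>t. indicator {- h..<0} t *\<^sub>R exp (- (1 / 2 :: real)))" using h by simp
      show "integrable lborel (\<lambda>t. indicator ?I t *\<^sub>R gt t)" by (intro integrable_mult_indicator igt) simp
      fix t
      show "indicator {- h..<0} t *\<^sub>R exp (- (1 / 2 :: real)) \<le> indicator ?I t *\<^sub>R gt t"
      proof (cases "t \<in> {- h..<0}")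
        case True
        have "\<bar>t\<bar> \<le> \<bar>h\<bar>" using True h by auto
        hence "t\<^sup>2 \<le> 1 / l" unfolding h(3)[symmetric] by (simp only: abs_le_square_iff)
        hence "l * t\<^sup>2 \<le> 1" using l0 by (simp add: field_simps)
        hence "exp (- (1 / 2)) \<le> gs l t" by (simp add: gs_def)
        moreover have "1 \<le> exp (- \<delta> * t)" using True d by (simp add: mult_nonneg_nonpos)
        ultimately have "1 * exp (- (1 / 2)) \<le> exp (- \<delta> * t) * gs l t" by (intro mult_mono) auto
        thus ?thesis using True h y by (simp add: gt_def)
      next
        case False
        have "0 \<le> gt t" by (simp add: gt_def)
        thus ?thesis using False by simp
      qed
    qed
    finally show ?thesis by (simp add: set_lebesgue_integral_def)
  qed
  have "complex_of_real (LINT t:?I|lborel. gt t) = (LINT t:?I|lborel. complex_of_real (gt t))"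
    by (rule set_integral_complex_of_real[symmetric])
  also have "\<dots> = (LINT t:?I|lborel. (w t + pp t) - z t)" by (simp add: z_def)
  also have "\<dots> = (LINT t:?I|lborel. w t) + (LINT t:?I|lborel. pp t) - (LINT t:?I|lborel. z t)"
    by (simp only: set_integral_diff(2)[OF set_integral_add(1)[OF iw1(1) ip] iz] set_integral_add(2)[OF iw1(1) ip])
  also have "(LINT t:?I|lborel. w t) = c1Z - (LINT t:{y..}|lborel. w t)" using split vw by simp
  finally have eq: "complex_of_real (LINT t:?I|lborel. gt t) = c1Z - (LINT t:{y..}|lborel. w t) + (LINT t:?I|lborel. pp t) - (LINT t:?I|lborel. z t)" .
  have "(LINT t:?I|lborel. gt t) \<le> norm (complex_of_real (LINT t:?I|lborel. gt t))" by simp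
  also have "\<dots> \<le> norm c1Z + norm (LINT t:{y..}|lborel. w t) + norm (LINT t:?I|lborel. pp t) + norm (LINT t:?I|lborel. z t)"
    unfolding eq by (intro order_trans[OF norm_triangle_ineq4] add_right_mono order_trans[OF norm_triangle_ineq]) auto
  also have "norm c1Z = sqrt (2 * pi / l) * exp (\<delta>\<^sup>2 / (2 * l)) * norm (zet (Complex (s0 + \<delta>) \<gamma>) * mpoly x (Complex (s0 + \<delta>) \<gamma>))"
    unfolding c1Z_def sd using l0 by (simp add: norm_mult)
  finally show ?thesis using gl Z PP W vtb unfolding vpb by linarith
qed

text \<open>The Moebius polynomial is frozen at its maximum over the window; the maximizing u
  becomes the sample point at which large values of M are counted.\<close>

lemma imean_le:
  assumes l: "l \<ge> 1" and L: "L \<ge> 0"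
  shows "\<exists>u. \<bar>u - \<gamma>\<bar> \<le> L \<and> imean l x \<gamma> \<le> norm (mpoly x (Complex s0 u)) * zmass L \<gamma>
     + 4 * exp 2 * sqrt l * (Cz * (1 + \<bar>\<gamma>\<bar>) * cnt x) * exp (- (L\<^sup>2 / (4 * l)))"
proof -
  define h where "h = (\<lambda>v. zc (\<gamma> - v) * norm (mpoly x (Complex s0 (\<gamma> - v))))"
  have "compact {\<gamma> - L..\<gamma> + L}" "{\<gamma> - L..\<gamma> + L} \<noteq> {}" using L by auto
  from continuous_attains_sup[OF this, of "\<lambda>u. norm (mpoly x (Complex s0 u))"] obtain u where
    u: "u \<in> {\<gamma> - L..\<gamma> + L}" "\<And>u'. u' \<in> {\<gamma> - L..\<gamma> + L} \<Longrightarrow> norm (mpoly x (Complex s0 u')) \<le> norm (mpoly x (Complex s0 u))"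
    using continuous_on_norm[OF mpoly_line_continuous] by blast
  have mM: "norm (mpoly x (Complex s0 v)) \<le> cnt x" for v using norm_mpoly_le[of "Complex s0 v" x] s0 by simp
  have hb: "h v \<le> (Cz * (1 + \<bar>\<gamma>\<bar>) * cnt x) * (1 + \<bar>v\<bar>)" for v
  proof -
    have "1 + \<bar>\<gamma> - v\<bar> \<le> (1 + \<bar>\<gamma>\<bar>) * (1 + \<bar>v\<bar>)"
    proof -
      have "0 \<le> \<bar>\<gamma>\<bar> * \<bar>v\<bar>" by simp
      thus ?thesis using abs_triangle_ineq4[of \<gamma> v] unfolding distrib_left distrib_right mult_1_left mult_1_right by linarith
    qed
    hence "Cz * (1 + \<bar>\<gamma> - v\<bar>) \<le> Cz * ((1 + \<bar>\<gamma>\<bar>) * (1 + \<bar>v\<bar>))" using Cz_nonneg by (intro mult_left_mono) auto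
    hence "zc (\<gamma> - v) \<le> Cz * ((1 + \<bar>\<gamma>\<bar>) * (1 + \<bar>v\<bar>))" using zc_growth[of "\<gamma> - v"] by linarith
    hence "h v \<le> (Cz * ((1 + \<bar>\<gamma>\<bar>) * (1 + \<bar>v\<bar>))) * cnt x" unfolding h_def using Cz_nonneg by (intro mult_mono mM) auto
    thus ?thesis by (simp add: mult_ac)
  qed
  have hm: "h \<in> borel_measurable borel" unfolding h_def by measurable
  have B: "Cz * (1 + \<bar>\<gamma>\<bar>) * cnt x \<ge> 0" using Cz_nonneg by simp
  have h0: "0 \<le> h v" for v by (simp add: h_def)
  note tb = gh_tail_bound[OF l hm B L h0 hb]
  have "(LINT v:{- L..L}|lborel. gh l v * h v) \<le> (LINT v:{- L..L}|lborel. norm (mpoly x (Complex s0 u)) * zc (\<gamma> - v))"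
  proof (rule set_integral_mono[OF tb(2)])
    show "set_integrable lborel {- L..L} (\<lambda>v. norm (mpoly x (Complex s0 u)) * zc (\<gamma> - v))"
      by (intro set_integrable_continuous continuous_intros continuous_on_compose2[OF zc_continuous[of UNIV]]) auto
    fix v assume v: "v \<in> {- L..L}"
    have "gh l v * h v \<le> 1 * h v" by (intro mult_right_mono gh_le_1 l h0)
    also have "\<dots> = norm (mpoly x (Complex s0 (\<gamma> - v))) * zc (\<gamma> - v)" by (simp add: h_def)
    also have "\<dots> \<le> norm (mpoly x (Complex s0 u)) * zc (\<gamma> - v)" using v by (intro mult_right_mono u(2)) auto
    finally show "gh l v * h v \<le> norm (mpoly x (Complex s0 u)) * zc (\<gamma> - v)" .
  qed
  also have "\<dots> = norm (mpoly x (Complex s0 u)) * zmass L \<gamma>"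
    unfolding zmass_def set_integral_reflect[of L zc \<gamma>, symmetric] by simp
  finally have "imean l x \<gamma> \<le> norm (mpoly x (Complex s0 u)) * zmass L \<gamma> + 4 * exp 2 * sqrt l * (Cz * (1 + \<bar>\<gamma>\<bar>) * cnt x) * exp (- (L\<^sup>2 / (4 * l)))"
    using tb(3) unfolding imean_def h_def by linarith
  moreover have "\<bar>u - \<gamma>\<bar> \<le> L" using u(1) by (auto simp: abs_le_iff)
  ultimately show ?thesis by blast
qed

lemma cnt_le_exp: "x \<ge> 0 \<Longrightarrow> cnt x \<le> (A + C0) * exp x"
  using cnt_le[of x] by simp

text \<open>Specializes \<open>detection\<close> to l = b * ln T and shows that everything except
  the polynomials and the tail takes at most half of the lower bound. The margin 2 / ln T of
  \<alpha> over s0 makes 1 / \<delta> at most ln T.\<close>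

lemma zero_detection:
  assumes c: "c \<ge> 1"
  shows "\<exists>b\<ge>16. \<exists>c2>0. \<exists>T0\<ge>3. \<forall>T\<ge>T0. \<forall>\<alpha> x y \<rho>. s0 + 2 / ln T \<le> \<alpha> \<longrightarrow> 1 \<le> x \<longrightarrow> x \<le> c * ln T \<longrightarrow> 0 \<le> y \<longrightarrow> y \<le> c * ln T \<longrightarrow>
     zet \<rho> = 0 \<longrightarrow> \<alpha> \<le> Re \<rho> \<longrightarrow> Re \<rho> \<le> 1 \<longrightarrow> b * ln T \<le> \<bar>Im \<rho>\<bar> \<longrightarrow> \<bar>Im \<rho>\<bar> \<le> T \<longrightarrow>
     (\<exists>u. \<bar>u - Im \<rho>\<bar> \<le> b * ln T \<and> c2 / sqrt (ln T) \<le>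
        (LINT t:{x - 1..<y}|lborel. exp (- (\<alpha> - s0) * t) * norm (ppoly (b * ln T) x t (Im \<rho>))) +
        ln T * exp (- (\<alpha> - s0) * y) * (norm (mpoly x (Complex s0 u)) * zmass (b * ln T) (Im \<rho>)))"
proof -
  \<comment> \<open>Makes l / 4 = (4 * c + 6) * ln T: the part 4 * c * ln T pays for cnt x * exp (3
    * y), the rest leaves a negative power of T.\<close>
  define b where "b = 16 * c + 24"
  have b: "b \<ge> 16" "b > 0" using c by (auto simp: b_def)
  define c2 where "c2 = exp (- (1 / 2)) / (2 * sqrt b * exp c)"
  have c2: "c2 > 0" using b by (simp add: c2_def)
  define K1 where "K1 = 2 * gconst * (A + C0)"
  define K2 where "K2 = A * sqrt (2 * pi) * exp 1 * (A + C0)"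
  define K3 where "K3 = 16 * exp 2 * b * Cz * (A + C0)"
  have AC: "A + C0 \<ge> 0" using A_pos C0_nonneg by simp
  have K: "K1 \<ge> 0" "K2 \<ge> 0" "K3 \<ge> 0"
    unfolding K1_def K2_def K3_def using gconst_nonneg AC A_pos Cz_nonneg b by auto
  define l0 where "l0 = 8 * (K1 + K2 + K3) * (sqrt b * exp (1 / 2)) + 2"
  have l0: "l0 \<ge> 2" unfolding l0_def using K b by simp
  show ?thesis
  proof (rule exI[of _ b], intro conjI b(1), rule exI[of _ c2], intro conjI c2, rule exI[of _ "exp l0"], intro conjI allI impI)
    have "1 + l0 \<le> exp l0" by (rule exp_ge_add_one_self)
    thus "3 \<le> exp l0" using l0 by linarith
    fix T \<alpha> x y :: real and \<rho> :: complex
    assume T: "exp l0 \<le> T" and al: "s0 + 2 / ln T \<le> \<alpha>" and x: "1 \<le> x" "x \<le> c * ln T" and y: "0 \<le> y" "y \<le> c * ln T"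
      and r0: "zet \<rho> = 0" and Re: "\<alpha> \<le> Re \<rho>" "Re \<rho> \<le> 1" and Im: "b * ln T \<le> \<bar>Im \<rho>\<bar>" "\<bar>Im \<rho>\<bar> \<le> T"
    define \<l> where "\<l> = ln T"
    have T1: "T > 0" using T by (rule less_le_trans[rotated]) simp
    have ell0: "\<l> \<ge> l0" using T T1 unfolding \<l>_def by (simp add: ln_ge_iff)
    hence ell: "\<l> \<ge> l0" "\<l> \<ge> 2" using l0 by auto
    have Tl: "T = exp \<l>" using T1 by (simp add: \<l>_def)
    define l where "l = b * \<l>"
    have l16: "l \<ge> 16"
    proof -
      have "16 * 1 \<le> b * \<l>" using b ell by (intro mult_mono) auto
      thus ?thesis by (simp add: l_def)
    qed
    define \<gamma> where "\<gamma> = Im \<rho>"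
    have g: "l \<le> \<bar>\<gamma>\<bar>" "\<bar>\<gamma>\<bar> \<le> T" "\<bar>\<gamma>\<bar> \<ge> 1" using Im l16 by (auto simp: \<gamma>_def l_def \<l>_def)
    define e1 where "e1 = exp (- (1 / 2)) / sqrt l"
    have e1: "e1 > 0" using l16 by (simp add: e1_def)
    define \<kappa> where "\<kappa> = sqrt (2 * pi) * exp 1"
    have kap: "\<kappa> > 0" by (simp add: \<kappa>_def)
    have l2: "2 / \<l> > 0" using ell by simp
    hence sl: "\<theta> < \<alpha>" "\<alpha> - s0 \<ge> 2 / \<l>" using al s0 unfolding \<l>_def by linarith+
    have rth: "\<theta> < Re \<rho>" using sl Re by simp
    have r1: "\<rho> \<noteq> 1" using g(3) by (auto simp: \<gamma>_def)
    have cont: "isCont (\<lambda>s. zet s * mpoly x s) \<rho>"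
    proof -
      have "(\<lambda>s. zet s * mpoly x s) holomorphic_on ({s. Re s > \<theta>} - {1})"
        unfolding mpoly_def by (intro holomorphic_intros zet_holomorphic)
      moreover have "open ({s. Re s > \<theta>} - {1})" by (simp add: open_halfspace_Re_gt open_delete)
      ultimately show ?thesis using rth r1
        by (intro continuous_on_interior[OF holomorphic_on_imp_continuous_on]) (auto simp: interior_open)
    qed
    have "e1 / (4 * \<kappa>) > 0" using e1 kap by simp
    then obtain d where d: "d > 0" "\<And>w. dist w \<rho> < d \<Longrightarrow> dist (zet w * mpoly x w) (zet \<rho> * mpoly x \<rho>) < e1 / (4 * \<kappa>)"
      using cont unfolding continuous_at_eps_delta by (metis dist_commute)
    \<comment> \<open>The transform is used at \<rho> - \<epsilon>, since it requires s0 + \<delta>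
      < 1 while Re \<rho> = 1 is allowed. By continuity the product is small there instead of zero,
      and \<epsilon> \<le> 1 / ln T keeps \<delta> close to Re \<rho> - s0.\<close>
    define \<epsilon> where "\<epsilon> = min (d / 2) (1 / (2 * \<l>))"
    have eps: "\<epsilon> > 0" "\<epsilon> < d" "\<epsilon> \<le> 1 / \<l>" using d ell by (auto simp: \<epsilon>_def min_def field_simps)
    define \<delta> where "\<delta> = Re \<rho> - \<epsilon> - s0"
    have dl: "\<delta> \<ge> 1 / \<l>" "\<delta> \<ge> (\<alpha> - s0) - 1 / \<l>" "s0 + \<delta> < 1" using sl Re eps by (auto simp: \<delta>_def)
    have "1 / \<l> > 0" using ell by simp
    hence d0: "\<delta> > 0" using dl(1) by linarith
    have d1: "\<delta> < 1" using dl s0 by linarith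
    have small: "norm (zet (Complex (s0 + \<delta>) \<gamma>) * mpoly x (Complex (s0 + \<delta>) \<gamma>)) \<le> e1 / (4 * \<kappa>)"
    proof -
      have "Complex (s0 + \<delta>) \<gamma> = \<rho> - of_real \<epsilon>" by (simp add: complex_eq_iff \<delta>_def \<gamma>_def)
      moreover have "dist (\<rho> - of_real \<epsilon>) \<rho> < d" using eps by (simp add: dist_norm)
      ultimately show ?thesis using d(2)[of "\<rho> - of_real \<epsilon>"] r0 by (simp add: dist_norm)
    qed
    have t3: "sqrt (2 * pi / l) * exp (\<delta>\<^sup>2 / (2 * l)) * norm (zet (Complex (s0 + \<delta>) \<gamma>) * mpoly x (Complex (s0 + \<delta>) \<gamma>)) \<le> e1 / 4"
    proof -
      have "2 * pi / l \<le> 2 * pi / 1" using l16 pi_gt_zero by (intro divide_left_mono) auto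
      hence a: "sqrt (2 * pi / l) \<le> sqrt (2 * pi)" by simp
      have "\<delta>\<^sup>2 \<le> 1" using d0 d1 by (intro power_le_one) auto
      hence "\<delta>\<^sup>2 / (2 * l) \<le> 1" using l16 by (simp add: field_simps)
      hence "sqrt (2 * pi / l) * exp (\<delta>\<^sup>2 / (2 * l)) * norm (zet (Complex (s0 + \<delta>) \<gamma>) * mpoly x (Complex (s0 + \<delta>) \<gamma>)) \<le> \<kappa> * (e1 / (4 * \<kappa>))"
        unfolding \<kappa>_def using a by (intro mult_mono small[unfolded \<kappa>_def]) auto
      thus ?thesis using kap by simp
    qed
    have cx: "cnt x \<le> (A + C0) * exp (c * \<l>)"
      using cnt_le_exp[of x] x AC by (intro order_trans[OF cnt_le_exp] mult_left_mono) (auto simp: \<l>_def)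
    have l4: "l / 4 = 4 * (c * \<l>) + 6 * \<l>" by (simp add: l_def b_def algebra_simps)
    have cl: "c * \<l> \<ge> 0" using c ell by simp
    have t1: "2 * gconst * cnt x * exp (3 * y - l / 4) \<le> K1 * exp (- \<l>)"
    proof -
      have "2 * gconst * cnt x * exp (3 * y - l / 4) \<le> 2 * gconst * ((A + C0) * exp (c * \<l>)) * exp (3 * (c * \<l>) - l / 4)"
        using y gconst_nonneg AC by (intro mult_mono cx order_refl) (auto simp: \<l>_def)
      also have "\<dots> = K1 * (exp (c * \<l>) * exp (3 * (c * \<l>) - l / 4))" by (simp add: K1_def)
      also have "exp (c * \<l>) * exp (3 * (c * \<l>) - l / 4) = exp (- 6 * \<l>)" unfolding exp_add[symmetric] l4 by (rule arg_cong[of _ _ exp]) simp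
      also have "K1 * exp (- 6 * \<l>) \<le> K1 * exp (- \<l>)" using K ell by (intro mult_left_mono) auto
      finally show ?thesis .
    qed
    \<comment> \<open>The pole is harmless because |\<gamma>| \<ge> l makes \<gamma>^2 / (2 * l) at
      least l / 2; zeros of smaller height are counted trivially later.\<close>
    have t2: "A * sqrt (2 * pi) * exp 1 * cnt x * exp (y - \<gamma>\<^sup>2 / (2 * l)) \<le> K2 * exp (- \<l>)"
    proof -
      have "l\<^sup>2 \<le> \<bar>\<gamma>\<bar>\<^sup>2" using g l16 by (intro power_mono) auto
      hence "l / 2 \<le> \<gamma>\<^sup>2 / (2 * l)" using l16 by (simp add: field_simps power2_eq_square)
      hence "A * sqrt (2 * pi) * exp 1 * cnt x * exp (y - \<gamma>\<^sup>2 / (2 * l)) \<le> A * sqrt (2 * pi) * exp 1 * ((A + C0) * exp (c * \<l>)) * exp (c * \<l> - l / 2)"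
        using y A_pos AC by (intro mult_mono cx order_refl) (auto simp: \<l>_def)
      also have "\<dots> = K2 * (exp (c * \<l>) * exp (c * \<l> - l / 2))" by (simp add: K2_def)
      also have "K2 * (exp (c * \<l>) * exp (c * \<l> - l / 2)) \<le> K2 * exp (- \<l>)"
      proof (intro mult_left_mono K)
        have "c * \<l> + (c * \<l> - l / 2) \<le> - \<l>" using l4 cl ell by linarith
        thus "exp (c * \<l>) * exp (c * \<l> - l / 2) \<le> exp (- \<l>)" unfolding exp_add[symmetric] exp_le_cancel_iff .
      qed
      finally show ?thesis .
    qed
    obtain u where u: "\<bar>u - \<gamma>\<bar> \<le> l" and im: "imean l x \<gamma> \<le> norm (mpoly x (Complex s0 u)) * zmass l \<gamma>
     + 4 * exp 2 * sqrt l * (Cz * (1 + \<bar>\<gamma>\<bar>) * cnt x) * exp (- (l\<^sup>2 / (4 * l)))"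
      using imean_le[of l l \<gamma> x] l16 by auto
    define mz where "mz = norm (mpoly x (Complex s0 u)) * zmass l \<gamma>"
    have mz0: "mz \<ge> 0" unfolding mz_def using zmass_nonneg by simp
    have t4: "\<l> * (4 * exp 2 * sqrt l * (Cz * (1 + \<bar>\<gamma>\<bar>) * cnt x) * exp (- (l\<^sup>2 / (4 * l)))) \<le> K3 * exp (- \<l>)"
    proof -
      have "sqrt l \<le> l" using l16 by (simp add: real_le_lsqrt self_le_power power2_eq_square real_sqrt_le_iff sqrt_le_D)
      hence s: "sqrt l \<le> b * \<l>" by (simp add: l_def)
      have "T \<ge> 1" using Tl ell by simp
      hence g2: "1 + \<bar>\<gamma>\<bar> \<le> 2 * exp \<l>" using g(2) unfolding Tl[symmetric] by linarith
      have ll: "l\<^sup>2 / (4 * l) = l / 4" using l16 by (simp add: power2_eq_square)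
      have "\<l> * (4 * exp 2 * sqrt l * (Cz * (1 + \<bar>\<gamma>\<bar>) * cnt x) * exp (- (l\<^sup>2 / (4 * l))))
        \<le> \<l> * (4 * exp 2 * (b * \<l>) * (Cz * (2 * exp \<l>) * ((A + C0) * exp (c * \<l>))) * exp (- (l / 4)))"
        unfolding ll using ell Cz_nonneg b AC by (intro mult_left_mono mult_mono s g2 cx order_refl mult_nonneg_nonneg) auto
      also have "\<dots> = (8 * exp 2 * b * Cz * (A + C0)) * (\<l>\<^sup>2 * (exp \<l> * exp (c * \<l>) * exp (- (l / 4))))"
        by (simp add: power2_eq_square)
      also have "\<l>\<^sup>2 * (exp \<l> * exp (c * \<l>) * exp (- (l / 4))) \<le> 2 * exp (- \<l>)"
      proof -
        have "\<l>\<^sup>2 \<le> 2 * exp \<l>" using exp_lower_Taylor_quadratic[of \<l>] ell by simp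
        moreover have "exp \<l> * exp (c * \<l>) * exp (- (l / 4)) \<le> exp (- 2 * \<l>)"
        proof -
          have "\<l> + c * \<l> + - (l / 4) \<le> - 2 * \<l>" using l4 cl ell by linarith
          thus ?thesis unfolding exp_add[symmetric] exp_le_cancel_iff .
        qed
        ultimately have "\<l>\<^sup>2 * (exp \<l> * exp (c * \<l>) * exp (- (l / 4))) \<le> (2 * exp \<l>) * exp (- 2 * \<l>)"
          by (intro mult_mono) auto
        also have "\<dots> = 2 * exp (- \<l>)" unfolding mult.assoc exp_add[symmetric] by simp
        finally show ?thesis .
      qed
      hence "(8 * exp 2 * b * Cz * (A + C0)) * (\<l>\<^sup>2 * (exp \<l> * exp (c * \<l>) * exp (- (l / 4)))) \<le> (8 * exp 2 * b * Cz * (A + C0)) * (2 * exp (- \<l>))"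
        using b Cz_nonneg AC by (intro mult_left_mono) auto
      also have "\<dots> = K3 * exp (- \<l>)" by (simp add: K3_def)
      finally show ?thesis .
    qed
    \<comment> \<open>The remainders are constants times 1 / T, whereas the main term is only of
      size 1 / sqrt (ln T); the threshold exp l0 for T is chosen for this comparison.\<close>
    have tiny: "(K1 + K2 + K3) * exp (- \<l>) \<le> e1 / 4"
    proof -
      have "\<l>\<^sup>2 / 2 \<le> exp \<l>" using exp_lower_Taylor_quadratic[of \<l>] ell by simp
      hence "sqrt \<l> * exp (- \<l>) \<le> \<l> * (2 / \<l>\<^sup>2)"
      proof (intro mult_mono)
        have "\<l> * 1 \<le> \<l> * \<l>" using ell by (intro mult_left_mono) auto
        thus "sqrt \<l> \<le> \<l>" using ell by (intro real_le_lsqrt) (auto simp: power2_eq_square)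
        show "exp (- \<l>) \<le> 2 / \<l>\<^sup>2" using \<open>\<l>\<^sup>2 / 2 \<le> exp \<l>\<close> ell by (simp add: exp_minus field_simps)
      qed (use ell in auto)
      also have "\<dots> = 2 / \<l>" using ell by (simp add: power2_eq_square)
      finally have a: "sqrt \<l> * exp (- \<l>) \<le> 2 / \<l>" .
      have "8 * (K1 + K2 + K3) * (sqrt b * exp (1 / 2)) \<le> \<l>" using ell unfolding l0_def by linarith
      hence "(K1 + K2 + K3) * (sqrt b * exp (1 / 2)) * (2 / \<l>) \<le> 1 / 4" using ell by (simp add: field_simps)
      moreover have "(K1 + K2 + K3) * (sqrt b * exp (1 / 2)) * (sqrt \<l> * exp (- \<l>)) \<le> (K1 + K2 + K3) * (sqrt b * exp (1 / 2)) * (2 / \<l>)"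
        using K b by (intro mult_left_mono a) auto
      ultimately have "(K1 + K2 + K3) * (sqrt b * exp (1 / 2)) * (sqrt \<l> * exp (- \<l>)) \<le> 1 / 4" by linarith
      hence "((K1 + K2 + K3) * exp (- \<l>)) * (sqrt l * exp (1 / 2)) \<le> 1 / 4" by (simp add: l_def real_sqrt_mult mult_ac)
      hence "(K1 + K2 + K3) * exp (- \<l>) \<le> 1 / 4 / (sqrt l * exp (1 / 2))"
        using l16 by (subst pos_le_divide_eq) auto
      also have "\<dots> = e1 / 4" by (simp add: e1_def exp_minus field_simps)
      finally show ?thesis .
    qed
    \<comment> \<open>\<delta> falls short of \<alpha> - s0 by at most 1 / ln T and t is at most c *
      ln T, so the exchange costs the constant factor exp c.\<close>
    have ec: "exp (- \<delta> * t) \<le> exp c * exp (- (\<alpha> - s0) * t)" if t: "0 \<le> t" "t \<le> y" for t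
    proof -
      have "((\<alpha> - s0) - \<delta>) * t \<le> (1 / \<l>) * (c * \<l>)" using dl t y ell by (intro mult_mono) (auto simp: \<l>_def)
      hence "- \<delta> * t \<le> c + - (\<alpha> - s0) * t" using ell by (simp add: algebra_simps)
      thus ?thesis unfolding exp_add[symmetric] by simp
    qed
    have I: "(LINT t:{x - 1..<y}|lborel. exp (- \<delta> * t) * norm (ppoly l x t \<gamma>)) \<le> exp c * (LINT t:{x - 1..<y}|lborel. exp (- (\<alpha> - s0) * t) * norm (ppoly l x t \<gamma>))"
    proof -
      have "(LINT t:{x - 1..<y}|lborel. exp (- \<delta> * t) * norm (ppoly l x t \<gamma>)) \<le> (LINT t:{x - 1..<y}|lborel. exp c * (exp (- (\<alpha> - s0) * t) * norm (ppoly l x t \<gamma>)))"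
      proof (rule set_integral_mono)
        show "set_integrable lborel {x - 1..<y} (\<lambda>t. exp (- \<delta> * t) * norm (ppoly l x t \<gamma>))"
          by (rule ppoly_set_integrable) (use l16 in simp)
        show "set_integrable lborel {x - 1..<y} (\<lambda>t. exp c * (exp (- (\<alpha> - s0) * t) * norm (ppoly l x t \<gamma>)))"
          by (intro set_integrable_mult_right impI ppoly_set_integrable) (use l16 in simp)
        fix t assume "t \<in> {x - 1..<y}"
        hence "exp (- \<delta> * t) \<le> exp c * exp (- (\<alpha> - s0) * t)" using x by (intro ec) auto
        hence "exp (- \<delta> * t) * norm (ppoly l x t \<gamma>) \<le> (exp c * exp (- (\<alpha> - s0) * t)) * norm (ppoly l x t \<gamma>)" by (intro mult_right_mono) auto
        thus "exp (- \<delta> * t) * norm (ppoly l x t \<gamma>) \<le> exp c * (exp (- (\<alpha> - s0) * t) * norm (ppoly l x t \<gamma>))" by (simp add: mult.assoc)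
      qed
      thus ?thesis by simp
    qed
    have J: "exp (- \<delta> * y) / \<delta> * imean l x \<gamma> \<le> exp c * (\<l> * exp (- (\<alpha> - s0) * y) * mz) + K3 * exp (- \<l>)"
    proof -
      have dinv: "1 / \<delta> \<le> \<l>" using dl(1) d0 ell by (simp add: field_simps)
      have e0: "exp (- \<delta> * y) \<le> 1" using d0 y by simp
      have "exp (- \<delta> * y) / \<delta> * imean l x \<gamma> = exp (- \<delta> * y) * (1 / \<delta>) * imean l x \<gamma>" by simp
      also have "\<dots> \<le> exp (- \<delta> * y) * \<l> * imean l x \<gamma>"
        using imean_nonneg[of l x \<gamma>] l16 by (intro mult_right_mono mult_left_mono dinv) auto
      also have "\<dots> \<le> exp (- \<delta> * y) * \<l> * (mz + 4 * exp 2 * sqrt l * (Cz * (1 + \<bar>\<gamma>\<bar>) * cnt x) * exp (- (l\<^sup>2 / (4 * l))))"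
        using im ell by (intro mult_left_mono) (auto simp: mz_def)
      also have "\<dots> = exp (- \<delta> * y) * (\<l> * mz) + exp (- \<delta> * y) * (\<l> * (4 * exp 2 * sqrt l * (Cz * (1 + \<bar>\<gamma>\<bar>) * cnt x) * exp (- (l\<^sup>2 / (4 * l)))))"
        by (simp only: distrib_left mult.assoc)
      also have "\<dots> \<le> (exp c * exp (- (\<alpha> - s0) * y)) * (\<l> * mz) + 1 * (K3 * exp (- \<l>))"
      proof (rule add_mono)
        show "exp (- \<delta> * y) * (\<l> * mz) \<le> (exp c * exp (- (\<alpha> - s0) * y)) * (\<l> * mz)"
          by (rule mult_right_mono[OF ec]) (use y ell mz0 in auto)
        have "0 \<le> \<l> * (4 * exp 2 * sqrt l * (Cz * (1 + \<bar>\<gamma>\<bar>) * cnt x) * exp (- (l\<^sup>2 / (4 * l))))"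
          using ell l16 Cz_nonneg by (intro mult_nonneg_nonneg) auto
        thus "exp (- \<delta> * y) * (\<l> * (4 * exp 2 * sqrt l * (Cz * (1 + \<bar>\<gamma>\<bar>) * cnt x) * exp (- (l\<^sup>2 / (4 * l))))) \<le> 1 * (K3 * exp (- \<l>))"
          by (intro mult_mono e0 t4) auto
      qed
      finally show ?thesis by (simp add: mult_ac)
    qed
    have "e1 \<le> exp c * (LINT t:{x - 1..<y}|lborel. exp (- (\<alpha> - s0) * t) * norm (ppoly l x t \<gamma>)) + K1 * exp (- \<l>) + K2 * exp (- \<l>) + e1 / 4
       + (exp c * (\<l> * exp (- (\<alpha> - s0) * y) * mz) + K3 * exp (- \<l>))"
      using detection[OF l16 x(1) y(1) d0 dl(3) g(3)] I t1 t2 t3 J unfolding e1_def[symmetric] by linarith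
    hence "e1 / 2 \<le> exp c * ((LINT t:{x - 1..<y}|lborel. exp (- (\<alpha> - s0) * t) * norm (ppoly l x t \<gamma>)) + \<l> * exp (- (\<alpha> - s0) * y) * mz)"
      using tiny by (simp add: algebra_simps)
    moreover have "e1 / 2 = exp c * (c2 / sqrt \<l>)" by (simp add: e1_def c2_def l_def real_sqrt_mult)
    ultimately have "c2 / sqrt \<l> \<le> (LINT t:{x - 1..<y}|lborel. exp (- (\<alpha> - s0) * t) * norm (ppoly l x t \<gamma>)) + \<l> * exp (- (\<alpha> - s0) * y) * mz"
      by (simp only: mult_le_cancel_left_pos exp_gt_zero)
    thus "\<exists>u. \<bar>u - Im \<rho>\<bar> \<le> b * ln T \<and> c2 / sqrt (ln T) \<le>
        (LINT t:{x - 1..<y}|lborel. exp (- (\<alpha> - s0) * t) * norm (ppoly (b * ln T) x t (Im \<rho>))) +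
        ln T * exp (- (\<alpha> - s0) * y) * (norm (mpoly x (Complex s0 u)) * zmass (b * ln T) (Im \<rho>))"
      using u unfolding mz_def l_def \<gamma>_def \<l>_def by blast
  qed
qed

text \<open>Common hypothesis for the Moebius polynomial and all \<open>ppoly\<close>, uniform in
  the lengths and scales, so that each large value estimate is proved once.\<close>

definition divisor_bounded :: "real \<Rightarrow> (nat multiset \<Rightarrow> complex) \<Rightarrow> nat multiset set \<Rightarrow> bool" where
  "divisor_bounded q c F \<longleftrightarrow> finite F \<and> (\<forall>m\<in>F. nu m \<le> q \<and> norm (c m) \<le> real (ndiv m) * exp (- s0 * nu m))"

lemma ndiv_ge_1: "real (ndiv m) \<ge> 1"
proof -
  have "card {m} \<le> card {k. k \<subseteq># m}" by (intro card_mono finite_submultisets) auto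
  thus ?thesis by (simp add: ndiv_def)
qed

lemma divisor_bounded_mpoly: "divisor_bounded x (\<lambda>m. of_real (mu m * exp (- s0 * nu m))) {m. nu m \<le> x}"
  unfolding divisor_bounded_def
proof (intro conjI ballI finite_nu)
  fix m
  have "\<bar>mu m\<bar> * exp (- s0 * nu m) \<le> real (ndiv m) * exp (- s0 * nu m)"
    using abs_mu_le[of m] ndiv_ge_1[of m] by (intro mult_right_mono) auto
  thus "norm (complex_of_real (mu m * exp (- s0 * nu m))) \<le> real (ndiv m) * exp (- s0 * nu m)"
    unfolding norm_of_real abs_mult abs_exp_cancel .
qed simp

lemma divisor_bounded_ppoly: "l \<ge> 0 \<Longrightarrow> divisor_bounded (t + 1) (\<lambda>k. of_real (acoef x k * exp (- s0 * nu k) * gs l (nu k - t))) {k. x < nu k \<and> nu k \<le> t + 1}"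
  unfolding divisor_bounded_def
proof (intro conjI ballI)
  assume l: "l \<ge> 0"
  show "finite {k. x < nu k \<and> nu k \<le> t + 1}" by (rule finite_subset[OF _ finite_nu[of "t + 1"]]) auto
  fix k
  have "\<bar>acoef x k\<bar> * exp (- s0 * nu k) * gs l (nu k - t) \<le> real (ndiv k) * exp (- s0 * nu k) * 1"
    using abs_acoef_le[of x k] gs_le_1[OF l] by (intro mult_mono) auto
  thus "norm (complex_of_real (acoef x k * exp (- s0 * nu k) * gs l (nu k - t))) \<le> real (ndiv k) * exp (- s0 * nu k)"
    unfolding norm_of_real abs_mult abs_exp_cancel abs_of_nonneg[OF gs_nonneg] by simp
qed simp

text \<open>The choice of s0 acts here: the square of exp (- s0 * \<nu>) times exp (\<theta> *
  \<nu>) is exp (- \<nu>), and the divisor squares then sum to a power of the harmonic sum.\<close>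

lemma divisor_bounded_weighted_sum:
  assumes "divisor_bounded q c F" and q: "q \<ge> 0"
  shows "(\<Sum>m\<in>F. (norm (c m))\<^sup>2 * exp (\<theta> * nu m)) \<le> harm q ^ 4"
proof -
  have F: "F \<subseteq> {m. nu m \<le> q}" "\<And>m. m \<in> F \<Longrightarrow> norm (c m) \<le> real (ndiv m) * exp (- s0 * nu m)"
    using assms by (auto simp: divisor_bounded_def)
  have "(\<Sum>m\<in>F. (norm (c m))\<^sup>2 * exp (\<theta> * nu m)) \<le> (\<Sum>m\<in>F. (real (ndiv m))\<^sup>2 * exp (- nu m))"
  proof (rule sum_mono)
    fix m assume m: "m \<in> F"
    have "(norm (c m))\<^sup>2 * exp (\<theta> * nu m) \<le> (real (ndiv m) * exp (- s0 * nu m))\<^sup>2 * exp (\<theta> * nu m)"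
      using F(2)[OF m] by (intro mult_right_mono power_mono) auto
    also have "\<dots> = (real (ndiv m))\<^sup>2 * (exp (2 * (- s0 * nu m)) * exp (\<theta> * nu m))" unfolding exp_double by (simp add: power_mult_distrib)
    also have "exp (2 * (- s0 * nu m)) * exp (\<theta> * nu m) = exp (- nu m)"
      unfolding exp_add[symmetric] by (simp add: s0_def field_simps)
    finally show "(norm (c m))\<^sup>2 * exp (\<theta> * nu m) \<le> (real (ndiv m))\<^sup>2 * exp (- nu m)" .
  qed
  also have "\<dots> \<le> (\<Sum>m | nu m \<le> q. (real (ndiv m))\<^sup>2 * exp (- nu m))" by (rule sum_mono2[OF finite_nu F(1)]) auto
  also have "\<dots> \<le> harm q ^ 4" by (rule divisor_square_sum)
  finally show ?thesis .
qed

text \<open>The weight factors as (exp ((1 - \<theta>) * \<nu>) + T) * exp (\<theta> * \<nu>). Of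
  the sixth power of q, two come from the derivative in the Sobolev bound and four from the harmonic
  sums.\<close>

lemma divisor_bounded_mean_value:
  "\<exists>K\<ge>1. \<forall>T\<ge>1. \<forall>q\<ge>1. \<forall>c F P. divisor_bounded q c F \<longrightarrow> finite P \<longrightarrow> (\<forall>a\<in>P. \<bar>a\<bar> \<le> 2 * T) \<longrightarrow> (\<forall>a\<in>P. \<forall>b\<in>P. a \<noteq> b \<longrightarrow> \<bar>a - b\<bar> > 1) \<longrightarrow>
     (\<Sum>t\<in>P. (norm (dpoly c F t))\<^sup>2) \<le> K * q ^ 6 * (exp ((1 - \<theta>) * q) + T)"
proof -
  obtain Kh where Kh: "Kh \<ge> 1" "\<And>q. q \<ge> 1 \<Longrightarrow> harm q \<le> Kh * q" using harm_bound by blast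
  define G where "G = 2 * exp (9 / 2) * sqrt (2 * pi) * gconst"
  have G: "G \<ge> 0" unfolding G_def using gconst_nonneg by simp
  show ?thesis
  proof (intro exI[of _ "max 1 (G * 2 * Kh ^ 4)"] conjI allI impI)
    fix T q :: real and c F P
    assume T: "1 \<le> T" and q: "1 \<le> q" and gd: "divisor_bounded q c F" and P: "finite P" "\<forall>a\<in>P. \<bar>a\<bar> \<le> 2 * T" "\<forall>a\<in>P. \<forall>b\<in>P. a \<noteq> b \<longrightarrow> 1 < \<bar>a - b\<bar>"
    have F: "finite F" "\<And>m. m \<in> F \<Longrightarrow> nu m \<le> q" using gd by (auto simp: divisor_bounded_def)
    have "(\<Sum>t\<in>P. (norm (dpoly c F t))\<^sup>2) \<le> G * (\<Sum>m\<in>F. (1 + (nu m)\<^sup>2) * (norm (c m))\<^sup>2 * (exp (nu m) + T * exp (\<theta> * nu m)))"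
      unfolding G_def by (rule dpoly_discrete_mean_value[OF F(1) T P(1)]) (use P in auto)
    also have "(\<Sum>m\<in>F. (1 + (nu m)\<^sup>2) * (norm (c m))\<^sup>2 * (exp (nu m) + T * exp (\<theta> * nu m))) \<le> (\<Sum>m\<in>F. (2 * q\<^sup>2 * (exp ((1 - \<theta>) * q) + T)) * ((norm (c m))\<^sup>2 * exp (\<theta> * nu m)))"
    proof (rule sum_mono)
      fix m assume m: "m \<in> F"
      have n: "0 \<le> nu m" "nu m \<le> q" using nu_nonneg[of m] F(2)[OF m] by auto
      have a: "1 + (nu m)\<^sup>2 \<le> 2 * q\<^sup>2"
      proof -
        have "(nu m)\<^sup>2 \<le> q\<^sup>2" using n by (intro power_mono) auto
        moreover have "1 \<le> q\<^sup>2" using q by (simp add: one_le_power)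
        ultimately show ?thesis by simp
      qed
      have "exp (nu m) = exp ((1 - \<theta>) * nu m) * exp (\<theta> * nu m)" unfolding exp_add[symmetric] by (simp add: algebra_simps)
      also have "\<dots> \<le> exp ((1 - \<theta>) * q) * exp (\<theta> * nu m)" using n theta by (intro mult_right_mono) (auto intro!: mult_left_mono)
      finally have b: "exp (nu m) + T * exp (\<theta> * nu m) \<le> (exp ((1 - \<theta>) * q) + T) * exp (\<theta> * nu m)" by (simp add: distrib_right)
      have "(1 + (nu m)\<^sup>2) * (norm (c m))\<^sup>2 * (exp (nu m) + T * exp (\<theta> * nu m)) \<le> (2 * q\<^sup>2) * (norm (c m))\<^sup>2 * ((exp ((1 - \<theta>) * q) + T) * exp (\<theta> * nu m))"
        using T by (intro mult_mono a b order_refl) auto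
      thus "(1 + (nu m)\<^sup>2) * (norm (c m))\<^sup>2 * (exp (nu m) + T * exp (\<theta> * nu m)) \<le> (2 * q\<^sup>2 * (exp ((1 - \<theta>) * q) + T)) * ((norm (c m))\<^sup>2 * exp (\<theta> * nu m))"
        by (simp add: mult_ac)
    qed
    also have "\<dots> = (2 * q\<^sup>2 * (exp ((1 - \<theta>) * q) + T)) * (\<Sum>m\<in>F. (norm (c m))\<^sup>2 * exp (\<theta> * nu m))" by (simp only: sum_distrib_left)
    also have "\<dots> \<le> (2 * q\<^sup>2 * (exp ((1 - \<theta>) * q) + T)) * (Kh * q) ^ 4"
      using q T by (intro mult_left_mono order_trans[OF divisor_bounded_weighted_sum[OF gd]] power_mono Kh harm_nonneg) auto
    finally have "(\<Sum>t\<in>P. (norm (dpoly c F t))\<^sup>2) \<le> G * ((2 * q\<^sup>2 * (exp ((1 - \<theta>) * q) + T)) * (Kh * q) ^ 4)"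
      using G by (simp add: mult_left_mono)
    also have "\<dots> = (G * 2 * Kh ^ 4) * (q ^ 6 * (exp ((1 - \<theta>) * q) + T))" by (simp add: power_mult_distrib mult_ac eval_nat_numeral)
    also have "\<dots> \<le> max 1 (G * 2 * Kh ^ 4) * (q ^ 6 * (exp ((1 - \<theta>) * q) + T))" using q T by (intro mult_right_mono) auto
    finally show "(\<Sum>t\<in>P. (norm (dpoly c F t))\<^sup>2) \<le> max 1 (G * 2 * Kh ^ 4) * q ^ 6 * (exp ((1 - \<theta>) * q) + T)" by (simp add: mult.assoc)
  qed simp
qed

end

section \<open>Large values\<close>

lemma separated_card_le:
  assumes "finite P" "\<And>a b. a \<in> P \<Longrightarrow> b \<in> P \<Longrightarrow> a \<noteq> b \<Longrightarrow> \<bar>a - b\<bar> > 1" "\<And>a. a \<in> P \<Longrightarrow> \<bar>a\<bar> \<le> M" "M \<ge> 0"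
  shows "real (card P) \<le> 2 * M + 1"
proof -
  have "(\<Sum>a\<in>P. (LINT u:{a + 0..a + 0 + 1}|lborel. (1::real))) \<le> (LINT u:{- M..M + 1}|lborel. (1::real))"
  proof (rule sum_separated_integrals[OF assms(1,2)])
    fix a assume "a \<in> P"
    from assms(3)[OF this] show "{a + 0..a + 0 + 1} \<subseteq> {- M..M + 1}" by (auto simp: abs_le_iff)
  qed (auto intro: set_integrable_continuous)
  thus ?thesis using assms(4) by (simp add: set_lebesgue_integral_def)
qed

lemma one_le_ln: "T \<ge> 3 \<Longrightarrow> ln T \<ge> (1::real)"
proof -
  assume T: "T \<ge> 3"
  have "exp (1::real) \<le> 3" by (rule exp_le)
  hence "exp 1 \<le> T" using T by linarith
  thus ?thesis using T by (subst ln_ge_iff) auto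
qed

text \<open>The moment is symmetrized to {- T..T} and the logarithm gets a natural exponent; T \<ge>
  3 ensures ln T \<ge> 1.\<close>

locale beurling_moment = beurling +
  fixes k H0 :: real and n :: nat
  assumes k: "k \<ge> 1" and H0: "H0 \<ge> 1"
    and moment: "T \<ge> 3 \<Longrightarrow> (LINT u:{- T..T}|lborel. zc u powr (2 * k)) \<le> H0 * T * (ln T) ^ n"
begin

text \<open>Differences of points, enlarged by their windows, reach a fixed multiple of T; ln (b *
  T) \<le> (ln b + 1) * ln T lets the constant absorb this.\<close>

lemma moment_scaled:
  assumes b: "b \<ge> 1"
  shows "\<exists>H1\<ge>1. \<forall>T\<ge>3. (LINT u:{- (b * T)..b * T}|lborel. zc u powr (2 * k)) \<le> H1 * T * (ln T) ^ n"
proof (intro exI[of _ "H0 * b * (ln b + 1) ^ n"] conjI allI impI)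
  have lb: "ln b \<ge> 0" using b by simp
  have "1 * 1 * 1 \<le> H0 * b * (ln b + 1) ^ n" using H0 b lb by (intro mult_mono one_le_power) auto
  thus "1 \<le> H0 * b * (ln b + 1) ^ n" by simp
  fix T :: real assume T: "3 \<le> T"
  have "1 * T \<le> b * T" using b T by (intro mult_right_mono) auto
  hence bT: "b * T \<ge> 3" using T by linarith
  have "ln (b * T) = ln b * 1 + ln T" using b T by (simp add: ln_mult)
  also have "\<dots> \<le> ln b * ln T + ln T" using lb one_le_ln[OF T] by (intro add_right_mono mult_left_mono) auto
  finally have "ln (b * T) \<le> (ln b + 1) * ln T" by (simp add: algebra_simps)
  moreover have "0 \<le> ln (b * T)" using bT by simp
  ultimately have "(ln (b * T)) ^ n \<le> ((ln b + 1) * ln T) ^ n" by (intro power_mono) auto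
  hence "H0 * (b * T) * (ln (b * T)) ^ n \<le> H0 * (b * T) * ((ln b + 1) * ln T) ^ n" using H0 bT by (intro mult_left_mono) auto
  with moment[OF bT] show "(LINT u:{- (b * T)..b * T}|lborel. zc u powr (2 * k)) \<le> H0 * b * (ln b + 1) ^ n * T * (ln T) ^ n"
    by (simp add: power_mult_distrib mult_ac)
qed

text \<open>\<open>halasz_moment\<close> with the level optimized. The power q^5 consists of four
  harmonic sums and the number of unit blocks; the Gaussian errors stay bounded per point because
  there are at most 5 * T points.\<close>

lemma divisor_bounded_halasz:
  assumes b: "b \<ge> 16"
  shows "\<exists>K\<ge>1. \<forall>T\<ge>3. \<forall>q\<ge>1. \<forall>c F P. divisor_bounded q c F \<longrightarrow> finite P \<longrightarrow> (\<forall>a\<in>P. \<bar>a\<bar> \<le> 2 * T) \<longrightarrow>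
     (\<forall>a\<in>P. \<forall>a'\<in>P. a \<noteq> a' \<longrightarrow> \<bar>a - a'\<bar> > 2 * (b * ln T)) \<longrightarrow>
     (\<Sum>t\<in>P. norm (dpoly c F t))\<^sup>2 \<le> K * q ^ 5 * (ln T) ^ (n + 1) * exp ((1 - s0) * q) *
        (real (card P) * exp ((1 - s0) * q) + real (card P) powr (2 - 1 / (2 * k)) * T powr (1 / (2 * k)))"
proof -
  obtain Kh where Kh: "Kh \<ge> 1" "\<And>q. q \<ge> 1 \<Longrightarrow> harm q \<le> Kh * q" using harm_bound by blast
  obtain H1 where H1: "H1 \<ge> 1" "\<And>T. T \<ge> 3 \<Longrightarrow> (LINT u:{- ((4 + b) * T)..(4 + b) * T}|lborel. zc u powr (2 * k)) \<le> H1 * T * (ln T) ^ n"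
    using moment_scaled[of "4 + b"] b by auto
  define Ka where "Ka = A * sqrt (2 * pi) * exp (1 / 2) * exp 1"
  define K5 where "K5 = 20 * exp 2 * Cz * (5 + b)"
  define Kb where "Kb = 6 * Ka + K5 + 3 * b * H1"
  have Ka0: "Ka \<ge> 0" unfolding Ka_def using A_pos by simp
  have K50: "K5 \<ge> 0" unfolding K5_def using Cz_nonneg b by simp
  have Kb0: "Kb \<ge> 0" unfolding Kb_def using Ka0 K50 b H1 by simp
  define K where "K = exp (1 / 2) * Kh ^ 4 * 3 * Kb"
  show ?thesis
  proof (intro exI[of _ "max 1 K"] conjI allI impI)
    fix T q :: real and c F P
    assume T: "3 \<le> T" and q: "1 \<le> q" and gd: "divisor_bounded q c F" and P: "finite P" "\<forall>a\<in>P. \<bar>a\<bar> \<le> 2 * T"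
      and sep: "\<forall>a\<in>P. \<forall>a'\<in>P. a \<noteq> a' \<longrightarrow> \<bar>a - a'\<bar> > 2 * (b * ln T)"
    define \<l> where "\<l> = ln T"
    have ell: "\<l> \<ge> 1" "\<l> \<le> T" using one_le_ln[OF T] ln_le_minus_one[of T] T by (auto simp: \<l>_def)
    define L where "L = b * \<l>"
    have L16: "L \<ge> 16 * \<l>" unfolding L_def using b ell by (intro mult_right_mono) auto
    hence L1: "L \<ge> 1" using ell by linarith
    define R where "R = real (card P)"
    define W where "W = R * exp ((1 - s0) * q) + R powr (2 - 1 / (2 * k)) * T powr (1 / (2 * k))"
    have F: "finite F" "\<And>m. m \<in> F \<Longrightarrow> nu m \<le> q" using gd by (auto simp: divisor_bounded_def)
    show "(\<Sum>t\<in>P. norm (dpoly c F t))\<^sup>2 \<le> max 1 K * q ^ 5 * (ln T) ^ (n + 1) * exp ((1 - s0) * q) *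
        (real (card P) * exp ((1 - s0) * q) + real (card P) powr (2 - 1 / (2 * k)) * T powr (1 / (2 * k)))"
    proof (cases "P = {}")
      case True
      thus ?thesis using q ell by (simp add: \<l>_def)
    next
      case False
      hence R1: "R \<ge> 1" unfolding R_def using P(1) by (simp add: Suc_le_eq card_gt_0_iff)
      define H where "H = H1 * T * \<l> ^ n"
      have Hpos: "H > 0" unfolding H_def using H1 T ell by simp
      \<comment> \<open>Balances the two parts of the level splitting: U powr (1 - 2 * k) * H = U *
        R.\<close>
      define U where "U = (H / R) powr (1 / (2 * k))"
      have U: "U > 0" unfolding U_def using Hpos R1 by simp
      have Up: "U powr (1 - 2 * k) * H = U * R"
      proof -
        have "U powr (2 * k) = H / R" unfolding U_def using Hpos R1 k by (simp add: powr_powr)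
        hence "U powr (1 - 2 * k) = U / (H / R)" using U by (simp add: powr_diff)
        thus ?thesis using Hpos R1 by simp
      qed
      have UR: "U * R = H powr (1 / (2 * k)) * R powr (1 - 1 / (2 * k))"
        unfolding U_def using Hpos R1 by (simp add: powr_divide powr_diff)
      have Hp: "H powr (1 / (2 * k)) \<le> H1 * \<l> ^ n * T powr (1 / (2 * k))"
      proof -
        have g: "1 \<le> H1 * \<l> ^ n" using H1 ell mult_mono[of 1 H1 1 "\<l> ^ n"] by (simp add: one_le_power)
        have "H powr (1 / (2 * k)) = (H1 * \<l> ^ n) powr (1 / (2 * k)) * T powr (1 / (2 * k))"
          unfolding H_def using g T H1 ell by (subst powr_mult[symmetric]) (auto simp: mult_ac)
        also have "(H1 * \<l> ^ n) powr (1 / (2 * k)) \<le> (H1 * \<l> ^ n) powr 1" using g k by (intro powr_mono) auto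
        finally show ?thesis using g T by (simp add: mult_right_mono)
      qed
      define J where "J = nat \<lceil>q\<rceil>"
      have J: "q \<le> real J" "real J \<le> q + 1" using q unfolding J_def by linarith+
      have R5: "R \<le> 5 * T"
      proof -
        have "R \<le> 2 * (2 * T) + 1" unfolding R_def
        proof (rule separated_card_le[OF P(1)])
          fix a a' assume "a \<in> P" "a' \<in> P" "a \<noteq> a'"
          hence "\<bar>a - a'\<bar> > 2 * L" using sep by (simp add: L_def \<l>_def)
          thus "\<bar>a - a'\<bar> > 1" using L1 by linarith
        qed (use P T in auto)
        thus ?thesis using T by linarith
      qed
      have Te: "exp (- \<l>) = 1 / T" using T by (simp add: \<l>_def exp_minus inverse_eq_divide)
      have LL: "L * 1 \<le> L\<^sup>2" unfolding power2_eq_square using L1 by (intro mult_left_mono) auto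
      have e1: "R * exp (- 2 * L\<^sup>2) \<le> 5"
      proof -
        have "exp (- 2 * L\<^sup>2) \<le> exp (- \<l>)" using LL L16 ell by simp
        hence "R * exp (- 2 * L\<^sup>2) \<le> (5 * T) * (1 / T)" unfolding Te using R5 R1 by (intro mult_mono) auto
        thus ?thesis using T by simp
      qed
      have e2: "R * (4 * exp 2 * Cz * (1 + (4 + b) * T) * exp (- (L\<^sup>2 / 4))) \<le> K5"
      proof -
        have "exp (- (L\<^sup>2 / 4)) \<le> exp (- \<l> + - \<l>)" using LL L16 ell by simp
        also have "\<dots> = (1 / T) * (1 / T)" unfolding exp_add Te ..
        finally have x: "exp (- (L\<^sup>2 / 4)) \<le> (1 / T) * (1 / T)" .
        have y: "1 + (4 + b) * T \<le> (5 + b) * T" using T by (simp add: algebra_simps)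
        have "R * (4 * exp 2 * Cz * (1 + (4 + b) * T) * exp (- (L\<^sup>2 / 4))) \<le> (5 * T) * (4 * exp 2 * Cz * ((5 + b) * T) * ((1 / T) * (1 / T)))"
          using R5 R1 Cz_nonneg b T by (intro mult_mono x y order_refl mult_nonneg_nonneg) auto
        also have "\<dots> = K5" using T by (simp add: K5_def)
        finally show ?thesis .
      qed
      have aJ: "A * sqrt (2 * pi) * exp (1 / 2) * exp ((1 - s0) * J) \<le> Ka * exp ((1 - s0) * q)"
      proof -
        have "(1 - s0) * J \<le> (1 - s0) * (q + 1)" using J s0 by (intro mult_left_mono) auto
        also have "\<dots> \<le> 1 + (1 - s0) * q" using s0 by (simp add: algebra_simps)
        finally have "exp ((1 - s0) * J) \<le> exp 1 * exp ((1 - s0) * q)" unfolding exp_add[symmetric] by simp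
        hence "A * sqrt (2 * pi) * exp (1 / 2) * exp ((1 - s0) * J) \<le> A * sqrt (2 * pi) * exp (1 / 2) * (exp 1 * exp ((1 - s0) * q))"
          using A_pos by (intro mult_left_mono) auto
        thus ?thesis by (simp add: Ka_def mult_ac)
      qed
      define S where "S = (\<Sum>m\<in>F. (norm (c m))\<^sup>2 * exp (s0 * nu m))"
      have S: "S \<le> exp ((1 - s0) * q) * (Kh * q) ^ 4"
      proof -
        have "S \<le> (\<Sum>m\<in>F. exp ((1 - s0) * q) * ((norm (c m))\<^sup>2 * exp (\<theta> * nu m)))" unfolding S_def
        proof (rule sum_mono)
          fix m assume m: "m \<in> F"
          have "s0 * nu m = (1 - s0) * nu m + \<theta> * nu m" by (simp add: s0_def field_simps)
          also have "\<dots> \<le> (1 - s0) * q + \<theta> * nu m" using F(2)[OF m] s0 by (intro add_right_mono mult_left_mono) auto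
          finally have "exp (s0 * nu m) \<le> exp ((1 - s0) * q) * exp (\<theta> * nu m)" unfolding exp_add[symmetric] by simp
          hence "(norm (c m))\<^sup>2 * exp (s0 * nu m) \<le> (norm (c m))\<^sup>2 * (exp ((1 - s0) * q) * exp (\<theta> * nu m))" by (intro mult_left_mono) auto
          thus "(norm (c m))\<^sup>2 * exp (s0 * nu m) \<le> exp ((1 - s0) * q) * ((norm (c m))\<^sup>2 * exp (\<theta> * nu m))" by (simp add: mult_ac)
        qed
        also have "\<dots> = exp ((1 - s0) * q) * (\<Sum>m\<in>F. (norm (c m))\<^sup>2 * exp (\<theta> * nu m))" by (simp only: sum_distrib_left)
        also have "\<dots> \<le> exp ((1 - s0) * q) * (Kh * q) ^ 4"
          using q by (intro mult_left_mono order_trans[OF divisor_bounded_weighted_sum[OF gd]] power_mono Kh harm_nonneg) auto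
        finally show ?thesis .
      qed
      have S0: "S \<ge> 0" unfolding S_def by (intro sum_nonneg) auto
      have H': "(LINT u:{- ((4 + b) * T)..(4 + b) * T}|lborel. zc u powr (2 * k)) \<le> H" using H1(2)[OF T] by (simp add: H_def \<l>_def)
      define Br where "Br = (A * sqrt (2 * pi) * exp (1 / 2) * exp ((1 - s0) * J) * (R + R\<^sup>2 * exp (- 2 * L\<^sup>2))
      + R * (2 * L * U * R + U powr (1 - 2 * k) * H) + R\<^sup>2 * (4 * exp 2 * Cz * (1 + (4 + b) * T) * exp (- (L\<^sup>2 / 4))))"
      have main: "(\<Sum>t\<in>P. norm (dpoly c F t))\<^sup>2 \<le> exp (1 / 2) * S * (real J + 1) * Br"
        unfolding S_def Br_def R_def
      proof (rule halasz_moment[OF P(1) F(1) _ _ _ _ H' _ U])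
        show "nu m \<le> real J" if "m \<in> F" for m using F(2)[OF that] J by linarith
        show "\<bar>a - a'\<bar> > 2 * L" if "a \<in> P" "a' \<in> P" "a \<noteq> a'" for a a' using sep that by (simp add: L_def \<l>_def)
        show "\<bar>a - a'\<bar> + L \<le> (4 + b) * T" if "a \<in> P" "a' \<in> P" for a a'
        proof -
          have "\<bar>a - a'\<bar> \<le> 4 * T" using P(2) that by (smt (verit))
          moreover have "L \<le> b * T" unfolding L_def using ell b by (intro mult_left_mono) auto
          ultimately show ?thesis by (simp add: distrib_right)
        qed
      qed (use L1 k in auto)
      have ellpow: "1 \<le> \<l> ^ (n + 1)" using ell(1) by (rule one_le_power)
      have Br: "Br \<le> Kb * \<l> ^ (n + 1) * W"
      proof -
        have b1: "A * sqrt (2 * pi) * exp (1 / 2) * exp ((1 - s0) * J) * (R + R\<^sup>2 * exp (- 2 * L\<^sup>2)) \<le> 6 * Ka * (R * exp ((1 - s0) * q))"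
        proof -
          have "R * (R * exp (- 2 * L\<^sup>2)) \<le> R * 5" using e1 R1 by (intro mult_left_mono) auto
          hence "R + R\<^sup>2 * exp (- 2 * L\<^sup>2) \<le> 6 * R" by (simp add: power2_eq_square mult.assoc)
          hence "A * sqrt (2 * pi) * exp (1 / 2) * exp ((1 - s0) * J) * (R + R\<^sup>2 * exp (- 2 * L\<^sup>2)) \<le> (Ka * exp ((1 - s0) * q)) * (6 * R)"
            using R1 Ka0 by (intro mult_mono aJ) auto
          thus ?thesis by (simp add: mult_ac)
        qed
        have b2: "R * (2 * L * U * R + U powr (1 - 2 * k) * H) \<le> (3 * b * H1) * \<l> ^ (n + 1) * (R powr (2 - 1 / (2 * k)) * T powr (1 / (2 * k)))"
        proof -
          have "R * (2 * L * U * R + U powr (1 - 2 * k) * H) = (2 * L + 1) * (R * (U * R))" unfolding Up by (simp add: algebra_simps)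
          also have "R * (U * R) = H powr (1 / (2 * k)) * (R powr 1 * R powr (1 - 1 / (2 * k)))" unfolding UR using R1 by simp
          also have "R powr 1 * R powr (1 - 1 / (2 * k)) = R powr (2 - 1 / (2 * k))" unfolding powr_add[symmetric] by simp
          also have "(2 * L + 1) * (H powr (1 / (2 * k)) * R powr (2 - 1 / (2 * k))) \<le> (3 * b * \<l>) * ((H1 * \<l> ^ n * T powr (1 / (2 * k))) * R powr (2 - 1 / (2 * k)))"
          proof (intro mult_mono Hp order_refl mult_nonneg_nonneg)
            have "3 * b * \<l> = 3 * L" by (simp add: L_def)
            thus "2 * L + 1 \<le> 3 * b * \<l>" using L1 by linarith
          qed (use L1 b ell H1 in auto)
          also have "\<dots> = (3 * b * H1) * \<l> ^ (n + 1) * (R powr (2 - 1 / (2 * k)) * T powr (1 / (2 * k)))" by (simp add: mult_ac)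
          finally show ?thesis .
        qed
        have b3: "R\<^sup>2 * (4 * exp 2 * Cz * (1 + (4 + b) * T) * exp (- (L\<^sup>2 / 4))) \<le> K5 * (R * exp ((1 - s0) * q))"
        proof -
          have "R\<^sup>2 * (4 * exp 2 * Cz * (1 + (4 + b) * T) * exp (- (L\<^sup>2 / 4))) = R * (R * (4 * exp 2 * Cz * (1 + (4 + b) * T) * exp (- (L\<^sup>2 / 4))))"
            by (simp add: power2_eq_square mult.assoc)
          also have "\<dots> \<le> R * K5" using e2 R1 by (intro mult_left_mono) auto
          also have "R * K5 * 1 \<le> R * K5 * exp ((1 - s0) * q)" using R1 K50 s0 q by (intro mult_left_mono) auto
          hence "R * K5 \<le> K5 * (R * exp ((1 - s0) * q))" by (simp add: mult_ac)
          finally show ?thesis .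
        qed
        have "Br \<le> (6 * Ka + K5) * (R * exp ((1 - s0) * q)) + (3 * b * H1) * \<l> ^ (n + 1) * (R powr (2 - 1 / (2 * k)) * T powr (1 / (2 * k)))"
          unfolding Br_def using b1 b2 b3 by (simp add: distrib_right)
        also have "\<dots> \<le> (Kb * \<l> ^ (n + 1)) * (R * exp ((1 - s0) * q)) + (Kb * \<l> ^ (n + 1)) * (R powr (2 - 1 / (2 * k)) * T powr (1 / (2 * k)))"
        proof (intro add_mono mult_right_mono)
          have "(6 * Ka + K5) * 1 \<le> Kb * \<l> ^ (n + 1)" using Ka0 K50 b H1 ellpow by (intro mult_mono) (auto simp: Kb_def)
          thus "6 * Ka + K5 \<le> Kb * \<l> ^ (n + 1)" by simp
          show "3 * b * H1 \<le> Kb" unfolding Kb_def using Ka0 K50 by simp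
        qed (use R1 ell in auto)
        also have "\<dots> = Kb * \<l> ^ (n + 1) * W" by (simp add: W_def distrib_left)
        finally show ?thesis .
      qed
      have W0: "W \<ge> 0" unfolding W_def using R1 by simp
      have "(\<Sum>t\<in>P. norm (dpoly c F t))\<^sup>2 \<le> exp (1 / 2) * (exp ((1 - s0) * q) * (Kh * q) ^ 4) * (3 * q) * (Kb * \<l> ^ (n + 1) * W)"
      proof (rule order_trans[OF main], rule mult_mono[OF mult_mono[OF mult_left_mono[OF S]] Br])
        show "real J + 1 \<le> 3 * q" using J q by linarith
        show "0 \<le> Br" unfolding Br_def using A_pos R1 L1 U Hpos Cz_nonneg b T
          by (intro add_nonneg_nonneg mult_nonneg_nonneg) auto
      qed (use S0 Kh q in auto)
      also have "\<dots> = K * (q ^ 5 * \<l> ^ (n + 1) * exp ((1 - s0) * q) * W)"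
        by (simp add: K_def power_mult_distrib mult_ac eval_nat_numeral)
      also have "\<dots> \<le> max 1 K * (q ^ 5 * \<l> ^ (n + 1) * exp ((1 - s0) * q) * W)" using q ell W0 by (intro mult_right_mono) auto
      finally show ?thesis unfolding W_def R_def \<l>_def by (simp only: mult.assoc)
    qed
  qed simp
qed

text \<open>A Chebyshev bound: the windows are disjoint, so their local moments add up to at most
  the global one.\<close>

lemma zmass_count:
  assumes b: "b \<ge> 16"
  shows "\<exists>K\<ge>1. \<exists>N. \<forall>T\<ge>3. \<forall>G U. finite G \<longrightarrow> (\<forall>a\<in>G. \<bar>a\<bar> \<le> T) \<longrightarrow>
     (\<forall>a\<in>G. \<forall>a'\<in>G. a \<noteq> a' \<longrightarrow> \<bar>a - a'\<bar> > 2 * (b * ln T)) \<longrightarrow> U > 0 \<longrightarrow> (\<forall>a\<in>G. zmass (b * ln T) a \<ge> U) \<longrightarrow>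
     real (card G) \<le> K * (ln T) ^ N * T * U powr (- (2 * k))"
proof -
  obtain H1 where H1: "H1 \<ge> 1" "\<And>T. T \<ge> 3 \<Longrightarrow> (LINT u:{- ((1 + b) * T)..(1 + b) * T}|lborel. zc u powr (2 * k)) \<le> H1 * T * (ln T) ^ n"
    using moment_scaled[of "1 + b"] b by auto
  define N1 where "N1 = nat \<lceil>2 * k\<rceil>"
  show ?thesis
  proof (intro exI[of _ "max 1 (2 * (4 * b) ^ N1 * H1)"] conjI exI[of _ "N1 + n"] allI impI)
    fix T U :: real and G
    assume T: "3 \<le> T" and G: "finite G" "\<forall>a\<in>G. \<bar>a\<bar> \<le> T" and sep: "\<forall>a\<in>G. \<forall>a'\<in>G. a \<noteq> a' \<longrightarrow> \<bar>a - a'\<bar> > 2 * (b * ln T)"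
      and U: "0 < U" and z: "\<forall>a\<in>G. U \<le> zmass (b * ln T) a"
    define \<l> where "\<l> = ln T"
    have ell: "\<l> \<ge> 1" "\<l> \<le> T" using one_le_ln[OF T] ln_le_minus_one[of T] T by (auto simp: \<l>_def)
    define L where "L = b * \<l>"
    have "16 * 1 \<le> L" unfolding L_def using b ell by (intro mult_mono) auto
    hence L1: "L \<ge> 1" by simp
    define R where "R = real (card G)"
    define H where "H = H1 * T * \<l> ^ n"
    \<comment> \<open>With this level the first part of \<open>zmass_le\<close> equals U / 2 and is
      absorbed on the left.\<close>
    define U' where "U' = U / (4 * L)"
    have U': "U' > 0" using U L1 by (simp add: U'_def)
    have "R * U = (\<Sum>a\<in>G. U)" by (simp add: R_def)
    also have "\<dots> \<le> (\<Sum>a\<in>G. zmass L a)" using z by (intro sum_mono) (simp add: L_def \<l>_def)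
    also have "\<dots> \<le> (\<Sum>a\<in>G. 2 * L * U' + U' powr (1 - 2 * k) * (LINT u:{a - 0 - L..a - 0 + L}|lborel. zc u powr (2 * k)))"
      unfolding diff_0_right using L1 k by (intro sum_mono zmass_le U') auto
    also have "\<dots> = R * (2 * L * U') + U' powr (1 - 2 * k) * (\<Sum>a\<in>G. (LINT u:{a - 0 - L..a - 0 + L}|lborel. zc u powr (2 * k)))"
      by (simp add: sum.distrib sum_distrib_left R_def)
    also have "2 * L * U' = U / 2" using L1 by (simp add: U'_def)
    also have "(\<Sum>a\<in>G. (LINT u:{a - 0 - L..a - 0 + L}|lborel. zc u powr (2 * k))) \<le> H"
    proof -
      have "(\<Sum>a\<in>G. (LINT u:{a - 0 - L..a - 0 + L}|lborel. zc u powr (2 * k))) \<le> (LINT u:{- ((1 + b) * T)..(1 + b) * T}|lborel. zc u powr (2 * k))"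
      proof (rule sum_local_moments[OF _ G(1)])
        show "\<bar>a - a'\<bar> > 2 * L" if "a \<in> G" "a' \<in> G" "a \<noteq> a'" for a a' using sep that by (simp add: L_def \<l>_def)
        show "\<bar>a - 0\<bar> + L \<le> (1 + b) * T" if "a \<in> G" for a
        proof -
          have "L \<le> b * T" unfolding L_def using ell b by (intro mult_left_mono) auto
          moreover have "\<bar>a\<bar> \<le> T" using G that by auto
          ultimately show ?thesis by (simp add: distrib_right)
        qed
      qed (use k in auto)
      also have "\<dots> \<le> H" using H1(2)[OF T] by (simp add: H_def \<l>_def)
      finally show ?thesis .
    qed
    finally have "R * U \<le> R * (U / 2) + U' powr (1 - 2 * k) * H" by (simp add: mult_left_mono)
    hence "R * U \<le> 2 * (U' powr (1 - 2 * k) * H)" by simp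
    hence "R \<le> 2 * (U' powr (1 - 2 * k) * H) / U" using U by (simp add: field_simps)
    also have "U' powr (1 - 2 * k) = (4 * L) powr (2 * k - 1) * (U * U powr (- (2 * k)))"
    proof -
      have "U' powr (1 - 2 * k) = U powr (1 - 2 * k) / (4 * L) powr (1 - 2 * k)" unfolding U'_def using U L1 by (simp add: powr_divide)
      also have "\<dots> = U powr (1 - 2 * k) * (4 * L) powr (2 * k - 1)" by (simp add: powr_minus_divide[of _ "2 * k - 1", symmetric] divide_inverse powr_minus[symmetric])
      also have "U powr (1 - 2 * k) = U * U powr (- (2 * k))" using U powr_add[of U 1 "- (2 * k)"] by simp
      finally show ?thesis by (simp only: mult_ac)
    qed
    also have "2 * ((4 * L) powr (2 * k - 1) * (U * U powr (- (2 * k))) * H) / U = 2 * (4 * L) powr (2 * k - 1) * H * U powr (- (2 * k))"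
      using U by simp
    also have "\<dots> \<le> 2 * (4 * L) ^ N1 * H * U powr (- (2 * k))"
    proof (intro mult_right_mono mult_left_mono)
      have "2 * k \<le> real N1" unfolding N1_def by (rule real_nat_ceiling_ge)
      hence "(4 * L) powr (2 * k - 1) \<le> (4 * L) powr (real N1)" using L1 by (intro powr_mono) auto
      also have "\<dots> = (4 * L) ^ N1" using L1 by (intro powr_realpow) auto
      finally show "(4 * L) powr (2 * k - 1) \<le> (4 * L) ^ N1" .
    qed (use H1 T ell in \<open>auto simp: H_def\<close>)
    also have "\<dots> = (2 * (4 * b) ^ N1 * H1) * (\<l> ^ (N1 + n) * T * U powr (- (2 * k)))"
      by (simp add: H_def L_def power_mult_distrib power_add mult_ac)
    also have "\<dots> \<le> max 1 (2 * (4 * b) ^ N1 * H1) * (\<l> ^ (N1 + n) * T * U powr (- (2 * k)))" using ell T by (intro mult_right_mono) auto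
    finally show "real (card G) \<le> max 1 (2 * (4 * b) ^ N1 * H1) * (ln T) ^ (N1 + n) * T * U powr (- (2 * k))"
      unfolding R_def \<l>_def by (simp only: mult.assoc)
  qed simp
qed

lemma large_values_mean_value:
  "\<exists>K\<ge>1. \<forall>T\<ge>1. \<forall>q\<ge>1. \<forall>c F P V. divisor_bounded q c F \<longrightarrow> finite P \<longrightarrow> (\<forall>a\<in>P. \<bar>a\<bar> \<le> 2 * T) \<longrightarrow> (\<forall>a\<in>P. \<forall>b\<in>P. a \<noteq> b \<longrightarrow> \<bar>a - b\<bar> > 1) \<longrightarrow>
     V > 0 \<longrightarrow> (\<forall>a\<in>P. V \<le> norm (dpoly c F a)) \<longrightarrow> real (card P) \<le> K * q ^ 6 * (exp ((1 - \<theta>) * q) + T) / V\<^sup>2"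
proof -
  from divisor_bounded_mean_value obtain K where K: "K \<ge> 1 \<and> (\<forall>T\<ge>1. \<forall>q\<ge>1. \<forall>c F P. divisor_bounded q c F \<longrightarrow> finite P \<longrightarrow> (\<forall>a\<in>P. \<bar>a\<bar> \<le> 2 * T) \<longrightarrow> (\<forall>a\<in>P. \<forall>b\<in>P. a \<noteq> b \<longrightarrow> \<bar>a - b\<bar> > 1) \<longrightarrow>
     (\<Sum>t\<in>P. (norm (dpoly c F t))\<^sup>2) \<le> K * q ^ 6 * (exp ((1 - \<theta>) * q) + T))" by (rule exE)
  show ?thesis
  proof (intro exI[of _ K] conjI allI impI conjunct1[OF K])
    fix T q V :: real and c F P
    assume a: "1 \<le> T" "1 \<le> q" "divisor_bounded q c F" "finite P" "\<forall>a\<in>P. \<bar>a\<bar> \<le> 2 * T" "\<forall>a\<in>P. \<forall>b\<in>P. a \<noteq> b \<longrightarrow> \<bar>a - b\<bar> > 1"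
      and V: "V > 0" "\<forall>a\<in>P. V \<le> norm (dpoly c F a)"
    have "real (card P) * V\<^sup>2 = (\<Sum>t\<in>P. V\<^sup>2)" by simp
    also have "\<dots> \<le> (\<Sum>t\<in>P. (norm (dpoly c F t))\<^sup>2)" using V by (intro sum_mono power_mono) auto
    also have "\<dots> \<le> K * q ^ 6 * (exp ((1 - \<theta>) * q) + T)" by (rule conjunct2[OF K, THEN spec, THEN mp, OF a(1), THEN spec, THEN mp, OF a(2), THEN spec, THEN spec, THEN spec, THEN mp, OF a(3), THEN mp, OF a(4), THEN mp, OF a(5), THEN mp, OF a(6)])
    finally show "real (card P) \<le> K * q ^ 6 * (exp ((1 - \<theta>) * q) + T) / V\<^sup>2" using V by (simp add: field_simps)
  qed
qed

text \<open>If R exceeds 2 * X, the other term must carry at least half of R, and cancelling R powr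
  (1 - s) bounds R powr s by 2 * Y.\<close>

lemma le_of_self_bound:
  fixes R X Y s :: real
  assumes s: "0 < s" and R: "R \<ge> 0" and X: "X \<ge> 0" and le: "R \<le> X + Y * R powr (1 - s)"
  shows "R \<le> 2 * X + (2 * Y) powr (1 / s)"
proof (cases "R \<le> 2 * X")
  case True
  moreover have "0 \<le> (2 * Y) powr (1 / s)" by simp
  ultimately show ?thesis by linarith
next
  case False
  hence R0: "R > 0" using X by linarith
  have "R \<le> 2 * (Y * R powr (1 - s))" using False le by linarith
  moreover have "R = R powr s * R powr (1 - s)" using R0 by (simp flip: powr_add)
  ultimately have "R powr s * R powr (1 - s) \<le> (2 * Y) * R powr (1 - s)" by simp
  hence "R powr s \<le> 2 * Y" using R0 by (simp add: mult_le_cancel_right)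
  hence "(R powr s) powr (1 / s) \<le> (2 * Y) powr (1 / s)" using s by (intro powr_mono2) auto
  moreover have "(R powr s) powr (1 / s) = R" using R0 s by (simp add: powr_powr)
  ultimately show ?thesis using X by linarith
qed

text \<open>At points with |dpoly| \<ge> V the Halasz inequality bounds R^2 * V^2 by terms in R and
  R powr (2 - 1 / (2 * k)). Division by R leaves an inequality for R in terms of itself, which
  \<open>le_of_self_bound\<close> resolves.\<close>

lemma large_values_halasz:
  assumes b: "b \<ge> 16"
  shows "\<exists>K\<ge>1. \<forall>T\<ge>3. \<forall>q\<ge>1. \<forall>c F P V. divisor_bounded q c F \<longrightarrow> finite P \<longrightarrow> (\<forall>a\<in>P. \<bar>a\<bar> \<le> 2 * T) \<longrightarrow>
     (\<forall>a\<in>P. \<forall>a'\<in>P. a \<noteq> a' \<longrightarrow> \<bar>a - a'\<bar> > 2 * (b * ln T)) \<longrightarrow>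
     V > 0 \<longrightarrow> (\<forall>a\<in>P. V \<le> norm (dpoly c F a)) \<longrightarrow>
     real (card P) \<le> 2 * (K * q ^ 5 * (ln T) ^ (n + 1) * exp (2 * (1 - s0) * q) / V\<^sup>2)
        + (2 * (K * q ^ 5 * (ln T) ^ (n + 1) * exp ((1 - s0) * q) / V\<^sup>2)) powr (2 * k) * T"
proof -
  from divisor_bounded_halasz[OF b] obtain K where K: "K \<ge> 1 \<and> (\<forall>T\<ge>3. \<forall>q\<ge>1. \<forall>c F P. divisor_bounded q c F \<longrightarrow> finite P \<longrightarrow> (\<forall>a\<in>P. \<bar>a\<bar> \<le> 2 * T) \<longrightarrow>
     (\<forall>a\<in>P. \<forall>a'\<in>P. a \<noteq> a' \<longrightarrow> \<bar>a - a'\<bar> > 2 * (b * ln T)) \<longrightarrow>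
     (\<Sum>t\<in>P. norm (dpoly c F t))\<^sup>2 \<le> K * q ^ 5 * (ln T) ^ (n + 1) * exp ((1 - s0) * q) *
        (real (card P) * exp ((1 - s0) * q) + real (card P) powr (2 - 1 / (2 * k)) * T powr (1 / (2 * k))))" by (rule exE)
  show ?thesis
  proof (intro exI[of _ K] conjI allI impI conjunct1[OF K])
    fix T q V :: real and c F P
    assume a: "3 \<le> T" "1 \<le> q" "divisor_bounded q c F" "finite P" "\<forall>a\<in>P. \<bar>a\<bar> \<le> 2 * T" "\<forall>a\<in>P. \<forall>a'\<in>P. a \<noteq> a' \<longrightarrow> \<bar>a - a'\<bar> > 2 * (b * ln T)"
      and V: "V > 0" "\<forall>a\<in>P. V \<le> norm (dpoly c F a)"
    define R where "R = real (card P)"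
    define s where "s = 1 / (2 * k)"
    have s: "s > 0" "1 / s = 2 * k" using k by (auto simp: s_def)
    define B where "B = K * q ^ 5 * (ln T) ^ (n + 1)"
    have B0: "B \<ge> 0" unfolding B_def using conjunct1[OF K] a(1,2) one_le_ln[OF a(1)] by simp
    define e where "e = exp ((1 - s0) * q)"
    have e2: "exp (2 * (1 - s0) * q) = e * e" unfolding e_def exp_add[symmetric] by simp
    have "R * V \<le> (\<Sum>t\<in>P. norm (dpoly c F t))" using sum_mono[of P "\<lambda>_. V"] V by (simp add: R_def)
    hence "(R * V)\<^sup>2 \<le> (\<Sum>t\<in>P. norm (dpoly c F t))\<^sup>2" using V by (intro power_mono) (auto simp: R_def)
    also have "\<dots> \<le> B * e * (R * e + R powr (2 - s) * T powr s)" unfolding B_def e_def R_def s_def by (rule conjunct2[OF K, THEN spec, THEN mp, OF a(1), THEN spec, THEN mp, OF a(2), THEN spec, THEN spec, THEN spec, THEN mp, OF a(3), THEN mp, OF a(4), THEN mp, OF a(5), THEN mp, OF a(6)])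
    finally have m: "(R * V)\<^sup>2 \<le> B * e * (R * e + R powr (2 - s) * T powr s)" .
    have "R \<le> B * (e * e) / V\<^sup>2 + (B * e / V\<^sup>2 * T powr s) * R powr (1 - s)"
    proof (cases "R = 0")
      case True
      thus ?thesis using B0 by (simp add: e_def)
    next
      case False
      hence R0: "R > 0" by (simp add: R_def)
      have "R powr (2 - s) = R * R powr (1 - s)" using R0 powr_add[of R 1 "1 - s"] by simp
      hence "R * (R * V\<^sup>2) \<le> R * (B * e * (e + R powr (1 - s) * T powr s))" using m by (simp add: power2_eq_square algebra_simps)
      hence "R * V\<^sup>2 \<le> B * e * (e + R powr (1 - s) * T powr s)" using R0 by (simp only: mult_le_cancel_left_pos)
      hence "R \<le> (B * e * (e + R powr (1 - s) * T powr s)) / V\<^sup>2" using V by (simp add: field_simps)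
      thus ?thesis by (simp add: add_divide_distrib algebra_simps)
    qed
    from le_of_self_bound[OF s(1) _ _ this]
    have "R \<le> 2 * (B * (e * e) / V\<^sup>2) + (2 * (B * e / V\<^sup>2 * T powr s)) powr (2 * k)" using B0 by (simp add: s(2) R_def e_def)
    also have "(2 * (B * e / V\<^sup>2 * T powr s)) powr (2 * k) = (2 * (B * e / V\<^sup>2)) powr (2 * k) * T"
    proof -
      have "(2 * (B * e / V\<^sup>2 * T powr s)) powr (2 * k) = (2 * (B * e / V\<^sup>2)) powr (2 * k) * (T powr s) powr (2 * k)"
        using B0 by (subst powr_mult[symmetric]) (auto simp: e_def mult_ac)
      also have "(T powr s) powr (2 * k) = T" using k a by (simp add: powr_powr s_def)
      finally show ?thesis .
    qed
    finally show "real (card P) \<le> 2 * (K * q ^ 5 * (ln T) ^ (n + 1) * exp (2 * (1 - s0) * q) / V\<^sup>2)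
        + (2 * (K * q ^ 5 * (ln T) ^ (n + 1) * exp ((1 - s0) * q) / V\<^sup>2)) powr (2 * k) * T"
      unfolding e2 e_def[symmetric] B_def[symmetric] R_def .
  qed
qed

text \<open>Spacing 6 * L with L = b * ln T leaves room for the sample points u, which lie within L
  of the ordinates and must still be more than 2 * L apart. The lower bound on the height is the one
  that suppresses the pole in \<open>zero_detection\<close>.\<close>

definition zero_set :: "real \<Rightarrow> real \<Rightarrow> real \<Rightarrow> complex set \<Rightarrow> bool" where
  "zero_set b T \<alpha> G \<longleftrightarrow> finite G \<and> (\<forall>\<rho>\<in>G. zet \<rho> = 0 \<and> \<alpha> \<le> Re \<rho> \<and> Re \<rho> \<le> 1 \<and> b * ln T \<le> \<bar>Im \<rho>\<bar> \<and> \<bar>Im \<rho>\<bar> \<le> T) \<and>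
     (\<forall>\<rho>\<in>G. \<forall>\<rho>'\<in>G. \<rho> \<noteq> \<rho>' \<longrightarrow> \<bar>Im \<rho> - Im \<rho>'\<bar> > 6 * (b * ln T))"

definition pint :: "real \<Rightarrow> real \<Rightarrow> real \<Rightarrow> real \<Rightarrow> real \<Rightarrow> real" where
  "pint l x y \<delta> \<gamma> = (LINT t:{x - 1..<y}|lborel. exp (- \<delta> * t) * norm (ppoly l x t \<gamma>))"

text \<open>Keeps only three spaced sets of real points, since the counting lemmas refer to
  ordinates and sample points and no longer to zeros.\<close>

definition splits :: "real \<Rightarrow> real \<Rightarrow> real \<Rightarrow> real \<Rightarrow> real \<Rightarrow> real \<Rightarrow> real \<Rightarrow> real \<Rightarrow> complex set \<Rightarrow> bool" where
  "splits b c2 T \<alpha> x y U V G \<longleftrightarrow>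
     (\<exists>G1 G2 Q. finite G1 \<and> finite G2 \<and> finite Q \<and> (\<forall>a\<in>G1 \<union> G2. \<bar>a\<bar> \<le> T) \<and> (\<forall>u\<in>Q. \<bar>u\<bar> \<le> 2 * T) \<and>
       (\<forall>a\<in>G1. \<forall>a'\<in>G1. a \<noteq> a' \<longrightarrow> \<bar>a - a'\<bar> > 2 * (b * ln T)) \<and>
       (\<forall>a\<in>G2. \<forall>a'\<in>G2. a \<noteq> a' \<longrightarrow> \<bar>a - a'\<bar> > 2 * (b * ln T)) \<and>
       (\<forall>a\<in>Q. \<forall>a'\<in>Q. a \<noteq> a' \<longrightarrow> \<bar>a - a'\<bar> > 2 * (b * ln T)) \<and>
       (\<forall>\<gamma>\<in>G1. c2 / (2 * ln T) \<le> pint (b * ln T) x y (\<alpha> - s0) \<gamma>) \<and>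
       (\<forall>\<gamma>\<in>G2. U \<le> zmass (b * ln T) \<gamma>) \<and> (\<forall>u\<in>Q. V \<le> norm (mpoly x (Complex s0 u))) \<and>
       card G \<le> card G1 + card G2 + card Q)"

text \<open>If a zero fell under none of the three cases, the polynomials would give less than half
  of the lower bound, and the condition on U * V limits the tail to the other half.\<close>

lemma zeros_split:
  assumes c: "c \<ge> 1"
  shows "\<exists>b\<ge>16. \<exists>c2>0. \<exists>T0\<ge>3. \<forall>T\<ge>T0. \<forall>\<alpha> x y G U V. s0 + 2 / ln T \<le> \<alpha> \<longrightarrow> 1 \<le> x \<longrightarrow> x \<le> c * ln T \<longrightarrow> 0 \<le> y \<longrightarrow> y \<le> c * ln T \<longrightarrow>
     zero_set b T \<alpha> G \<longrightarrow> U > 0 \<longrightarrow> V > 0 \<longrightarrow> U * V \<le> c2 * exp ((\<alpha> - s0) * y) / (2 * (ln T)\<^sup>2) \<longrightarrow>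
     splits b c2 T \<alpha> x y U V G"
proof -
  obtain b c2 T0 where b: "b \<ge> 16" and c2: "c2 > 0" and T0: "T0 \<ge> 3" and zd: "\<And>T \<alpha> x y \<rho>. T \<ge> T0 \<Longrightarrow> s0 + 2 / ln T \<le> \<alpha> \<Longrightarrow> 1 \<le> x \<Longrightarrow> x \<le> c * ln T \<Longrightarrow> 0 \<le> y \<Longrightarrow> y \<le> c * ln T \<Longrightarrow>
     zet \<rho> = 0 \<Longrightarrow> \<alpha> \<le> Re \<rho> \<Longrightarrow> Re \<rho> \<le> 1 \<Longrightarrow> b * ln T \<le> \<bar>Im \<rho>\<bar> \<Longrightarrow> \<bar>Im \<rho>\<bar> \<le> T \<Longrightarrow>
     (\<exists>u. \<bar>u - Im \<rho>\<bar> \<le> b * ln T \<and> c2 / sqrt (ln T) \<le> pint (b * ln T) x y (\<alpha> - s0) (Im \<rho>) +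
        ln T * exp (- (\<alpha> - s0) * y) * (norm (mpoly x (Complex s0 u)) * zmass (b * ln T) (Im \<rho>)))"
    using zero_detection[OF c] unfolding pint_def by blast
  show ?thesis
  proof (rule exI[of _ b], intro conjI b, rule exI[of _ c2], intro conjI c2, rule exI[of _ T0], intro conjI T0 allI impI)
    fix T \<alpha> x y U V :: real and G
    assume T: "T0 \<le> T" and al: "s0 + 2 / ln T \<le> \<alpha>" and x: "1 \<le> x" "x \<le> c * ln T" and y: "0 \<le> y" "y \<le> c * ln T"
      and zs: "zero_set b T \<alpha> G" and U: "0 < U" and V: "0 < V" and UV: "U * V \<le> c2 * exp ((\<alpha> - s0) * y) / (2 * (ln T)\<^sup>2)"
    have T3: "T \<ge> 3" using T T0 by linarith
    define \<l> where "\<l> = ln T"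
    have ell: "\<l> \<ge> 1" using one_le_ln[OF T3] by (simp add: \<l>_def)
    define L where "L = b * \<l>"
    have Lpos: "L > 0" unfolding L_def using b ell by simp
    have G: "finite G" "\<And>\<rho>. \<rho> \<in> G \<Longrightarrow> zet \<rho> = 0" "\<And>\<rho>. \<rho> \<in> G \<Longrightarrow> \<alpha> \<le> Re \<rho>" "\<And>\<rho>. \<rho> \<in> G \<Longrightarrow> Re \<rho> \<le> 1"
       "\<And>\<rho>. \<rho> \<in> G \<Longrightarrow> L \<le> \<bar>Im \<rho>\<bar>" "\<And>\<rho>. \<rho> \<in> G \<Longrightarrow> \<bar>Im \<rho>\<bar> \<le> T"
       and sep: "\<And>\<rho> \<rho>'. \<rho> \<in> G \<Longrightarrow> \<rho>' \<in> G \<Longrightarrow> \<rho> \<noteq> \<rho>' \<Longrightarrow> \<bar>Im \<rho> - Im \<rho>'\<bar> > 6 * L"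
      using zs by (auto simp: zero_set_def L_def \<l>_def)
    have "\<forall>\<rho>\<in>G. \<exists>u. \<bar>u - Im \<rho>\<bar> \<le> L \<and> c2 / sqrt \<l> \<le> pint L x y (\<alpha> - s0) (Im \<rho>) +
        \<l> * exp (- (\<alpha> - s0) * y) * (norm (mpoly x (Complex s0 u)) * zmass L (Im \<rho>))"
      using zd[OF T al x y] G(2-6) unfolding L_def \<l>_def by blast
    then obtain u where u: "\<And>\<rho>. \<rho> \<in> G \<Longrightarrow> \<bar>u \<rho> - Im \<rho>\<bar> \<le> L" and ud: "\<And>\<rho>. \<rho> \<in> G \<Longrightarrow> c2 / sqrt \<l> \<le> pint L x y (\<alpha> - s0) (Im \<rho>) +
        \<l> * exp (- (\<alpha> - s0) * y) * (norm (mpoly x (Complex s0 (u \<rho>))) * zmass L (Im \<rho>))" by metis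
    define A1 where "A1 = {\<rho> \<in> G. c2 / (2 * \<l>) \<le> pint L x y (\<alpha> - s0) (Im \<rho>)}"
    define A2 where "A2 = {\<rho> \<in> G. U \<le> zmass L (Im \<rho>)}"
    define A3 where "A3 = {\<rho> \<in> G. V \<le> norm (mpoly x (Complex s0 (u \<rho>)))}"
    have "\<rho> \<in> A1 \<union> A2 \<union> A3" if r: "\<rho> \<in> G" for \<rho>
    proof (rule ccontr)
      assume n: "\<rho> \<notin> A1 \<union> A2 \<union> A3"
      have "sqrt \<l> \<le> \<l>" using ell by (intro real_le_lsqrt) (auto simp: power2_eq_square)
      hence "c2 / \<l> \<le> c2 / sqrt \<l>" using ell c2 by (intro divide_left_mono) auto
      moreover have "pint L x y (\<alpha> - s0) (Im \<rho>) < c2 / (2 * \<l>)" using n r by (auto simp: A1_def)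
      moreover have "c2 / \<l> = c2 / (2 * \<l>) + c2 / (2 * \<l>)" using ell by (simp add: field_simps)
      ultimately have "c2 / (2 * \<l>) < \<l> * exp (- (\<alpha> - s0) * y) * (norm (mpoly x (Complex s0 (u \<rho>))) * zmass L (Im \<rho>))"
        using ud[OF r] by linarith
      also have "\<dots> \<le> \<l> * exp (- (\<alpha> - s0) * y) * (V * U)"
        using n r ell V zmass_nonneg[of L "Im \<rho>"] by (intro mult_left_mono mult_mono) (auto simp: A2_def A3_def)
      also have "\<dots> \<le> \<l> * exp (- (\<alpha> - s0) * y) * (c2 * exp ((\<alpha> - s0) * y) / (2 * \<l>\<^sup>2))"
        using UV ell by (intro mult_left_mono) (auto simp: \<l>_def mult.commute)
      also have "\<dots> = (exp (- (\<alpha> - s0) * y) * exp ((\<alpha> - s0) * y)) * (c2 / (2 * \<l>))" using ell by (simp add: power2_eq_square)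
      also have "exp (- (\<alpha> - s0) * y) * exp ((\<alpha> - s0) * y) = 1" unfolding exp_add[symmetric] by (simp add: algebra_simps)
      finally show False by simp
    qed
    hence Gsub: "G \<subseteq> A1 \<union> A2 \<union> A3" by blast
    have AG: "A1 \<subseteq> G" "A2 \<subseteq> G" "A3 \<subseteq> G" by (auto simp: A1_def A2_def A3_def)
    have fin: "finite A1" "finite A2" "finite A3" using AG G(1) finite_subset by blast+
    have injI: "inj_on Im B" if "B \<subseteq> G" for B
      by (rule inj_onI) (use sep that Lpos in fastforce)
    have usep: "\<bar>u \<rho> - u \<rho>'\<bar> > 2 * L" if "\<rho> \<in> G" "\<rho>' \<in> G" "\<rho> \<noteq> \<rho>'" for \<rho> \<rho>'
      using u[OF that(1)] u[OF that(2)] sep[OF that] Lpos by linarith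
    have injU: "inj_on u A3"
      by (rule inj_onI) (use usep AG Lpos in fastforce)
    have "card G \<le> card (A1 \<union> A2 \<union> A3)" using fin Gsub by (intro card_mono) auto
    also have "\<dots> \<le> card A1 + card A2 + card A3" by (meson card_Un_le order_trans add_right_mono)
    also have "card A1 = card (Im ` A1)" by (rule card_image[symmetric, OF injI[OF AG(1)]])
    also have "card A2 = card (Im ` A2)" by (rule card_image[symmetric, OF injI[OF AG(2)]])
    also have "card A3 = card (u ` A3)" by (rule card_image[symmetric, OF injU])
    finally have card: "card G \<le> card (Im ` A1) + card (Im ` A2) + card (u ` A3)" .
    have isep: "\<bar>Im \<rho> - Im \<rho>'\<bar> > 2 * L" if "\<rho> \<in> G" "\<rho>' \<in> G" "\<rho> \<noteq> \<rho>'" for \<rho> \<rho>' using sep[OF that] Lpos by linarith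
    have ub: "\<bar>u \<rho>\<bar> \<le> 2 * T" if "\<rho> \<in> G" for \<rho> using u[OF that] G(5,6)[OF that] by linarith
    show "splits b c2 T \<alpha> x y U V G"
      unfolding splits_def \<l>_def[symmetric] L_def[symmetric]
    proof (rule exI[of _ "Im ` A1"], rule exI[of _ "Im ` A2"], rule exI[of _ "u ` A3"], intro conjI card ballI impI)
      show "\<bar>a - a'\<bar> > 2 * L" if "a \<in> Im ` A1" "a' \<in> Im ` A1" "a \<noteq> a'" for a a'
        using that isep AG(1) by blast
      show "\<bar>a - a'\<bar> > 2 * L" if "a \<in> Im ` A2" "a' \<in> Im ` A2" "a \<noteq> a'" for a a'
        using that isep AG(2) by blast
      show "\<bar>a - a'\<bar> > 2 * L" if "a \<in> u ` A3" "a' \<in> u ` A3" "a \<noteq> a'" for a a'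
        using that usep AG(3) by blast
      show "\<bar>a\<bar> \<le> T" if "a \<in> Im ` A1 \<union> Im ` A2" for a using that G(6) AG by blast
      show "\<bar>a\<bar> \<le> 2 * T" if "a \<in> u ` A3" for a using that ub AG by blast
    qed (use fin in \<open>auto simp: A1_def A2_def A3_def\<close>)
  qed
qed

text \<open>The sum over the points and the integral over scales are interchanged, so a bound for
  every single scale t suffices and no scale has to be selected by pigeonhole.\<close>

lemma card_le_pint:
  assumes G: "finite G" and l: "l > 0" and x: "x \<ge> 1" and y: "y \<ge> 0" and B: "B \<ge> 0"
    and pt: "\<And>t. x - 1 \<le> t \<Longrightarrow> t < y \<Longrightarrow> exp (- \<delta> * t) * (\<Sum>\<gamma>\<in>G. norm (ppoly l x t \<gamma>)) \<le> B"
    and c0: "\<And>\<gamma>. \<gamma> \<in> G \<Longrightarrow> c0 \<le> pint l x y \<delta> \<gamma>"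
  shows "real (card G) * c0 \<le> y * B"
proof -
  let ?I = "{x - 1..<y}"
  have i: "integrable lborel (\<lambda>t. indicator ?I t *\<^sub>R (exp (- \<delta> * t) * norm (ppoly l x t \<gamma>)))" for \<gamma>
    using ppoly_set_integrable[OF l] by (simp add: set_integrable_def)
  have "real (card G) * c0 \<le> (\<Sum>\<gamma>\<in>G. pint l x y \<delta> \<gamma>)" using sum_mono[of G "\<lambda>_. c0"] c0 by simp
  also have "\<dots> = (LINT t|lborel. (\<Sum>\<gamma>\<in>G. indicator ?I t *\<^sub>R (exp (- \<delta> * t) * norm (ppoly l x t \<gamma>))))"
    unfolding pint_def set_lebesgue_integral_def by (rule Bochner_Integration.integral_sum[symmetric]) (rule i)
  also have "\<dots> \<le> (LINT t|lborel. indicator ?I t *\<^sub>R B)"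
  proof (rule integral_mono)
    show "integrable lborel (\<lambda>t. \<Sum>\<gamma>\<in>G. indicator ?I t *\<^sub>R (exp (- \<delta> * t) * norm (ppoly l x t \<gamma>)))"
      by (intro Bochner_Integration.integrable_sum i)
    show "integrable lborel (\<lambda>t. indicator ?I t *\<^sub>R B)" by (cases "x - 1 \<le> y") auto
    fix t
    show "(\<Sum>\<gamma>\<in>G. indicator ?I t *\<^sub>R (exp (- \<delta> * t) * norm (ppoly l x t \<gamma>))) \<le> indicator ?I t *\<^sub>R B"
    proof (cases "t \<in> ?I")
      case True
      hence "exp (- \<delta> * t) * (\<Sum>\<gamma>\<in>G. norm (ppoly l x t \<gamma>)) \<le> B" by (intro pt) auto
      thus ?thesis using True by (simp add: sum_distrib_left)
    qed simp
  qed
  also have "\<dots> \<le> y * B"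
  proof (cases "x - 1 \<le> y")
    case True
    hence "(LINT t|lborel. indicator ?I t *\<^sub>R B) = (y - (x - 1)) * B" by simp
    also have "\<dots> \<le> y * B" using x B by (intro mult_right_mono) auto
    finally show ?thesis .
  next
    case False
    hence "?I = {}" by auto
    thus ?thesis using y B by simp
  qed
  finally show ?thesis .
qed

lemma card_le_pint_square:
  assumes G: "finite G" and l: "l > 0" and x: "x \<ge> 1" and y: "y \<ge> 0" and S: "S \<ge> 0" and c: "c0 \<ge> 0"
    and pt: "\<And>t. x - 1 \<le> t \<Longrightarrow> t < y \<Longrightarrow> exp (- 2 * \<delta> * t) * (\<Sum>\<gamma>\<in>G. norm (ppoly l x t \<gamma>))\<^sup>2 \<le> S"
    and c0: "\<And>\<gamma>. \<gamma> \<in> G \<Longrightarrow> c0 \<le> pint l x y \<delta> \<gamma>"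
  shows "(real (card G) * c0)\<^sup>2 \<le> y\<^sup>2 * S"
proof -
  have "real (card G) * c0 \<le> y * sqrt S"
  proof (rule card_le_pint[OF G l x y _ _ c0])
    fix t assume t: "x - 1 \<le> t" "t < y"
    have "(exp (- \<delta> * t) * (\<Sum>\<gamma>\<in>G. norm (ppoly l x t \<gamma>)))\<^sup>2 = exp (2 * (- \<delta> * t)) * (\<Sum>\<gamma>\<in>G. norm (ppoly l x t \<gamma>))\<^sup>2"
      unfolding power_mult_distrib exp_double ..
    hence "(exp (- \<delta> * t) * (\<Sum>\<gamma>\<in>G. norm (ppoly l x t \<gamma>)))\<^sup>2 \<le> S" using pt[OF t] by (simp add: mult.assoc)
    thus "exp (- \<delta> * t) * (\<Sum>\<gamma>\<in>G. norm (ppoly l x t \<gamma>)) \<le> sqrt S" by (rule real_le_rsqrt)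
  qed (use S in auto)
  hence "(real (card G) * c0)\<^sup>2 \<le> (y * sqrt S)\<^sup>2" using c by (intro power_mono) auto
  thus ?thesis using S by (simp add: power_mult_distrib)
qed

end

section \<open>Zero density estimates\<close>

lemma polylog_sum3:
  fixes r1 r2 r3 :: real
  assumes r: "r1 \<le> K1 * l ^ N1 * X" "r2 \<le> K2 * l ^ N2 * X" "r3 \<le> K3 * l ^ N3 * X"
    and K: "K1 \<ge> 0" "K2 \<ge> 0" "K3 \<ge> 0" and l: "l \<ge> 1" and X: "X \<ge> 0"
  shows "r1 + r2 + r3 \<le> max 1 (K1 + K2 + K3) * l ^ (N1 + N2 + N3) * X"
proof -
  have m: "l ^ i \<le> l ^ (N1 + N2 + N3)" if "i \<le> N1 + N2 + N3" for i using l that by (rule power_increasing[rotated])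
  have "K1 * l ^ N1 * X \<le> K1 * l ^ (N1 + N2 + N3) * X" "K2 * l ^ N2 * X \<le> K2 * l ^ (N1 + N2 + N3) * X"
     "K3 * l ^ N3 * X \<le> K3 * l ^ (N1 + N2 + N3) * X"
    using K X by (auto intro!: mult_right_mono mult_left_mono m)
  moreover have "(K1 + K2 + K3) * l ^ (N1 + N2 + N3) * X \<le> max 1 (K1 + K2 + K3) * l ^ (N1 + N2 + N3) * X"
    using l X by (intro mult_right_mono) auto
  moreover have "(K1 + K2 + K3) * l ^ (N1 + N2 + N3) * X = K1 * l ^ (N1 + N2 + N3) * X + K2 * l ^ (N1 + N2 + N3) * X + K3 * l ^ (N1 + N2 + N3) * X"
    by (simp add: algebra_simps)
  ultimately show ?thesis using r by linarith
qed

lemma polylog_powr: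
  fixes K l r :: real
  assumes "K \<ge> 0" "l \<ge> 1"
  shows "(K * l ^ m) powr r \<le> K powr r * l ^ (m * nat \<lceil>r\<rceil>)"
proof -
  have "(K * l ^ m) powr r = K powr r * (l ^ m) powr r" using assms by (simp add: powr_mult)
  also have "(l ^ m) powr r \<le> (l ^ m) powr real (nat \<lceil>r\<rceil>)"
    using assms by (intro powr_mono) (auto simp: le_nat_iff intro: order_trans[OF le_of_int_ceiling])
  also have "\<dots> = l ^ (m * nat \<lceil>r\<rceil>)" using assms by (subst powr_realpow) (auto simp: power_mult)
  finally show ?thesis using assms by (simp add: mult_left_mono)
qed

context beurling_moment
begin

text \<open>
  The length \<open>x\<close> is determined by \<open>exp ((1 - \<theta>) * x) = T\<close>, and \<open>y\<close> by
  \<open>exp (2 * (1 - \<alpha>) * y) = T * U powr (- 2 * k)\<close> with \<open>U = exp ((\<alpha> - s0) * y / (k + 1))\<close>: this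
  equates the three contributions.
\<close>

lemma zero_set_card_mean_value:
  "\<exists>b\<ge>16. \<exists>K\<ge>1. \<exists>N. \<exists>T0\<ge>3. \<forall>T\<ge>T0. \<forall>\<alpha> G. s0 + 2 / ln T \<le> \<alpha> \<longrightarrow> \<alpha> \<le> 1 \<longrightarrow> zero_set b T \<alpha> G \<longrightarrow>
     real (card G) \<le> K * (ln T) ^ N * exp (2 * (k + 1) * (1 - \<alpha>) / (2 * (1 - \<alpha>) + k * (1 - \<theta>)) * ln T)"
proof -
  define d where "d = 1 - \<theta>"
  have d: "0 < d" "d \<le> 1" using theta by (auto simp: d_def)
  \<comment> \<open>Common bound for x / ln T = 1 / d and y / ln T \<le> (k + 1) / (k * d), by k
    \<ge> 1.\<close>
  define c where "c = 2 / d"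
  have c: "c \<ge> 1" using d by (simp add: c_def)
  obtain b c2 T0 where b: "b \<ge> 16" and c2: "c2 > 0" and T0: "T0 \<ge> 3" and split: "\<forall>T\<ge>T0. \<forall>\<alpha> x y G U V. s0 + 2 / ln T \<le> \<alpha> \<longrightarrow> 1 \<le> x \<longrightarrow> x \<le> c * ln T \<longrightarrow> 0 \<le> y \<longrightarrow> y \<le> c * ln T \<longrightarrow>
     zero_set b T \<alpha> G \<longrightarrow> U > 0 \<longrightarrow> V > 0 \<longrightarrow> U * V \<le> c2 * exp ((\<alpha> - s0) * y) / (2 * (ln T)\<^sup>2) \<longrightarrow> splits b c2 T \<alpha> x y U V G"
    using zeros_split[OF c] by (elim exE conjE) (rule that; assumption)
  from divisor_bounded_mean_value obtain Km where Km: "Km \<ge> 1 \<and> (\<forall>T\<ge>1. \<forall>q\<ge>1. \<forall>c F P. divisor_bounded q c F \<longrightarrow> finite P \<longrightarrow> (\<forall>a\<in>P. \<bar>a\<bar> \<le> 2 * T) \<longrightarrow> (\<forall>a\<in>P. \<forall>b\<in>P. a \<noteq> b \<longrightarrow> \<bar>a - b\<bar> > 1) \<longrightarrow>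
     (\<Sum>t\<in>P. (norm (dpoly c F t))\<^sup>2) \<le> Km * q ^ 6 * (exp ((1 - \<theta>) * q) + T))" by (rule exE)
  from large_values_mean_value obtain Kq where Kq: "Kq \<ge> 1 \<and> (\<forall>T\<ge>1. \<forall>q\<ge>1. \<forall>c F P V. divisor_bounded q c F \<longrightarrow> finite P \<longrightarrow> (\<forall>a\<in>P. \<bar>a\<bar> \<le> 2 * T) \<longrightarrow> (\<forall>a\<in>P. \<forall>b\<in>P. a \<noteq> b \<longrightarrow> \<bar>a - b\<bar> > 1) \<longrightarrow>
     V > 0 \<longrightarrow> (\<forall>a\<in>P. V \<le> norm (dpoly c F a)) \<longrightarrow> real (card P) \<le> Kq * q ^ 6 * (exp ((1 - \<theta>) * q) + T) / V\<^sup>2)" by (rule exE)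
  from zmass_count[OF b] obtain Kz where "Kz \<ge> 1 \<and> (\<exists>N. \<forall>T\<ge>3. \<forall>G U. finite G \<longrightarrow> (\<forall>a\<in>G. \<bar>a\<bar> \<le> T) \<longrightarrow>
     (\<forall>a\<in>G. \<forall>a'\<in>G. a \<noteq> a' \<longrightarrow> \<bar>a - a'\<bar> > 2 * (b * ln T)) \<longrightarrow> U > 0 \<longrightarrow> (\<forall>a\<in>G. zmass (b * ln T) a \<ge> U) \<longrightarrow>
     real (card G) \<le> Kz * (ln T) ^ N * T * U powr (- (2 * k)))" by (rule exE)
  then obtain Nz where Kz: "Kz \<ge> 1 \<and> (\<forall>T\<ge>3. \<forall>G U. finite G \<longrightarrow> (\<forall>a\<in>G. \<bar>a\<bar> \<le> T) \<longrightarrow>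
     (\<forall>a\<in>G. \<forall>a'\<in>G. a \<noteq> a' \<longrightarrow> \<bar>a - a'\<bar> > 2 * (b * ln T)) \<longrightarrow> U > 0 \<longrightarrow> (\<forall>a\<in>G. zmass (b * ln T) a \<ge> U) \<longrightarrow>
     real (card G) \<le> Kz * (ln T) ^ Nz * T * U powr (- (2 * k)))" by (elim conjE exE) (rule that, rule conjI; assumption)
  define K1 where "K1 = c\<^sup>2 * 4 / c2\<^sup>2 * (2 * Km * (2 * c) ^ 6 * exp 1)"
  define K3 where "K3 = 8 * Kq / c2\<^sup>2 * (1 / d) ^ 6"
  show ?thesis
  proof (rule exI[of _ b], intro conjI b, rule exI[of _ "max 1 (K1 + Kz + K3)"], intro conjI, simp, rule exI[of _ "10 + Nz + 10"], rule exI[of _ T0], intro conjI T0 allI impI)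
    fix T \<alpha> :: real and G
    assume T: "T0 \<le> T" and al: "s0 + 2 / ln T \<le> \<alpha>" "\<alpha> \<le> 1" and zs: "zero_set b T \<alpha> G"
    have T3: "T \<ge> 3" and T1: "T \<ge> 1" using T T0 by linarith+
    define \<l> where "\<l> = ln T"
    have ell: "\<l> \<ge> 1" using one_le_ln[OF T3] by (simp add: \<l>_def)
    have expl: "exp \<l> = T" using T3 by (simp add: \<l>_def)
    define \<delta> where "\<delta> = \<alpha> - s0"
    have del: "\<delta> \<ge> 0"
    proof -
      have "0 \<le> 2 / ln T" using ell by (simp add: \<l>_def)
      thus ?thesis using al(1) unfolding \<delta>_def by linarith
    qed
    define den where "den = 2 * (1 - \<alpha>) + k * d"
    have kd: "k * d \<ge> d" using k d by simp
    have den: "den \<ge> k * d" using al by (simp add: den_def)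
    have den0: "den > 0" using den kd d by linarith
    define y' where "y' = (k + 1) / den"
    have "y' \<le> (k + 1) / (k * d)" unfolding y'_def using den kd d k den0 by (intro divide_left_mono mult_pos_pos) auto
    also have "\<dots> \<le> c" using k d by (simp add: c_def field_simps)
    finally have y'c: "y' \<le> c" .
    have y'0: "y' \<ge> 0" using den0 k by (simp add: y'_def)
    define x y where "x = \<l> / d" and "y = y' * \<l>"
    have x1: "x \<ge> 1" using ell d by (simp add: x_def)
    have xc: "x \<le> c * \<l>" using ell d by (simp add: x_def c_def divide_right_mono)
    have y0: "y \<ge> 0" using y'0 ell by (simp add: y_def)
    have yc: "y \<le> c * \<l>" using y'c ell by (simp add: y_def)
    define E where "E = 2 * (k + 1) * (1 - \<alpha>) / (2 * (1 - \<alpha>) + k * (1 - \<theta>))"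
    have Ey: "E * \<l> = 2 * (1 - \<alpha>) * y" by (simp add: E_def y_def y'_def den_def d_def) (simp add: algebra_simps)
    \<comment> \<open>The left side is the logarithm of T * U powr (- (2 * k)).\<close>
    have Eden: "\<l> - 2 * k * (\<delta> * y / (k + 1)) = E * \<l>"
    proof -
      have a: "\<delta> * y / (k + 1) = \<delta> * \<l> / den" using k den0 by (simp add: y_def y'_def)
      have "\<l> - 2 * k * (\<delta> * \<l> / den) = (den - 2 * k * \<delta>) / den * \<l>" using den0 by (simp add: field_simps)
      also have "den - 2 * k * \<delta> = 2 * (k + 1) * (1 - \<alpha>)" by (simp add: den_def d_def \<delta>_def s0_def field_simps)
      finally show ?thesis unfolding a by (simp add: E_def den_def d_def)
    qed
    define U V where "U = exp (\<delta> * y / (k + 1))" and "V = c2 * exp (\<delta> * y * k / (k + 1)) / (2 * \<l>\<^sup>2)"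
    have U0: "U > 0" by (simp add: U_def)
    have V0: "V > 0" using c2 ell by (simp add: V_def)
    have "exp (\<delta> * y / (k + 1)) * exp (\<delta> * y * k / (k + 1)) = exp (\<delta> * y)"
      unfolding exp_add[symmetric]
    proof (rule arg_cong[of _ _ exp])
      have "\<delta> * y + \<delta> * y * k = \<delta> * y * (k + 1)" by (simp add: algebra_simps)
      thus "\<delta> * y / (k + 1) + \<delta> * y * k / (k + 1) = \<delta> * y" unfolding add_divide_distrib[symmetric] using k by simp
    qed
    hence "U * V = c2 * exp ((\<alpha> - s0) * y) / (2 * (ln T)\<^sup>2)" by (simp add: U_def V_def \<delta>_def \<l>_def algebra_simps)
    hence UV: "U * V \<le> c2 * exp ((\<alpha> - s0) * y) / (2 * (ln T)\<^sup>2)" by simp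
    have "splits b c2 T \<alpha> x y U V G"
      by (rule split[THEN spec, THEN mp, OF T, THEN spec, THEN spec, THEN spec, THEN spec, THEN spec, THEN spec, THEN mp, OF al(1), THEN mp, OF x1,
          THEN mp, OF xc[unfolded \<l>_def], THEN mp, OF y0, THEN mp, OF yc[unfolded \<l>_def], THEN mp, OF zs, THEN mp, OF U0, THEN mp, OF V0, THEN mp, OF UV])
    then obtain G1 G2 Q where fin: "finite G1" "finite G2" "finite Q" and bd: "\<forall>a\<in>G1 \<union> G2. \<bar>a\<bar> \<le> T" "\<forall>u\<in>Q. \<bar>u\<bar> \<le> 2 * T"
       and sep1: "\<forall>a\<in>G1. \<forall>a'\<in>G1. a \<noteq> a' \<longrightarrow> \<bar>a - a'\<bar> > 2 * (b * ln T)"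
       and sep2: "\<forall>a\<in>G2. \<forall>a'\<in>G2. a \<noteq> a' \<longrightarrow> \<bar>a - a'\<bar> > 2 * (b * ln T)"
       and sepQ: "\<forall>a\<in>Q. \<forall>a'\<in>Q. a \<noteq> a' \<longrightarrow> \<bar>a - a'\<bar> > 2 * (b * ln T)"
       and g1: "\<forall>\<gamma>\<in>G1. c2 / (2 * ln T) \<le> pint (b * ln T) x y (\<alpha> - s0) \<gamma>"
       and g2: "\<forall>\<gamma>\<in>G2. U \<le> zmass (b * ln T) \<gamma>" and q: "\<forall>u\<in>Q. V \<le> norm (mpoly x (Complex s0 u))"
       and card: "card G \<le> card G1 + card G2 + card Q"
      unfolding splits_def by (elim exE conjE) (rule that)
    have "16 * 1 \<le> b * \<l>" using b ell by (intro mult_mono) auto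
    hence bl: "2 * (b * ln T) > 1" "b * ln T > 0" by (auto simp: \<l>_def)
    have sep1': "\<forall>a\<in>G1. \<forall>b\<in>G1. a \<noteq> b \<longrightarrow> \<bar>a - b\<bar> > 1" using sep1 bl(1) by force
    have sepQ': "\<forall>a\<in>Q. \<forall>b\<in>Q. a \<noteq> b \<longrightarrow> \<bar>a - b\<bar> > 1" using sepQ bl(1) by force
    have bd1: "\<forall>a\<in>G1. \<bar>a\<bar> \<le> 2 * T" and bd2: "\<forall>a\<in>G2. \<bar>a\<bar> \<le> T" using bd(1) T3 by force+
    have c2_bound: "real (card G2) \<le> Kz * \<l> ^ Nz * exp (E * \<l>)"
    proof -
      have "real (card G2) \<le> Kz * (ln T) ^ Nz * T * U powr (- (2 * k))"
        by (rule conjunct2[OF Kz, THEN spec, THEN mp, OF T3, THEN spec, THEN spec, THEN mp, OF fin(2), THEN mp, OF bd2, THEN mp, OF sep2, THEN mp, OF U0, THEN mp, OF g2])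
      moreover have "T * U powr (- (2 * k)) = exp (E * \<l>)"
      proof -
        have "U powr (- (2 * k)) = exp (- (2 * k) * (\<delta> * y / (k + 1)))" unfolding U_def by (simp add: powr_def)
        hence "T * U powr (- (2 * k)) = exp (\<l> + - (2 * k) * (\<delta> * y / (k + 1)))" unfolding exp_add expl by simp
        also have "\<l> + - (2 * k) * (\<delta> * y / (k + 1)) = E * \<l>" using Eden by simp
        finally show ?thesis .
      qed
      ultimately show ?thesis by (simp add: \<l>_def mult.assoc)
    qed
    have q_bound: "real (card Q) \<le> K3 * \<l> ^ 10 * exp (E * \<l>)"
    proof -
      have m: "\<forall>u\<in>Q. V \<le> norm (dpoly (\<lambda>m. of_real (mu m * exp (- s0 * nu m))) {m. nu m \<le> x} u)"
        using q unfolding mpoly_dpoly .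
      have "real (card Q) \<le> Kq * x ^ 6 * (exp ((1 - \<theta>) * x) + T) / V\<^sup>2"
        by (rule conjunct2[OF Kq, THEN spec, THEN mp, OF T1, THEN spec, THEN mp, OF x1, THEN spec, THEN spec, THEN spec, THEN spec, THEN mp, OF divisor_bounded_mpoly, THEN mp, OF fin(3), THEN mp, OF bd(2), THEN mp, OF sepQ', THEN mp, OF V0, THEN mp, OF m])
      also have "exp ((1 - \<theta>) * x) = T" using d expl by (simp add: x_def d_def)
      also have "Kq * x ^ 6 * (T + T) / V\<^sup>2 = K3 * \<l> ^ 10 * (T * (1 / (exp (\<delta> * y * k / (k + 1)))\<^sup>2))"
        using c2 ell d by (simp add: V_def K3_def x_def field_simps eval_nat_numeral)
      also have "T * (1 / (exp (\<delta> * y * k / (k + 1)))\<^sup>2) = exp (E * \<l>)"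
      proof -
        have "1 / (exp (\<delta> * y * k / (k + 1)))\<^sup>2 = exp (- (2 * k * (\<delta> * y / (k + 1))))"
          unfolding exp_minus exp_double[symmetric] by (simp add: divide_inverse algebra_simps)
        hence "T * (1 / (exp (\<delta> * y * k / (k + 1)))\<^sup>2) = exp (\<l> + - (2 * k * (\<delta> * y / (k + 1))))" unfolding exp_add expl by simp
        also have "\<l> + - (2 * k * (\<delta> * y / (k + 1))) = E * \<l>" using Eden by simp
        finally show ?thesis .
      qed
      finally show ?thesis .
    qed
    have g1_bound: "real (card G1) \<le> K1 * \<l> ^ 10 * exp (E * \<l>)"
    proof -
      define R where "R = real (card G1)"
      define M where "M = 2 * Km * (2 * c * \<l>) ^ 6 * exp 1 * exp (E * \<l>)"
      have M0: "M \<ge> 0" unfolding M_def using conjunct1[OF Km] c ell by simp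
      have "(R * (c2 / (2 * \<l>)))\<^sup>2 \<le> y\<^sup>2 * (R * M)" unfolding R_def
      proof (rule card_le_pint_square[where x = x and l = "b * ln T" and \<delta> = \<delta>])
        fix t assume t: "x - 1 \<le> t" "t < y"
        have t1: "t + 1 \<ge> 1" using t x1 by linarith
        have "y + 1 \<le> 2 * c * \<l>"
        proof -
          have "1 * 1 \<le> c * \<l>" using c ell by (intro mult_mono) auto
          thus ?thesis using yc by simp
        qed
        hence tc: "t + 1 \<le> 2 * c * \<l>" using t by linarith
        have bl': "0 \<le> b * ln T" using bl by simp
        have "(\<Sum>\<gamma>\<in>G1. (norm (ppoly (b * ln T) x t \<gamma>))\<^sup>2) \<le> Km * (t + 1) ^ 6 * (exp ((1 - \<theta>) * (t + 1)) + T)"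
          unfolding ppoly_def
          by (rule conjunct2[OF Km, THEN spec, THEN mp, OF T1, THEN spec, THEN mp, OF t1, THEN spec, THEN spec, THEN spec, THEN mp, OF divisor_bounded_ppoly[OF bl'], THEN mp, OF fin(1), THEN mp, OF bd1, THEN mp, OF sep1'])
        also have "\<dots> \<le> Km * (2 * c * \<l>) ^ 6 * (2 * exp (d * (t + 1)))"
        proof (rule mult_mono)
          show "Km * (t + 1) ^ 6 \<le> Km * (2 * c * \<l>) ^ 6" using conjunct1[OF Km] tc t1 by (intro mult_left_mono power_mono) auto
          \<comment> \<open>On t \<ge> x - 1 the term T of the mean value theorem is at most exp (d
            * (t + 1)), because exp (d * x) = T; only the length term remains.\<close>
          have "\<l> = d * x" using d by (simp add: x_def)
          also have "\<dots> \<le> d * (t + 1)" using t d by (intro mult_left_mono) auto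
          finally have "exp \<l> \<le> exp (d * (t + 1))" by simp
          thus "exp ((1 - \<theta>) * (t + 1)) + T \<le> 2 * exp (d * (t + 1))" unfolding expl d_def by simp
        qed (use conjunct1[OF Km] c ell T3 in auto)
        finally have s: "(\<Sum>\<gamma>\<in>G1. (norm (ppoly (b * ln T) x t \<gamma>))\<^sup>2) \<le> 2 * Km * (2 * c * \<l>) ^ 6 * exp (d * (t + 1))" by simp
        \<comment> \<open>Passes from the sum of squares to the square of the sum required by
          \<open>card_le_pint_square\<close>; the extra factor \<open>card G1\<close> cancels at the
          end.\<close>
        have "(\<Sum>\<gamma>\<in>G1. norm (ppoly (b * ln T) x t \<gamma>) * 1)\<^sup>2 \<le> (\<Sum>\<gamma>\<in>G1. (norm (ppoly (b * ln T) x t \<gamma>))\<^sup>2) * (\<Sum>\<gamma>\<in>G1. 1\<^sup>2)"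
          by (rule Cauchy_Schwarz_ineq_sum)
        also have "\<dots> \<le> (2 * Km * (2 * c * \<l>) ^ 6 * exp (d * (t + 1))) * real (card G1)" using s by (simp add: mult_right_mono)
        finally have cs: "(\<Sum>\<gamma>\<in>G1. norm (ppoly (b * ln T) x t \<gamma>))\<^sup>2 \<le> (2 * Km * (2 * c * \<l>) ^ 6 * exp (d * (t + 1))) * real (card G1)" by simp
        \<comment> \<open>Up to a constant the exponent is 2 * (1 - \<alpha>) * t, nondecreasing in
          t, so t = y is the worst scale.\<close>
        have e: "exp (- 2 * \<delta> * t) * exp (d * (t + 1)) \<le> exp 1 * exp (E * \<l>)"
          unfolding exp_add[symmetric] exp_le_cancel_iff
        proof -
          have "- 2 * \<delta> * t + d * (t + 1) = d + 2 * (1 - \<alpha>) * t" by (simp add: \<delta>_def d_def s0_def field_simps)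
          also have "\<dots> \<le> 1 + 2 * (1 - \<alpha>) * y" using d al t by (intro add_mono mult_left_mono) auto
          finally show "- 2 * \<delta> * t + d * (t + 1) \<le> 1 + E * \<l>" unfolding Ey .
        qed
        have "exp (- 2 * \<delta> * t) * (\<Sum>\<gamma>\<in>G1. norm (ppoly (b * ln T) x t \<gamma>))\<^sup>2 \<le> exp (- 2 * \<delta> * t) * ((2 * Km * (2 * c * \<l>) ^ 6 * exp (d * (t + 1))) * real (card G1))"
          by (rule mult_left_mono[OF cs]) simp
        also have "\<dots> = (2 * Km * (2 * c * \<l>) ^ 6 * real (card G1)) * (exp (- 2 * \<delta> * t) * exp (d * (t + 1)))" by (simp only: mult_ac)
        also have "\<dots> \<le> (2 * Km * (2 * c * \<l>) ^ 6 * real (card G1)) * (exp 1 * exp (E * \<l>))"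
          using conjunct1[OF Km] c ell by (intro mult_left_mono[OF e]) simp
        also have "\<dots> = real (card G1) * M" by (simp add: M_def mult_ac)
        finally show "exp (- 2 * \<delta> * t) * (\<Sum>\<gamma>\<in>G1. norm (ppoly (b * ln T) x t \<gamma>))\<^sup>2 \<le> real (card G1) * M" .
      qed (use fin bl x1 y0 M0 c2 ell g1 in \<open>auto simp: \<l>_def \<delta>_def\<close>)
      also have "\<dots> \<le> (c * \<l>)\<^sup>2 * (R * M)" using yc y0 M0 by (intro mult_right_mono power_mono) (auto simp: R_def)
      finally have m: "(R * (c2 / (2 * \<l>)))\<^sup>2 \<le> (c * \<l>)\<^sup>2 * (R * M)" .
      have "R \<le> ((c * \<l>)\<^sup>2 * M) / (c2 / (2 * \<l>))\<^sup>2"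
      proof (cases "R = 0")
        case True thus ?thesis using M0 by simp
      next
        case False
        hence R0: "R > 0" by (simp add: R_def)
        have "R * (R * (c2 / (2 * \<l>))\<^sup>2) \<le> R * ((c * \<l>)\<^sup>2 * M)" using m by (simp add: power_mult_distrib power2_eq_square mult_ac)
        hence "R * (c2 / (2 * \<l>))\<^sup>2 \<le> (c * \<l>)\<^sup>2 * M" using R0 by (simp only: mult_le_cancel_left_pos)
        thus ?thesis using c2 ell by (subst pos_le_divide_eq) auto
      qed
      also have "\<dots> = K1 * \<l> ^ 10 * exp (E * \<l>)"
        unfolding M_def K1_def using c2 ell by (simp add: field_simps eval_nat_numeral)
      finally show ?thesis unfolding R_def .
    qed
    have "real (card G) \<le> real (card G1) + real (card G2) + real (card Q)" using card by linarith
    also have "\<dots> \<le> max 1 (K1 + Kz + K3) * \<l> ^ (10 + Nz + 10) * exp (E * \<l>)"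
      by (rule polylog_sum3[OF g1_bound c2_bound q_bound]) (use conjunct1[OF Km] conjunct1[OF Kz] conjunct1[OF Kq] c d ell in \<open>auto simp: K1_def K3_def\<close>)
    finally show "real (card G) \<le> max 1 (K1 + Kz + K3) * (ln T) ^ (10 + Nz + 10) * exp (2 * (k + 1) * (1 - \<alpha>) / (2 * (1 - \<alpha>) + k * (1 - \<theta>)) * ln T)"
      unfolding \<l>_def E_def .
  qed
qed

text \<open>
  With \<open>\<eta> = 4 * \<alpha> - 3 - \<theta>\<close>, the choice \<open>U = exp (\<eta> * x / 2)\<close> equates the second terms of the Halasz
  inequality for both polynomials with the contribution of the zeta moment; \<open>x\<close> and \<open>y\<close> then solve
  \<open>(\<alpha> - s0) * y = (\<eta> / 2 + \<alpha> - s0) * x\<close> and \<open>exp (2 * (1 - \<alpha>) * y) = T * exp (- k * \<eta> * x)\<close>.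
\<close>

lemma zero_set_card_halasz:
  "\<exists>b\<ge>16. \<exists>K\<ge>1. \<exists>N. \<exists>T0\<ge>3. \<forall>T\<ge>T0. \<forall>\<alpha> G. s0 + 2 / ln T \<le> \<alpha> \<longrightarrow> (3 * k - 1 + (k - 1) * \<theta>) / (4 * k - 2) \<le> \<alpha> \<longrightarrow> \<alpha> \<le> 1 \<longrightarrow> zero_set b T \<alpha> G \<longrightarrow>
     real (card G) \<le> K * (ln T) ^ N * exp (4 * (3 * \<alpha> - 2 - \<theta>) * (1 - \<alpha>) /
        (k * (2 * \<alpha> - 1 - \<theta>) * (4 * \<alpha> - 3 - \<theta>) + 4 * (3 * \<alpha> - 2 - \<theta>) * (1 - \<alpha>)) * ln T)"
proof -
  define d where "d = 1 - \<theta>"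
  have d: "0 < d" "d \<le> 1" using theta by (auto simp: d_def)
  have k1: "2 * k - 1 > 0" using k by simp
  \<comment> \<open>Lower bound, uniform in \<alpha>, for the denominator of the exponent: the range
    of \<alpha> gives 2 * \<delta> \<ge> k * d / (2 * k - 1) and \<eta> \<ge> d / (2 * k - 1). It
    keeps x and y below c * ln T.\<close>
  define D0 where "D0 = k * (k * d / (2 * k - 1)) * (d / (2 * k - 1))"
  have D0: "D0 > 0" using k d k1 by (simp add: D0_def)
  define c where "c = max 1 (2 / D0)"
  have c: "c \<ge> 1" "2 / D0 \<le> c" by (auto simp: c_def)
  obtain b c2 T1 where b: "b \<ge> 16" and c2: "c2 > 0" and T1: "T1 \<ge> 3" and split: "\<forall>T\<ge>T1. \<forall>\<alpha> x y G U V. s0 + 2 / ln T \<le> \<alpha> \<longrightarrow> 1 \<le> x \<longrightarrow> x \<le> c * ln T \<longrightarrow> 0 \<le> y \<longrightarrow> y \<le> c * ln T \<longrightarrow>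
     zero_set b T \<alpha> G \<longrightarrow> U > 0 \<longrightarrow> V > 0 \<longrightarrow> U * V \<le> c2 * exp ((\<alpha> - s0) * y) / (2 * (ln T)\<^sup>2) \<longrightarrow> splits b c2 T \<alpha> x y U V G"
    using zeros_split[OF c(1)] by (elim exE conjE) (rule that; assumption)
  from divisor_bounded_halasz[OF b] obtain Km where Km: "Km \<ge> 1 \<and> (\<forall>T\<ge>3. \<forall>q\<ge>1. \<forall>c F P. divisor_bounded q c F \<longrightarrow> finite P \<longrightarrow> (\<forall>a\<in>P. \<bar>a\<bar> \<le> 2 * T) \<longrightarrow>
     (\<forall>a\<in>P. \<forall>a'\<in>P. a \<noteq> a' \<longrightarrow> \<bar>a - a'\<bar> > 2 * (b * ln T)) \<longrightarrow>
     (\<Sum>t\<in>P. norm (dpoly c F t))\<^sup>2 \<le> Km * q ^ 5 * (ln T) ^ (n + 1) * exp ((1 - s0) * q) *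
        (real (card P) * exp ((1 - s0) * q) + real (card P) powr (2 - 1 / (2 * k)) * T powr (1 / (2 * k))))" by (rule exE)
  from large_values_halasz[OF b] obtain Kq where Kq: "Kq \<ge> 1 \<and> (\<forall>T\<ge>3. \<forall>q\<ge>1. \<forall>c F P V. divisor_bounded q c F \<longrightarrow> finite P \<longrightarrow> (\<forall>a\<in>P. \<bar>a\<bar> \<le> 2 * T) \<longrightarrow>
     (\<forall>a\<in>P. \<forall>a'\<in>P. a \<noteq> a' \<longrightarrow> \<bar>a - a'\<bar> > 2 * (b * ln T)) \<longrightarrow>
     V > 0 \<longrightarrow> (\<forall>a\<in>P. V \<le> norm (dpoly c F a)) \<longrightarrow>
     real (card P) \<le> 2 * (Kq * q ^ 5 * (ln T) ^ (n + 1) * exp (2 * (1 - s0) * q) / V\<^sup>2)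
        + (2 * (Kq * q ^ 5 * (ln T) ^ (n + 1) * exp ((1 - s0) * q) / V\<^sup>2)) powr (2 * k) * T)" by (rule exE)
  from zmass_count[OF b] obtain Kz where "Kz \<ge> 1 \<and> (\<exists>N. \<forall>T\<ge>3. \<forall>G U. finite G \<longrightarrow> (\<forall>a\<in>G. \<bar>a\<bar> \<le> T) \<longrightarrow>
     (\<forall>a\<in>G. \<forall>a'\<in>G. a \<noteq> a' \<longrightarrow> \<bar>a - a'\<bar> > 2 * (b * ln T)) \<longrightarrow> U > 0 \<longrightarrow> (\<forall>a\<in>G. zmass (b * ln T) a \<ge> U) \<longrightarrow>
     real (card G) \<le> Kz * (ln T) ^ N * T * U powr (- (2 * k)))" by (rule exE)
  then obtain Nz where Kz: "Kz \<ge> 1 \<and> (\<forall>T\<ge>3. \<forall>G U. finite G \<longrightarrow> (\<forall>a\<in>G. \<bar>a\<bar> \<le> T) \<longrightarrow>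
     (\<forall>a\<in>G. \<forall>a'\<in>G. a \<noteq> a' \<longrightarrow> \<bar>a - a'\<bar> > 2 * (b * ln T)) \<longrightarrow> U > 0 \<longrightarrow> (\<forall>a\<in>G. zmass (b * ln T) a \<ge> U) \<longrightarrow>
     real (card G) \<le> Kz * (ln T) ^ Nz * T * U powr (- (2 * k)))" by (elim conjE exE) (rule that, rule conjI; assumption)
  \<comment> \<open>Chosen so that x \<ge> 1: the denominator D is at most k + 4, and 2 * \<delta>
    is at least d / 2.\<close>
  define T0 where "T0 = max T1 (exp ((k + 4) * (2 / d)))"
  have T0: "T0 \<ge> 3" using T1 by (simp add: T0_def)
  define r where "r = nat \<lceil>2 * k\<rceil>"
  define w1 where "w1 = (2 * c / c2)\<^sup>2 * (Km * (2 * c) ^ 5 * exp 2)"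
  define q1 where "q1 = 8 * Kq * c ^ 5 / c2\<^sup>2"
  have w1: "w1 \<ge> 0" unfolding w1_def using conjunct1[OF Km] c by simp
  have q1: "q1 \<ge> 0" unfolding q1_def using conjunct1[OF Kq] c by simp
  define K1 where "K1 = 2 * w1 + (2 * w1) powr (2 * k)"
  define K3 where "K3 = q1 + q1 powr (2 * k)"
  have K13: "K1 \<ge> 0" "K3 \<ge> 0" using w1 q1 by (auto simp: K1_def K3_def)
  define N where "N = (n + 10) + (n + 10) * r"
  show ?thesis
  proof (rule exI[of _ b], intro conjI b, rule exI[of _ "max 1 (K1 + Kz + K3)"], intro conjI, simp, rule exI[of _ "N + Nz + N"], rule exI[of _ T0], intro conjI T0 allI impI)
    fix T \<alpha> :: real and G
    assume T: "T0 \<le> T" and al: "s0 + 2 / ln T \<le> \<alpha>" "(3 * k - 1 + (k - 1) * \<theta>) / (4 * k - 2) \<le> \<alpha>" "\<alpha> \<le> 1" and zs: "zero_set b T \<alpha> G"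
    have T3: "T \<ge> 3" and TT1: "T1 \<le> T" using T T0 by (auto simp: T0_def)
    define \<l> where "\<l> = ln T"
    have ell: "\<l> \<ge> 1" using one_le_ln[OF T3] by (simp add: \<l>_def)
    have expl: "exp \<l> = T" using T3 by (simp add: \<l>_def)
    have ellbig: "\<l> \<ge> (k + 4) * (2 / d)"
    proof -
      have "exp ((k + 4) * (2 / d)) \<le> exp \<l>" using T expl by (simp add: T0_def)
      thus ?thesis by (simp only: exp_le_cancel_iff)
    qed
    define \<delta> where "\<delta> = \<alpha> - s0"
    define \<eta> where "\<eta> = 4 * \<alpha> - 3 - \<theta>"
    define \<kappa> where "\<kappa> = 3 * \<alpha> - 2 - \<theta>"
    have alk: "3 * k - 1 + (k - 1) * \<theta> \<le> \<alpha> * (4 * k - 2)" using al(2) k by (simp add: field_simps)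
    have d2: "2 * \<delta> = 2 * \<alpha> - 1 - \<theta>" by (simp add: \<delta>_def s0_def field_simps)
    have dlow: "k * d / (2 * k - 1) \<le> 2 * \<delta>"
      unfolding d2 using alk k1 by (subst pos_divide_le_eq) (auto simp: d_def algebra_simps)
    have etalow: "d / (2 * k - 1) \<le> \<eta>"
      unfolding \<eta>_def using alk k1 by (subst pos_divide_le_eq) (auto simp: d_def algebra_simps)
    have half: "d / 2 \<le> k * d / (2 * k - 1)" using k1 d k by (simp add: field_simps)
    have eta0: "\<eta> > 0" using etalow d k1 by (smt (verit) divide_pos_pos)
    have kap: "\<kappa> = \<eta> / 2 + \<delta>" by (simp add: \<kappa>_def \<eta>_def \<delta>_def s0_def field_simps)
    have del0: "\<delta> > 0" using dlow half d by linarith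
    have up: "2 * \<delta> \<le> 1" "\<eta> \<le> 1" "\<kappa> \<le> 1" "0 \<le> 1 - \<alpha>" "1 - \<alpha> \<le> 1" using d2 al(3) theta del0 s0 by (auto simp: \<eta>_def \<kappa>_def \<delta>_def)
    have kap0: "\<kappa> > 0" using kap eta0 del0 by simp
    define D where "D = k * (2 * \<delta>) * \<eta> + 4 * \<kappa> * (1 - \<alpha>)"
    have "D0 \<le> k * (2 * \<delta>) * \<eta>" unfolding D0_def using dlow etalow k d k1 del0 by (intro mult_mono) auto
    moreover have "0 \<le> 4 * \<kappa> * (1 - \<alpha>)" using kap0 up by simp
    ultimately have Dlow: "D0 \<le> D" by (simp add: D_def)
    hence Dpos: "D > 0" using D0 by linarith
    have Dup: "D \<le> k + 4"
    proof -
      have "k * (2 * \<delta>) * \<eta> \<le> k * 1 * 1" using up k del0 eta0 by (intro mult_mono) auto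
      moreover have "4 * \<kappa> * (1 - \<alpha>) \<le> 4 * 1 * 1" using up kap0 by (intro mult_mono) auto
      ultimately show ?thesis by (simp add: D_def)
    qed
    define x y where "x = \<l> * (2 * \<delta> / D)" and "y = \<l> * (2 * \<kappa> / D)"
    have x1: "x \<ge> 1"
    proof -
      have "D \<le> (k + 4) * (2 / d * (2 * \<delta>))"
      proof -
        have "d / 2 \<le> 2 * \<delta>" using dlow half by (rule order_trans[rotated])
        hence "1 \<le> 2 / d * (2 * \<delta>)" using d by (simp add: field_simps)
        hence "(k + 4) * 1 \<le> (k + 4) * (2 / d * (2 * \<delta>))" using k by (intro mult_left_mono) auto
        hence "k + 4 \<le> (k + 4) * (2 / d * (2 * \<delta>))" unfolding mult_1_right .
        thus ?thesis by (rule order_trans[OF Dup])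
      qed
      also have "\<dots> = (k + 4) * (2 / d) * (2 * \<delta>)" by simp
      also have "\<dots> \<le> \<l> * (2 * \<delta>)" using ellbig del0 by (intro mult_right_mono) auto
      finally show ?thesis unfolding x_def using Dpos by (simp add: field_simps)
    qed
    have "2 * \<delta> \<le> 2 * \<kappa>" using kap eta0 by simp
    hence xy: "x \<le> y" unfolding x_def y_def using ell Dpos by (intro mult_left_mono divide_right_mono) auto
    have y0: "y \<ge> 0" using x1 xy by linarith
    have yc: "y \<le> c * \<l>"
    proof -
      have "2 * \<kappa> / D \<le> 2 / D0" using up kap0 D0 Dlow Dpos by (intro frac_le) auto
      also have "\<dots> \<le> c" by (rule c)
      finally have "\<l> * (2 * \<kappa> / D) \<le> \<l> * c" using ell by (intro mult_left_mono) auto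
      thus ?thesis by (simp add: y_def mult.commute)
    qed
    have xc: "x \<le> c * \<l>" using xy yc by linarith
    define E where "E = 4 * \<kappa> * (1 - \<alpha>) / D"
    have Eeq: "E = 4 * (3 * \<alpha> - 2 - \<theta>) * (1 - \<alpha>) /
        (k * (2 * \<alpha> - 1 - \<theta>) * (4 * \<alpha> - 3 - \<theta>) + 4 * (3 * \<alpha> - 2 - \<theta>) * (1 - \<alpha>))"
      unfolding E_def D_def d2 \<kappa>_def \<eta>_def ..
    have Ey: "E * \<l> = 2 * (1 - \<alpha>) * y" by (simp add: E_def y_def)
    have Ex: "\<l> - k * \<eta> * x = E * \<l>"
    proof -
      have "\<l> - k * \<eta> * x = (D - k * (2 * \<delta>) * \<eta>) / D * \<l>" using Dpos by (simp add: x_def field_simps)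
      also have "D - k * (2 * \<delta>) * \<eta> = 4 * \<kappa> * (1 - \<alpha>)" by (simp add: D_def)
      finally show ?thesis by (simp add: E_def)
    qed
    define X where "X = exp (E * \<l>)"
    have X0: "X > 0" by (simp add: X_def)
    have TX: "T * exp (- (k * \<eta> * x)) = X"
    proof -
      have "T * exp (- (k * \<eta> * x)) = exp (\<l> + - (k * \<eta> * x))" unfolding exp_add expl ..
      also have "\<l> + - (k * \<eta> * x) = E * \<l>" using Ex by simp
      finally show ?thesis by (simp add: X_def)
    qed
    have xX: "exp (2 * (1 - \<alpha>) * x) \<le> X" unfolding X_def Ey exp_le_cancel_iff using xy up by (intro mult_left_mono) auto
    define U V where "U = exp (\<eta> / 2 * x)" and "V = c2 * exp (\<delta> * x) / (2 * \<l>\<^sup>2)"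
    have U0: "U > 0" by (simp add: U_def)
    have V0: "V > 0" using c2 ell by (simp add: V_def)
    have "exp (\<eta> / 2 * x) * exp (\<delta> * x) = exp (\<delta> * y)"
      unfolding exp_add[symmetric]
    proof (rule arg_cong[of _ _ exp])
      have "\<eta> / 2 * x + \<delta> * x = \<kappa> * x" by (simp add: kap algebra_simps)
      thus "\<eta> / 2 * x + \<delta> * x = \<delta> * y" by (simp add: x_def y_def)
    qed
    hence "U * V = c2 * exp ((\<alpha> - s0) * y) / (2 * (ln T)\<^sup>2)" by (simp add: U_def V_def \<delta>_def \<l>_def algebra_simps)
    hence UV: "U * V \<le> c2 * exp ((\<alpha> - s0) * y) / (2 * (ln T)\<^sup>2)" by simp
    have "splits b c2 T \<alpha> x y U V G"
      by (rule split[THEN spec, THEN mp, OF TT1, THEN spec, THEN spec, THEN spec, THEN spec, THEN spec, THEN spec, THEN mp, OF al(1), THEN mp, OF x1,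
          THEN mp, OF xc[unfolded \<l>_def], THEN mp, OF y0, THEN mp, OF yc[unfolded \<l>_def], THEN mp, OF zs, THEN mp, OF U0, THEN mp, OF V0, THEN mp, OF UV])
    then obtain G1 G2 Q where fin: "finite G1" "finite G2" "finite Q" and bd: "\<forall>a\<in>G1 \<union> G2. \<bar>a\<bar> \<le> T" "\<forall>u\<in>Q. \<bar>u\<bar> \<le> 2 * T"
       and sep1: "\<forall>a\<in>G1. \<forall>a'\<in>G1. a \<noteq> a' \<longrightarrow> \<bar>a - a'\<bar> > 2 * (b * ln T)"
       and sep2: "\<forall>a\<in>G2. \<forall>a'\<in>G2. a \<noteq> a' \<longrightarrow> \<bar>a - a'\<bar> > 2 * (b * ln T)"
       and sepQ: "\<forall>a\<in>Q. \<forall>a'\<in>Q. a \<noteq> a' \<longrightarrow> \<bar>a - a'\<bar> > 2 * (b * ln T)"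
       and g1: "\<forall>\<gamma>\<in>G1. c2 / (2 * ln T) \<le> pint (b * ln T) x y (\<alpha> - s0) \<gamma>"
       and g2: "\<forall>\<gamma>\<in>G2. U \<le> zmass (b * ln T) \<gamma>" and q: "\<forall>u\<in>Q. V \<le> norm (mpoly x (Complex s0 u))"
       and card: "card G \<le> card G1 + card G2 + card Q"
      unfolding splits_def by (elim exE conjE) (rule that)
    have "16 * 1 \<le> b * \<l>" using b ell by (intro mult_mono) auto
    hence bl: "b * ln T > 0" by (auto simp: \<l>_def)
    have bd1: "\<forall>a\<in>G1. \<bar>a\<bar> \<le> 2 * T" and bd2: "\<forall>a\<in>G2. \<bar>a\<bar> \<le> T" using bd(1) T3 by force+
    have pw: "\<l> ^ i \<le> \<l> ^ N" if "i \<le> N" for i using ell that by (rule power_increasing[rotated])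
    have pw1: "\<l> ^ (n + 10) \<le> \<l> ^ N" "\<l> ^ ((n + 10) * r) \<le> \<l> ^ N" by (rule pw, simp add: N_def)+
    have c2_bound: "real (card G2) \<le> Kz * \<l> ^ Nz * X"
    proof -
      have "real (card G2) \<le> Kz * (ln T) ^ Nz * T * U powr (- (2 * k))"
        by (rule conjunct2[OF Kz, THEN spec, THEN mp, OF T3, THEN spec, THEN spec, THEN mp, OF fin(2), THEN mp, OF bd2, THEN mp, OF sep2, THEN mp, OF U0, THEN mp, OF g2])
      moreover have "U powr (- (2 * k)) = exp (- (k * \<eta> * x))" unfolding U_def by (simp add: powr_def)
      ultimately show ?thesis using TX by (simp add: \<l>_def mult.assoc)
    qed
    have q_bound: "real (card Q) \<le> K3 * \<l> ^ N * X"
    proof -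
      have m: "\<forall>u\<in>Q. V \<le> norm (dpoly (\<lambda>m. of_real (mu m * exp (- s0 * nu m))) {m. nu m \<le> x} u)"
        using q unfolding mpoly_dpoly .
      define Z where "Z = 2 * (Kq * x ^ 5 * \<l> ^ (n + 1))"
      have Z0: "Z \<ge> 0" unfolding Z_def using conjunct1[OF Kq] x1 ell by simp
      have cardQ: "real (card Q) \<le> Z * exp (2 * (1 - s0) * x) / V\<^sup>2 + (Z * exp ((1 - s0) * x) / V\<^sup>2) powr (2 * k) * T"
        using conjunct2[OF Kq, THEN spec, THEN mp, OF T3, THEN spec, THEN mp, OF x1, THEN spec, THEN spec, THEN spec, THEN spec, THEN mp, OF divisor_bounded_mpoly, THEN mp, OF fin(3), THEN mp, OF bd(2), THEN mp, OF sepQ, THEN mp, OF V0, THEN mp, OF m]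
        unfolding Z_def \<l>_def by (simp only: mult.assoc times_divide_eq_right)
      have Zb: "Z * (4 * \<l> ^ 4 / c2\<^sup>2) \<le> q1 * \<l> ^ (n + 10)"
      proof -
        have "Z * (4 * \<l> ^ 4 / c2\<^sup>2) \<le> 2 * (Kq * (c * \<l>) ^ 5 * \<l> ^ (n + 1)) * (4 * \<l> ^ 4 / c2\<^sup>2)"
          unfolding Z_def using conjunct1[OF Kq] x1 xc ell by (intro mult_right_mono mult_left_mono power_mono) auto
        also have "\<dots> = q1 * (\<l> ^ 5 * \<l> ^ (n + 1) * \<l> ^ 4)" by (simp add: q1_def power_mult_distrib)
        also have "\<l> ^ 5 * \<l> ^ (n + 1) * \<l> ^ 4 = \<l> ^ (n + 10)" unfolding power_add[symmetric] by (rule arg_cong[of _ _ "\<lambda>i. \<l> ^ i"]) simp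
        finally show ?thesis .
      qed
      have Vinv: "1 / V\<^sup>2 = (4 * \<l> ^ 4 / c2\<^sup>2) * exp (- (2 * (\<delta> * x)))"
      proof -
        have "exp (- (2 * (\<delta> * x))) = 1 / (exp (\<delta> * x))\<^sup>2" unfolding exp_minus exp_double inverse_eq_divide ..
        moreover have "1 / (c2 * e / (2 * \<l>\<^sup>2))\<^sup>2 = (4 * \<l> ^ 4 / c2\<^sup>2) * (1 / e\<^sup>2)" for e :: real
          by (simp add: power_divide power_mult_distrib)
        ultimately show ?thesis unfolding V_def by simp
      qed
      have f1: "Z * exp (2 * (1 - s0) * x) / V\<^sup>2 \<le> (q1 * \<l> ^ (n + 10)) * X"
      proof -
        have e: "exp (2 * (1 - s0) * x) * exp (- (2 * (\<delta> * x))) = exp (2 * (1 - \<alpha>) * x)"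
          unfolding exp_add[symmetric] by (rule arg_cong[of _ _ exp]) (simp add: \<delta>_def algebra_simps)
        have "Z * exp (2 * (1 - s0) * x) / V\<^sup>2 = Z * exp (2 * (1 - s0) * x) * (1 / V\<^sup>2)" by simp
        also have "\<dots> = (Z * (4 * \<l> ^ 4 / c2\<^sup>2)) * exp (2 * (1 - \<alpha>) * x)" unfolding Vinv e[symmetric] by (simp only: mult_ac)
        also have "\<dots> \<le> (q1 * \<l> ^ (n + 10)) * X" by (rule mult_mono[OF Zb xX]) (use q1 ell in auto)
        finally show ?thesis .
      qed
      \<comment> \<open>The exponent is (1 - s0 - 2 * \<delta>) * x = - \<eta> / 2 * x; this is
        where \<eta> comes from.\<close>
      have f2: "(Z * exp ((1 - s0) * x) / V\<^sup>2) powr (2 * k) * T \<le> (q1 powr (2 * k) * \<l> ^ ((n + 10) * r)) * X"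
      proof -
        have e: "exp ((1 - s0) * x) * exp (- (2 * (\<delta> * x))) = exp (- (\<eta> / 2 * x))"
          unfolding exp_add[symmetric] by (rule arg_cong[of _ _ exp]) (simp add: \<delta>_def \<eta>_def s0_def field_simps)
        have "Z * exp ((1 - s0) * x) / V\<^sup>2 = Z * exp ((1 - s0) * x) * (1 / V\<^sup>2)" by simp
        also have "\<dots> = (Z * (4 * \<l> ^ 4 / c2\<^sup>2)) * exp (- (\<eta> / 2 * x))" unfolding Vinv e[symmetric] by (simp only: mult_ac)
        also have "\<dots> \<le> (q1 * \<l> ^ (n + 10)) * exp (- (\<eta> / 2 * x))" using Zb by (intro mult_right_mono) auto
        finally have "(Z * exp ((1 - s0) * x) / V\<^sup>2) powr (2 * k) \<le> ((q1 * \<l> ^ (n + 10)) * exp (- (\<eta> / 2 * x))) powr (2 * k)"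
          using Z0 k by (intro powr_mono2) auto
        also have "\<dots> = (q1 * \<l> ^ (n + 10)) powr (2 * k) * exp (- (\<eta> / 2 * x)) powr (2 * k)" by (rule powr_mult)
        also have "exp (- (\<eta> / 2 * x)) powr (2 * k) = exp (- (k * \<eta> * x))" by (simp add: powr_def)
        also have "(q1 * \<l> ^ (n + 10)) powr (2 * k) * exp (- (k * \<eta> * x)) \<le> (q1 powr (2 * k) * \<l> ^ ((n + 10) * r)) * exp (- (k * \<eta> * x))"
          unfolding r_def by (intro mult_right_mono polylog_powr q1 ell) auto
        finally have "(Z * exp ((1 - s0) * x) / V\<^sup>2) powr (2 * k) * T \<le> (q1 powr (2 * k) * \<l> ^ ((n + 10) * r)) * exp (- (k * \<eta> * x)) * T"
          using T3 by (intro mult_right_mono) auto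
        thus ?thesis unfolding TX[symmetric] by (simp only: mult_ac)
      qed
      have "(q1 * \<l> ^ (n + 10)) * X \<le> (q1 * \<l> ^ N) * X" using q1 X0 pw1 by (intro mult_right_mono mult_left_mono) auto
      moreover have "(q1 powr (2 * k) * \<l> ^ ((n + 10) * r)) * X \<le> (q1 powr (2 * k) * \<l> ^ N) * X" using X0 pw1 by (intro mult_right_mono mult_left_mono) auto
      moreover have "K3 * \<l> ^ N * X = (q1 * \<l> ^ N) * X + (q1 powr (2 * k) * \<l> ^ N) * X" by (simp add: K3_def algebra_simps)
      ultimately show ?thesis using cardQ f1 f2 by linarith
    qed
    have g1_bound: "real (card G1) \<le> K1 * \<l> ^ N * X"
    proof -
      define R where "R = real (card G1)"
      define s where "s = 1 / (2 * k)"
      have s: "s > 0" "1 / s = 2 * k" using k by (auto simp: s_def)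
      define M where "M = Km * (2 * c * \<l>) ^ 5 * \<l> ^ (n + 1) * exp 2"
      have M0: "M \<ge> 0" unfolding M_def using conjunct1[OF Km] c ell by simp
      \<comment> \<open>Normalized so that Y powr (2 * k) = T * exp (- (k * \<eta> * x)) =
        X.\<close>
      define Y where "Y = T powr s * exp (- (\<eta> / 2 * x))"
      have Y0: "Y \<ge> 0" by (simp add: Y_def)
      have S0: "M * (R * X + R powr (2 - s) * Y) \<ge> 0" using M0 X0 Y0 by (simp add: R_def)
      have "(R * (c2 / (2 * \<l>)))\<^sup>2 \<le> y\<^sup>2 * (M * (R * X + R powr (2 - s) * Y))" unfolding R_def
      proof (rule card_le_pint_square[where x = x and l = "b * ln T" and \<delta> = \<delta>])
        fix t assume t: "x - 1 \<le> t" "t < y"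
        have t1: "t + 1 \<ge> 1" using t x1 by linarith
        have "y + 1 \<le> 2 * c * \<l>"
        proof -
          have "1 * 1 \<le> c * \<l>" using c ell by (intro mult_mono) auto
          thus ?thesis using yc by simp
        qed
        hence tc: "t + 1 \<le> 2 * c * \<l>" using t by linarith
        have bl': "0 \<le> b * ln T" using bl by simp
        define h where "h = exp ((1 - s0) * (t + 1))"
        have "(\<Sum>\<gamma>\<in>G1. norm (ppoly (b * ln T) x t \<gamma>))\<^sup>2 \<le> Km * (t + 1) ^ 5 * (ln T) ^ (n + 1) * exp ((1 - s0) * (t + 1)) *
           (real (card G1) * exp ((1 - s0) * (t + 1)) + real (card G1) powr (2 - 1 / (2 * k)) * T powr (1 / (2 * k)))"
          unfolding ppoly_def
          by (rule conjunct2[OF Km, THEN spec, THEN mp, OF T3, THEN spec, THEN mp, OF t1, THEN spec, THEN spec, THEN spec, THEN mp, OF divisor_bounded_ppoly[OF bl'], THEN mp, OF fin(1), THEN mp, OF bd1, THEN mp, OF sep1])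
        hence "(\<Sum>\<gamma>\<in>G1. norm (ppoly (b * ln T) x t \<gamma>))\<^sup>2 \<le> (Km * (t + 1) ^ 5 * \<l> ^ (n + 1)) * (h * (R * h + R powr (2 - s) * T powr s))"
          unfolding h_def R_def s_def \<l>_def by (simp only: mult.assoc)
        also have "\<dots> \<le> (Km * (2 * c * \<l>) ^ 5 * \<l> ^ (n + 1)) * (h * (R * h + R powr (2 - s) * T powr s))"
          using conjunct1[OF Km] tc t1 ell by (intro mult_right_mono mult_left_mono power_mono) (auto simp: h_def R_def)
        finally have m: "(\<Sum>\<gamma>\<in>G1. norm (ppoly (b * ln T) x t \<gamma>))\<^sup>2 \<le> (Km * (2 * c * \<l>) ^ 5 * \<l> ^ (n + 1)) * (h * (R * h + R powr (2 - s) * T powr s))" .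
        have e1: "exp (- 2 * \<delta> * t) * (h * h) \<le> exp 2 * X"
          unfolding h_def X_def exp_add[symmetric] exp_le_cancel_iff
        proof -
          have "- 2 * \<delta> * t + ((1 - s0) * (t + 1) + (1 - s0) * (t + 1)) = 2 * (1 - s0) + 2 * (1 - \<alpha>) * t" by (simp add: \<delta>_def algebra_simps)
          also have "\<dots> \<le> 2 + 2 * (1 - \<alpha>) * y" using s0 theta up t by (intro add_mono mult_left_mono) auto
          finally show "- 2 * \<delta> * t + ((1 - s0) * (t + 1) + (1 - s0) * (t + 1)) \<le> 2 + E * \<l>" unfolding Ey .
        qed
        \<comment> \<open>This term decreases in t at the rate \<eta> / 2, so its worst scale is t =
          x - 1, whereas the first term is worst at t = y. Hence both lengths have to be
          tuned.\<close>
        have e2: "exp (- 2 * \<delta> * t) * h \<le> exp 2 * exp (- (\<eta> / 2 * x))"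
          unfolding h_def exp_add[symmetric] exp_le_cancel_iff
        proof -
          have "- 2 * \<delta> * t + (1 - s0) * (t + 1) = (1 - s0) - \<eta> / 2 * t" by (simp add: \<delta>_def \<eta>_def s0_def field_simps)
          also have "\<dots> \<le> (1 - s0) - \<eta> / 2 * (x - 1)" using t eta0 by (intro diff_left_mono mult_left_mono) auto
          also have "\<dots> = (1 - s0) + \<eta> / 2 - \<eta> / 2 * x" by (simp add: right_diff_distrib)
          also have "\<dots> \<le> 2 + - (\<eta> / 2 * x)" using up s0 theta by linarith
          finally show "- 2 * \<delta> * t + (1 - s0) * (t + 1) \<le> 2 + - (\<eta> / 2 * x)" .
        qed
        have RR: "R \<ge> 0" by (simp add: R_def)
        have "exp (- 2 * \<delta> * t) * (h * (R * h + R powr (2 - s) * T powr s)) = (exp (- 2 * \<delta> * t) * (h * h)) * R + (exp (- 2 * \<delta> * t) * h) * (R powr (2 - s) * T powr s)"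
          by (simp add: algebra_simps)
        also have "\<dots> \<le> (exp 2 * X) * R + (exp 2 * exp (- (\<eta> / 2 * x))) * (R powr (2 - s) * T powr s)"
          using RR by (intro add_mono mult_right_mono e1 e2) auto
        finally have e: "exp (- 2 * \<delta> * t) * (h * (R * h + R powr (2 - s) * T powr s)) \<le> exp 2 * (R * X + R powr (2 - s) * Y)"
          by (simp add: Y_def algebra_simps)
        have "exp (- 2 * \<delta> * t) * (\<Sum>\<gamma>\<in>G1. norm (ppoly (b * ln T) x t \<gamma>))\<^sup>2 \<le> exp (- 2 * \<delta> * t) * ((Km * (2 * c * \<l>) ^ 5 * \<l> ^ (n + 1)) * (h * (R * h + R powr (2 - s) * T powr s)))"
          by (rule mult_left_mono[OF m]) simp
        also have "\<dots> = (Km * (2 * c * \<l>) ^ 5 * \<l> ^ (n + 1)) * (exp (- 2 * \<delta> * t) * (h * (R * h + R powr (2 - s) * T powr s)))"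
          by (simp only: mult_ac)
        also have "\<dots> \<le> (Km * (2 * c * \<l>) ^ 5 * \<l> ^ (n + 1)) * (exp 2 * (R * X + R powr (2 - s) * Y))"
          using conjunct1[OF Km] c ell by (intro mult_left_mono[OF e]) simp
        also have "\<dots> = M * (R * X + R powr (2 - s) * Y)" by (simp only: M_def mult.assoc)
        finally show "exp (- 2 * \<delta> * t) * (\<Sum>\<gamma>\<in>G1. norm (ppoly (b * ln T) x t \<gamma>))\<^sup>2 \<le> M * (real (card G1) * X + real (card G1) powr (2 - s) * Y)" unfolding R_def .
      qed (use fin bl x1 y0 S0 c2 ell g1 in \<open>auto simp: \<l>_def \<delta>_def R_def\<close>)
      also have "\<dots> \<le> (c * \<l>)\<^sup>2 * (M * (R * X + R powr (2 - s) * Y))" using yc y0 S0 by (intro mult_right_mono power_mono) auto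
      finally have m: "(R * (c2 / (2 * \<l>)))\<^sup>2 \<le> (c * \<l>)\<^sup>2 * (M * (R * X + R powr (2 - s) * Y))" .
      define W where "W = (c * \<l>)\<^sup>2 * M / (c2 / (2 * \<l>))\<^sup>2"
      have W: "W = w1 * \<l> ^ (n + 10)"
      proof -
        have "W = w1 * (\<l> ^ 2 * \<l> ^ 2 * \<l> ^ 5 * \<l> ^ (n + 1))" unfolding W_def w1_def M_def using c2 ell by (simp add: field_simps)
        also have "\<l> ^ 2 * \<l> ^ 2 * \<l> ^ 5 * \<l> ^ (n + 1) = \<l> ^ (n + 10)" unfolding power_add[symmetric] by (rule arg_cong[of _ _ "\<lambda>i. \<l> ^ i"]) simp
        finally show ?thesis .
      qed
      have W0: "W \<ge> 0" unfolding W using w1 ell by simp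
      \<comment> \<open>Division by R leaves a self-bounding inequality; both terms of its solution
        are X up to powers of the logarithm.\<close>
      have RWX: "R \<le> W * X + (W * Y) * R powr (1 - s)"
      proof (cases "R = 0")
        case True thus ?thesis using W0 X0 Y0 by simp
      next
        case False
        hence R0: "R > 0" by (simp add: R_def)
        have "R powr (2 - s) = R * R powr (1 - s)" using R0 powr_add[of R 1 "1 - s"] by simp
        hence "R * (R * (c2 / (2 * \<l>))\<^sup>2) \<le> R * ((c * \<l>)\<^sup>2 * M * (X + R powr (1 - s) * Y))" using m by (simp add: power_mult_distrib power2_eq_square algebra_simps)
        hence "R * (c2 / (2 * \<l>))\<^sup>2 \<le> (c * \<l>)\<^sup>2 * M * (X + R powr (1 - s) * Y)" using R0 by (simp only: mult_le_cancel_left_pos)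
        hence "R \<le> ((c * \<l>)\<^sup>2 * M * (X + R powr (1 - s) * Y)) / (c2 / (2 * \<l>))\<^sup>2" using c2 ell by (subst pos_le_divide_eq) auto
        also have "\<dots> = W * X + (W * Y) * R powr (1 - s)" unfolding W_def by (simp add: add_divide_distrib algebra_simps)
        finally show ?thesis .
      qed
      have "R \<le> 2 * (W * X) + (2 * (W * Y)) powr (1 / s)"
        using W0 X0 by (intro le_of_self_bound[OF s(1) _ _ RWX]) (auto simp: R_def)
      also have "(2 * (W * Y)) powr (1 / s) = (2 * W) powr (2 * k) * Y powr (2 * k)" unfolding s(2) mult.assoc[symmetric] by (rule powr_mult)
      also have "Y powr (2 * k) = X"
      proof -
        have "Y powr (2 * k) = (T powr s) powr (2 * k) * exp (- (\<eta> / 2 * x)) powr (2 * k)" unfolding Y_def by (rule powr_mult)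
        also have "(T powr s) powr (2 * k) = T" using k T3 by (simp add: powr_powr s_def)
        also have "exp (- (\<eta> / 2 * x)) powr (2 * k) = exp (- (k * \<eta> * x))" by (simp add: powr_def)
        also have "T * exp (- (k * \<eta> * x)) = X" by (rule TX)
        finally show ?thesis .
      qed
      finally have R1: "R \<le> 2 * (W * X) + (2 * W) powr (2 * k) * X" .
      have W2: "2 * W = (2 * w1) * \<l> ^ (n + 10)" unfolding W by simp
      have "(2 * W) powr (2 * k) \<le> (2 * w1) powr (2 * k) * \<l> ^ ((n + 10) * r)" unfolding W2 r_def by (rule polylog_powr) (use w1 ell in auto)
      also have "\<dots> \<le> (2 * w1) powr (2 * k) * \<l> ^ N" using pw1 by (intro mult_left_mono) auto
      finally have a: "(2 * W) powr (2 * k) * X \<le> (2 * w1) powr (2 * k) * \<l> ^ N * X" using X0 by (intro mult_right_mono) auto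
      have "W \<le> w1 * \<l> ^ N" unfolding W using w1 pw1 by (intro mult_left_mono) auto
      hence b: "W * X \<le> w1 * \<l> ^ N * X" using X0 by (intro mult_right_mono) auto
      have "K1 * \<l> ^ N * X = 2 * (w1 * \<l> ^ N * X) + (2 * w1) powr (2 * k) * \<l> ^ N * X" by (simp add: K1_def algebra_simps)
      thus ?thesis using R1 a b unfolding R_def by linarith
    qed
    have "real (card G) \<le> real (card G1) + real (card G2) + real (card Q)" using card by linarith
    also have "\<dots> \<le> max 1 (K1 + Kz + K3) * \<l> ^ (N + Nz + N) * X"
      by (rule polylog_sum3[OF g1_bound c2_bound q_bound]) (use conjunct1[OF Kz] K13 ell X0 in auto)
    finally show "real (card G) \<le> max 1 (K1 + Kz + K3) * (ln T) ^ (N + Nz + N) * exp (4 * (3 * \<alpha> - 2 - \<theta>) * (1 - \<alpha>) /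
        (k * (2 * \<alpha> - 1 - \<theta>) * (4 * \<alpha> - 3 - \<theta>) + 4 * (3 * \<alpha> - 2 - \<theta>) * (1 - \<alpha>)) * ln T)"
      unfolding \<l>_def X_def Eeq .
  qed
qed

section \<open>From well-spaced zeros to all zeros\<close>

lemma window_count:
  "\<exists>K\<ge>1. \<forall>T\<ge>3. \<forall>w\<ge>1. \<forall>t Z. finite Z \<longrightarrow> (\<forall>\<rho>\<in>Z. s0 \<le> Re \<rho> \<and> Re \<rho> \<le> 2 \<and> \<bar>Im \<rho> - t\<bar> \<le> w \<and> \<bar>Im \<rho>\<bar> \<le> T) \<longrightarrow>
     real (\<Sum>\<rho>\<in>Z. nat (zorder zf \<rho>)) \<le> K * w * ln T"
proof -
  obtain c1 where c1: "c1 > 0" "\<And>t. norm (zet (Complex 2 t)) \<ge> c1" using zet_lower_bound by blast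
  obtain K0 where K0: "K0 \<ge> 0" and loc: "\<forall>T\<ge>2. \<forall>t Z. \<bar>t\<bar> \<le> T \<longrightarrow> finite Z \<longrightarrow> Z \<subseteq> {\<rho>. s0 \<le> Re \<rho> \<and> Re \<rho> \<le> 2 \<and> \<bar>Im \<rho> - t\<bar> \<le> (1 - \<theta>) / 6} \<longrightarrow>
      real (\<Sum>\<rho>\<in>Z. nat (zorder zf \<rho>)) \<le> K0 * ln T"
    using local_zero_count[OF c1] by blast
  define h where "h = (1 - \<theta>) / 6"
  have h: "h > 0" using theta by (simp add: h_def)
  define K where "K = max 1 ((2 / h + 2) * K0)"
  show ?thesis
  proof (intro exI[of _ K] conjI allI impI)
    show "K \<ge> 1" by (simp add: K_def)
    fix T w t :: real and Z
    assume T: "3 \<le> T" and w: "1 \<le> w" and Z: "finite Z" "\<forall>\<rho>\<in>Z. s0 \<le> Re \<rho> \<and> Re \<rho> \<le> 2 \<and> \<bar>Im \<rho> - t\<bar> \<le> w \<and> \<bar>Im \<rho>\<bar> \<le> T"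
    have lT: "ln T \<ge> 1" by (rule one_le_ln[OF T])
    define J where "J = {\<lfloor>(t - w) / h\<rfloor>..\<lfloor>(t + w) / h\<rfloor>}"
    have J: "(\<lambda>\<rho>. \<lfloor>Im \<rho> / h\<rfloor>) ` Z \<subseteq> J"
    proof
      fix j assume "j \<in> (\<lambda>\<rho>. \<lfloor>Im \<rho> / h\<rfloor>) ` Z"
      then obtain \<rho> where r: "\<rho> \<in> Z" "j = \<lfloor>Im \<rho> / h\<rfloor>" by blast
      hence "t - w \<le> Im \<rho>" "Im \<rho> \<le> t + w" using Z(2) by (auto simp: abs_le_iff)
      hence "(t - w) / h \<le> Im \<rho> / h" "Im \<rho> / h \<le> (t + w) / h" using h by (simp_all add: divide_right_mono)
      thus "j \<in> J" unfolding J_def r(2) by (auto intro: floor_mono)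
    qed
    have cell: "real (sum (\<lambda>\<rho>. nat (zorder zf \<rho>)) {\<rho> \<in> Z. \<lfloor>Im \<rho> / h\<rfloor> = j}) \<le> K0 * ln T" for j
    proof (cases "{\<rho> \<in> Z. \<lfloor>Im \<rho> / h\<rfloor> = j} = {}")
      case True
      show ?thesis unfolding True using K0 lT by simp
    next
      case False
      then obtain \<rho>0 where r0: "\<rho>0 \<in> Z" "\<lfloor>Im \<rho>0 / h\<rfloor> = j" by blast
      have ran: "real_of_int j * h \<le> Im \<rho>" "Im \<rho> < (real_of_int j + 1) * h" if "\<lfloor>Im \<rho> / h\<rfloor> = j" for \<rho>
      proof -
        have "real_of_int j \<le> Im \<rho> / h" "Im \<rho> / h < real_of_int j + 1" using that by linarith+
        thus "real_of_int j * h \<le> Im \<rho>" "Im \<rho> < (real_of_int j + 1) * h" using h by (simp_all add: pos_le_divide_eq pos_divide_less_eq)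
      qed
      have sub: "{\<rho> \<in> Z. \<lfloor>Im \<rho> / h\<rfloor> = j} \<subseteq> {\<rho>. s0 \<le> Re \<rho> \<and> Re \<rho> \<le> 2 \<and> \<bar>Im \<rho> - Im \<rho>0\<bar> \<le> (1 - \<theta>) / 6}"
        unfolding h_def[symmetric]
      proof
        fix \<rho> assume "\<rho> \<in> {\<rho> \<in> Z. \<lfloor>Im \<rho> / h\<rfloor> = j}"
        hence r: "\<rho> \<in> Z" "\<lfloor>Im \<rho> / h\<rfloor> = j" by auto
        have e: "(real_of_int j + 1) * h = real_of_int j * h + h" by (simp add: algebra_simps)
        have "\<bar>Im \<rho> - Im \<rho>0\<bar> \<le> h" using ran[OF r(2)] ran[OF r0(2)] unfolding e by linarith
        thus "\<rho> \<in> {\<rho>. s0 \<le> Re \<rho> \<and> Re \<rho> \<le> 2 \<and> \<bar>Im \<rho> - Im \<rho>0\<bar> \<le> h}" using Z(2) r(1) by blast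
      qed
      have a: "\<bar>Im \<rho>0\<bar> \<le> T" "T \<ge> 2" "finite {\<rho> \<in> Z. \<lfloor>Im \<rho> / h\<rfloor> = j}" using Z r0 T by auto
      show ?thesis
        by (rule loc[THEN spec, THEN mp, OF a(2), THEN spec, THEN spec, THEN mp, OF a(1), THEN mp, OF a(3), THEN mp, OF sub])
    qed
    have "(\<Sum>\<rho>\<in>Z. nat (zorder zf \<rho>)) = (\<Sum>j\<in>J. sum (\<lambda>\<rho>. nat (zorder zf \<rho>)) {\<rho> \<in> Z. \<lfloor>Im \<rho> / h\<rfloor> = j})"
      by (rule sum.group[symmetric]) (use Z J in \<open>auto simp: J_def\<close>)
    hence "real (\<Sum>\<rho>\<in>Z. nat (zorder zf \<rho>)) = (\<Sum>j\<in>J. real (sum (\<lambda>\<rho>. nat (zorder zf \<rho>)) {\<rho> \<in> Z. \<lfloor>Im \<rho> / h\<rfloor> = j}))" by simp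
    also have "\<dots> \<le> (\<Sum>j\<in>J. K0 * ln T)" by (rule sum_mono) (rule cell)
    also have "\<dots> = real (card J) * (K0 * ln T)" by simp
    also have "\<dots> \<le> ((2 / h + 2) * w) * (K0 * ln T)"
    proof (rule mult_right_mono)
      have "(t - w) / h \<le> (t + w) / h" using h w by (intro divide_right_mono) auto
      hence "\<lfloor>(t - w) / h\<rfloor> \<le> \<lfloor>(t + w) / h\<rfloor>" by (rule floor_mono)
      hence "real (card J) = real_of_int \<lfloor>(t + w) / h\<rfloor> - real_of_int \<lfloor>(t - w) / h\<rfloor> + 1" by (simp add: J_def)
      also have "\<dots> \<le> (t + w) / h - ((t - w) / h - 1) + 1" by linarith
      also have "\<dots> = (2 / h) * w + 2" using h by (simp add: field_simps)
      also have "\<dots> \<le> (2 / h) * w + 2 * w" using w by simp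
      finally show "real (card J) \<le> (2 / h + 2) * w" by (simp add: distrib_right)
    qed (use K0 lT in auto)
    also have "\<dots> = ((2 / h + 2) * K0) * (w * ln T)" by simp
    also have "\<dots> \<le> K * (w * ln T)" using w lT by (intro mult_right_mono) (auto simp: K_def)
    finally show "real (\<Sum>\<rho>\<in>Z. nat (zorder zf \<rho>)) \<le> K * w * ln T" by (simp add: mult.assoc)
  qed
qed

text \<open>Zeros above height b * ln T are sorted into blocks of height 6 * (b * ln T) with one
  representative each. Representatives of blocks with indices of equal parity form a
  \<open>zero_set\<close>, which bounds the number of occupied blocks; each block, and the low
  strip, is counted trivially.\<close>

lemma zero_count_of_zero_sets:
  assumes K: "K \<ge> 1" and win: "\<And>w t Z. w \<ge> 1 \<Longrightarrow> finite Z \<Longrightarrow> (\<forall>\<rho>\<in>Z. s0 \<le> Re \<rho> \<and> Re \<rho> \<le> 2 \<and> \<bar>Im \<rho> - t\<bar> \<le> w \<and> \<bar>Im \<rho>\<bar> \<le> T) \<Longrightarrow>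
     real (\<Sum>\<rho>\<in>Z. nat (zorder zf \<rho>)) \<le> K * w * ln T"
    and T: "T \<ge> 3" and b: "b \<ge> 16" and al: "s0 \<le> \<alpha>"
    and B: "\<And>G. zero_set b T \<alpha> G \<Longrightarrow> real (card G) \<le> B"
    and Z: "finite Z" "\<And>\<rho>. \<rho> \<in> Z \<Longrightarrow> zet \<rho> = 0" "\<And>\<rho>. \<rho> \<in> Z \<Longrightarrow> \<alpha> \<le> Re \<rho>" "\<And>\<rho>. \<rho> \<in> Z \<Longrightarrow> \<bar>Im \<rho>\<bar> \<le> T"
  shows "real (\<Sum>\<rho>\<in>Z. nat (zorder zf \<rho>)) \<le> K * b * (ln T)\<^sup>2 * (1 + 12 * B)"
proof -
  define \<l> where "\<l> = ln T"
  have ell: "\<l> \<ge> 1" using one_le_ln[OF T] by (simp add: \<l>_def)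
  have Re1: "Re \<rho> \<le> 1" if "\<rho> \<in> Z" for \<rho> using zet_nonzero[of \<rho>] Z(2)[OF that] by fastforce
  define W where "W = 6 * (b * \<l>)"
  have bl: "b * \<l> \<ge> 1" using mult_mono[of 16 b 1 \<l>] b ell by simp
  have W1: "W \<ge> 1" using bl by (simp add: W_def)
  define Z1 where "Z1 = {\<rho> \<in> Z. \<bar>Im \<rho>\<bar> \<le> b * \<l>}"
  define Z2 where "Z2 = {\<rho> \<in> Z. b * \<l> < \<bar>Im \<rho>\<bar>}"
  have fin: "finite Z1" "finite Z2" using Z(1) by (auto simp: Z1_def Z2_def)
  have un: "Z = Z1 \<union> Z2" "Z1 \<inter> Z2 = {}" by (auto simp: Z1_def Z2_def)
  have z1: "real (\<Sum>\<rho>\<in>Z1. nat (zorder zf \<rho>)) \<le> K * (b * \<l>) * \<l>"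
    unfolding \<l>_def by (rule win[where t = 0]) (use bl fin Z al Re1 in \<open>force simp: Z1_def \<l>_def\<close>)+
  define f where "f = (\<lambda>\<rho>. \<lfloor>Im \<rho> / W\<rfloor>)"
  have ran: "real_of_int (f \<rho>) * W \<le> Im \<rho>" "Im \<rho> < real_of_int (f \<rho>) * W + W" for \<rho>
  proof -
    have "real_of_int (f \<rho>) \<le> Im \<rho> / W" "Im \<rho> / W < real_of_int (f \<rho>) + 1" unfolding f_def by linarith+
    hence "real_of_int (f \<rho>) * W \<le> Im \<rho>" "Im \<rho> < (real_of_int (f \<rho>) + 1) * W" using W1 by (simp_all add: pos_le_divide_eq pos_divide_less_eq)
    thus "real_of_int (f \<rho>) * W \<le> Im \<rho>" "Im \<rho> < real_of_int (f \<rho>) * W + W" by (simp_all add: algebra_simps)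
  qed
  define J where "J = f ` Z2"
  have J: "finite J" unfolding J_def using fin by simp
  define r where "r = (\<lambda>j. SOME \<rho>. \<rho> \<in> Z2 \<and> f \<rho> = j)"
  have r: "r j \<in> Z2" "f (r j) = j" if "j \<in> J" for j
  proof -
    have "\<exists>\<rho>. \<rho> \<in> Z2 \<and> f \<rho> = j" using that by (auto simp: J_def)
    from someI_ex[OF this] show "r j \<in> Z2" "f (r j) = j" by (auto simp: r_def)
  qed
  have cards: "real (card I) \<le> B" if I: "I \<subseteq> J" and par: "\<And>i j. i \<in> I \<Longrightarrow> j \<in> I \<Longrightarrow> even (i - j)" for I
  proof -
    have inj: "inj_on r I" by (rule inj_onI) (metis I r(2) subsetD)
    have far: "\<bar>Im (r i) - Im (r j)\<bar> > W" if ij: "i \<in> I" "j \<in> I" "i < j" for i j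
    proof -
      \<comment> \<open>Equal parity makes distinct indices differ by at least 2, so a whole block
        lies between the representatives.\<close>
      obtain m where m: "j - i = 2 * m" using par[OF ij(2,1)] by (elim evenE)
      hence "i + 2 \<le> j" using ij(3) by presburger
      hence "(real_of_int i + 2) * W \<le> real_of_int j * W" using W1 by (intro mult_right_mono) auto
      hence "real_of_int i * W + 2 * W \<le> real_of_int j * W" by (simp add: algebra_simps)
      thus ?thesis using ran(2)[of "r i"] ran(1)[of "r j"] r(2) ij I by (auto simp: subset_iff)
    qed
    have "zero_set b T \<alpha> (r ` I)"
      unfolding zero_set_def \<l>_def[symmetric]
    proof (intro conjI ballI impI)
      show "finite (r ` I)" using finite_subset[OF I J] by simp
      fix \<rho> assume "\<rho> \<in> r ` I"
      then obtain i where "\<rho> = r i" "i \<in> I" by blast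
      hence "\<rho> \<in> Z2" using r(1) I by blast
      thus "zet \<rho> = 0" "\<alpha> \<le> Re \<rho>" "Re \<rho> \<le> 1" "b * \<l> \<le> \<bar>Im \<rho>\<bar>" "\<bar>Im \<rho>\<bar> \<le> T" using Z Re1 by (auto simp: Z2_def)
    next
      fix \<rho> \<rho>' assume a: "\<rho> \<in> r ` I" "\<rho>' \<in> r ` I" "\<rho> \<noteq> \<rho>'"
      then obtain i j where ij: "\<rho> = r i" "i \<in> I" "\<rho>' = r j" "j \<in> I" by blast
      have "i \<noteq> j" using a(3) unfolding ij(1,3) by blast
      hence "i < j \<or> j < i" by linarith
      thus "\<bar>Im \<rho> - Im \<rho>'\<bar> > 6 * (b * \<l>)" unfolding W_def[symmetric] ij using far[of i j] far[of j i] ij by (auto simp: abs_minus_commute)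
    qed
    from B[OF this] show ?thesis by (simp add: card_image[OF inj])
  qed
  have "real (card J) \<le> 2 * B"
  proof -
    have "J = {j \<in> J. even j} \<union> {j \<in> J. odd j}" by blast
    hence "card J \<le> card {j \<in> J. even j} + card {j \<in> J. odd j}" by (metis card_Un_le)
    moreover have "real (card {j \<in> J. even j}) \<le> B" by (rule cards) auto
    moreover have "real (card {j \<in> J. odd j}) \<le> B" by (rule cards) auto
    ultimately show ?thesis by linarith
  qed
  have cell: "real (sum (\<lambda>\<rho>. nat (zorder zf \<rho>)) {\<rho> \<in> Z2. f \<rho> = j}) \<le> K * W * \<l>" if j: "j \<in> J" for j
    unfolding \<l>_def
  proof (rule win[OF W1, where t = "Im (r j)"])
    show "finite {\<rho> \<in> Z2. f \<rho> = j}" using fin by simp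
    show "\<forall>\<rho>\<in>{\<rho> \<in> Z2. f \<rho> = j}. s0 \<le> Re \<rho> \<and> Re \<rho> \<le> 2 \<and> \<bar>Im \<rho> - Im (r j)\<bar> \<le> W \<and> \<bar>Im \<rho>\<bar> \<le> T"
    proof
      fix \<rho> assume "\<rho> \<in> {\<rho> \<in> Z2. f \<rho> = j}"
      hence q: "\<rho> \<in> Z" "f \<rho> = j" by (auto simp: Z2_def)
      have "\<bar>Im \<rho> - Im (r j)\<bar> \<le> W" using ran[of \<rho>] ran[of "r j"] r(2)[OF j] q(2) by (simp add: abs_le_iff)
      thus "s0 \<le> Re \<rho> \<and> Re \<rho> \<le> 2 \<and> \<bar>Im \<rho> - Im (r j)\<bar> \<le> W \<and> \<bar>Im \<rho>\<bar> \<le> T"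
        using Z(3,4)[OF q(1)] Re1[OF q(1)] al by simp
    qed
  qed
  have "(\<Sum>\<rho>\<in>Z2. nat (zorder zf \<rho>)) = (\<Sum>j\<in>J. sum (\<lambda>\<rho>. nat (zorder zf \<rho>)) {\<rho> \<in> Z2. f \<rho> = j})"
    by (rule sum.group[symmetric]) (use fin J in \<open>auto simp: J_def\<close>)
  hence "real (\<Sum>\<rho>\<in>Z2. nat (zorder zf \<rho>)) = (\<Sum>j\<in>J. real (sum (\<lambda>\<rho>. nat (zorder zf \<rho>)) {\<rho> \<in> Z2. f \<rho> = j}))" by simp
  also have "\<dots> \<le> (\<Sum>j\<in>J. K * W * \<l>)" by (rule sum_mono) (rule cell)
  also have "\<dots> = real (card J) * (K * W * \<l>)" by simp
  also have "\<dots> \<le> (2 * B) * (K * W * \<l>)" using K W1 ell \<open>real (card J) \<le> 2 * B\<close> by (intro mult_right_mono) auto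
  finally have z2: "real (\<Sum>\<rho>\<in>Z2. nat (zorder zf \<rho>)) \<le> (2 * B) * (K * W * \<l>)" .
  have "(\<Sum>\<rho>\<in>Z. nat (zorder zf \<rho>)) = (\<Sum>\<rho>\<in>Z1. nat (zorder zf \<rho>)) + (\<Sum>\<rho>\<in>Z2. nat (zorder zf \<rho>))"
    unfolding un(1) by (rule sum.union_disjoint[OF fin un(2)])
  hence "real (\<Sum>\<rho>\<in>Z. nat (zorder zf \<rho>)) \<le> K * (b * \<l>) * \<l> + (2 * B) * (K * W * \<l>)" using z1 z2 by linarith
  also have "\<dots> = K * b * \<l>\<^sup>2 * (1 + 12 * B)" by (simp add: W_def power2_eq_square algebra_simps)
  finally show ?thesis unfolding \<l>_def .
qed

lemma zero_density_of_zero_sets: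
  assumes spaced: "\<exists>b\<ge>16. \<exists>K\<ge>1. \<exists>N. \<exists>T0\<ge>3. \<forall>T\<ge>T0. \<forall>\<alpha> G. s0 + 2 / ln T \<le> \<alpha> \<longrightarrow> ok \<alpha> \<longrightarrow> \<alpha> \<le> 1 \<longrightarrow> zero_set b T \<alpha> G \<longrightarrow>
       real (card G) \<le> K * (ln T) ^ N * exp (E \<alpha> * ln T)"
    and E: "\<And>\<alpha>. s0 \<le> \<alpha> \<Longrightarrow> ok \<alpha> \<Longrightarrow> \<alpha> \<le> 1 \<Longrightarrow> 0 \<le> E \<alpha>" "\<And>\<alpha>. s0 \<le> \<alpha> \<Longrightarrow> ok \<alpha> \<Longrightarrow> \<alpha> \<le> 1 \<Longrightarrow> 1 - E \<alpha> \<le> M * (\<alpha> - s0)" and M: "M \<ge> 0"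
  shows "\<exists>K D. \<forall>T\<ge>2. \<forall>\<alpha>\<ge>s0. ok \<alpha> \<longrightarrow> (\<forall>Z. finite Z \<longrightarrow> (\<forall>\<rho>\<in>Z. zet \<rho> = 0 \<and> \<alpha> \<le> Re \<rho> \<and> \<bar>Im \<rho>\<bar> \<le> T) \<longrightarrow>
     real (\<Sum>\<rho>\<in>Z. nat (zorder zf \<rho>)) \<le> K * T powr E \<alpha> * ln T powr D)"
proof -
  obtain b K N T0 where b: "b \<ge> 16" and K: "K \<ge> 1" and T0: "T0 \<ge> 3" and cr: "\<forall>T\<ge>T0. \<forall>\<alpha> G. s0 + 2 / ln T \<le> \<alpha> \<longrightarrow> ok \<alpha> \<longrightarrow> \<alpha> \<le> 1 \<longrightarrow> zero_set b T \<alpha> G \<longrightarrow>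
       real (card G) \<le> K * (ln T) ^ N * exp (E \<alpha> * ln T)"
    using spaced by (elim exE conjE) (rule that; assumption)
  from window_count obtain Kw where Kw0: "Kw \<ge> 1 \<and> (\<forall>T\<ge>3. \<forall>w\<ge>1. \<forall>t Z. finite Z \<longrightarrow> (\<forall>\<rho>\<in>Z. s0 \<le> Re \<rho> \<and> Re \<rho> \<le> 2 \<and> \<bar>Im \<rho> - t\<bar> \<le> w \<and> \<bar>Im \<rho>\<bar> \<le> T) \<longrightarrow>
     real (\<Sum>\<rho>\<in>Z. nat (zorder zf \<rho>)) \<le> Kw * w * ln T)" by (rule exE)
  note Kw = conjunct1[OF Kw0]
  have win: "real (\<Sum>\<rho>\<in>Z. nat (zorder zf \<rho>)) \<le> Kw * w * ln T"
    if "T \<ge> 3" "w \<ge> 1" "finite Z" "\<forall>\<rho>\<in>Z. s0 \<le> Re \<rho> \<and> Re \<rho> \<le> 2 \<and> \<bar>Im \<rho> - t\<bar> \<le> w \<and> \<bar>Im \<rho>\<bar> \<le> T" for T w t Z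
    by (rule conjunct2[OF Kw0, THEN spec, THEN mp, OF that(1), THEN spec, THEN mp, OF that(2), THEN spec, THEN spec, THEN mp, OF that(3), THEN mp, OF that(4)])
  define D where "D = real (N + 2)"
  define Ka where "Ka = max (Kw * b * 13 * K) (Kw * exp (2 * M))"
  \<comment> \<open>The division by \<open>ln 2 powr D\<close> compensates for the factor
    \<open>ln T powr D\<close>, which may be below 1 when T is near 2.\<close>
  define Kb where "Kb = Kw * T0 * ln T0 / ln 2 powr D"
  have l2: "ln 2 > (0::real)" by simp
  have Ka0: "Ka \<ge> 0" using Kw by (simp add: Ka_def le_max_iff_disj)
  have Kb0: "Kb \<ge> 0" using Kw T0 by (simp add: Kb_def)
  show ?thesis
  proof (rule exI[of _ "Ka + Kb"], rule exI[of _ D], intro allI impI)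
    fix T \<alpha> :: real and Z
    assume T: "2 \<le> T" and al: "s0 \<le> \<alpha>" and ok: "ok \<alpha>" and Z: "finite Z" "\<forall>\<rho>\<in>Z. zet \<rho> = 0 \<and> \<alpha> \<le> Re \<rho> \<and> \<bar>Im \<rho>\<bar> \<le> T"
    have Re1: "Re \<rho> \<le> 1" if "\<rho> \<in> Z" for \<rho> using zet_nonzero[of \<rho>] Z(2) that by fastforce
    let ?S = "real (\<Sum>\<rho>\<in>Z. nat (zorder zf \<rho>))"
    show "?S \<le> (Ka + Kb) * T powr E \<alpha> * ln T powr D"
    proof (cases "\<alpha> \<le> 1")
      case False
      hence "Z = {}" using Z(2) Re1 by force
      thus ?thesis using Ka0 Kb0 by simp
    next
      case a1: True
      have E0: "0 \<le> E \<alpha>" by (rule E(1)[OF al ok a1])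
      have TE: "T powr E \<alpha> \<ge> 1" using T E0 by (intro ge_one_powr_ge_zero) auto
      show ?thesis
      proof (cases "T \<ge> T0")
        case False
        have "?S \<le> Kw * T0 * ln T0"
          by (rule win[where t = 0]) (use T0 False T Z Re1 al in force)+
        also have "\<dots> = Kb * ln 2 powr D" using l2 by (simp add: Kb_def)
        also have "\<dots> \<le> Kb * ln T powr D" using Kb0 T l2 by (intro mult_left_mono powr_mono2) (auto simp: D_def)
        also have "\<dots> \<le> (Ka + Kb) * T powr E \<alpha> * ln T powr D"
        proof (intro mult_right_mono)
          have "Kb * 1 \<le> (Ka + Kb) * T powr E \<alpha>" using Ka0 Kb0 TE by (intro mult_mono) auto
          thus "Kb \<le> (Ka + Kb) * T powr E \<alpha>" by simp
        qed simp
        finally show ?thesis .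
      next
        case TT: True
        have T3: "T \<ge> 3" using TT T0 by linarith
        define \<l> where "\<l> = ln T"
        have ell: "\<l> \<ge> 1" using one_le_ln[OF T3] by (simp add: \<l>_def)
        have expl: "exp \<l> = T" using T3 by (simp add: \<l>_def)
        have TX: "T powr E \<alpha> = exp (E \<alpha> * \<l>)" using T3 by (simp add: powr_def \<l>_def)
        have lD: "\<l> powr D = \<l> ^ (N + 2)" unfolding D_def using ell by (subst powr_realpow) auto
        have "?S \<le> Ka * \<l> ^ (N + 2) * T powr E \<alpha>"
        proof (cases "s0 + 2 / ln T \<le> \<alpha>")
          case True
          have l1: "1 \<le> K * \<l> ^ N * T powr E \<alpha>"
          proof -
            have "1 * 1 * 1 \<le> K * \<l> ^ N * T powr E \<alpha>" using K ell TE by (intro mult_mono one_le_power) auto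
            thus ?thesis by simp
          qed
          have "?S \<le> Kw * b * (ln T)\<^sup>2 * (1 + 12 * (K * (ln T) ^ N * exp (E \<alpha> * ln T)))"
          proof (rule zero_count_of_zero_sets[OF Kw win[OF T3] T3 b al _ Z(1)])
            fix G assume "zero_set b T \<alpha> G"
            from cr[THEN spec, THEN mp, OF TT, THEN spec, THEN spec, THEN mp, OF True, THEN mp, OF ok, THEN mp, OF a1, THEN mp, OF this]
            show "real (card G) \<le> K * (ln T) ^ N * exp (E \<alpha> * ln T)" .
          qed (use Z(2) in auto)
          hence "?S \<le> Kw * b * \<l>\<^sup>2 * (1 + 12 * (K * \<l> ^ N * T powr E \<alpha>))" unfolding TX \<l>_def .
          also have "\<dots> \<le> Kw * b * \<l>\<^sup>2 * (13 * (K * \<l> ^ N * T powr E \<alpha>))" using l1 Kw b ell by (intro mult_left_mono) auto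
          also have "\<dots> = (Kw * b * 13 * K) * (\<l> ^ (N + 2) * T powr E \<alpha>)" by (simp add: power_add power2_eq_square mult_ac)
          also have "\<dots> \<le> Ka * (\<l> ^ (N + 2) * T powr E \<alpha>)" using ell by (intro mult_right_mono) (auto simp: Ka_def)
          finally show ?thesis by (simp add: mult.assoc)
        next
          case False
          have "?S \<le> Kw * T * ln T"
            by (rule win[where t = 0]) (use T3 Z Re1 al in force)+
          also have "Kw * T * ln T = Kw * (exp (E \<alpha> * \<l>) * exp ((1 - E \<alpha>) * \<l>)) * \<l>"
          proof -
            have "exp (E \<alpha> * \<l>) * exp ((1 - E \<alpha>) * \<l>) = T" unfolding exp_add[symmetric] expl[symmetric] by (rule arg_cong[of _ _ exp]) (simp add: algebra_simps)
            thus ?thesis unfolding \<l>_def[symmetric] by simp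
          qed
          also have "\<dots> \<le> Kw * (exp (E \<alpha> * \<l>) * exp (2 * M)) * \<l>"
          proof (intro mult_right_mono mult_left_mono)
            have "\<alpha> - s0 \<le> 2 / \<l>" using False by (simp add: \<l>_def)
            hence "M * (\<alpha> - s0) \<le> M * (2 / \<l>)" using M by (intro mult_left_mono) auto
            hence "1 - E \<alpha> \<le> M * (2 / \<l>)" using E(2)[OF al ok a1] by linarith
            hence "(1 - E \<alpha>) * \<l> \<le> M * (2 / \<l>) * \<l>" using ell by (intro mult_right_mono) auto
            thus "exp ((1 - E \<alpha>) * \<l>) \<le> exp (2 * M)" using ell by (simp add: mult.commute)
          qed (use Kw ell in auto)
          also have "\<dots> = (Kw * exp (2 * M)) * (\<l> ^ 1 * T powr E \<alpha>)" unfolding TX by simp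
          also have "\<dots> \<le> Ka * (\<l> ^ (N + 2) * T powr E \<alpha>)"
            using ell Kw by (intro mult_mono mult_right_mono power_increasing) (auto simp: Ka_def le_max_iff_disj)
          finally show ?thesis by (simp add: mult.assoc)
        qed
        also have "\<dots> = Ka * T powr E \<alpha> * \<l> powr D" unfolding lD by simp
        also have "\<dots> \<le> (Ka + Kb) * T powr E \<alpha> * \<l> powr D" using Kb0 by (intro mult_right_mono) auto
        finally show ?thesis unfolding \<l>_def .
      qed
    qed
  qed
qed

text \<open>The constant M comes from 1 - E \<alpha> = 2 * k * (\<alpha> - s0) / (2 * (1 - \<alpha>)
  + k * (1 - \<theta>)), which vanishes linearly at s0.\<close>

lemma zero_density_mean_value:
  "\<exists>K D. \<forall>T\<ge>2. \<forall>\<alpha>\<ge>s0. (\<forall>Z. finite Z \<longrightarrow> (\<forall>\<rho>\<in>Z. zet \<rho> = 0 \<and> \<alpha> \<le> Re \<rho> \<and> \<bar>Im \<rho>\<bar> \<le> T) \<longrightarrow>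
     real (\<Sum>\<rho>\<in>Z. nat (zorder zf \<rho>)) \<le> K * T powr (2 * (k + 1) * (1 - \<alpha>) / (2 * (1 - \<alpha>) + k * (1 - \<theta>))) * ln T powr D)"
proof -
  let ?E = "\<lambda>\<alpha>. 2 * (k + 1) * (1 - \<alpha>) / (2 * (1 - \<alpha>) + k * (1 - \<theta>))"
  have "\<exists>K D. \<forall>T\<ge>2. \<forall>\<alpha>\<ge>s0. True \<longrightarrow> (\<forall>Z. finite Z \<longrightarrow> (\<forall>\<rho>\<in>Z. zet \<rho> = 0 \<and> \<alpha> \<le> Re \<rho> \<and> \<bar>Im \<rho>\<bar> \<le> T) \<longrightarrow>
     real (\<Sum>\<rho>\<in>Z. nat (zorder zf \<rho>)) \<le> K * T powr ?E \<alpha> * ln T powr D)"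
  proof (rule zero_density_of_zero_sets[where M = "2 / (1 - \<theta>)"])
    show "\<exists>b\<ge>16. \<exists>K\<ge>1. \<exists>N. \<exists>T0\<ge>3. \<forall>T\<ge>T0. \<forall>\<alpha> G. s0 + 2 / ln T \<le> \<alpha> \<longrightarrow> True \<longrightarrow> \<alpha> \<le> 1 \<longrightarrow> zero_set b T \<alpha> G \<longrightarrow>
       real (card G) \<le> K * (ln T) ^ N * exp (?E \<alpha> * ln T)"
      using zero_set_card_mean_value by simp
    fix \<alpha> :: real assume a: "s0 \<le> \<alpha>" "\<alpha> \<le> 1"
    have kd: "k * (1 - \<theta>) > 0" using k theta by simp
    show "0 \<le> ?E \<alpha>" using a k kd by (intro divide_nonneg_pos) auto
    have den: "2 * (1 - \<alpha>) + k * (1 - \<theta>) > 0" using a kd by (intro add_nonneg_pos) auto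
    have "1 - ?E \<alpha> = ((2 * (1 - \<alpha>) + k * (1 - \<theta>)) - 2 * (k + 1) * (1 - \<alpha>)) / (2 * (1 - \<alpha>) + k * (1 - \<theta>))"
      using den by (simp add: diff_divide_distrib)
    also have "(2 * (1 - \<alpha>) + k * (1 - \<theta>)) - 2 * (k + 1) * (1 - \<alpha>) = 2 * k * (\<alpha> - s0)" by (simp add: s0_def field_simps)
    also have "2 * k * (\<alpha> - s0) / (2 * (1 - \<alpha>) + k * (1 - \<theta>)) \<le> 2 * k * (\<alpha> - s0) / (k * (1 - \<theta>))"
      using a k kd den by (intro divide_left_mono) auto
    also have "\<dots> = 2 / (1 - \<theta>) * (\<alpha> - s0)" using k theta by (simp add: field_simps)
    finally show "1 - ?E \<alpha> \<le> 2 / (1 - \<theta>) * (\<alpha> - s0)" .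
  qed (use theta in auto)
  thus ?thesis by simp
qed

text \<open>Here \<alpha> stays away from s0 by a fixed amount, so M = 1 / (?a0 - s0) works with
  nothing more than E \<alpha> \<ge> 0.\<close>

lemma zero_density_halasz:
  "\<exists>K D. \<forall>T\<ge>2. \<forall>\<alpha>\<ge>(3 * k - 1 + (k - 1) * \<theta>) / (4 * k - 2). (\<forall>Z. finite Z \<longrightarrow> (\<forall>\<rho>\<in>Z. zet \<rho> = 0 \<and> \<alpha> \<le> Re \<rho> \<and> \<bar>Im \<rho>\<bar> \<le> T) \<longrightarrow>
     real (\<Sum>\<rho>\<in>Z. nat (zorder zf \<rho>)) \<le> K * T powr (4 * (3 * \<alpha> - 2 - \<theta>) * (1 - \<alpha>) /
        (k * (2 * \<alpha> - 1 - \<theta>) * (4 * \<alpha> - 3 - \<theta>) + 4 * (3 * \<alpha> - 2 - \<theta>) * (1 - \<alpha>))) * ln T powr D)"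
proof -
  let ?a0 = "(3 * k - 1 + (k - 1) * \<theta>) / (4 * k - 2)"
  let ?E = "\<lambda>\<alpha>. 4 * (3 * \<alpha> - 2 - \<theta>) * (1 - \<alpha>) / (k * (2 * \<alpha> - 1 - \<theta>) * (4 * \<alpha> - 3 - \<theta>) + 4 * (3 * \<alpha> - 2 - \<theta>) * (1 - \<alpha>))"
  have a0: "?a0 - s0 = k * (1 - \<theta>) / (4 * k - 2)" using k by (simp add: s0_def field_simps)
  have a0': "?a0 - s0 > 0" unfolding a0 using k theta by simp
  define M where "M = 1 / (?a0 - s0)"
  have "\<exists>K D. \<forall>T\<ge>2. \<forall>\<alpha>\<ge>s0. ?a0 \<le> \<alpha> \<longrightarrow> (\<forall>Z. finite Z \<longrightarrow> (\<forall>\<rho>\<in>Z. zet \<rho> = 0 \<and> \<alpha> \<le> Re \<rho> \<and> \<bar>Im \<rho>\<bar> \<le> T) \<longrightarrow>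
     real (\<Sum>\<rho>\<in>Z. nat (zorder zf \<rho>)) \<le> K * T powr ?E \<alpha> * ln T powr D)"
  proof (rule zero_density_of_zero_sets[where M = M, OF zero_set_card_halasz])
    fix \<alpha> :: real assume a: "?a0 \<le> \<alpha>" "\<alpha> \<le> 1"
    have alk: "3 * k - 1 + (k - 1) * \<theta> \<le> \<alpha> * (4 * k - 2)" using a(1) k by (simp add: field_simps)
    have "(4 * \<alpha> - 3 - \<theta>) * (2 * k - 1) \<ge> 1 - \<theta>" using alk by (simp add: algebra_simps)
    hence e: "4 * \<alpha> - 3 - \<theta> > 0" using theta k by (smt (verit) mult_nonpos_nonneg)
    have t: "2 * \<alpha> - 1 - \<theta> > 0"
    proof -
      have "\<alpha> - s0 > 0" using a(1) a0' by linarith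
      thus ?thesis by (simp add: s0_def field_simps)
    qed
    have c: "3 * \<alpha> - 2 - \<theta> > 0" using e t by argo
    have n: "0 \<le> 4 * (3 * \<alpha> - 2 - \<theta>) * (1 - \<alpha>)" using c a(2) by simp
    moreover have "0 < k * (2 * \<alpha> - 1 - \<theta>) * (4 * \<alpha> - 3 - \<theta>)" using k e t by simp
    ultimately show E0: "0 \<le> ?E \<alpha>" by (intro divide_nonneg_pos) auto
    have "1 = M * (?a0 - s0)" using a0' by (simp add: M_def)
    also have "\<dots> \<le> M * (\<alpha> - s0)" using a(1) a0' by (intro mult_left_mono) (auto simp: M_def)
    finally show "1 - ?E \<alpha> \<le> M * (\<alpha> - s0)" using E0 by linarith
  qed (use a0' in \<open>auto simp: M_def\<close>)
  then obtain K D where KD: "\<forall>T\<ge>2. \<forall>\<alpha>\<ge>s0. ?a0 \<le> \<alpha> \<longrightarrow> (\<forall>Z. finite Z \<longrightarrow> (\<forall>\<rho>\<in>Z. zet \<rho> = 0 \<and> \<alpha> \<le> Re \<rho> \<and> \<bar>Im \<rho>\<bar> \<le> T) \<longrightarrow>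
     real (\<Sum>\<rho>\<in>Z. nat (zorder zf \<rho>)) \<le> K * T powr ?E \<alpha> * ln T powr D)" by (elim exE)
  show ?thesis
  proof (rule exI[of _ K], rule exI[of _ D], intro allI impI)
    fix T \<alpha> :: real and Z
    assume T: "2 \<le> T" and a: "?a0 \<le> \<alpha>" and Z: "finite Z" "\<forall>\<rho>\<in>Z. zet \<rho> = 0 \<and> \<alpha> \<le> Re \<rho> \<and> \<bar>Im \<rho>\<bar> \<le> T"
    have sa: "s0 \<le> \<alpha>" using a a0' by linarith
    show "real (\<Sum>\<rho>\<in>Z. nat (zorder zf \<rho>)) \<le> K * T powr ?E \<alpha> * ln T powr D"
      by (rule KD[THEN spec, THEN mp, OF T, THEN spec, THEN mp, OF sa, THEN mp, OF a, THEN spec, THEN mp, OF Z(1), THEN mp, OF Z(2)])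
  qed
qed

end

section \<open>Transfer to the notions of the theorem\<close>

lemma beurling_of_asymptotic:
  assumes p: "beurling_primes p" and A: "A > 0" and th: "0 \<le> \<theta>" "\<theta> < 1"
    and O: "(\<lambda>x. real (beurling_count p x) - A * x) \<in> O[at_top](\<lambda>x. x powr \<theta>)"
  shows "\<exists>C0. beurling p A \<theta> C0"
proof -
  have p1: "\<And>j. 1 < p j" using p by (simp add: beurling_primes_def)
  note B1 = one_le_beurling_int[where p = p, OF p1]
  obtain c where c: "c > 0" and "eventually (\<lambda>x. norm (real (beurling_count p x) - A * x) \<le> c * norm (x powr \<theta>)) at_top"
    using landau_o.bigE[OF O] by blast
  then obtain X0 where X0: "\<And>x. x \<ge> X0 \<Longrightarrow> norm (real (beurling_count p x) - A * x) \<le> c * norm (x powr \<theta>)"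
    unfolding eventually_at_top_linorder by blast
  define X where "X = max 1 X0"
  have X: "X \<ge> 1" "\<And>x. x \<ge> X \<Longrightarrow> \<bar>real (beurling_count p x) - A * x\<bar> \<le> c * x powr \<theta>"
    using X0 by (auto simp: X_def)
  \<comment> \<open>\<open>card\<close> of an infinite set is 0, so infinitely many generalized
    integers below x would make \<open>beurling_count\<close> vanish at all larger arguments,
    against the growth A * z.\<close>
  have fin: "finite {m. beurling_int p m \<le> x}" for x
  proof (rule ccontr)
    assume inf: "infinite {m. beurling_int p m \<le> x}"
    define z where "z = max (max x X) (((c + 1) / A) powr (1 / (1 - \<theta>)))"
    have z: "z \<ge> x" "z \<ge> X" "z \<ge> ((c + 1) / A) powr (1 / (1 - \<theta>))" by (auto simp: z_def)
    have z1: "z \<ge> 1" using z X by linarith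
    have "{m. beurling_int p m \<le> x} \<subseteq> {m. beurling_int p m \<le> z}" using z(1) by auto
    hence "infinite {m. beurling_int p m \<le> z}" using inf finite_subset by blast
    hence "beurling_count p z = 0" by (simp add: beurling_count_def)
    hence le: "A * z \<le> c * z powr \<theta>" using X(2)[OF z(2)] A z1 by simp
    have zz: "z powr (1 - \<theta>) * z powr \<theta> = z" using z1 by (simp flip: powr_add)
    have "(A * z powr (1 - \<theta>)) * z powr \<theta> \<le> c * z powr \<theta>" unfolding mult.assoc zz by (rule le)
    hence "A * z powr (1 - \<theta>) \<le> c" using z1 by (simp add: mult_le_cancel_right)
    moreover have "c + 1 \<le> A * z powr (1 - \<theta>)"
    proof -
      have "(((c + 1) / A) powr (1 / (1 - \<theta>))) powr (1 - \<theta>) \<le> z powr (1 - \<theta>)" using z(3) th by (intro powr_mono2) auto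
      moreover have "(((c + 1) / A) powr (1 / (1 - \<theta>))) powr (1 - \<theta>) = (c + 1) / A" using A c th by (simp add: powr_powr)
      ultimately have "(c + 1) / A \<le> z powr (1 - \<theta>)" by (simp only:)
      thus ?thesis using A by (simp add: pos_divide_le_eq mult.commute)
    qed
    ultimately show False by linarith
  qed
  define C0 where "C0 = max c (real (beurling_count p X) + A * X)"
  have mono: "beurling_count p x \<le> beurling_count p X" if "x \<le> X" for x
    unfolding beurling_count_def by (rule card_mono[OF fin]) (use that in auto)
  \<comment> \<open>The asymptotic bound is available for x \<ge> X only. Between 1 and X the count
    is controlled by monotonicity; below 1 it is 0 and x \<le> x powr \<theta>, which covers
    negative u in the locale.\<close>
  have bound: "\<bar>real (beurling_count p x) - A * x\<bar> \<le> C0 * x powr \<theta>" if x: "x > 0" for x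
  proof (cases "x \<ge> X")
    case True
    have "c * x powr \<theta> \<le> C0 * x powr \<theta>" by (intro mult_right_mono) (auto simp: C0_def)
    thus ?thesis using X(2)[OF True] by linarith
  next
    case False
    show ?thesis
    proof (cases "x \<ge> 1")
      case True
      have "A * x \<le> A * X" using A False by simp
      hence "\<bar>real (beurling_count p x) - A * x\<bar> \<le> real (beurling_count p X) + A * X"
        using of_nat_mono[OF mono[of x], where 'a = real] False mult_pos_pos[OF A x] by (simp add: abs_le_iff)
      also have "\<dots> \<le> C0 * 1" by (simp add: C0_def)
      also have "\<dots> \<le> C0 * x powr \<theta>" using True th A X c by (intro mult_left_mono ge_one_powr_ge_zero) (auto simp: C0_def le_max_iff_disj)
      finally show ?thesis .
    next
      case x1: False
      have "{m. beurling_int p m \<le> x} = {}" using B1 x1 by (auto simp: not_le intro: less_le_trans)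
      hence "beurling_count p x = 0" by (simp add: beurling_count_def)
      moreover have "A * x \<le> C0 * x powr \<theta>"
      proof (rule mult_mono)
        have "A * 1 \<le> A * X" using A X(1) by (intro mult_left_mono) auto
        hence "A \<le> real (beurling_count p X) + A * X" by linarith
        thus "A \<le> C0" by (simp add: C0_def)
        have "x powr 1 \<le> x powr \<theta>" using x x1 th by (intro powr_mono') auto
        thus "x \<le> x powr \<theta>" using x by simp
      qed (use x c in \<open>auto simp: C0_def\<close>)
      ultimately show ?thesis using A x by simp
    qed
  qed
  have set_eq: "{m. ln (beurling_int p m) \<le> u} = {m. beurling_int p m \<le> exp u}" for u
  proof -
    have "ln (beurling_int p m) \<le> u \<longleftrightarrow> beurling_int p m \<le> exp u" for m
      using ln_le_cancel_iff[of "beurling_int p m" "exp u"] B1[of m] by (simp del: ln_le_cancel_iff)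
    thus ?thesis by simp
  qed
  have "beurling p A \<theta> C0"
  proof (unfold_locales)
    fix m u
    show "0 \<le> ln (beurling_int p m)" using B1[of m] by simp
    show "finite {m. ln (beurling_int p m) \<le> u}" unfolding set_eq by (rule fin)
    have "exp u powr \<theta> = exp (\<theta> * u)" by (simp add: powr_def)
    thus "\<bar>real (card {m. ln (beurling_int p m) \<le> u}) - A * exp u\<bar> \<le> C0 * exp (\<theta> * u)"
      unfolding set_eq using bound[of "exp u"] by (simp add: beurling_count_def)
  qed (use A th p1 in auto)
  thus ?thesis by blast
qed

context beurling
begin

lemma zet_continuation:
  "zet meromorphic_on {s. Re s > \<theta>}"
  "zet holomorphic_on ({s. Re s > \<theta>} - {1})"
  "\<forall>s. Re s > 1 \<longrightarrow> zet s = (\<Sum>\<^sub>\<infinity>m. complex_of_real (beurling_int p m) powr (- s))"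
proof -
  have op: "open {s. Re s > \<theta>}" by (rule open_halfspace_Re_gt)
  have "mel meromorphic_on {s. Re s > \<theta>}"
    using mel_holomorphic by (intro analytic_on_imp_meromorphic_on) (simp add: analytic_on_open[OF op])
  thus "zet meromorphic_on {s. Re s > \<theta>}" unfolding zet_def
    by (intro meromorphic_intros)
  show "zet holomorphic_on ({s. Re s > \<theta>} - {1})" by (rule zet_holomorphic)
  have "complex_of_real (beurling_int p m) powr (- s) = exp (- s * of_real (nu m))" for m s
    using beurling_int_pos[of m] by (simp add: powr_def Ln_of_real)
  thus "\<forall>s. Re s > 1 \<longrightarrow> zet s = (\<Sum>\<^sub>\<infinity>m. complex_of_real (beurling_int p m) powr (- s))"
    using dirichlet_summable(2) by simp
qed

text \<open>Identity theorem on the half-plane without the point 1, which is still connected.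
  \<open>zet\<close> witnesses that the choice defining \<open>beurling_zeta\<close> has a
  candidate.\<close>

lemma beurling_zeta_eq:
  assumes s: "Re s > \<theta>" "s \<noteq> 1"
  shows "beurling_zeta p \<theta> s = zet s"
proof -
  have op: "open {s. Re s > \<theta>}" "connected {s. Re s > \<theta>}"
    by (simp_all add: open_halfspace_Re_gt convex_halfspace_Re_gt convex_connected)
  have "\<exists>Z. Z meromorphic_on {s. Re s > \<theta>} \<and> Z holomorphic_on ({s. Re s > \<theta>} - {1}) \<and>
     (\<forall>s. Re s > 1 \<longrightarrow> Z s = (\<Sum>\<^sub>\<infinity>m. complex_of_real (beurling_int p m) powr (- s)))"
    using zet_continuation by blast
  from someI_ex[OF this]
  have Z: "beurling_zeta p \<theta> holomorphic_on ({s. Re s > \<theta>} - {1})"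
     "\<forall>s. Re s > 1 \<longrightarrow> beurling_zeta p \<theta> s = (\<Sum>\<^sub>\<infinity>m. complex_of_real (beurling_int p m) powr (- s))"
    unfolding beurling_zeta_def[symmetric] by auto
  show ?thesis
  proof (rule analytic_continuation_open[where f = "beurling_zeta p \<theta>" and g = zet and s = "{s. Re s > 1}" and s' = "{s. Re s > \<theta>} - {1}"])
    show "open {s. Re s > 1}" by (rule open_halfspace_Re_gt)
    show "open ({s. Re s > \<theta>} - {1})" using op by (intro open_delete)
    show "{s. Re s > 1} \<noteq> {}" by (auto intro!: exI[of _ "2 :: complex"])
    show "connected ({s. Re s > \<theta>} - {1})" by (rule connected_open_delete[OF op]) simp
    show "{s. Re s > 1} \<subseteq> {s. Re s > \<theta>} - {1}" using theta by auto
    show "beurling_zeta p \<theta> z = zet z" if "z \<in> {s. Re s > 1}" for z using Z(2) zet_continuation(3) that by simp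
  qed (use s Z zet_holomorphic in auto)
qed

lemma beurling_zeros_eq:
  assumes al: "\<alpha> > \<theta>"
  shows "beurling_zeros p \<theta> \<alpha> T = (\<Sum>\<rho> | \<rho> \<noteq> 1 \<and> zet \<rho> = 0 \<and> \<alpha> \<le> Re \<rho> \<and> \<bar>Im \<rho>\<bar> \<le> T. nat (zorder zf \<rho>))"
  unfolding beurling_zeros_def
proof (rule sum.cong)
  show "{\<rho>. \<rho> \<noteq> 1 \<and> beurling_zeta p \<theta> \<rho> = 0 \<and> \<alpha> \<le> Re \<rho> \<and> \<bar>Im \<rho>\<bar> \<le> T} = {\<rho>. \<rho> \<noteq> 1 \<and> zet \<rho> = 0 \<and> \<alpha> \<le> Re \<rho> \<and> \<bar>Im \<rho>\<bar> \<le> T}"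
    using beurling_zeta_eq al by auto
next
  fix \<rho> assume "\<rho> \<in> {\<rho>. \<rho> \<noteq> 1 \<and> zet \<rho> = 0 \<and> \<alpha> \<le> Re \<rho> \<and> \<bar>Im \<rho>\<bar> \<le> T}"
  hence r: "Re \<rho> > \<theta>" "\<rho> \<noteq> 1" using al by auto
  have "open ({s. Re s > \<theta>} - {1})" by (intro open_delete open_halfspace_Re_gt)
  hence "eventually (\<lambda>s. s \<in> {s. Re s > \<theta>} - {1}) (at \<rho>)" using r by (intro eventually_at_in_open') auto
  hence "eventually (\<lambda>s. beurling_zeta p \<theta> s = zet s) (at \<rho>)"
    by eventually_elim (use beurling_zeta_eq in auto)
  hence "zorder (beurling_zeta p \<theta>) \<rho> = zorder zet \<rho>" by (rule zorder_cong) simp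
  thus "nat (zorder (beurling_zeta p \<theta>) \<rho>) = nat (zorder zf \<rho>)" using zorder_zf[OF r] by simp
qed

lemma zc_minus: "zc (- u) = zc u"
proof -
  have "Complex s0 (- u) = cnj (Complex s0 u)" by (simp add: complex_eq_iff)
  thus ?thesis unfolding zc_def by (simp only: zet_cnj complex_mod_cnj)
qed

text \<open>Conjugation symmetry doubles the integral over {0..T}; the real exponent C is rounded up
  to a natural number, which is allowed because ln T \<ge> 1.\<close>

lemma beurling_moment_of_bound:
  assumes k: "k \<ge> 1"
    and m: "\<And>T. T \<ge> 2 \<Longrightarrow> 1 / T * integral {0..T} (\<lambda>t. norm (beurling_zeta p \<theta> (Complex ((1 + \<theta>) / 2) t)) powr (2 * k)) \<le> M * ln T powr C"
  shows "beurling_moment p A \<theta> C0 k (max 1 (2 * \<bar>M\<bar>)) (nat \<lceil>C\<rceil>)"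
proof (unfold_locales)
  let ?f = "\<lambda>u. zc u powr (2 * k)"
  fix T :: real assume T: "3 \<le> T"
  have l: "ln T \<ge> 1" by (rule one_le_ln[OF T])
  have f: "continuous_on S ?f" for S using k by (intro zc_powr_continuous) auto
  have "norm (beurling_zeta p \<theta> (Complex ((1 + \<theta>) / 2) t)) = zc t" for t
    using s0 unfolding zc_def s0_def[symmetric] by (subst beurling_zeta_eq) (auto simp: complex_eq_iff)
  hence m1: "1 / T * integral {0..T} ?f \<le> M * ln T powr C" using m[of T] T by simp
  have "integral {0..T} ?f \<le> T * (M * ln T powr C)" using m1 T by (simp add: field_simps)
  also have "\<dots> \<le> T * (\<bar>M\<bar> * (ln T) ^ nat \<lceil>C\<rceil>)"
  proof (intro mult_left_mono mult_mono)
    have "ln T powr C \<le> ln T powr real (nat \<lceil>C\<rceil>)" using l by (intro powr_mono) (auto intro: real_nat_ceiling_ge)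
    thus "ln T powr C \<le> (ln T) ^ nat \<lceil>C\<rceil>" using l by (simp add: powr_realpow)
  qed (use T in auto)
  finally have half: "integral {0..T} ?f \<le> T * (\<bar>M\<bar> * (ln T) ^ nat \<lceil>C\<rceil>)" .
  have "(LINT u:{- T..T}|lborel. ?f u) = integral {- T..T} ?f"
    by (rule set_borel_integral_eq_integral(2)) (intro set_integrable_continuous f)
  also have "\<dots> = integral {- T..0} ?f + integral {0..T} ?f"
    using T by (intro Henstock_Kurzweil_Integration.integral_combine[symmetric] integrable_continuous_real f) auto
  also have "integral {- T..0} ?f = integral {0..T} ?f"
    using Henstock_Kurzweil_Integration.integral_reflect_real[of T 0 ?f] by (simp add: zc_minus)
  finally have "(LINT u:{- T..T}|lborel. ?f u) \<le> 2 * (T * (\<bar>M\<bar> * (ln T) ^ nat \<lceil>C\<rceil>))" using half by linarith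
  also have "\<dots> = (2 * \<bar>M\<bar>) * (T * (ln T) ^ nat \<lceil>C\<rceil>)" by simp
  also have "\<dots> \<le> max 1 (2 * \<bar>M\<bar>) * (T * (ln T) ^ nat \<lceil>C\<rceil>)" using T l by (intro mult_right_mono) auto
  finally show "(LINT u:{- T..T}|lborel. ?f u) \<le> max 1 (2 * \<bar>M\<bar>) * T * (ln T) ^ nat \<lceil>C\<rceil>" by (simp add: mult.assoc)
qed (use k in auto)

text \<open>Bounds for finite sets of zeros suffice: for an infinite set the defining sum is 0 by
  convention, and the empty set gives B \<ge> 0.\<close>

lemma beurling_zeros_le:
  assumes al: "\<alpha> > \<theta>"
    and le: "\<And>Z. finite Z \<Longrightarrow> (\<forall>\<rho>\<in>Z. zet \<rho> = 0 \<and> \<alpha> \<le> Re \<rho> \<and> \<bar>Im \<rho>\<bar> \<le> T) \<Longrightarrow> real (\<Sum>\<rho>\<in>Z. nat (zorder zf \<rho>)) \<le> B"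
  shows "real (beurling_zeros p \<theta> \<alpha> T) \<le> B"
proof (cases "finite {\<rho>. \<rho> \<noteq> 1 \<and> zet \<rho> = 0 \<and> \<alpha> \<le> Re \<rho> \<and> \<bar>Im \<rho>\<bar> \<le> T}")
  case True
  show ?thesis unfolding beurling_zeros_eq[OF al] by (rule le[OF True]) auto
next
  case False
  hence "beurling_zeros p \<theta> \<alpha> T = 0" unfolding beurling_zeros_eq[OF al] by (rule sum.infinite)
  thus ?thesis using le[of "{}"] by simp
qed

end

theorem theorem5p1:
  fixes p :: "nat \<Rightarrow> real" and A \<theta> k C :: real
  assumes "beurling_primes p"
    and "A > 0" and "0 \<le> \<theta>" and "\<theta> < 1"
    and "(\<lambda>x. real (beurling_count p x) - A * x) \<in> O[at_top](\<lambda>x. x powr \<theta>)"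
    and "k \<ge> 1"
    and zeta_moment: "\<exists>M. \<forall>T\<ge>2.
      1 / T * integral {0..T} (\<lambda>t. norm (beurling_zeta p \<theta> (Complex ((1 + \<theta>) / 2) t)) powr (2 * k))
        \<le> M * ln T powr C"
    and deriv_moment: "2 * k \<in> \<int> \<or> (\<exists>M. \<forall>T\<ge>2.
      1 / T * integral {0..T} (\<lambda>t. norm (deriv (beurling_zeta p \<theta>) (Complex ((1 + \<theta>) / 2) t)) powr (2 * k))
        \<le> M * ln T powr C)"
  shows "(\<exists>K D. \<forall>T\<ge>2. \<forall>\<alpha>\<ge>(1 + \<theta>) / 2.
      real (beurling_zeros p \<theta> \<alpha> T)
        \<le> K * T powr (2 * (k + 1) * (1 - \<alpha>) / (2 * (1 - \<alpha>) + k * (1 - \<theta>))) * ln T powr D) \<and>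
    (\<exists>K D. \<forall>T\<ge>2. \<forall>\<alpha>\<ge>(3 * k - 1 + (k - 1) * \<theta>) / (4 * k - 2).
      real (beurling_zeros p \<theta> \<alpha> T)
        \<le> K * T powr (4 * (3 * \<alpha> - 2 - \<theta>) * (1 - \<alpha>) /
                (k * (2 * \<alpha> - 1 - \<theta>) * (4 * \<alpha> - 3 - \<theta>) + 4 * (3 * \<alpha> - 2 - \<theta>) * (1 - \<alpha>)))
            * ln T powr D)"
proof -
  obtain C0 where "beurling p A \<theta> C0" using beurling_of_asymptotic[OF assms(1-5)] by blast
  then interpret beurling p A \<theta> C0 .
  obtain M where "\<And>T. T \<ge> 2 \<Longrightarrow> 1 / T * integral {0..T} (\<lambda>t. norm (beurling_zeta p \<theta> (Complex ((1 + \<theta>) / 2) t)) powr (2 * k)) \<le> M * ln T powr C"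
    using zeta_moment by blast
  from beurling_moment_of_bound[OF assms(6) this]
  interpret beurling_moment p A \<theta> C0 k "max 1 (2 * \<bar>M\<bar>)" "nat \<lceil>C\<rceil>" .
  show ?thesis
  proof (intro conjI)
    from zero_density_mean_value obtain K D where KD: "\<forall>T\<ge>2. \<forall>\<alpha>\<ge>s0. (\<forall>Z. finite Z \<longrightarrow> (\<forall>\<rho>\<in>Z. zet \<rho> = 0 \<and> \<alpha> \<le> Re \<rho> \<and> \<bar>Im \<rho>\<bar> \<le> T) \<longrightarrow>
       real (\<Sum>\<rho>\<in>Z. nat (zorder zf \<rho>)) \<le> K * T powr (2 * (k + 1) * (1 - \<alpha>) / (2 * (1 - \<alpha>) + k * (1 - \<theta>))) * ln T powr D)" by (elim exE)
    show "\<exists>K D. \<forall>T\<ge>2. \<forall>\<alpha>\<ge>(1 + \<theta>) / 2. real (beurling_zeros p \<theta> \<alpha> T)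
        \<le> K * T powr (2 * (k + 1) * (1 - \<alpha>) / (2 * (1 - \<alpha>) + k * (1 - \<theta>))) * ln T powr D"
      unfolding s0_def[symmetric]
    proof (rule exI[of _ K], rule exI[of _ D], intro allI impI)
      fix T \<alpha> :: real assume T: "2 \<le> T" and a: "s0 \<le> \<alpha>"
      have al: "\<alpha> > \<theta>" using a s0 by linarith
      show "real (beurling_zeros p \<theta> \<alpha> T) \<le> K * T powr (2 * (k + 1) * (1 - \<alpha>) / (2 * (1 - \<alpha>) + k * (1 - \<theta>))) * ln T powr D"
        by (rule beurling_zeros_le[OF al KD[THEN spec, THEN mp, OF T, THEN spec, THEN mp, OF a, THEN spec, THEN mp, THEN mp]])
    qed
  next
    let ?a0 = "(3 * k - 1 + (k - 1) * \<theta>) / (4 * k - 2)"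
    from zero_density_halasz obtain K D where KD: "\<forall>T\<ge>2. \<forall>\<alpha>\<ge>?a0. (\<forall>Z. finite Z \<longrightarrow> (\<forall>\<rho>\<in>Z. zet \<rho> = 0 \<and> \<alpha> \<le> Re \<rho> \<and> \<bar>Im \<rho>\<bar> \<le> T) \<longrightarrow>
       real (\<Sum>\<rho>\<in>Z. nat (zorder zf \<rho>)) \<le> K * T powr (4 * (3 * \<alpha> - 2 - \<theta>) * (1 - \<alpha>) /
        (k * (2 * \<alpha> - 1 - \<theta>) * (4 * \<alpha> - 3 - \<theta>) + 4 * (3 * \<alpha> - 2 - \<theta>) * (1 - \<alpha>))) * ln T powr D)" by (elim exE)
    show "\<exists>K D. \<forall>T\<ge>2. \<forall>\<alpha>\<ge>?a0. real (beurling_zeros p \<theta> \<alpha> T)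
        \<le> K * T powr (4 * (3 * \<alpha> - 2 - \<theta>) * (1 - \<alpha>) /
                (k * (2 * \<alpha> - 1 - \<theta>) * (4 * \<alpha> - 3 - \<theta>) + 4 * (3 * \<alpha> - 2 - \<theta>) * (1 - \<alpha>)))
            * ln T powr D"
    proof (rule exI[of _ K], rule exI[of _ D], intro allI impI)
      fix T \<alpha> :: real assume T: "2 \<le> T" and a: "?a0 \<le> \<alpha>"
      \<comment> \<open>The second range of \<alpha> begins to the right of \<theta>, as the
        identification of the two zero counts requires.\<close>
      have "?a0 - \<theta> = (3 * k - 1) * (1 - \<theta>) / (4 * k - 2)" using \<open>k \<ge> 1\<close> by (simp add: field_simps)
      moreover have "\<dots> > 0" using \<open>k \<ge> 1\<close> theta by simp
      ultimately have al: "\<alpha> > \<theta>" using a by linarith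
      show "real (beurling_zeros p \<theta> \<alpha> T) \<le> K * T powr (4 * (3 * \<alpha> - 2 - \<theta>) * (1 - \<alpha>) /
                (k * (2 * \<alpha> - 1 - \<theta>) * (4 * \<alpha> - 3 - \<theta>) + 4 * (3 * \<alpha> - 2 - \<theta>) * (1 - \<alpha>)))
            * ln T powr D"
        by (rule beurling_zeros_le[OF al KD[THEN spec, THEN mp, OF T, THEN spec, THEN mp, OF a, THEN spec, THEN mp, THEN mp]])
    qed
  qed
qed

end
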